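(* Let $d\in\mathbb{N}$, $s\in\mathbb{R}$, $0<p<\infty$, $0<q\le\infty$ and $\varphi\in\mathcal{G}_p$. Let $q'\in[1,\infty]$ be given by $\frac1{q'}=(1-\frac1q)_+$. Then $$\mathcal{N}^s_{\varphi,p,q}(\mathbb{R}^d)\hookrightarrow L_\infty(\mathbb{R}^d)$$ if, and only if, $$\left\{2^{-js}\varphi(2^{-j})^{-1}\right\}_{j\in\mathbb{N}_0}\in\ell_{q'}.$$
   Context: $a_+=\max(a,0)$ and $\mathbb{N}_0=\mathbb{N}\cup\{0\}$. $X\hookrightarrow Y$ means $X\subset Y$ with continuous natural embedding. $\mathcal{G}_p$ is the set of all nondecreasing functions $\varphi:(0,\infty)\to(0,\infty)$ such that $t\mapsto \varphi(t)t^{-d/p}$ is nonincreasing. For $\varphi\in\mathcal{G}_p$, the generalised Morrey space $\mathcal{M}_{\varphi,p}(\mathbb{R}^d)$ is the set of all $f\in L_p^{\mathrm{loc}}(\mathbb{R}^d)$ with $$\|f\mid\mathcal{M}_{\varphi,p}(\mathbb{R}^d)\|:=\sup_{Q}\varphi(\ell(Q))\Big(\frac{1}{|Q|}\int_Q|f(y)|^p\,dy\Big)^{1/p}<\infty,$$ the supremum being over all dyadic cubes $Q=2^{-j}([0,1)^d+k)$, $j\in\mathbb{Z}$, $k\in\mathbb{Z}^d$, with side length $\ell(Q)$. Let $Q(r)$ be the compact cube centred at $0$ with side length $r$ and sides parallel to the axes. Let $\eta_0,\eta\in\mathcal{S}(\mathbb{R}^d)$ be nonnegative compactly supported functions with $\eta_0>0$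 on $Q(2)$, $0\notin\operatorname{supp}\eta$ and $\eta>0$ on $Q(2)\setminus Q(1)$; put $\eta_j(x)=\eta(2^{-j}x)$, $j\in\mathbb{N}$. The generalised Besov-Morrey space $\mathcal{N}^s_{\varphi,p,q}(\mathbb{R}^d)$ is the set of all $f\in\mathcal{S}'(\mathbb{R}^d)$ with $$\|f\mid\mathcal{N}^s_{\varphi,p,q}(\mathbb{R}^d)\|:=\Big(\sum_{j=0}^\infty2^{jsq}\big\|\mathcal{F}^{-1}(\eta_j\mathcal{F}f)\mid\mathcal{M}_{\varphi,p}(\mathbb{R}^d)\big\|^q\Big)^{1/q}<\infty$$ (usual modification if $q=\infty$). Different choices of $\eta_0,\eta$ give equivalent quasi-norms. *)

theory Defs
  imports "HOL-Analysis.Analysis" "HOL-Probability.Essential_Supremum"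
begin

definition partial_deriv ::
    "'n \<Rightarrow> (real^'n::finite \<Rightarrow> 'b::real_normed_vector) \<Rightarrow> real^'n \<Rightarrow> 'b" where
  "partial_deriv i f = (\<lambda>x. frechet_derivative f (at x) (axis i 1))"

text \<open>A list \<open>[i\<^sub>1, \<dots>, i\<^sub>m]\<close> of coordinate directions plays the role of a multi-index of order \<open>m\<close>.\<close>

definition iter_deriv ::
    "'n list \<Rightarrow> (real^'n::finite \<Rightarrow> 'b::real_normed_vector) \<Rightarrow> real^'n \<Rightarrow> 'b" where
  "iter_deriv \<alpha> f = foldr partial_deriv \<alpha> f"

definition schwartz :: "(real^'n::finite \<Rightarrow> 'b::real_normed_vector) set" where
  "schwartz = {f. \<forall>\<alpha>. (\<forall>x. iter_deriv \<alpha> f differentiable (at x)) \<and>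
     (\<forall>m::nat. bounded (range (\<lambda>x. (1 + norm x) ^ m *\<^sub>R iter_deriv \<alpha> f x)))}"

definition schwartz_seminorm ::
    "nat \<Rightarrow> (real^'n::finite \<Rightarrow> 'b::real_normed_vector) \<Rightarrow> real" where
  "schwartz_seminorm N f =
     (SUP (\<alpha>, x)\<in>{\<alpha>. length \<alpha> \<le> N} \<times> UNIV. (1 + norm x) ^ N * norm (iter_deriv \<alpha> f x))"

type_synonym 'n functional = "(real^'n \<Rightarrow> complex) \<Rightarrow> complex"

text \<open>
  Functionals are total functions in HOL; requiring the value 0 outside the Schwartz space
  makes equality of functionals coincide with equality of distributions.
\<close>

definition tempered :: "'n::finite functional set" where
  "tempered = {u.
     (\<forall>\<psi>. \<psi> \<notin> schwartz \<longrightarrow> u \<psi> = 0) \<and>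
     (\<forall>\<psi>\<in>schwartz. \<forall>\<theta>\<in>schwartz. u (\<lambda>x. \<psi> x + \<theta> x) = u \<psi> + u \<theta>) \<and>
     (\<forall>c. \<forall>\<psi>\<in>schwartz. u (\<lambda>x. c * \<psi> x) = c * u \<psi>) \<and>
     (\<exists>C N. \<forall>\<psi>\<in>schwartz. norm (u \<psi>) \<le> C * schwartz_seminorm N \<psi>)}"

definition fourier :: "(real^'n::finite \<Rightarrow> complex) \<Rightarrow> real^'n \<Rightarrow> complex" where
  "fourier \<psi> = (\<lambda>\<xi>. complex_of_real ((2 * pi) powr (- real CARD('n) / 2)) *
     (\<integral>x. exp (- \<i> * complex_of_real (x \<bullet> \<xi>)) * \<psi> x \<partial>lborel))"

definition inv_fourier :: "(real^'n::finite \<Rightarrow> complex) \<Rightarrow> real^'n \<Rightarrow> complex" where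
  "inv_fourier \<psi> = (\<lambda>x. complex_of_real ((2 * pi) powr (- real CARD('n) / 2)) *
     (\<integral>\<xi>. exp (\<i> * complex_of_real (x \<bullet> \<xi>)) * \<psi> \<xi> \<partial>lborel))"

definition fourier_distr :: "'n::finite functional \<Rightarrow> 'n functional" where
  "fourier_distr u = (\<lambda>\<psi>. if \<psi> \<in> schwartz then u (fourier \<psi>) else 0)"

definition inv_fourier_distr :: "'n::finite functional \<Rightarrow> 'n functional" where
  "inv_fourier_distr u = (\<lambda>\<psi>. if \<psi> \<in> schwartz then u (inv_fourier \<psi>) else 0)"

definition mult_distr :: "(real^'n::finite \<Rightarrow> real) \<Rightarrow> 'n functional \<Rightarrow> 'n functional" where
  "mult_distr h u = (\<lambda>\<psi>. if \<psi> \<in> schwartz then u (\<lambda>x. h x *\<^sub>R \<psi> x) else 0)"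

definition represents :: "(real^'n::finite \<Rightarrow> complex) \<Rightarrow> 'n functional \<Rightarrow> bool" where
  "represents g u \<longleftrightarrow> g \<in> borel_measurable lborel \<and>
     (\<forall>\<psi>\<in>schwartz. integrable lborel (\<lambda>x. g x * \<psi> x) \<and> u \<psi> = (\<integral>x. g x * \<psi> x \<partial>lborel))"

text \<open>
  The value of a function-space quasi-norm \<open>nrm\<close> (invariant under changes on null sets) on a
  distribution. A function representing a distribution is unique almost everywhere, so the
  infimum is over at most one value; it is \<open>\<infinity>\<close> if no function represents the distribution.
\<close>

definition distr_norm ::
    "((real^'n::finite \<Rightarrow> complex) \<Rightarrow> ennreal) \<Rightarrow> 'n functional \<Rightarrow> ennreal" where
  "distr_norm nrm u = (INF g\<in>{g. represents g u}. nrm g)"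

text \<open>Only used for exponents \<open>a > 0\<close>.\<close>

definition ennpowr :: "ennreal \<Rightarrow> real \<Rightarrow> ennreal" where
  "ennpowr x a = (if x = \<infinity> then \<infinity> else ennreal (enn2real x powr a))"

definition lq_norm :: "ereal \<Rightarrow> (nat \<Rightarrow> ennreal) \<Rightarrow> ennreal" where
  "lq_norm q a = (if q = \<infinity> then (SUP j. a j)
     else ennpowr (\<Sum>j. ennpowr (a j) (real_of_ereal q)) (1 / real_of_ereal q))"

definition lq :: "ereal \<Rightarrow> (nat \<Rightarrow> real) set" where
  "lq q = {a. lq_norm q (\<lambda>j. ennreal \<bar>a j\<bar>) < \<infinity>}"

text \<open>Functions in \<open>L\<^sub>\<infinity>\<close> are identified with the distributions they represent.\<close>

definition Linf_norm :: "'n::finite functional \<Rightarrow> ennreal" where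
  "Linf_norm = distr_norm (\<lambda>g. esssup lborel (\<lambda>x. ennreal (norm (g x))))"

definition Linf :: "'n::finite functional set" where
  "Linf = {u \<in> tempered. Linf_norm u < \<infinity>}"

definition morrey_class :: "nat \<Rightarrow> real \<Rightarrow> (real \<Rightarrow> real) set" where
  "morrey_class d p = {\<phi>. (\<forall>t>0. \<phi> t > 0) \<and> mono_on {0<..} \<phi> \<and>
     antimono_on {0<..} (\<lambda>t. \<phi> t * t powr (- real d / p))}"

definition dyadic_cube :: "int \<Rightarrow> int^'n::finite \<Rightarrow> (real^'n) set" where
  "dyadic_cube j k = {x. \<forall>i. 2 powi (- j) * of_int (k $ i) \<le> x $ i \<and>
     x $ i < 2 powi (- j) * (of_int (k $ i) + 1)}"

text \<open>
  A measurable function with finite norm is automatically in \<open>L\<^sub>p\<^sup>l\<^sup>o\<^sup>c\<close>, because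
  \<open>\<phi> > 0\<close> and compact sets are covered by finitely many dyadic cubes.
\<close>

definition morrey_norm ::
    "(real \<Rightarrow> real) \<Rightarrow> real \<Rightarrow> (real^'n::finite \<Rightarrow> complex) \<Rightarrow> ennreal" where
  "morrey_norm \<phi> p g = (SUP (j, k)\<in>UNIV. ennreal (\<phi> (2 powi (- j))) *
     ennpowr ((\<integral>\<^sup>+y\<in>dyadic_cube j k. ennreal (norm (g y) powr p) \<partial>lborel)
               / emeasure lborel (dyadic_cube j k :: (real^'n) set)) (1 / p))"

definition centred_cube :: "real \<Rightarrow> (real^'n::finite) set" where
  "centred_cube r = {x. \<forall>i. \<bar>x $ i\<bar> \<le> r / 2}"

definition resolution_pair :: "(real^'n::finite \<Rightarrow> real) \<Rightarrow> (real^'n \<Rightarrow> real) \<Rightarrow> bool" where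
  "resolution_pair \<eta>0 \<eta> \<longleftrightarrow>
     \<eta>0 \<in> schwartz \<and> \<eta> \<in> schwartz \<and> (\<forall>x. \<eta>0 x \<ge> 0) \<and> (\<forall>x. \<eta> x \<ge> 0) \<and>
     compact (closure {x. \<eta>0 x \<noteq> 0}) \<and> compact (closure {x. \<eta> x \<noteq> 0}) \<and>
     (\<forall>x\<in>centred_cube 2. \<eta>0 x > 0) \<and>
     0 \<notin> closure {x. \<eta> x \<noteq> 0} \<and> (\<forall>x\<in>centred_cube 2 - centred_cube 1. \<eta> x > 0)"

definition eta :: "(real^'n::finite \<Rightarrow> real) \<Rightarrow> (real^'n \<Rightarrow> real) \<Rightarrow> nat \<Rightarrow> real^'n \<Rightarrow> real" where
  "eta \<eta>0 \<eta> j = (if j = 0 then \<eta>0 else (\<lambda>x. \<eta> ((1 / 2 ^ j) *\<^sub>R x)))"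

definition besov_morrey_norm ::
    "(real^'n::finite \<Rightarrow> real) \<Rightarrow> (real^'n \<Rightarrow> real) \<Rightarrow> real \<Rightarrow> (real \<Rightarrow> real) \<Rightarrow> real \<Rightarrow> ereal \<Rightarrow>
     'n functional \<Rightarrow> ennreal" where
  "besov_morrey_norm \<eta>0 \<eta> s \<phi> p q f = lq_norm q (\<lambda>j. ennreal (2 powr (real j * s)) *
     distr_norm (morrey_norm \<phi> p)
       (inv_fourier_distr (mult_distr (eta \<eta>0 \<eta> j) (fourier_distr f))))"

definition besov_morrey ::
    "(real^'n::finite \<Rightarrow> real) \<Rightarrow> (real^'n \<Rightarrow> real) \<Rightarrow> real \<Rightarrow> (real \<Rightarrow> real) \<Rightarrow> real \<Rightarrow> ereal \<Rightarrow>
     'n functional set" where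
  "besov_morrey \<eta>0 \<eta> s \<phi> p q = {f \<in> tempered. besov_morrey_norm \<eta>0 \<eta> s \<phi> p q f < \<infinity>}"

text \<open>
  Inclusion, with the inclusion map continuous for the topologies given by the quasi-norms
  (\<open>g - f\<close> is the pointwise difference of functionals).
\<close>

definition continuously_embedded ::
    "'n::finite functional set \<Rightarrow> ('n functional \<Rightarrow> ennreal) \<Rightarrow>
     'n functional set \<Rightarrow> ('n functional \<Rightarrow> ennreal) \<Rightarrow> bool" where
  "continuously_embedded X nX Y nY \<longleftrightarrow> X \<subseteq> Y \<and>
     (\<forall>f\<in>X. \<forall>\<epsilon>>0. \<exists>\<delta>>0. \<forall>g\<in>X. nX (g - f) < \<delta> \<longrightarrow> nY (g - f) < \<epsilon>)"

end

theory Submission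
  imports Defs "HOL-Probability.Probability"
begin

text \<open>
  Write \<open>f\<^sub>j = F\<^sup>-\<^sup>1(\<eta>\<^sub>j F f)\<close>. For the sufficiency, a Plancherel--Polya--Nikolskii inequality bounds \<open>f\<^sub>j\<close> uniformly
  by a constant times \<open>\<phi>(2\<^sup>-\<^sup>j)\<^sup>-\<^sup>1\<close> times its Morrey norm, because \<open>f\<^sub>j\<close> is reproduced by convolution with a
  rapidly decaying kernel of scale \<open>2\<^sup>-\<^sup>j\<close>, whose action only sees averages over dyadic cubes of side \<open>2\<^sup>-\<^sup>j\<close>.
  By Hoelder's inequality (the embedding of \<open>\<ell>\<^sub>q\<close> into \<open>\<ell>\<^sub>1\<close> if \<open>q \<le> 1\<close>) these bounds are summable, and \<open>f\<close> is the
  uniformly convergent sum of the \<open>f\<^sub>j\<close>, smoothed by convolution kernels that are bounded in \<open>L\<^sub>1\<close>.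

  For the necessity, the embedding is tested on \<open>\<Sum>\<^sub>j \<lambda>\<^sub>j 2\<^sup>-\<^sup>j\<^sup>d F\<^sup>-\<^sup>1\<eta>\<^sub>j\<close> with \<open>\<lambda>\<^sub>j \<ge> 0\<close>: its value at \<open>0\<close> is a multiple of
  \<open>\<Sum>\<^sub>j \<lambda>\<^sub>j\<close>, while the two monotonicity properties of \<open>\<phi>\<close> bound the Morrey norm of its \<open>j\<close>-th block by a multiple
  of \<open>\<lambda>\<^sub>j \<phi>(2\<^sup>-\<^sup>j)\<close>, up to neighbouring indices. The converse of Hoelder's inequality concludes.
\<close>

text \<open>The blocks f_j are given as distributions, each represented by a function about which
  nothing is known beyond integrability against Schwartz functions and control of its averages of
  order p. So neither the convolution identity f_j = K * f_j nor, for p < 1, finiteness of sup |f_j|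
  is available at the start; a damping factor with frequencies in a tiny ball supplies both and is
  removed by a limit. The pair \<open>\<eta>0\<close>, \<open>\<eta>\<close> is arbitrary, so its
  dilates need not sum to 1: quotients of finite sums of them replace a partition of unity, and the
  kernels that arise at all levels are dilates of a few fixed ones, which keeps constants
  independent of the level. \<open>distr_norm\<close> is an infimum over representing functions, so
  their uniqueness almost everywhere is needed; it also turns identities tested on Schwartz
  functions into pointwise ones. Block 0 is a ball, not an annulus, and no dilate of
  \<open>\<eta>\<close>: test functions use only indices j >= 1, and the one missing term of the
  sequence is added at the end. As the triangle inequality fails for q < 1, overlaps of blocks are
  handled by counting.\<close>

section \<open>Decay faster than every power\<close>

definition rapidly_decaying :: "('a::real_normed_vector \<Rightarrow> 'b::real_normed_vector) \<Rightarrow> bool" where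
  "rapidly_decaying f \<longleftrightarrow> (\<forall>m::nat. \<exists>C. \<forall>x. (1 + norm x) ^ m * norm (f x) \<le> C)"

lemma rapidly_decaying_iff_bounded:
  "rapidly_decaying f \<longleftrightarrow> (\<forall>m::nat. bounded (range (\<lambda>x. (1 + norm x) ^ m *\<^sub>R f x)))"
  by (simp add: rapidly_decaying_def bounded_iff)

lemma rapidly_decayingE:
  assumes "rapidly_decaying f"
  obtains C where "C > 0" "\<And>x. (1 + norm x) ^ m * norm (f x) \<le> C"
proof -
  obtain C where C: "\<And>x. (1 + norm x) ^ m * norm (f x) \<le> C"
    using assms by (auto simp: rapidly_decaying_def)
  show ?thesis
    by (rule that[of "max C 1"]) (use C in \<open>auto simp: le_max_iff_disj\<close>)
qed

lemma rapidly_decaying_add: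
  assumes "rapidly_decaying f" "rapidly_decaying g"
  shows "rapidly_decaying (\<lambda>x. f x + g x)"
  unfolding rapidly_decaying_def
proof
  fix m
  obtain A B where AB: "\<And>x. (1 + norm x) ^ m * norm (f x) \<le> A"
      "\<And>x. (1 + norm x) ^ m * norm (g x) \<le> B"
    using assms by (meson rapidly_decaying_def)
  have "(1 + norm x) ^ m * norm (f x + g x) \<le> A + B" for x
  proof -
    have "(1 + norm x) ^ m * norm (f x + g x) \<le> (1 + norm x) ^ m * (norm (f x) + norm (g x))"
      by (intro mult_left_mono norm_triangle_ineq) auto
    then show ?thesis using AB[of x] by (simp add: algebra_simps)
  qed
  then show "\<exists>C. \<forall>x. (1 + norm x) ^ m * norm (f x + g x) \<le> C" by blast
qed

text \<open>A polynomial factor is harmless: order \<open>m\<close> of decay for \<open>g\<close> is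
  paid for with order \<open>m + l\<close> of \<open>f\<close>.\<close>

lemma rapidly_decaying_dominated:
  assumes "rapidly_decaying f" "\<And>x. norm (g x) \<le> K * (1 + norm x) ^ l * norm (f x)"
  shows "rapidly_decaying g"
  unfolding rapidly_decaying_def
proof
  fix m
  obtain A where A: "\<And>x. (1 + norm x) ^ (m + l) * norm (f x) \<le> A"
    using assms by (meson rapidly_decaying_def)
  have "(1 + norm x) ^ m * norm (g x) \<le> \<bar>K\<bar> * A" for x
  proof -
    have "norm (g x) \<le> \<bar>K\<bar> * ((1 + norm x) ^ l * norm (f x))"
      using assms(2)[of x] mult_right_mono[OF abs_ge_self[of K], of "(1 + norm x) ^ l * norm (f x)"]
      by (simp add: mult.assoc)
    then have "(1 + norm x) ^ m * norm (g x)
        \<le> (1 + norm x) ^ m * (\<bar>K\<bar> * ((1 + norm x) ^ l * norm (f x)))"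
      by (intro mult_left_mono) auto
    also have "\<dots> = \<bar>K\<bar> * ((1 + norm x) ^ (m + l) * norm (f x))"
      by (simp add: power_add)
    also have "\<dots> \<le> \<bar>K\<bar> * A" using A by (intro mult_left_mono) auto
    finally show ?thesis .
  qed
  then show "\<exists>C. \<forall>x. (1 + norm x) ^ m * norm (g x) \<le> C" by blast
qed

lemma rapidly_decaying_compact_support:
  fixes f :: "'a::euclidean_space \<Rightarrow> 'b::real_normed_vector"
  assumes "continuous_on UNIV f" "compact (closure {x. f x \<noteq> 0})"
  shows "rapidly_decaying f"
  unfolding rapidly_decaying_def
proof
  fix m
  let ?S = "closure {x. f x \<noteq> 0}"
  have "continuous_on ?S (\<lambda>x. (1 + norm x) ^ m * norm (f x))"
    by (intro continuous_intros continuous_on_subset[OF assms(1)]) auto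
  then have "bounded ((\<lambda>x. (1 + norm x) ^ m * norm (f x)) ` ?S)"
    using assms(2) compact_continuous_image compact_imp_bounded by blast
  then obtain B where B: "\<And>x. x \<in> ?S \<Longrightarrow> norm ((1 + norm x) ^ m * norm (f x)) \<le> B"
    by (auto simp: bounded_iff)
  have "(1 + norm x) ^ m * norm (f x) \<le> max B 0" for x
  proof (cases "x \<in> ?S")
    case True
    then show ?thesis using B[OF True] by auto
  next
    case False
    then have "f x = 0" using closure_subset[of "{x. f x \<noteq> 0}"] by auto
    then show ?thesis by simp
  qed
  then show "\<exists>C. \<forall>x. (1 + norm x) ^ m * norm (f x) \<le> C" by blast
qed

subsection \<open>Partial derivatives\<close>

lemma partial_deriv_eq:
  assumes "(f has_derivative f') (at x)"
  shows "partial_deriv i f x = f' (axis i 1)"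
  using assms frechet_derivative_at[of f f' x] by (simp add: partial_deriv_def)

text \<open>Linearity applied to the expansion of \<open>h\<close> in coordinate vectors. This is
  how bounds on partial derivatives come to control increments.\<close>

lemma has_derivative_partial:
  fixes f :: "real^'n::finite \<Rightarrow> 'b::real_normed_vector"
  assumes "f differentiable (at x)"
  shows "(f has_derivative (\<lambda>h. \<Sum>i\<in>UNIV. h $ i *\<^sub>R partial_deriv i f x)) (at x)"
proof -
  let ?D = "frechet_derivative f (at x)"
  have D: "(f has_derivative ?D) (at x)" using assms frechet_derivative_works by blast
  then interpret bounded_linear ?D by (rule has_derivative_bounded_linear)
  have "?D h = (\<Sum>i\<in>UNIV. h $ i *\<^sub>R partial_deriv i f x)" for h
  proof -
    have "h = (\<Sum>i\<in>UNIV. h $ i *\<^sub>R axis i 1)"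
      by (simp add: vec_eq_iff axis_def if_distrib cong: if_cong)
    then have "?D h = ?D (\<Sum>i\<in>UNIV. h $ i *\<^sub>R axis i 1)" by simp
    also have "\<dots> = (\<Sum>i\<in>UNIV. h $ i *\<^sub>R partial_deriv i f x)"
      by (simp add: sum scaleR partial_deriv_def)
    finally show ?thesis .
  qed
  then show ?thesis using D by (metis (no_types, lifting) ext)
qed

lemma partial_deriv_add:
  assumes "f differentiable (at x)" "g differentiable (at x)"
  shows "partial_deriv i (\<lambda>x. f x + g x) x = partial_deriv i f x + partial_deriv i g x"
  using has_derivative_add[of f _ "at x" g] assms
  by (subst partial_deriv_eq) (auto simp: frechet_derivative_works partial_deriv_def)

lemma partial_deriv_bilinear:
  assumes "bounded_bilinear pr" "f differentiable (at x)" "g differentiable (at x)"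
  shows "partial_deriv i (\<lambda>x. pr (f x) (g x)) x
           = pr (partial_deriv i f x) (g x) + pr (f x) (partial_deriv i g x)"
proof -
  have "((\<lambda>x. pr (f x) (g x)) has_derivative
      (\<lambda>h. pr (f x) (frechet_derivative g (at x) h) + pr (frechet_derivative f (at x) h) (g x))) (at x)"
    using assms bounded_bilinear.FDERIV[OF assms(1), of f _ x UNIV g]
    by (auto simp: frechet_derivative_works)
  then show ?thesis
    by (subst partial_deriv_eq) (auto simp: partial_deriv_def add.commute)
qed

lemma partial_deriv_bounded_linear:
  assumes "bounded_linear L" "f differentiable (at x)"
  shows "partial_deriv i (\<lambda>x. L (f x)) x = L (partial_deriv i f x)"
  using bounded_linear.has_derivative[OF assms(1)] assms(2)
  by (subst partial_deriv_eq) (auto simp: frechet_derivative_works partial_deriv_def)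

lemma has_derivative_affine_comp:
  fixes f :: "real^'n::finite \<Rightarrow> 'b::real_normed_vector"
  assumes "f differentiable (at (c *\<^sub>R x + a))"
  shows "((\<lambda>x. f (c *\<^sub>R x + a)) has_derivative
    (\<lambda>h. frechet_derivative f (at (c *\<^sub>R x + a)) (c *\<^sub>R h))) (at x)"
proof -
  have "((\<lambda>x. c *\<^sub>R x + a) has_derivative (\<lambda>h. c *\<^sub>R h)) (at x)"
    by (auto intro!: derivative_eq_intros)
  from has_derivative_compose[OF this] assms show ?thesis
    by (simp add: frechet_derivative_works)
qed

lemma partial_deriv_affine_comp:
  fixes f :: "real^'n::finite \<Rightarrow> 'b::real_normed_vector"
  assumes "f differentiable (at (c *\<^sub>R x + a))"
  shows "partial_deriv i (\<lambda>x. f (c *\<^sub>R x + a)) x = c *\<^sub>R partial_deriv i f (c *\<^sub>R x + a)"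
proof -
  interpret bounded_linear "frechet_derivative f (at (c *\<^sub>R x + a))"
    using assms frechet_derivative_works has_derivative_bounded_linear by blast
  show ?thesis
    by (subst partial_deriv_eq[OF has_derivative_affine_comp[OF assms]])
      (simp add: partial_deriv_def scaleR)
qed

lemma partial_deriv_coord: "partial_deriv i (\<lambda>x. x $ j) x = (if i = j then 1 else 0)"
proof -
  have "((\<lambda>x. x $ j) has_derivative (\<lambda>h. h $ j)) (at x)"
    by (auto intro!: bounded_linear_imp_has_derivative bounded_linear_vec_nth)
  then show ?thesis using partial_deriv_eq by (fastforce simp: axis_def)
qed

text \<open>The complement of the closed support is open, so \<open>f\<close> agrees with the zero
  function near \<open>x\<close>.\<close>

lemma partial_deriv_zero_off_support:
  assumes "x \<notin> closure {x. f x \<noteq> 0}"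
  shows "(f has_derivative (\<lambda>_. 0)) (at x)" "partial_deriv i f x = 0"
proof -
  have "open (- closure {x. f x \<noteq> 0})" by auto
  moreover have "x \<in> - closure {x. f x \<noteq> 0}" using assms by auto
  ultimately have "\<forall>\<^sub>F y in nhds x. y \<in> - closure {x. f x \<noteq> 0}"
    using eventually_nhds by blast
  then have "\<forall>\<^sub>F y in nhds x. f y = 0"
    by (rule eventually_mono) (use closure_subset[of "{x. f x \<noteq> 0}"] in auto)
  then have "\<forall>\<^sub>F y in at x. (0::'b) = f y" "0 = f x"
    by (auto simp: eventually_nhds_conv_at elim!: eventually_mono)
  then show D: "(f has_derivative (\<lambda>_. 0)) (at x)"
    using has_derivative_transform_eventually[of "\<lambda>_. 0" "\<lambda>_. 0" x UNIV f] by auto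
  show "partial_deriv i f x = 0" using partial_deriv_eq[OF D] by simp
qed

subsection \<open>The Schwartz space\<close>

text \<open>Grades \<open>schwartz\<close> by the number of derivatives, so that closure properties
  follow by induction: sum, product, chain and quotient rules express one derivative of a compound
  function by compound functions of the same kind. The recursion strips the derivative applied
  first, which is the last entry of the list in \<open>iter_deriv\<close>.\<close>

primrec schwartz_upto :: "nat \<Rightarrow> (real^'n::finite \<Rightarrow> 'b::real_normed_vector) \<Rightarrow> bool" where
  "schwartz_upto 0 f \<longleftrightarrow> (\<forall>x. f differentiable (at x)) \<and> rapidly_decaying f"
| "schwartz_upto (Suc n) f \<longleftrightarrow> (\<forall>x. f differentiable (at x)) \<and> rapidly_decaying f \<and>
     (\<forall>i. schwartz_upto n (partial_deriv i f))"

lemma schwartz_uptoD: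
  assumes "schwartz_upto n f"
  shows "f differentiable (at x)" "rapidly_decaying f"
  using assms by (cases n; auto)+

lemma iter_deriv_simps:
  "iter_deriv [] f = f" "iter_deriv (\<alpha> @ [i]) f = iter_deriv \<alpha> (partial_deriv i f)"
  "iter_deriv (i # \<alpha>) f = partial_deriv i (iter_deriv \<alpha> f)"
  by (auto simp: iter_deriv_def)

lemma schwartz_upto_iter_deriv:
  "schwartz_upto n f \<longleftrightarrow> (\<forall>\<alpha>. length \<alpha> \<le> n \<longrightarrow>
     (\<forall>x. iter_deriv \<alpha> f differentiable (at x)) \<and> rapidly_decaying (iter_deriv \<alpha> f))"
proof (induction n arbitrary: f)
  case 0
  then show ?case by (simp add: iter_deriv_simps)
next
  case (Suc n)
  show ?case
  proof
    assume L: "schwartz_upto (Suc n) f"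
    show "\<forall>\<alpha>. length \<alpha> \<le> Suc n \<longrightarrow>
     (\<forall>x. iter_deriv \<alpha> f differentiable (at x)) \<and> rapidly_decaying (iter_deriv \<alpha> f)"
    proof (intro allI impI)
      fix \<alpha> :: "'a list" assume "length \<alpha> \<le> Suc n"
      \<comment> \<open>The list is split at its end because its last entry is the derivative
        applied first.\<close>
      then show "(\<forall>x. iter_deriv \<alpha> f differentiable (at x)) \<and> rapidly_decaying (iter_deriv \<alpha> f)"
        using L Suc.IH by (cases \<alpha> rule: rev_cases) (auto simp: iter_deriv_simps)
    qed
  next
    assume R: "\<forall>\<alpha>. length \<alpha> \<le> Suc n \<longrightarrow>
     (\<forall>x. iter_deriv \<alpha> f differentiable (at x)) \<and> rapidly_decaying (iter_deriv \<alpha> f)"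
    have "length \<alpha> \<le> n \<Longrightarrow> (\<forall>x. iter_deriv \<alpha> (partial_deriv i f) differentiable (at x)) \<and>
        rapidly_decaying (iter_deriv \<alpha> (partial_deriv i f))" for \<alpha> i
      using R[rule_format, of "\<alpha> @ [i]"] by (simp add: iter_deriv_simps)
    then show "schwartz_upto (Suc n) f"
      using R[rule_format, of "[]"] Suc.IH by (simp add: iter_deriv_simps)
  qed
qed

lemma schwartz_iff_upto: "f \<in> schwartz \<longleftrightarrow> (\<forall>n. schwartz_upto n f)"
  unfolding schwartz_upto_iter_deriv schwartz_def rapidly_decaying_iff_bounded by auto

lemma schwartz_differentiable: "f \<in> schwartz \<Longrightarrow> f differentiable (at x)"
  by (meson schwartz_iff_upto schwartz_uptoD)

lemma schwartz_rapidly_decaying: "f \<in> schwartz \<Longrightarrow> rapidly_decaying f"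
  by (meson schwartz_iff_upto schwartz_uptoD)

lemma schwartz_partial_deriv: "f \<in> schwartz \<Longrightarrow> partial_deriv i f \<in> schwartz"
  unfolding schwartz_iff_upto by (metis schwartz_upto.simps(2))

lemma schwartz_iter_deriv: "f \<in> schwartz \<Longrightarrow> iter_deriv \<alpha> f \<in> schwartz"
  by (induction \<alpha>) (auto simp: iter_deriv_simps schwartz_partial_deriv)

lemma schwartz_continuous: "f \<in> schwartz \<Longrightarrow> continuous_on UNIV f"
  using schwartz_differentiable differentiable_imp_continuous_within
  by (metis continuous_at_imp_continuous_on)

lemma schwartz_measurable: "f \<in> schwartz \<Longrightarrow> f \<in> borel_measurable borel"
  using schwartz_continuous borel_measurable_continuous_onI by blast

lemma schwartz_upto_add:
  "schwartz_upto n f \<Longrightarrow> schwartz_upto n g \<Longrightarrow> schwartz_upto n (\<lambda>x. f x + g x)"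
proof (induction n arbitrary: f g)
  case 0
  then show ?case by (auto intro: rapidly_decaying_add)
next
  case (Suc n)
  then have "partial_deriv i (\<lambda>x. f x + g x) = (\<lambda>x. partial_deriv i f x + partial_deriv i g x)" for i
    by (auto intro!: partial_deriv_add)
  then show ?case using Suc by (auto intro!: rapidly_decaying_add)
qed

lemma schwartz_add: "f \<in> schwartz \<Longrightarrow> g \<in> schwartz \<Longrightarrow> (\<lambda>x. f x + g x) \<in> schwartz"
  by (simp add: schwartz_iff_upto schwartz_upto_add)

lemma schwartz_upto_mono: "schwartz_upto (Suc n) f \<Longrightarrow> schwartz_upto n f"
  by (simp add: schwartz_upto_iter_deriv)

lemma bounded_linear_comp_differentiable:
  "bounded_linear L \<Longrightarrow> f differentiable (at x) \<Longrightarrow> (\<lambda>x. L (f x)) differentiable (at x)"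
  unfolding differentiable_def using bounded_linear.has_derivative by blast

lemma schwartz_upto_bounded_linear:
  "bounded_linear L \<Longrightarrow> schwartz_upto n f \<Longrightarrow> schwartz_upto n (\<lambda>x. L (f x))"
proof (induction n arbitrary: f)
  case 0
  obtain K where K: "\<And>x. norm (L x) \<le> norm x * K"
    using bounded_linear.bounded[OF 0(1)] by auto
  have "rapidly_decaying (\<lambda>x. L (f x))"
    by (rule rapidly_decaying_dominated[where f=f and K=K and l=0]) (use 0 K in \<open>auto simp: mult.commute\<close>)
  then show ?case using 0 bounded_linear_comp_differentiable[of L f] by auto
next
  case (Suc n)
  have "rapidly_decaying (\<lambda>x. L (f x))"
    using Suc.IH[OF Suc.prems(1) schwartz_upto_mono[OF Suc.prems(2)]] schwartz_uptoD by blast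
  moreover have "partial_deriv i (\<lambda>x. L (f x)) = (\<lambda>x. L (partial_deriv i f x))" for i
    using Suc by (auto intro!: partial_deriv_bounded_linear)
  ultimately show ?case using Suc bounded_linear_comp_differentiable[of L f] by auto
qed

lemma schwartz_bounded_linear: "bounded_linear L \<Longrightarrow> f \<in> schwartz \<Longrightarrow> (\<lambda>x. L (f x)) \<in> schwartz"
  by (simp add: schwartz_iff_upto schwartz_upto_bounded_linear)

lemma bounded_bilinear_differentiable:
  assumes "bounded_bilinear pr" "f differentiable (at x)" "g differentiable (at x)"
  shows "(\<lambda>x. pr (f x) (g x)) differentiable (at x)"
  using assms bounded_bilinear.FDERIV[OF assms(1), of f _ x UNIV g]
  unfolding differentiable_def by blast

text \<open>A single Leibniz rule serves scaling and complex multiplication. In each of its two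
  terms only one factor is differentiated; the other is lowered by one order with
  \<open>schwartz_upto_mono\<close> to fit the induction hypothesis.\<close>

lemma schwartz_upto_bilinear:
  assumes "bounded_bilinear pr"
  shows "schwartz_upto n f \<Longrightarrow> schwartz_upto n g \<Longrightarrow> schwartz_upto n (\<lambda>x. pr (f x) (g x))"
proof (induction n arbitrary: f g)
  case 0
  obtain K where K: "\<And>a b. norm (pr a b) \<le> norm a * norm b * K"
    using bounded_bilinear.bounded[OF assms] by auto
  obtain B where B: "B > 0" "\<And>x. (1 + norm x) ^ 0 * norm (g x) \<le> B"
    using rapidly_decayingE[of g 0] 0 by auto
  have "norm (pr (f x) (g x)) \<le> (\<bar>K\<bar> * B) * (1 + norm x) ^ 0 * norm (f x)" for x
  proof -
    have "norm (pr (f x) (g x)) \<le> norm (f x) * norm (g x) * \<bar>K\<bar>"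
      using K[of "f x" "g x"] mult_left_mono[OF abs_ge_self[of K], of "norm (f x) * norm (g x)"] by simp
    also have "\<dots> \<le> norm (f x) * B * \<bar>K\<bar>"
      using B(2)[of x] by (intro mult_right_mono mult_left_mono) auto
    finally show ?thesis by (simp add: mult_ac)
  qed
  then have "rapidly_decaying (\<lambda>x. pr (f x) (g x))"
    by (rule rapidly_decaying_dominated[rotated]) (use 0 in auto)
  moreover have "(\<lambda>x. pr (f x) (g x)) differentiable (at x)" for x
    using 0 by (intro bounded_bilinear_differentiable[OF assms]) auto
  ultimately show ?case by simp
next
  case (Suc n)
  have "rapidly_decaying (\<lambda>x. pr (f x) (g x))"
    by (rule schwartz_uptoD[OF Suc.IH[OF Suc.prems[THEN schwartz_upto_mono]]])
  moreover have "partial_deriv i (\<lambda>x. pr (f x) (g x)) =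
      (\<lambda>x. pr (partial_deriv i f x) (g x) + pr (f x) (partial_deriv i g x))" for i
    using Suc by (auto intro!: partial_deriv_bilinear[OF assms])
  moreover have "schwartz_upto n (\<lambda>x. pr (partial_deriv i f x) (g x) + pr (f x) (partial_deriv i g x))" for i
    using Suc.prems by (intro schwartz_upto_add Suc.IH) (auto intro: schwartz_upto_mono)
  moreover have "(\<lambda>x. pr (f x) (g x)) differentiable (at x)" for x
    using Suc.prems by (intro bounded_bilinear_differentiable[OF assms]) auto
  ultimately show ?case by simp
qed

lemma schwartz_bilinear:
  "bounded_bilinear pr \<Longrightarrow> f \<in> schwartz \<Longrightarrow> g \<in> schwartz \<Longrightarrow> (\<lambda>x. pr (f x) (g x)) \<in> schwartz"
  by (simp add: schwartz_iff_upto schwartz_upto_bilinear)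

lemma schwartz_scaleR_fun:
  "f \<in> schwartz \<Longrightarrow> g \<in> schwartz \<Longrightarrow> (\<lambda>x. f x *\<^sub>R g x) \<in> schwartz"
  by (rule schwartz_bilinear[OF bounded_bilinear_scaleR])

lemma schwartz_mult_fun:
  fixes f g :: "_ \<Rightarrow> 'a::real_normed_algebra"
  shows "f \<in> schwartz \<Longrightarrow> g \<in> schwartz \<Longrightarrow> (\<lambda>x. f x * g x) \<in> schwartz"
  by (rule schwartz_bilinear[OF bounded_bilinear_mult])

lemma schwartz_cmult:
  fixes f :: "_ \<Rightarrow> 'a::real_normed_algebra"
  shows "f \<in> schwartz \<Longrightarrow> (\<lambda>x. c * f x) \<in> schwartz"
  by (rule schwartz_bounded_linear[OF bounded_linear_mult_right])

lemma schwartz_minus: "f \<in> schwartz \<Longrightarrow> (\<lambda>x. - f x) \<in> schwartz"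
  by (rule schwartz_bounded_linear[OF bounded_linear_minus[OF bounded_linear_ident]])

lemma schwartz_diff: "f \<in> schwartz \<Longrightarrow> g \<in> schwartz \<Longrightarrow> (\<lambda>x. f x - g x) \<in> schwartz"
  using schwartz_add[of f "\<lambda>x. - g x"] schwartz_minus by auto

lemma schwartz_zero: "(\<lambda>x::real^'n::finite. 0::'b::real_normed_vector) \<in> schwartz"
proof -
  have "schwartz_upto n (\<lambda>x::real^'n. 0::'b)" for n
    by (induction n) (auto simp: rapidly_decaying_def partial_deriv_def)
  then show ?thesis by (simp add: schwartz_iff_upto)
qed

lemma schwartz_sum:
  "(\<And>i. i \<in> I \<Longrightarrow> f i \<in> schwartz) \<Longrightarrow> (\<lambda>x. \<Sum>i\<in>I. f i x) \<in> schwartz"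
  by (induction I rule: infinite_finite_induct) (auto simp: schwartz_zero schwartz_add)

lemma schwartz_of_real:
  "f \<in> schwartz \<Longrightarrow> (\<lambda>x. complex_of_real (f x)) \<in> schwartz"
  by (rule schwartz_bounded_linear[OF bounded_linear_of_real])

text \<open>Solving z = c x + a for x shows that the weights at \<open>x\<close> and at its affine
  image are comparable.\<close>

lemma norm_affine_ge:
  fixes x a :: "'a::real_normed_vector"
  assumes "c \<noteq> 0"
  shows "1 + norm x \<le> (1 + 1 / \<bar>c\<bar>) * (1 + norm a) * (1 + norm (c *\<^sub>R x + a))"
proof -
  define z where "z = c *\<^sub>R x + a"
  have "x = (1 / c) *\<^sub>R (z - a)" using assms by (simp add: z_def)
  then have "norm x \<le> (1 / \<bar>c\<bar>) * (norm z + norm a)"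
    by (metis abs_divide abs_one mult_left_mono norm_scaleR norm_triangle_ineq4 zero_le_divide_1_iff abs_ge_zero)
  also have "\<dots> \<le> (1 / \<bar>c\<bar>) * ((1 + norm a) * (1 + norm z))"
    by (intro mult_left_mono) (auto simp: algebra_simps)
  finally have "norm x \<le> (1 / \<bar>c\<bar>) * ((1 + norm a) * (1 + norm z))" .
  moreover have "1 \<le> (1 + norm a) * (1 + norm z)"
    by (simp add: algebra_simps)
  ultimately have "1 + norm x \<le> (1 + norm a) * (1 + norm z) + (1 / \<bar>c\<bar>) * ((1 + norm a) * (1 + norm z))"
    by linarith
  also have "\<dots> = (1 + 1 / \<bar>c\<bar>) * (1 + norm a) * (1 + norm z)" by (simp only: ring_distribs)
  finally show ?thesis by (simp add: z_def)
qed

lemma rapidly_decaying_affine: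
  fixes f :: "'a::real_normed_vector \<Rightarrow> 'b::real_normed_vector"
  assumes "rapidly_decaying f" "c \<noteq> 0"
  shows "rapidly_decaying (\<lambda>x. f (c *\<^sub>R x + a))"
  unfolding rapidly_decaying_def
proof
  fix m
  obtain A where A: "\<And>x. (1 + norm x) ^ m * norm (f x) \<le> A"
    using assms by (meson rapidly_decaying_def)
  define K where "K = (1 + 1 / \<bar>c\<bar>) * (1 + norm a)"
  have "(1 + norm x) ^ m * norm (f (c *\<^sub>R x + a)) \<le> K ^ m * A" for x
  proof -
    have "(1 + norm x) ^ m \<le> (K * (1 + norm (c *\<^sub>R x + a))) ^ m"
      using norm_affine_ge[OF assms(2), of x a] by (intro power_mono) (auto simp: K_def)
    then have "(1 + norm x) ^ m * norm (f (c *\<^sub>R x + a)) \<le>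
        (K * (1 + norm (c *\<^sub>R x + a))) ^ m * norm (f (c *\<^sub>R x + a))"
      by (intro mult_right_mono) auto
    also have "\<dots> = K ^ m * ((1 + norm (c *\<^sub>R x + a)) ^ m * norm (f (c *\<^sub>R x + a)))"
      by (simp add: power_mult_distrib)
    also have "\<dots> \<le> K ^ m * A" using A by (intro mult_left_mono) (auto simp: K_def)
    finally show ?thesis .
  qed
  then show "\<exists>C. \<forall>x. (1 + norm x) ^ m * norm (f (c *\<^sub>R x + a)) \<le> C" by blast
qed

lemma schwartz_upto_affine:
  assumes "c \<noteq> 0"
  shows "schwartz_upto n f \<Longrightarrow> schwartz_upto n (\<lambda>x. f (c *\<^sub>R x + a))"
proof (induction n arbitrary: f)
  case 0
  then show ?case using assms has_derivative_affine_comp[of f c _ a]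
    by (auto simp: differentiable_def intro: rapidly_decaying_affine)
next
  case (Suc n)
  have "partial_deriv i (\<lambda>x. f (c *\<^sub>R x + a)) = (\<lambda>x. c *\<^sub>R partial_deriv i f (c *\<^sub>R x + a))" for i
    using Suc by (auto intro!: partial_deriv_affine_comp)
  moreover have "schwartz_upto n (\<lambda>x. c *\<^sub>R partial_deriv i f (c *\<^sub>R x + a))" for i
    using Suc by (intro schwartz_upto_bounded_linear[OF bounded_linear_scaleR_right]) auto
  ultimately show ?case using Suc.prems assms has_derivative_affine_comp[of f c _ a]
    by (auto simp: differentiable_def intro: rapidly_decaying_affine)
qed

lemma schwartz_affine:
  "c \<noteq> 0 \<Longrightarrow> f \<in> schwartz \<Longrightarrow> (\<lambda>x. f (c *\<^sub>R x + a)) \<in> schwartz"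
  by (simp add: schwartz_iff_upto schwartz_upto_affine)

lemma schwartz_dilation: "c \<noteq> 0 \<Longrightarrow> f \<in> schwartz \<Longrightarrow> (\<lambda>x. f (c *\<^sub>R x)) \<in> schwartz"
  using schwartz_affine[of c f 0] by simp

lemma schwartz_reflection: "f \<in> schwartz \<Longrightarrow> (\<lambda>x. f (- x)) \<in> schwartz"
  using schwartz_dilation[of "-1" f] by simp

text \<open>A coordinate function is not itself in \<open>schwartz\<close>, so the bilinear rule
  does not apply. The factor costs one power of the weight, and its own derivative is
  constant.\<close>

lemma schwartz_upto_coord_mult:
  "schwartz_upto n f \<Longrightarrow> schwartz_upto n (\<lambda>x. x $ j *\<^sub>R f x)"
proof (induction n arbitrary: f)
  have R: "rapidly_decaying (\<lambda>x. x $ j *\<^sub>R f x)" if "rapidly_decaying f"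
    for f :: "real^'a \<Rightarrow> 'b"
  proof (rule rapidly_decaying_dominated[OF that, where K=1 and l=1])
    fix x :: "real^'a"
    have "\<bar>x $ j\<bar> \<le> 1 + norm x" using component_le_norm_cart[of x j] by linarith
    then show "norm (x $ j *\<^sub>R f x) \<le> 1 * (1 + norm x) ^ 1 * norm (f x)"
      by (simp add: mult_right_mono)
  qed
  have D: "(\<lambda>x. x $ j) differentiable (at x)" for x :: "real^'a"
    using bounded_linear_imp_differentiable[OF bounded_linear_vec_nth] by blast
  {
    case 0
    then show ?case
      using R D bounded_bilinear_differentiable[OF bounded_bilinear_scaleR] by auto
  next
    case (Suc n)
    have "partial_deriv i (\<lambda>x. x $ j *\<^sub>R f x) =
      (\<lambda>x. (if i = j then 1 else 0) *\<^sub>R f x + x $ j *\<^sub>R partial_deriv i f x)" for i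
      by (rule ext, subst partial_deriv_bilinear[OF bounded_bilinear_scaleR D])
        (use Suc in \<open>auto simp: partial_deriv_coord\<close>)
    moreover have "schwartz_upto n (\<lambda>x. (if i = j then 1 else 0) *\<^sub>R f x + x $ j *\<^sub>R partial_deriv i f x)" for i
      using Suc by (intro schwartz_upto_add schwartz_upto_bounded_linear[OF bounded_linear_scaleR_right])
        (auto intro: schwartz_upto_mono simp del: schwartz_upto.simps simp: schwartz_upto.simps(2))
    ultimately show ?case
      using Suc R D bounded_bilinear_differentiable[OF bounded_bilinear_scaleR] by auto
  }
qed

lemma schwartz_coord_mult: "f \<in> schwartz \<Longrightarrow> (\<lambda>x. x $ j *\<^sub>R f x) \<in> schwartz"
  by (simp add: schwartz_iff_upto schwartz_upto_coord_mult)

text \<open>The denominator may vanish off the support of \<open>a\<close>; there the quotient is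
  locally zero because division by 0 yields 0. The induction survives differentiation since the new
  numerators are again supported in the support of \<open>a\<close> and the new denominators are
  powers of \<open>b\<close>.\<close>

lemma schwartz_upto_divide:
  fixes a b :: "real^'n::finite \<Rightarrow> real"
  assumes "schwartz_upto n a" "schwartz_upto n b"
    "compact (closure {x. a x \<noteq> 0})" "\<And>x. x \<in> closure {x. a x \<noteq> 0} \<Longrightarrow> b x \<noteq> 0"
  shows "schwartz_upto n (\<lambda>x. a x / b x)"
  using assms
proof (induction n arbitrary: a b)
  \<comment> \<open>The quotient rule as a formula valid at every point: off the support of
    \<open>a\<close> both sides are zero, whatever \<open>b\<close> does.\<close>
  have D: "((\<lambda>x. a x / b x) has_derivative
      (\<lambda>h. (frechet_derivative a (at x) h * b x - a x * frechet_derivative b (at x) h) / (b x * b x))) (at x)"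
    if "\<And>x. a differentiable (at x)" "\<And>x. b differentiable (at x)"
      "\<And>x. x \<in> closure {x. a x \<noteq> 0} \<Longrightarrow> b x \<noteq> 0" for a b :: "real^'n \<Rightarrow> real" and x
  proof (cases "x \<in> closure {x. a x \<noteq> 0}")
    case True
    show ?thesis
      by (rule has_derivative_divide') (use that True frechet_derivative_works in blast)+
  next
    case False
    have "{x. a x / b x \<noteq> 0} \<subseteq> {x. a x \<noteq> 0}" by auto
    then have "x \<notin> closure {x. a x / b x \<noteq> 0}" using False closure_mono by blast
    then have 1: "((\<lambda>x. a x / b x) has_derivative (\<lambda>_. 0)) (at x)"
      by (rule partial_deriv_zero_off_support)
    have "frechet_derivative a (at x) = (\<lambda>_. 0)"
      using frechet_derivative_at[OF partial_deriv_zero_off_support(1)[OF False]] by simp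
    moreover have "a x = 0" using False closure_subset[of "{x. a x \<noteq> 0}"] by auto
    ultimately show ?thesis using 1 by simp
  qed
  have R: "rapidly_decaying (\<lambda>x. a x / b x)"
    if "\<And>x. a differentiable (at x)" "\<And>x. b differentiable (at x)"
      "compact (closure {x. a x \<noteq> 0})"
      "\<And>x. x \<in> closure {x. a x \<noteq> 0} \<Longrightarrow> b x \<noteq> 0" for a b :: "real^'n \<Rightarrow> real"
  proof (rule rapidly_decaying_compact_support)
    show "continuous_on UNIV (\<lambda>x. a x / b x)"
      using D[OF that(1,2,4)] by (meson has_derivative_continuous continuous_at_imp_continuous_on)
    have "closure {x. a x / b x \<noteq> 0} \<subseteq> closure {x. a x \<noteq> 0}" by (intro closure_mono) auto
    then show "compact (closure {x. a x / b x \<noteq> 0})"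
      using that(3) by (simp add: compact_eq_bounded_closed) (blast intro: bounded_subset)
  qed
  have D': "(\<lambda>x. a x / b x) differentiable (at x)"
    if "\<And>x. a differentiable (at x)" "\<And>x. b differentiable (at x)"
      "\<And>x. x \<in> closure {x. a x \<noteq> 0} \<Longrightarrow> b x \<noteq> 0" for a b :: "real^'n \<Rightarrow> real" and x
    using D[OF that] unfolding differentiable_def by blast
  {
    case 0
    then have d: "a differentiable (at x)" "b differentiable (at x)" for x by auto
    show ?case using D'[OF d 0(4)] R[OF d 0(3,4)] by simp
  next
    case (Suc n)
    have d: "a differentiable (at x)" "b differentiable (at x)" for x using Suc.prems by auto
    \<comment> \<open>Written as a sum of two quotients, each an instance of the induction
      hypothesis. At zeros of \<open>b\<close> both sides are 0.\<close>
    have "partial_deriv i (\<lambda>x. a x / b x) =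
      (\<lambda>x. partial_deriv i a x / b x + (- (a x * partial_deriv i b x)) / (b x * b x))" for i
    proof
      fix x
      have "partial_deriv i (\<lambda>x. a x / b x) x
          = (partial_deriv i a x * b x - a x * partial_deriv i b x) / (b x * b x)"
        using partial_deriv_eq[OF D[OF d Suc.prems(4)]] by (simp add: partial_deriv_def)
      then show "partial_deriv i (\<lambda>x. a x / b x) x =
         partial_deriv i a x / b x + (- (a x * partial_deriv i b x)) / (b x * b x)"
        by (cases "b x = 0") (simp_all add: field_simps)
    qed
    moreover have "schwartz_upto n (\<lambda>x. partial_deriv i a x / b x + (- (a x * partial_deriv i b x)) / (b x * b x))" for i
    proof (rule schwartz_upto_add)
      have c: "compact (closure A)" if "A \<subseteq> closure {x. a x \<noteq> 0}" for A
        using that Suc.prems(3) by (meson bounded_subset compact_closure compact_imp_bounded)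
      have cl: "closure A \<subseteq> closure {x. a x \<noteq> 0}" if "A \<subseteq> closure {x. a x \<noteq> 0}" for A
        using that by (simp add: closure_minimal)
      have s1: "{x. partial_deriv i a x \<noteq> 0} \<subseteq> closure {x. a x \<noteq> 0}"
        using partial_deriv_zero_off_support(2) by blast
      have s2: "{x. - (a x * partial_deriv i b x) \<noteq> 0} \<subseteq> closure {x. a x \<noteq> 0}"
        using closure_subset[of "{x. a x \<noteq> 0}"] by auto
      show "schwartz_upto n (\<lambda>x. partial_deriv i a x / b x)"
      proof (rule Suc.IH)
        show "schwartz_upto n b" using Suc.prems(2) by (rule schwartz_upto_mono)
      qed (use Suc.prems c[OF s1] cl[OF s1] in auto)
      show "schwartz_upto n (\<lambda>x. (- (a x * partial_deriv i b x)) / (b x * b x))"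
      proof (rule Suc.IH)
        show "schwartz_upto n (\<lambda>x. b x * b x)"
          using Suc.prems(2) schwartz_upto_mono by (intro schwartz_upto_bilinear[OF bounded_bilinear_mult]) blast+
        show "schwartz_upto n (\<lambda>x. - (a x * partial_deriv i b x))"
          using Suc.prems schwartz_upto_mono
          by (intro schwartz_upto_bounded_linear[OF bounded_linear_minus[OF bounded_linear_ident]]
              schwartz_upto_bilinear[OF bounded_bilinear_mult]) (blast, simp)
        show "compact (closure {x. - (a x * partial_deriv i b x) \<noteq> 0})" by (rule c[OF s2])
        show "b x * b x \<noteq> 0" if "x \<in> closure {x. - (a x * partial_deriv i b x) \<noteq> 0}" for x
          using that cl[OF s2] Suc.prems(4) by auto
      qed
    qed
    ultimately show ?case using D'[OF d Suc.prems(4)] R[OF d Suc.prems(3,4)] by simp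
  }
qed

lemma schwartz_divide:
  fixes a b :: "real^'n::finite \<Rightarrow> real"
  assumes "a \<in> schwartz" "b \<in> schwartz"
    "compact (closure {x. a x \<noteq> 0})" "\<And>x. x \<in> closure {x. a x \<noteq> 0} \<Longrightarrow> b x \<noteq> 0"
  shows "(\<lambda>x. a x / b x) \<in> schwartz"
  using assms by (auto simp: schwartz_iff_upto intro: schwartz_upto_divide)

subsection \<open>Integrability\<close>

text \<open>The exponent is twice the dimension so that every coordinate can be charged one factor
  (1 + |x|)^2, which dominates 1 + t^2 for that coordinate t.\<close>

definition weight :: "'a::euclidean_space \<Rightarrow> real" where
  "weight x = 1 / (1 + norm x) ^ (2 * DIM('a))"

lemma weight_pos: "weight x > 0"
proof -
  have "1 + norm x > 0" by (simp add: add_pos_nonneg)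
  then show ?thesis by (simp add: weight_def)
qed

lemma weight_measurable [measurable]: "weight \<in> borel_measurable borel"
  unfolding weight_def[abs_def] by measurable

text \<open>The majorant is a product of the one-dimensional integrable functions 1 / (1 + t^2), so
  its integral factorises.\<close>

lemma integrable_weight: "integrable lborel (weight :: 'a::euclidean_space \<Rightarrow> real)"
proof -
  let ?g = "\<lambda>t::real. inverse (1 + t\<^sup>2)"
  have "integrable lborel ?g"
    using integrable_inverse_1_plus_square by (simp add: set_integrable_def einterval_def)
  then have fin: "(\<integral>\<^sup>+t. ennreal (?g t) \<partial>lborel) < \<infinity>"
    by (simp add: integrable_iff_bounded)
  have le: "weight x \<le> (\<Prod>b\<in>Basis. ?g (x \<bullet> b))" for x :: 'a
  proof -
    have "(\<Prod>b\<in>Basis. 1 + (x \<bullet> b)\<^sup>2) \<le> (\<Prod>b\<in>(Basis::'a set). (1 + norm x)\<^sup>2)"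
    proof (intro prod_mono conjI)
      fix b :: 'a assume "b \<in> Basis"
      then have "(x \<bullet> b)\<^sup>2 \<le> (norm x)\<^sup>2" using Basis_le_norm[of b x]
        by (metis abs_ge_zero power2_abs power_mono)
      then show "1 + (x \<bullet> b)\<^sup>2 \<le> (1 + norm x)\<^sup>2" using norm_ge_zero[of x] by (simp only: power2_sum power_one)
    qed (simp add: add_nonneg_nonneg)
    also have "\<dots> = (1 + norm x) ^ (2 * DIM('a))" by (simp add: power_mult)
    finally have "(\<Prod>b\<in>Basis. 1 + (x \<bullet> b)\<^sup>2) \<le> (1 + norm x) ^ (2 * DIM('a))" .
    moreover have "0 < (\<Prod>b\<in>Basis. 1 + (x \<bullet> b)\<^sup>2)" by (intro prod_pos) (simp add: add_pos_nonneg)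
    ultimately have "weight x \<le> 1 / (\<Prod>b\<in>Basis. 1 + (x \<bullet> b)\<^sup>2)"
      unfolding weight_def by (intro divide_left_mono) (auto intro!: mult_pos_pos intro: less_le_trans)
    also have "\<dots> = (\<Prod>b\<in>Basis. ?g (x \<bullet> b))"
      by (simp add: divide_inverse prod_inversef[symmetric])
    finally show ?thesis .
  qed
  have "(\<integral>\<^sup>+x. ennreal (norm (weight (x::'a))) \<partial>lborel)
      \<le> (\<integral>\<^sup>+x. (\<Prod>b\<in>(Basis::'a set). ennreal (?g (x \<bullet> b))) \<partial>lborel)"
    by (intro nn_integral_mono) (use le in \<open>simp add: prod_ennreal abs_of_pos[OF weight_pos] ennreal_leI\<close>)
  also have "\<dots> = (\<Prod>b\<in>(Basis::'a set). (\<integral>\<^sup>+t. ennreal (?g t) \<partial>lborel))"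
    by (rule nn_integral_lborel_prod) auto
  also have "\<dots> < \<infinity>" using fin by (auto simp: less_top[symmetric] power_eq_top_ennreal)
  finally show ?thesis by (intro integrableI_bounded) auto
qed

lemma rapidly_decaying_le_weight:
  fixes f :: "'a::euclidean_space \<Rightarrow> 'b::real_normed_vector"
  assumes "rapidly_decaying f"
  obtains C where "C > 0" "\<And>x. norm (f x) \<le> C * weight x"
proof -
  obtain C where C: "C > 0" "\<And>x. (1 + norm x) ^ (2 * DIM('a)) * norm (f x) \<le> C"
    using rapidly_decayingE[OF assms] by metis
  have "norm (f x) \<le> C * weight x" for x
  proof -
    have "(1 + norm x) ^ (2 * DIM('a)) > 0" by (simp add: add_pos_nonneg)
    then show ?thesis using C(2)[of x] by (simp add: weight_def field_simps)
  qed
  then show ?thesis using C(1) that by blast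
qed

lemma rapidly_decaying_integrable:
  fixes f :: "'a::euclidean_space \<Rightarrow> 'b::{banach, second_countable_topology}"
  assumes "rapidly_decaying f" "f \<in> borel_measurable borel"
  shows "integrable lborel f"
proof -
  obtain C where C: "C > 0" "\<And>x. norm (f x) \<le> C * weight x"
    using rapidly_decaying_le_weight[OF assms(1)] by metis
  show ?thesis
    by (rule Bochner_Integration.integrable_bound[of _ "\<lambda>x. C * weight x"])
      (use C assms(2) integrable_weight weight_pos in \<open>auto intro: order.trans[OF C(2)] abs_ge_self\<close>)
qed

lemma schwartz_integrable:
  fixes f :: "_ \<Rightarrow> 'b::{banach, second_countable_topology}"
  shows "f \<in> schwartz \<Longrightarrow> integrable lborel f"
  using rapidly_decaying_integrable schwartz_measurable schwartz_rapidly_decaying by blast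

lemma nn_integral_lborel_affine:
  fixes f :: "'a::euclidean_space \<Rightarrow> ennreal"
  assumes [measurable]: "f \<in> borel_measurable borel" and c: "c \<noteq> 0"
  shows "(\<integral>\<^sup>+x. f x \<partial>lborel) = ennreal (\<bar>c\<bar> ^ DIM('a)) * (\<integral>\<^sup>+x. f (t + c *\<^sub>R x) \<partial>lborel)"
  by (subst lborel_affine[OF c, of t])
     (simp add: nn_integral_density nn_integral_distr nn_integral_cmult)

lemma integrable_lborel_affine:
  fixes f :: "'a::euclidean_space \<Rightarrow> 'b::{banach, second_countable_topology}"
  assumes f: "integrable lborel f" and c: "c \<noteq> 0"
  shows "integrable lborel (\<lambda>x. f (t + c *\<^sub>R x))"
  using f f[THEN borel_measurable_integrable] c unfolding integrable_iff_bounded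
  by (subst (asm) nn_integral_lborel_affine[where c=c and t=t]) (auto simp: ennreal_mult_less_top)

lemma integral_lborel_affine:
  fixes f :: "'a::euclidean_space \<Rightarrow> 'b::{banach, second_countable_topology}"
  assumes f[measurable]: "f \<in> borel_measurable borel" and c: "c \<noteq> 0"
  shows "(\<integral>x. f x \<partial>lborel) = (\<bar>c\<bar> ^ DIM('a)) *\<^sub>R (\<integral>x. f (t + c *\<^sub>R x) \<partial>lborel)"
  by (subst lborel_affine[OF c, of t])
     (simp add: integral_density integral_distr)

lemma integral_lborel_shift:
  fixes f :: "'a::euclidean_space \<Rightarrow> 'b::{banach, second_countable_topology}"
  assumes "f \<in> borel_measurable borel"
  shows "(\<integral>x. f (t + x) \<partial>lborel) = (\<integral>x. f x \<partial>lborel)"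
  using integral_lborel_affine[OF assms, of 1 t] by simp

lemma integral_lborel_reflect:
  fixes f :: "'a::euclidean_space \<Rightarrow> 'b::{banach, second_countable_topology}"
  assumes "f \<in> borel_measurable borel"
  shows "(\<integral>x. f (t - x) \<partial>lborel) = (\<integral>x. f x \<partial>lborel)"
  using integral_lborel_affine[OF assms, of "-1" t] by simp

text \<open>The common form of Fubini's theorem for exponentials, Gaussians and Schwartz kernels: a
  bounded \<open>B\<close> leaves |a| |b| as an integrable majorant on the product space.\<close>

lemma fubini_bounded:
  fixes a b :: "'a::euclidean_space \<Rightarrow> complex" and B :: "'a \<times> 'a \<Rightarrow> complex"
  assumes a: "integrable lborel a" and b: "integrable lborel b"
    and B[measurable]: "B \<in> borel_measurable borel" and bd: "\<And>z. norm (B z) \<le> K"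
  shows "(\<integral>x. a x * (\<integral>y. B (x, y) * b y \<partial>lborel) \<partial>lborel)
       = (\<integral>y. b y * (\<integral>x. B (x, y) * a x \<partial>lborel) \<partial>lborel)"
proof -
  have am[measurable]: "a \<in> borel_measurable borel" and bm[measurable]: "b \<in> borel_measurable borel"
    using a b by (auto dest: borel_measurable_integrable)
  have Bp[measurable]: "B \<in> borel_measurable (borel \<Otimes>\<^sub>M borel)" using B by (simp add: borel_prod)
  let ?f = "\<lambda>(x, y). a x * (B (x, y) * b y)"
  have K0: "0 \<le> K" using bd[of undefined] norm_ge_zero order.trans by blast
  have sec: "integrable lborel (\<lambda>y. B (x, y) * b y)" for x
    by (rule Bochner_Integration.integrable_bound[of _ "\<lambda>y. K * norm (b y)"])
      (use b bd K0 in \<open>auto simp: norm_mult intro!: mult_right_mono\<close>)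
  have "integrable (lborel \<Otimes>\<^sub>M lborel) ?f"
  proof (rule lborel_pair.Fubini_integrable)
    show "?f \<in> borel_measurable (lborel \<Otimes>\<^sub>M lborel)" by measurable
    show "AE x in lborel. integrable lborel (\<lambda>y. ?f (x, y))" using sec by auto
    show "integrable lborel (\<lambda>x. \<integral>y. norm (?f (x, y)) \<partial>lborel)"
    proof (rule Bochner_Integration.integrable_bound[of _ "\<lambda>x. norm (a x) * (K * (\<integral>y. norm (b y) \<partial>lborel))"])
      show "integrable lborel (\<lambda>x. norm (a x) * (K * (\<integral>y. norm (b y) \<partial>lborel)))" using a by auto
      have "(\<integral>y. norm (a x * (B (x, y) * b y)) \<partial>lborel)
          \<le> norm (a x) * (K * (\<integral>y. norm (b y) \<partial>lborel))" for x
      proof -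
        have "(\<integral>y. norm (a x * (B (x, y) * b y)) \<partial>lborel) \<le> (\<integral>y. norm (a x) * (K * norm (b y)) \<partial>lborel)"
        proof (rule integral_mono)
          show "integrable lborel (\<lambda>y. norm (a x * (B (x, y) * b y)))"
            using sec[of x] by (intro integrable_norm integrable_mult_right)
          show "integrable lborel (\<lambda>y. norm (a x) * (K * norm (b y)))" using b by auto
        qed (use bd in \<open>auto simp: norm_mult intro!: mult_left_mono mult_right_mono\<close>)
        then show ?thesis by simp
      qed
      then show "AE x in lborel. norm (\<integral>y. norm (?f (x, y)) \<partial>lborel)
          \<le> norm (norm (a x) * (K * (\<integral>y. norm (b y) \<partial>lborel)))"
        by (auto simp: Bochner_Integration.integral_nonneg intro: order.trans[OF _ abs_ge_self])
    qed (measurable)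
  qed
  from lborel_pair.Fubini_integral[OF this[simplified]]
  have "(\<integral>y. (\<integral>x. a x * (B (x, y) * b y) \<partial>lborel) \<partial>lborel) =
     (\<integral>x. (\<integral>y. a x * (B (x, y) * b y) \<partial>lborel) \<partial>lborel)" by simp
  moreover have "(\<integral>x. a x * (B (x, y) * b y) \<partial>lborel) = b y * (\<integral>x. B (x, y) * a x \<partial>lborel)" for y
    by (subst integral_mult_right_zero[symmetric]) (simp add: mult_ac)
  ultimately show ?thesis by simp
qed

lemma has_derivative_quadratic_remainder:
  fixes f :: "'a::real_normed_vector \<Rightarrow> 'b::real_normed_vector"
  assumes "bounded_linear L" "\<And>h. norm (f (x + h) - f x - L h) \<le> C * (norm h)\<^sup>2"
  shows "(f has_derivative L) (at x)"
proof (rule has_derivativeI_sandwich[where H="\<lambda>y. C * norm (y - x)" and e=1])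
  fix y assume "y \<noteq> x"
  then have "norm (y - x) > 0" by simp
  moreover have "norm (f y - f x - L (y - x)) \<le> C * (norm (y - x))\<^sup>2"
    using assms(2)[of "y - x"] by simp
  ultimately show "norm (f y - f x - L (y - x)) / norm (y - x) \<le> C * norm (y - x)"
    by (simp add: divide_le_eq power2_eq_square mult_ac)
next
  have "((\<lambda>y. C * norm (y - x)) \<longlongrightarrow> C * norm (x - x)) (at x)"
    by (intro tendsto_intros)
  then show "((\<lambda>y. C * norm (y - x)) \<longlongrightarrow> 0) (at x)" by simp
qed (use assms in auto)

text \<open>Mean value inequality on the segment from \<open>x\<close> to \<open>x + v\<close>. The
  weight is moved from \<open>x\<close> to an intermediate point z by 1 + |x| <= (1 + |z|)(1 + |v|),
  which explains the growth in \<open>v\<close> on the right.\<close>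

lemma schwartz_increment:
  fixes \<theta> :: "real^'n::finite \<Rightarrow> 'b::real_normed_vector"
  assumes "\<theta> \<in> schwartz"
  obtains C where "C > 0"
    "\<And>x v. (1 + norm x) ^ m * norm (\<theta> (x + v) - \<theta> x) \<le> C * (norm v * (1 + norm v) ^ m)"
proof -
  have "\<exists>C>0. \<forall>x. (1 + norm x) ^ m * norm (partial_deriv i \<theta> x) \<le> C" for i
    using rapidly_decayingE[OF schwartz_rapidly_decaying[OF schwartz_partial_deriv[OF assms]]] by metis
  then obtain C where C: "\<And>i. C i > 0" "\<And>i x. (1 + norm x) ^ m * norm (partial_deriv i \<theta> x) \<le> C i"
    by metis
  have "(1 + norm x) ^ m * norm (\<theta> (x + v) - \<theta> x) \<le> (\<Sum>i\<in>UNIV. C i) * (norm v * (1 + norm v) ^ m)" for x v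
  proof -
    define B where "B = (\<Sum>i\<in>UNIV. C i) * ((1 + norm v) ^ m / (1 + norm x) ^ m)"
    have pos: "(1 + norm x) ^ m > 0" by (simp add: add_pos_nonneg)
    have "norm (\<theta> (x + v) - \<theta> x) \<le> B * norm (x + v - x)"
    proof (rule differentiable_bound[of "closed_segment x (x + v)"])
      fix z assume z: "z \<in> closed_segment x (x + v)"
      show "(\<theta> has_derivative (\<lambda>h. \<Sum>i\<in>UNIV. h $ i *\<^sub>R partial_deriv i \<theta> z)) (at z within closed_segment x (x + v))"
        by (rule has_derivative_at_withinI[OF has_derivative_partial[OF schwartz_differentiable[OF assms]]])
      have zv: "norm (z - x) \<le> norm v"
        using segment_bound1[OF z] by simp
      have "norm x \<le> norm z + norm (z - x)"
        by (metis norm_minus_commute norm_triangle_sub add.commute)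
      then have "1 + norm x \<le> (1 + norm z) * (1 + norm v)" using zv mult_nonneg_nonneg[OF norm_ge_zero norm_ge_zero, of z v]
        unfolding distrib_left distrib_right by linarith
      then have "(1 + norm x) ^ m \<le> ((1 + norm z) * (1 + norm v)) ^ m" by (intro power_mono) auto
      then have pw: "(1 + norm x) ^ m \<le> (1 + norm z) ^ m * (1 + norm v) ^ m" by (simp add: power_mult_distrib)
      have pd: "norm (partial_deriv i \<theta> z) \<le> C i * ((1 + norm v) ^ m / (1 + norm x) ^ m)" for i
      proof -
        have "(1 + norm x) ^ m * norm (partial_deriv i \<theta> z)
          \<le> ((1 + norm z) ^ m * (1 + norm v) ^ m) * norm (partial_deriv i \<theta> z)"
          using pw by (rule mult_right_mono) simp
        also have "\<dots> = (1 + norm v) ^ m * ((1 + norm z) ^ m * norm (partial_deriv i \<theta> z))" by simp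
        also have "\<dots> \<le> (1 + norm v) ^ m * C i" using C(2) by (intro mult_left_mono) auto
        finally show ?thesis using pos by (simp add: field_simps)
      qed
      show "onorm (\<lambda>h. \<Sum>i\<in>UNIV. h $ i *\<^sub>R partial_deriv i \<theta> z) \<le> B"
      proof (rule onorm_bound)
        show "0 \<le> B" unfolding B_def using C(1) by (intro mult_nonneg_nonneg sum_nonneg) (auto intro: less_imp_le)
        fix h :: "real^'n"
        have "norm (\<Sum>i\<in>UNIV. h $ i *\<^sub>R partial_deriv i \<theta> z) \<le> (\<Sum>i\<in>UNIV. norm h * (C i * ((1 + norm v) ^ m / (1 + norm x) ^ m)))"
          unfolding norm_scaleR[symmetric] using pd component_le_norm_cart[of h]
          by (intro sum_norm_le) (auto simp only: norm_scaleR intro!: mult_mono norm_ge_zero)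
        also have "\<dots> = B * norm h"
          by (simp only: B_def sum_distrib_left sum_distrib_right mult_ac)
        finally show "norm (\<Sum>i\<in>UNIV. h $ i *\<^sub>R partial_deriv i \<theta> z) \<le> B * norm h" .
      qed
    qed auto
    then show ?thesis using pos by (simp add: B_def field_simps)
  qed
  moreover have "(\<Sum>i\<in>UNIV. C i) > 0" using C(1) by (intro sum_pos) auto
  ultimately show ?thesis using that by blast
qed

subsection \<open>The Fourier transform on the Schwartz space\<close>

definition fourier_const :: "'n::finite itself \<Rightarrow> real" where
  "fourier_const _ = (2 * pi) powr (- real CARD('n) / 2)"

lemma fourier_const_pos: "fourier_const TYPE('n::finite) > 0"
  by (simp add: fourier_const_def)

definition expi :: "real \<Rightarrow> complex" where "expi t = exp (\<i> * complex_of_real t)"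

lemma norm_expi [simp]: "norm (expi t) = 1"
  by (simp add: expi_def)

lemma expi_add: "expi (s + t) = expi s * expi t"
  by (simp add: expi_def exp_add distrib_left)

lemma expi_0 [simp]: "expi 0 = 1" by (simp add: expi_def)

lemma continuous_on_expi [continuous_intros]:
  "continuous_on S f \<Longrightarrow> continuous_on S (\<lambda>x. expi (f x))"
  unfolding expi_def by (intro continuous_intros)

lemma measurable_expi [measurable]: "expi \<in> borel_measurable borel"
  by (intro borel_measurable_continuous_onI continuous_intros)

lemma expi_approx: "norm (expi t - 1) \<le> \<bar>t\<bar>" "norm (expi t - 1 - \<i> * t) \<le> t\<^sup>2"
proof -
  show "norm (expi t - 1) \<le> \<bar>t\<bar>" using iexp_approx1[of t 0] by (simp add: expi_def)
  have "norm (expi t - 1 - \<i> * t) \<le> \<bar>t\<bar>\<^sup>2 / 2"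
    using iexp_approx1[of t 1] by (simp add: expi_def numeral_2_eq_2 diff_diff_eq)
  also have "\<dots> \<le> t\<^sup>2" by simp
  finally show "norm (expi t - 1 - \<i> * t) \<le> t\<^sup>2" .
qed

lemma fourier_eq:
  fixes \<psi> :: "real^'n::finite \<Rightarrow> complex"
  shows "fourier \<psi> \<xi> = fourier_const TYPE('n) * (\<integral>x. expi (- (x \<bullet> \<xi>)) * \<psi> x \<partial>lborel)"
  by (simp add: fourier_def fourier_const_def expi_def)

lemma inv_fourier_eq:
  fixes \<psi> :: "real^'n::finite \<Rightarrow> complex"
  shows "inv_fourier \<psi> \<xi> = fourier_const TYPE('n) * (\<integral>x. expi (x \<bullet> \<xi>) * \<psi> x \<partial>lborel)"
  by (simp add: inv_fourier_def fourier_const_def expi_def inner_commute)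

lemma inv_fourier_minus: "inv_fourier \<psi> \<xi> = fourier \<psi> (- \<xi>)"
  by (simp add: fourier_eq inv_fourier_eq)

lemma integrable_expi_mult:
  assumes "integrable lborel \<psi>" "f \<in> borel_measurable borel"
  shows "integrable lborel (\<lambda>x. expi (f x) * \<psi> x)"
  by (rule Bochner_Integration.integrable_bound[OF assms(1)])
    (use assms in \<open>auto simp: norm_mult dest: borel_measurable_integrable\<close>)

lemma inv_fourier_reflect:
  assumes "\<psi> \<in> schwartz"
  shows "inv_fourier \<psi> = fourier (\<lambda>x. \<psi> (- x))"
proof
  fix \<xi> :: "real^'a"
  have [measurable]: "\<psi> \<in> borel_measurable borel" using assms by (rule schwartz_measurable)
  show "inv_fourier \<psi> \<xi> = fourier (\<lambda>x. \<psi> (- x)) \<xi>"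
    using integral_lborel_reflect[of "\<lambda>x. expi (x \<bullet> \<xi>) * \<psi> x" 0]
    by (simp add: fourier_eq inv_fourier_eq)
qed

text \<open>The second-order remainder of the exponential is at most (x . h)^2, so integrating it
  gives a remainder of size |h|^2 times the second moment of |\<psi>|; no limit under the integral
  is taken.\<close>

lemma fourier_has_derivative:
  fixes \<psi> :: "real^'n::finite \<Rightarrow> complex"
  assumes S: "\<psi> \<in> schwartz"
  shows "(fourier \<psi> has_derivative (\<lambda>h. fourier (\<lambda>x. (x \<bullet> h) *\<^sub>R (- \<i> * \<psi> x)) \<xi>)) (at \<xi>)"
proof (rule has_derivative_quadratic_remainder)
  have [measurable]: "\<psi> \<in> borel_measurable borel" using S by (rule schwartz_measurable)
  let ?k = "fourier_const TYPE('n)"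
  have R: "rapidly_decaying \<psi>" using S by (rule schwartz_rapidly_decaying)
  have R1: "rapidly_decaying (\<lambda>x. (x \<bullet> h) *\<^sub>R (- \<i> * \<psi> x))" for h
  proof (rule rapidly_decaying_dominated[OF R, where K="norm h" and l=1])
    fix x :: "real^'n"
    have "\<bar>x \<bullet> h\<bar> \<le> norm h * (1 + norm x)"
      using Cauchy_Schwarz_ineq2[of x h] norm_ge_zero[of h] by (simp only: distrib_left mult.commute)
    then show "norm ((x \<bullet> h) *\<^sub>R (- \<i> * \<psi> x)) \<le> norm h * (1 + norm x) ^ 1 * norm (\<psi> x)"
      by (simp add: norm_mult mult_right_mono)
  qed
  have I1: "integrable lborel (\<lambda>x. (x \<bullet> h) *\<^sub>R (- \<i> * \<psi> x))" for h
    by (rule rapidly_decaying_integrable[OF R1]) measurable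
  have I2: "integrable lborel (\<lambda>x. (norm x)\<^sup>2 * norm (\<psi> x))"
  proof (rule rapidly_decaying_integrable)
    show "rapidly_decaying (\<lambda>x. (norm x)\<^sup>2 * norm (\<psi> x))"
      by (rule rapidly_decaying_dominated[OF R, where K=1 and l=2])
        (auto intro!: mult_right_mono power_mono)
  qed measurable
  have E1: "integrable lborel (\<lambda>x. expi (- (x \<bullet> \<xi>)) * ((x \<bullet> h) *\<^sub>R (- \<i> * \<psi> x)))" for h
    by (intro integrable_expi_mult I1) measurable
  have E0: "integrable lborel (\<lambda>x. expi (- (x \<bullet> \<xi>)) * \<psi> x)" for \<xi>
    by (intro integrable_expi_mult schwartz_integrable S) measurable
  show "bounded_linear (\<lambda>h. fourier (\<lambda>x. (x \<bullet> h) *\<^sub>R (- \<i> * \<psi> x)) \<xi>)"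
    unfolding linear_conv_bounded_linear[symmetric]
  proof (rule linearI)
    fix a b
    have "fourier (\<lambda>x. (x \<bullet> (a + b)) *\<^sub>R (- \<i> * \<psi> x)) \<xi> =
      ?k * (\<integral>x. expi (- (x \<bullet> \<xi>)) * ((x \<bullet> a) *\<^sub>R (- \<i> * \<psi> x)) + expi (- (x \<bullet> \<xi>)) * ((x \<bullet> b) *\<^sub>R (- \<i> * \<psi> x)) \<partial>lborel)"
      by (simp only: fourier_eq inner_add_right scaleR_add_left distrib_left)
    then show "fourier (\<lambda>x. (x \<bullet> (a + b)) *\<^sub>R (- \<i> * \<psi> x)) \<xi> =
       fourier (\<lambda>x. (x \<bullet> a) *\<^sub>R (- \<i> * \<psi> x)) \<xi> + fourier (\<lambda>x. (x \<bullet> b) *\<^sub>R (- \<i> * \<psi> x)) \<xi>"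
      by (simp only: Bochner_Integration.integral_add[OF E1 E1] fourier_eq distrib_left)
  next
    fix r :: real and b
    have "fourier (\<lambda>x. (x \<bullet> (r *\<^sub>R b)) *\<^sub>R (- \<i> * \<psi> x)) \<xi> =
      ?k * (\<integral>x. r *\<^sub>R (expi (- (x \<bullet> \<xi>)) * ((x \<bullet> b) *\<^sub>R (- \<i> * \<psi> x))) \<partial>lborel)"
      by (simp only: fourier_eq inner_scaleR_right scaleR_scaleR[symmetric] mult_scaleR_right)
    then show "fourier (\<lambda>x. (x \<bullet> (r *\<^sub>R b)) *\<^sub>R (- \<i> * \<psi> x)) \<xi> = r *\<^sub>R fourier (\<lambda>x. (x \<bullet> b) *\<^sub>R (- \<i> * \<psi> x)) \<xi>"
      by (simp only: integral_scaleR_right fourier_eq mult_scaleR_right)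
  qed
  fix h
  let ?R = "\<lambda>x. (expi (- (x \<bullet> (\<xi> + h))) * \<psi> x - expi (- (x \<bullet> \<xi>)) * \<psi> x) - expi (- (x \<bullet> \<xi>)) * ((x \<bullet> h) *\<^sub>R (- \<i> * \<psi> x))"
  have eq: "fourier \<psi> (\<xi> + h) - fourier \<psi> \<xi> - fourier (\<lambda>x. (x \<bullet> h) *\<^sub>R (- \<i> * \<psi> x)) \<xi> =
    ?k * (\<integral>x. (expi (- (x \<bullet> (\<xi> + h))) * \<psi> x - expi (- (x \<bullet> \<xi>)) * \<psi> x) - expi (- (x \<bullet> \<xi>)) * ((x \<bullet> h) *\<^sub>R (- \<i> * \<psi> x)) \<partial>lborel)"
    by (simp only: fourier_eq right_diff_distrib[symmetric] Bochner_Integration.integral_diff[OF E0 E0]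
        Bochner_Integration.integral_diff[OF Bochner_Integration.integrable_diff[OF E0 E0] E1])
  have le: "norm (\<integral>x. ?R x \<partial>lborel)
      \<le> (\<integral>x. (norm h)\<^sup>2 * ((norm x)\<^sup>2 * norm (\<psi> x)) \<partial>lborel)"
  proof (rule Bochner_Integration.integral_norm_bound_integral)
    show "integrable lborel (\<lambda>x. expi (- (x \<bullet> (\<xi> + h))) * \<psi> x - expi (- (x \<bullet> \<xi>)) * \<psi> x - expi (- (x \<bullet> \<xi>)) * ((x \<bullet> h) *\<^sub>R (- \<i> * \<psi> x)))"
      using E0 E1 by (intro Bochner_Integration.integrable_diff)
    show "integrable lborel (\<lambda>x. (norm h)\<^sup>2 * ((norm x)\<^sup>2 * norm (\<psi> x)))"
      using I2 by auto
    fix x :: "real^'n"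
    have "expi (- (x \<bullet> (\<xi> + h))) * \<psi> x - expi (- (x \<bullet> \<xi>)) * \<psi> x - expi (- (x \<bullet> \<xi>)) * ((x \<bullet> h) *\<^sub>R (- \<i> * \<psi> x))
       = expi (- (x \<bullet> \<xi>)) * (expi (- (x \<bullet> h)) - 1 - \<i> * of_real (- (x \<bullet> h))) * \<psi> x"
      by (simp add: inner_add_right expi_add scaleR_conv_of_real algebra_simps flip: expi_add)
    then have "norm (expi (- (x \<bullet> (\<xi> + h))) * \<psi> x - expi (- (x \<bullet> \<xi>)) * \<psi> x - expi (- (x \<bullet> \<xi>)) * ((x \<bullet> h) *\<^sub>R (- \<i> * \<psi> x)))
       = norm (expi (- (x \<bullet> h)) - 1 - \<i> * of_real (- (x \<bullet> h))) * norm (\<psi> x)"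
      by (simp only: norm_mult norm_expi mult_1)
    also have "\<dots> \<le> (- (x \<bullet> h))\<^sup>2 * norm (\<psi> x)"
      by (intro mult_right_mono expi_approx) auto
    also have "(- (x \<bullet> h))\<^sup>2 \<le> (norm x * norm h)\<^sup>2"
      using Cauchy_Schwarz_ineq2[of x h] by (simp add: abs_le_square_iff[symmetric] power2_eq_square[symmetric])
    finally show "norm (expi (- (x \<bullet> (\<xi> + h))) * \<psi> x - expi (- (x \<bullet> \<xi>)) * \<psi> x - expi (- (x \<bullet> \<xi>)) * ((x \<bullet> h) *\<^sub>R (- \<i> * \<psi> x)))
       \<le> (norm h)\<^sup>2 * ((norm x)\<^sup>2 * norm (\<psi> x))" by (simp add: power_mult_distrib mult_ac mult_right_mono)
  qed
  have "norm (fourier \<psi> (\<xi> + h) - fourier \<psi> \<xi> - fourier (\<lambda>x. (x \<bullet> h) *\<^sub>R (- \<i> * \<psi> x)) \<xi>)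
      = ?k * norm (\<integral>x. ?R x \<partial>lborel)"
    unfolding eq norm_mult using fourier_const_pos[where 'n='n] by (simp only: norm_of_real abs_of_pos)
  also have "\<dots> \<le> ?k * (\<integral>x. (norm h)\<^sup>2 * ((norm x)\<^sup>2 * norm (\<psi> x)) \<partial>lborel)"
    using fourier_const_pos[where 'n='n] by (intro mult_left_mono le less_imp_le)
  finally show "norm (fourier \<psi> (\<xi> + h) - fourier \<psi> \<xi> - fourier (\<lambda>x. (x \<bullet> h) *\<^sub>R (- \<i> * \<psi> x)) \<xi>)
      \<le> (?k * (\<integral>x. (norm x)\<^sup>2 * norm (\<psi> x) \<partial>lborel)) * (norm h)\<^sup>2"
    unfolding integral_mult_right_zero by (simp only: mult_ac)
qed

lemma partial_deriv_fourier:
  "\<psi> \<in> schwartz \<Longrightarrow> partial_deriv i (fourier \<psi>) = fourier (\<lambda>x. x $ i *\<^sub>R (- \<i> * \<psi> x))"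
  by (rule ext, subst partial_deriv_eq[OF fourier_has_derivative]) (simp_all add: inner_axis)

text \<open>Replaces integration by parts: translating by t along the axis multiplies the transform
  by exp(i t \<xi>_i), so the difference quotient has an explicit transform. Both sides are then
  followed as t tends to 0.\<close>

lemma fourier_partial_deriv:
  fixes \<psi> :: "real^'n::finite \<Rightarrow> complex"
  assumes S: "\<psi> \<in> schwartz"
  shows "fourier (partial_deriv i \<psi>) \<xi> = \<i> * \<xi> $ i * fourier \<psi> \<xi>"
proof -
  have [measurable]: "\<psi> \<in> borel_measurable borel" using S by (rule schwartz_measurable)
  have [measurable]: "partial_deriv i \<psi> \<in> borel_measurable borel"
    using S by (intro schwartz_measurable schwartz_partial_deriv)
  define e :: "real^'n" where "e = axis i 1"
  have ne: "norm e = 1" by (simp add: e_def norm_axis_1)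
  define t where "t n = 1 / real (Suc n)" for n
  have t: "0 < t n" "t n \<le> 1" for n by (auto simp: t_def)
  have t0: "t \<longlonglongrightarrow> 0" unfolding t_def using LIMSEQ_inverse_real_of_nat by (simp add: inverse_eq_divide)
  define D where "D n x = expi (- (x \<bullet> \<xi>)) * ((1 / t n) *\<^sub>R (\<psi> (x + t n *\<^sub>R e) - \<psi> x))" for n x
  obtain C where C: "C > 0"
    "\<And>x v. (1 + norm x) ^ (2 * CARD('n)) * norm (\<psi> (x + v) - \<psi> x) \<le> C * (norm v * (1 + norm v) ^ (2 * CARD('n)))"
    using schwartz_increment[OF S] by blast
  have int: "(\<integral>x. D n x \<partial>lborel) = (1 / t n) * (expi (t n * \<xi> $ i) - 1) * (\<integral>x. expi (- (x \<bullet> \<xi>)) * \<psi> x \<partial>lborel)" for n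
  proof -
    have 1: "integrable lborel (\<lambda>x. expi (- (x \<bullet> \<xi>)) * \<psi> x)"
      by (intro integrable_expi_mult schwartz_integrable S) measurable
    have 2: "integrable lborel (\<lambda>x. expi (- (x \<bullet> \<xi>)) * \<psi> (x + t n *\<^sub>R e))"
      by (intro integrable_expi_mult schwartz_integrable)
        (use schwartz_affine[of 1, OF _ S] in auto)
    have "(\<integral>x. expi (- (x \<bullet> \<xi>)) * \<psi> (x + t n *\<^sub>R e) \<partial>lborel)
        = (\<integral>x. expi (t n * \<xi> $ i) * (expi (- ((t n *\<^sub>R e + x) \<bullet> \<xi>)) * \<psi> (t n *\<^sub>R e + x)) \<partial>lborel)"
      by (intro Bochner_Integration.integral_cong)
        (auto simp: add.commute e_def inner_add_left inner_axis' mult.assoc[symmetric] simp flip: expi_add)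
    also have "\<dots> = expi (t n * \<xi> $ i) * (\<integral>x. expi (- (x \<bullet> \<xi>)) * \<psi> x \<partial>lborel)"
      using integral_lborel_shift[of "\<lambda>x. expi (- (x \<bullet> \<xi>)) * \<psi> x" "t n *\<^sub>R e"] by simp
    finally have 3: "(\<integral>x. expi (- (x \<bullet> \<xi>)) * \<psi> (x + t n *\<^sub>R e) \<partial>lborel) = expi (t n * \<xi> $ i) * (\<integral>x. expi (- (x \<bullet> \<xi>)) * \<psi> x \<partial>lborel)" .
    have "(\<integral>x. D n x \<partial>lborel) = (\<integral>x. (1 / t n) *\<^sub>R (expi (- (x \<bullet> \<xi>)) * \<psi> (x + t n *\<^sub>R e) - expi (- (x \<bullet> \<xi>)) * \<psi> x) \<partial>lborel)"
      by (simp add: D_def right_diff_distrib scaleR_conv_of_real mult_ac)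
    also have "\<dots> = (1 / t n) *\<^sub>R (\<integral>x. (expi (- (x \<bullet> \<xi>)) * \<psi> (x + t n *\<^sub>R e) - expi (- (x \<bullet> \<xi>)) * \<psi> x) \<partial>lborel)"
      by (rule integral_scaleR_right)
    also have "(\<integral>x. (expi (- (x \<bullet> \<xi>)) * \<psi> (x + t n *\<^sub>R e) - expi (- (x \<bullet> \<xi>)) * \<psi> x) \<partial>lborel) =
       expi (t n * \<xi> $ i) * (\<integral>x. expi (- (x \<bullet> \<xi>)) * \<psi> x \<partial>lborel) - (\<integral>x. expi (- (x \<bullet> \<xi>)) * \<psi> x \<partial>lborel)"
      using 1 2 3 by simp
    finally show ?thesis by (simp add: scaleR_conv_of_real algebra_simps)
  qed
  have lim1: "(\<lambda>n. \<integral>x. D n x \<partial>lborel) \<longlonglongrightarrow> (\<integral>x. expi (- (x \<bullet> \<xi>)) * partial_deriv i \<psi> x \<partial>lborel)"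
  proof (rule integral_dominated_convergence[where w="\<lambda>x. (C * 2 ^ (2 * CARD('n))) * weight x"])
    show "integrable lborel (\<lambda>x::real^'n. (C * 2 ^ (2 * CARD('n))) * weight x)"
      using integrable_weight by auto
    show "AE x in lborel. (\<lambda>n. D n x) \<longlonglongrightarrow> expi (- (x \<bullet> \<xi>)) * partial_deriv i \<psi> x"
    proof (rule AE_I2)
      fix x :: "real^'n"
      have p: "frechet_derivative \<psi> (at x) (s *\<^sub>R e) = s *\<^sub>R partial_deriv i \<psi> x" for s
        using linear_frechet_derivative[OF schwartz_differentiable[OF S, of x]]
        by (simp add: linear_cmul partial_deriv_def e_def)
      have "((\<lambda>s. x + s *\<^sub>R e) has_derivative (\<lambda>h. h *\<^sub>R e)) (at 0)"
        by (auto intro!: derivative_eq_intros)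
      moreover have "(\<psi> has_derivative frechet_derivative \<psi> (at x)) (at (x + 0 *\<^sub>R e))"
        using schwartz_differentiable[OF S, of x] by (simp add: frechet_derivative_works)
      ultimately have "((\<lambda>s. \<psi> (x + s *\<^sub>R e)) has_derivative (\<lambda>s. s *\<^sub>R partial_deriv i \<psi> x)) (at 0)"
        using has_derivative_compose[of "\<lambda>s. x + s *\<^sub>R e" "\<lambda>h. h *\<^sub>R e" 0 UNIV \<psi>]
        by (simp only: p[symmetric])
      then have "((\<lambda>s. norm (\<psi> (x + s *\<^sub>R e) - \<psi> x - s *\<^sub>R partial_deriv i \<psi> x) / norm s) \<longlongrightarrow> 0) (at 0)"
        by (simp add: has_derivative_at)
      then have "((\<lambda>s. (\<psi> (x + s *\<^sub>R e) - \<psi> x) /\<^sub>R s - partial_deriv i \<psi> x) \<longlongrightarrow> 0) (at 0)"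
      proof (rule Lim_null_comparison[rotated])
        show "\<forall>\<^sub>F s in at 0. norm ((\<psi> (x + s *\<^sub>R e) - \<psi> x) /\<^sub>R s - partial_deriv i \<psi> x)
            \<le> norm (\<psi> (x + s *\<^sub>R e) - \<psi> x - s *\<^sub>R partial_deriv i \<psi> x) / norm s"
        proof (rule eventually_at_filter[THEN iffD2], rule always_eventually, safe)
          fix s :: real assume "s \<noteq> 0"
          then have "(\<psi> (x + s *\<^sub>R e) - \<psi> x) /\<^sub>R s - partial_deriv i \<psi> x
            = (\<psi> (x + s *\<^sub>R e) - \<psi> x - s *\<^sub>R partial_deriv i \<psi> x) /\<^sub>R s"
            by (simp add: scaleR_diff_right)
          then show "norm ((\<psi> (x + s *\<^sub>R e) - \<psi> x) /\<^sub>R s - partial_deriv i \<psi> x)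
            \<le> norm (\<psi> (x + s *\<^sub>R e) - \<psi> x - s *\<^sub>R partial_deriv i \<psi> x) / norm s"
            by (simp add: divide_inverse mult.commute)
        qed
      qed
      then have "((\<lambda>s. (\<psi> (x + s *\<^sub>R e) - \<psi> x) /\<^sub>R s) \<longlongrightarrow> partial_deriv i \<psi> x) (at 0)"
        by (rule LIM_zero_cancel)
      moreover have "filterlim t (at 0) sequentially"
        using t0 t(1) by (auto simp: filterlim_at intro!: always_eventually less_imp_neq[symmetric])
      ultimately have "(\<lambda>n. (\<psi> (x + t n *\<^sub>R e) - \<psi> x) /\<^sub>R t n) \<longlonglongrightarrow> partial_deriv i \<psi> x"
        by (rule filterlim_compose)
      then show "(\<lambda>n. D n x) \<longlonglongrightarrow> expi (- (x \<bullet> \<xi>)) * partial_deriv i \<psi> x"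
        unfolding D_def by (intro tendsto_intros) (simp add: inverse_eq_divide)
    qed
    fix n
    show "AE x in lborel. norm (D n x) \<le> (C * 2 ^ (2 * CARD('n))) * weight x"
    proof (rule AE_I2)
      fix x :: "real^'n"
      have pos: "(1 + norm x) ^ (2 * CARD('n)) > 0" by (simp add: add_pos_nonneg)
      have "(1 + norm x) ^ (2 * CARD('n)) * norm (\<psi> (x + t n *\<^sub>R e) - \<psi> x) \<le> C * (t n * (1 + t n) ^ (2 * CARD('n)))"
        using C(2)[of x "t n *\<^sub>R e"] ne t[of n] by simp
      \<comment> \<open>Because \<open>t n\<close> is at most 1, the growth factor of the increment
        estimate is bounded uniformly in \<open>n\<close>, as dominated convergence
        requires.\<close>
      also have "\<dots> \<le> C * (t n * 2 ^ (2 * CARD('n)))"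
        using C(1) t[of n] by (intro mult_left_mono power_mono) auto
      finally have le: "(1 + norm x) ^ (2 * CARD('n)) * norm (\<psi> (x + t n *\<^sub>R e) - \<psi> x) \<le> C * (t n * 2 ^ (2 * CARD('n)))" .
      have "norm (D n x) = (1 / t n) * norm (\<psi> (x + t n *\<^sub>R e) - \<psi> x)"
        unfolding D_def norm_mult norm_expi norm_scaleR using t[of n] by simp
      then have "(1 + norm x) ^ (2 * CARD('n)) * norm (D n x) \<le> (1 / t n) * (C * (t n * 2 ^ (2 * CARD('n))))"
        using mult_left_mono[OF le, of "1 / t n"] t[of n] by (simp add: mult_ac)
      also have "\<dots> = C * 2 ^ (2 * CARD('n))" using t[of n] by simp
      finally show "norm (D n x) \<le> (C * 2 ^ (2 * CARD('n))) * weight x"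
        using pos by (simp add: weight_def pos_le_divide_eq mult.commute)
    qed
  qed (auto simp: D_def)
  have lim2: "(\<lambda>n. (1 / t n) * (expi (t n * \<xi> $ i) - 1) * (\<integral>x. expi (- (x \<bullet> \<xi>)) * \<psi> x \<partial>lborel))
     \<longlonglongrightarrow> (\<i> * \<xi> $ i) * (\<integral>x. expi (- (x \<bullet> \<xi>)) * \<psi> x \<partial>lborel)"
  proof (rule tendsto_mult_right)
    have "(\<lambda>n. (1 / t n) * (expi (t n * \<xi> $ i) - 1) - \<i> * \<xi> $ i) \<longlonglongrightarrow> 0"
    proof (rule Lim_null_comparison)
      show "(\<lambda>n. t n * (\<xi> $ i)\<^sup>2) \<longlonglongrightarrow> 0" using tendsto_mult_left_zero[OF t0] by blast
      have "norm ((1 / t n) * (expi (t n * \<xi> $ i) - 1) - \<i> * \<xi> $ i) \<le> t n * (\<xi> $ i)\<^sup>2" for n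
      proof -
        have "(1 / t n) * (expi (t n * \<xi> $ i) - 1) - \<i> * \<xi> $ i = (1 / t n) * (expi (t n * \<xi> $ i) - 1 - \<i> * of_real (t n * \<xi> $ i))"
          using t(1)[of n] by (simp add: field_simps)
        then have "norm ((1 / t n) * (expi (t n * \<xi> $ i) - 1) - \<i> * \<xi> $ i)
            = (1 / t n) * norm (expi (t n * \<xi> $ i) - 1 - \<i> * of_real (t n * \<xi> $ i))"
          using t(1)[of n] by (simp only: norm_mult) (simp add: norm_divide)
        also have "\<dots> \<le> (1 / t n) * (t n * \<xi> $ i)\<^sup>2"
          using t(1)[of n] by (intro mult_left_mono expi_approx) auto
        also have "\<dots> = t n * (\<xi> $ i)\<^sup>2" using t(1)[of n] by (simp add: power2_eq_square)
        finally show ?thesis .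
      qed
      then show "\<forall>\<^sub>F n in sequentially. norm ((1 / t n) * (expi (t n * \<xi> $ i) - 1) - \<i> * \<xi> $ i) \<le> t n * (\<xi> $ i)\<^sup>2"
        by simp
    qed
    then show "(\<lambda>n. (1 / t n) * (expi (t n * \<xi> $ i) - 1)) \<longlonglongrightarrow> \<i> * \<xi> $ i"
      by (simp only: LIM_zero_iff)
  qed
  have "(\<integral>x. expi (- (x \<bullet> \<xi>)) * partial_deriv i \<psi> x \<partial>lborel) = (\<i> * \<xi> $ i) * (\<integral>x. expi (- (x \<bullet> \<xi>)) * \<psi> x \<partial>lborel)"
    using LIMSEQ_unique[OF lim1] lim2 int by simp
  then show ?thesis by (simp add: fourier_eq)
qed

lemma fourier_cmult: "fourier (\<lambda>x. c * \<psi> x) \<xi> = c * fourier \<psi> \<xi>"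
proof -
  have "(\<integral>x. expi (- (x \<bullet> \<xi>)) * (c * \<psi> x) \<partial>lborel) = (\<integral>x. c * (expi (- (x \<bullet> \<xi>)) * \<psi> x) \<partial>lborel)"
    by (simp add: mult_ac)
  then show ?thesis by (simp add: fourier_eq)
qed

lemma fourier_bounded:
  fixes \<psi> :: "real^'n::finite \<Rightarrow> complex"
  shows "norm (fourier \<psi> \<xi>) \<le> fourier_const TYPE('n) * (\<integral>x. norm (\<psi> x) \<partial>lborel)"
proof -
  have "norm (fourier \<psi> \<xi>) = fourier_const TYPE('n) * norm (\<integral>x. expi (- (x \<bullet> \<xi>)) * \<psi> x \<partial>lborel)"
    using fourier_const_pos[where 'n='n] by (simp add: fourier_eq norm_mult)
  also have "\<dots> \<le> fourier_const TYPE('n) * (\<integral>x. norm (expi (- (x \<bullet> \<xi>)) * \<psi> x) \<partial>lborel)"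
    using fourier_const_pos[where 'n='n] by (intro mult_left_mono integral_norm_bound) auto
  finally show ?thesis by (simp add: norm_mult)
qed

text \<open>Each further power of |\<xi>| is bounded by the sum of the |\<xi>_i| and traded for a
  derivative of \<open>\<psi>\<close>; the induction therefore runs over all Schwartz functions at
  once.\<close>

lemma fourier_rapidly_decaying:
  fixes \<psi> :: "real^'n::finite \<Rightarrow> complex"
  assumes "\<psi> \<in> schwartz"
  shows "rapidly_decaying (fourier \<psi>)"
proof -
  have "\<exists>C. \<forall>\<xi>. (1 + norm \<xi>) ^ m * norm (fourier \<psi> \<xi>) \<le> C" for m
    using assms
  proof (induction m arbitrary: \<psi>)
    case 0
    then show ?case using fourier_bounded by auto
  next
    case (Suc m)
    obtain C where C: "\<And>\<xi>. (1 + norm \<xi>) ^ m * norm (fourier \<psi> \<xi>) \<le> C" using Suc by blast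
    have "\<exists>C. \<forall>\<xi>. (1 + norm \<xi>) ^ m * norm (fourier (partial_deriv i \<psi>) \<xi>) \<le> C" for i
      using Suc by (intro Suc.IH schwartz_partial_deriv)
    then obtain B where B: "\<And>i \<xi>. (1 + norm \<xi>) ^ m * norm (fourier (partial_deriv i \<psi>) \<xi>) \<le> B i" by metis
    have "(1 + norm \<xi>) ^ Suc m * norm (fourier \<psi> \<xi>) \<le> C + (\<Sum>i\<in>UNIV. B i)" for \<xi>
    proof -
      have "(1 + norm \<xi>) ^ Suc m * norm (fourier \<psi> \<xi>)
        = (1 + norm \<xi>) ^ m * norm (fourier \<psi> \<xi>) + norm \<xi> * ((1 + norm \<xi>) ^ m * norm (fourier \<psi> \<xi>))"
        by (simp add: algebra_simps)
      also have "\<dots> \<le> C + (\<Sum>i\<in>UNIV. \<bar>\<xi> $ i\<bar>) * ((1 + norm \<xi>) ^ m * norm (fourier \<psi> \<xi>))"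
        using C norm_le_l1_cart[of \<xi>] by (intro add_mono mult_right_mono) auto
      also have "(\<Sum>i\<in>UNIV. \<bar>\<xi> $ i\<bar>) * ((1 + norm \<xi>) ^ m * norm (fourier \<psi> \<xi>))
          = (\<Sum>i\<in>UNIV. (1 + norm \<xi>) ^ m * norm (fourier (partial_deriv i \<psi>) \<xi>))"
        using fourier_partial_deriv[OF Suc.prems] by (simp add: norm_mult sum_distrib_left sum_distrib_right mult_ac)
      also have "\<dots> \<le> (\<Sum>i\<in>UNIV. B i)" using B by (intro sum_mono)
      finally show ?thesis by simp
    qed
    then show ?case by blast
  qed
  then show ?thesis by (simp add: rapidly_decaying_def)
qed

lemma schwartz_fourier: "\<psi> \<in> schwartz \<Longrightarrow> fourier \<psi> \<in> schwartz"
proof -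
  have "\<psi> \<in> schwartz \<Longrightarrow> schwartz_upto n (fourier \<psi>)" for n
  proof (induction n arbitrary: \<psi>)
    case 0
    then show ?case using fourier_has_derivative fourier_rapidly_decaying
      by (auto simp: differentiable_def)
  next
    case (Suc n)
    have "schwartz_upto n (fourier (\<lambda>x. x $ i *\<^sub>R (- \<i> * \<psi> x)))" for i
      using Suc by (intro Suc.IH schwartz_coord_mult schwartz_cmult)
    then show ?case using Suc.prems fourier_has_derivative fourier_rapidly_decaying
      by (auto simp: differentiable_def partial_deriv_fourier)
  qed
  then show "\<psi> \<in> schwartz \<Longrightarrow> fourier \<psi> \<in> schwartz" by (simp add: schwartz_iff_upto)
qed

lemma schwartz_inv_fourier: "\<psi> \<in> schwartz \<Longrightarrow> inv_fourier \<psi> \<in> schwartz"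
  by (simp add: inv_fourier_reflect schwartz_fourier schwartz_reflection)

subsection \<open>Fourier inversion\<close>

text \<open>With this normalisation the Gaussian is its own transform under the symmetric constant
  \<open>fourier_const\<close>.\<close>

definition gauss :: "'a::euclidean_space \<Rightarrow> real" where
  "gauss x = exp (- (norm x)\<^sup>2 / 2)"

lemma gauss_measurable [measurable]: "gauss \<in> borel_measurable borel"
  unfolding gauss_def[abs_def] by measurable

lemma gauss_bounds [simp]: "0 < gauss x" "gauss x \<le> 1" "0 \<le> gauss x" "gauss x \<noteq> 0"
  by (auto simp: gauss_def)

lemma integral_lborel_prod:
  fixes f :: "'a::euclidean_space \<Rightarrow> real \<Rightarrow> complex"
  assumes "\<And>b. b \<in> Basis \<Longrightarrow> integrable lborel (f b)"
  shows "(\<integral>x. (\<Prod>b\<in>Basis. f b (x \<bullet> b)) \<partial>lborel) = (\<Prod>b\<in>Basis. (\<integral>t. f b t \<partial>lborel))"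
    and "integrable lborel (\<lambda>x. \<Prod>b\<in>Basis. f b (x \<bullet> b))"
proof -
  interpret product_sigma_finite "\<lambda>_::'a. lborel :: real measure" ..
  have [measurable]: "f b \<in> borel_measurable borel" if "b \<in> Basis" for b
    using borel_measurable_integrable[OF assms[OF that]] by simp
  have m: "(\<lambda>g. \<Sum>b\<in>Basis. g b *\<^sub>R b) \<in> measurable (\<Pi>\<^sub>M b\<in>(Basis::'a set). lborel) borel"
    by measurable
  have fm: "(\<lambda>x::'a. \<Prod>b\<in>Basis. f b (x \<bullet> b)) \<in> borel_measurable borel" by measurable
  have "(\<integral>x. (\<Prod>b\<in>Basis. f b (x \<bullet> b)) \<partial>lborel)
      = (\<integral>g. (\<Prod>b\<in>Basis. f b ((\<Sum>b\<in>Basis. g b *\<^sub>R b) \<bullet> b)) \<partial>(\<Pi>\<^sub>M b\<in>(Basis::'a set). lborel))"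
    by (subst lborel_eq, subst integral_distr[OF m fm]) simp
  also have "\<dots> = (\<integral>g. (\<Prod>b\<in>Basis. f b (g b)) \<partial>(\<Pi>\<^sub>M b\<in>(Basis::'a set). lborel))"
    by (intro Bochner_Integration.integral_cong prod.cong) (auto simp: inner_sum_left inner_Basis if_distrib cong: if_cong)
  also have "\<dots> = (\<Prod>b\<in>Basis. (\<integral>t. f b t \<partial>lborel))"
    using assms by (intro product_integral_prod) auto
  finally show "(\<integral>x. (\<Prod>b\<in>Basis. f b (x \<bullet> b)) \<partial>lborel) = (\<Prod>b\<in>Basis. (\<integral>t. f b t \<partial>lborel))" .
  have "integrable (\<Pi>\<^sub>M b\<in>(Basis::'a set). lborel) (\<lambda>g. \<Prod>b\<in>Basis. f b (g b))"
    using assms by (intro product_integrable_prod) auto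
  also have "(\<lambda>g. \<Prod>b\<in>Basis. f b (g b)) = (\<lambda>g. \<Prod>b\<in>Basis. f b ((\<Sum>b\<in>Basis. g b *\<^sub>R b) \<bullet> b))"
    by (intro ext prod.cong) (auto simp: inner_sum_left inner_Basis if_distrib cong: if_cong)
  finally show "integrable lborel (\<lambda>x. \<Prod>b\<in>Basis. f b (x \<bullet> b))"
    by (subst lborel_eq, subst integrable_distr_eq[OF m fm])
qed

text \<open>Read off from the characteristic function of the standard normal distribution, whose
  density differs only by the factor sqrt(2 pi).\<close>

lemma gauss_1d:
  "integrable lborel (\<lambda>x::real. expi (x * t) * complex_of_real (exp (- x\<^sup>2 / 2)))"
  "(\<integral>x. expi (x * t) * complex_of_real (exp (- x\<^sup>2 / 2)) \<partial>lborel) = sqrt (2 * pi) * exp (- t\<^sup>2 / 2)"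
proof -
  have d: "exp (- x\<^sup>2 / 2) = sqrt (2 * pi) * std_normal_density x" for x
    by (simp add: normal_density_def)
  have i: "integrable lborel (\<lambda>x. complex_of_real (std_normal_density x))"
    using integrable_std_normal_moment[of 0] by (simp add: integrable_of_real)
  then have i1: "integrable lborel (\<lambda>x. expi (x * t) * complex_of_real (std_normal_density x))"
    by (rule Bochner_Integration.integrable_bound) (auto simp: norm_mult)
  have "(\<integral>x. expi (x * t) * complex_of_real (std_normal_density x) \<partial>lborel) = char std_normal_distribution t"
    unfolding char_def
    by (subst integral_density) (auto simp: expi_def scaleR_conv_of_real mult_ac)
  then have e1: "(\<integral>x. expi (x * t) * complex_of_real (std_normal_density x) \<partial>lborel) = exp (- t\<^sup>2 / 2)"
    by (simp add: char_std_normal_distribution)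
  have r: "(\<lambda>x. expi (x * t) * complex_of_real (exp (- x\<^sup>2 / 2)))
     = (\<lambda>x. sqrt (2 * pi) * (expi (x * t) * complex_of_real (std_normal_density x)))"
    unfolding d by (auto simp: mult_ac)
  show "integrable lborel (\<lambda>x::real. expi (x * t) * complex_of_real (exp (- x\<^sup>2 / 2)))"
    unfolding r by (intro integrable_mult_right i1)
  show "(\<integral>x. expi (x * t) * complex_of_real (exp (- x\<^sup>2 / 2)) \<partial>lborel) = sqrt (2 * pi) * exp (- t\<^sup>2 / 2)"
    unfolding r by (simp only: integral_mult_right_zero e1 of_real_mult)
qed

lemma gauss_transform:
  fixes t :: "real^'n::finite"
  shows "integrable lborel (\<lambda>x. expi (x \<bullet> t) * complex_of_real (gauss x))"
    "(\<integral>x. expi (x \<bullet> t) * complex_of_real (gauss x) \<partial>lborel) = gauss t / fourier_const TYPE('n)"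
proof -
  let ?f = "\<lambda>(b::real^'n) x. expi (x * (t \<bullet> b)) * complex_of_real (exp (- x\<^sup>2 / 2))"
  have nsq: "(norm x)\<^sup>2 = (\<Sum>b\<in>Basis. (x \<bullet> b)\<^sup>2)" for x :: "real^'n"
    by (subst power2_norm_eq_inner, subst euclidean_inner) (simp add: power2_eq_square)
  have g: "gauss x = (\<Prod>b\<in>Basis. exp (- (x \<bullet> b)\<^sup>2 / 2))" for x :: "real^'n"
    by (simp add: gauss_def nsq exp_sum[symmetric] sum_negf sum_divide_distrib)
  have ex: "expi (sum h A) = (\<Prod>b\<in>A. expi (h b))" for h and A :: "(real^'n) set"
    by (induction A rule: infinite_finite_induct) (auto simp: expi_add)
  have p: "expi (x \<bullet> t) * complex_of_real (gauss x) = (\<Prod>b\<in>Basis. ?f b (x \<bullet> b))" for x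
    by (simp add: g prod.distrib ex[symmetric] euclidean_inner[of x t])
  show "integrable lborel (\<lambda>x. expi (x \<bullet> t) * complex_of_real (gauss x))"
    unfolding p by (rule integral_lborel_prod) (rule gauss_1d)
  have c: "(sqrt (2 * pi)) ^ CARD('n) = 1 / fourier_const TYPE('n)"
  proof -
    have "(sqrt (2 * pi)) ^ CARD('n) = ((2 * pi) powr (1/2)) powr CARD('n)"
      by (simp add: powr_half_sqrt powr_realpow)
    also have "\<dots> = (2 * pi) powr (CARD('n) / 2)" by (simp add: powr_powr)
    also have "\<dots> = 1 / fourier_const TYPE('n)"
      by (simp add: fourier_const_def powr_minus_divide)
    finally show ?thesis .
  qed
  have "(\<integral>x. expi (x \<bullet> t) * complex_of_real (gauss x) \<partial>lborel) = (\<Prod>b\<in>(Basis::(real^'n) set). (\<integral>x. ?f b x \<partial>lborel))"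
    unfolding p by (rule integral_lborel_prod) (rule gauss_1d)
  also have "\<dots> = (\<Prod>b\<in>(Basis::(real^'n) set). complex_of_real (sqrt (2 * pi)) * exp (- (t \<bullet> b)\<^sup>2 / 2))"
    by (simp only: gauss_1d of_real_mult)
  also have "\<dots> = complex_of_real ((sqrt (2 * pi)) ^ CARD('n) * gauss t)"
    by (simp add: prod.distrib g)
  finally show "(\<integral>x. expi (x \<bullet> t) * complex_of_real (gauss x) \<partial>lborel) = gauss t / fourier_const TYPE('n)"
    by (simp add: c)
qed

lemma measurable_expi_inner:
  fixes y :: "'a::euclidean_space"
  shows "(\<lambda>z. expi ((snd z - y) \<bullet> fst z)) \<in> borel_measurable borel"
  by (intro borel_measurable_continuous_onI continuous_intros)

text \<open>The double integral does not converge absolutely, so a factor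
  \<open>gauss (e n *\<^sub>R \<xi>)\<close> is inserted to permit Fubini. Its transform is an
  approximate identity of width \<open>e n\<close>, and \<open>n\<close> then tends to infinity on
  both sides.\<close>

lemma fourier_inv_fourier:
  fixes \<psi> :: "real^'n::finite \<Rightarrow> complex"
  assumes S: "\<psi> \<in> schwartz"
  shows "fourier (inv_fourier \<psi>) = \<psi>"
proof
  fix y :: "real^'n"
  let ?k = "fourier_const TYPE('n)"
  define a where "a = inv_fourier \<psi>"
  have aS: "a \<in> schwartz" unfolding a_def by (rule schwartz_inv_fourier[OF S])
  have [measurable]: "a \<in> borel_measurable borel" "\<psi> \<in> borel_measurable borel"
    using aS S by (auto intro: schwartz_measurable)
  define e where "e n = 1 / real (Suc n)" for n
  have e: "0 < e n" for n by (auto simp: e_def)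
  have e0: "e \<longlonglongrightarrow> 0" unfolding e_def using LIMSEQ_inverse_real_of_nat by (simp add: inverse_eq_divide)
  have gi: "integrable lborel (\<lambda>x. complex_of_real (gauss (x :: real^'n)))"
    using gauss_transform(1)[of 0] by simp
  obtain C where C: "\<And>x. norm (\<psi> x) \<le> C"
    using rapidly_decayingE[OF schwartz_rapidly_decaying[OF S], of 0] by auto
  have eq: "(\<integral>\<xi>. complex_of_real (gauss (e n *\<^sub>R \<xi>)) * (expi (- (\<xi> \<bullet> y)) * a \<xi>) \<partial>lborel)
      = (\<integral>z. \<psi> (y + e n *\<^sub>R z) * complex_of_real (gauss z) \<partial>lborel)" (is "?L n = ?R n") for n
  proof -
    have "?L n = (\<integral>\<xi>. ?k * (complex_of_real (gauss (e n *\<^sub>R \<xi>)) * (\<integral>x. expi ((x - y) \<bullet> \<xi>) * \<psi> x \<partial>lborel)) \<partial>lborel)"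
    proof (intro Bochner_Integration.integral_cong refl)
      fix \<xi> :: "real^'n"
      have "expi (- (\<xi> \<bullet> y)) * (\<integral>x. expi (x \<bullet> \<xi>) * \<psi> x \<partial>lborel) = (\<integral>x. expi ((x - y) \<bullet> \<xi>) * \<psi> x \<partial>lborel)"
        by (subst integral_mult_right_zero[symmetric])
          (simp add: inner_diff_left inner_commute[of \<xi> y] mult.assoc[symmetric] flip: expi_add)
      then show "complex_of_real (gauss (e n *\<^sub>R \<xi>)) * (expi (- (\<xi> \<bullet> y)) * a \<xi>)
        = ?k * (complex_of_real (gauss (e n *\<^sub>R \<xi>)) * (\<integral>x. expi ((x - y) \<bullet> \<xi>) * \<psi> x \<partial>lborel))"
        by (simp add: a_def inv_fourier_eq)
    qed
    also have "\<dots> = ?k * (\<integral>\<xi>. complex_of_real (gauss (e n *\<^sub>R \<xi>)) * (\<integral>x. expi ((x - y) \<bullet> \<xi>) * \<psi> x \<partial>lborel) \<partial>lborel)"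
      by simp
    also have "(\<integral>\<xi>. complex_of_real (gauss (e n *\<^sub>R \<xi>)) * (\<integral>x. expi ((x - y) \<bullet> \<xi>) * \<psi> x \<partial>lborel) \<partial>lborel)
      = (\<integral>x. \<psi> x * (\<integral>\<xi>. expi ((x - y) \<bullet> \<xi>) * complex_of_real (gauss (e n *\<^sub>R \<xi>)) \<partial>lborel) \<partial>lborel)"
      using fubini_bounded[OF _ schwartz_integrable[OF S] measurable_expi_inner, of "\<lambda>\<xi>. complex_of_real (gauss (e n *\<^sub>R \<xi>))" y 1]
        integrable_lborel_affine[OF gi, of "e n" 0] e[of n]
      by simp
    also have "\<dots> = (\<integral>x. \<psi> x * complex_of_real ((1 / e n) ^ CARD('n) * (gauss ((1 / e n) *\<^sub>R (x - y)) / ?k)) \<partial>lborel)"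
    proof (intro Bochner_Integration.integral_cong refl arg_cong2[where f="(*)"])
      fix x :: "real^'n"
      have "(\<integral>\<xi>. expi ((x - y) \<bullet> \<xi>) * complex_of_real (gauss (e n *\<^sub>R \<xi>)) \<partial>lborel)
          = (1 / e n) ^ CARD('n) *\<^sub>R (\<integral>\<xi>. expi ((x - y) \<bullet> ((1 / e n) *\<^sub>R \<xi>)) * complex_of_real (gauss (e n *\<^sub>R (1 / e n) *\<^sub>R \<xi>)) \<partial>lborel)"
        using integral_lborel_affine[of "\<lambda>\<xi>. expi ((x - y) \<bullet> \<xi>) * complex_of_real (gauss (e n *\<^sub>R \<xi>))" "1 / e n" 0] e[of n]
        by simp
      also have "(\<integral>\<xi>. expi ((x - y) \<bullet> ((1 / e n) *\<^sub>R \<xi>)) * complex_of_real (gauss (e n *\<^sub>R (1 / e n) *\<^sub>R \<xi>)) \<partial>lborel)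
          = (\<integral>\<xi>. expi (\<xi> \<bullet> ((1 / e n) *\<^sub>R (x - y))) * complex_of_real (gauss \<xi>) \<partial>lborel)"
        using e[of n] by (simp add: inner_commute)
      finally show "(\<integral>\<xi>. expi ((x - y) \<bullet> \<xi>) * complex_of_real (gauss (e n *\<^sub>R \<xi>)) \<partial>lborel)
         = complex_of_real ((1 / e n) ^ CARD('n) * (gauss ((1 / e n) *\<^sub>R (x - y)) / ?k))"
        by (simp only: gauss_transform scaleR_conv_of_real of_real_mult)
    qed
    also have "?k * (\<integral>x. \<psi> x * complex_of_real ((1 / e n) ^ CARD('n) * (gauss ((1 / e n) *\<^sub>R (x - y)) / ?k)) \<partial>lborel)
       = (\<integral>x. \<psi> x * complex_of_real ((1 / e n) ^ CARD('n) * gauss ((1 / e n) *\<^sub>R (x - y))) \<partial>lborel)"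
      using fourier_const_pos[where 'n='n]
      by (subst integral_mult_right_zero[symmetric]) (simp add: mult_ac)
    also have "\<dots> = e n ^ CARD('n) *\<^sub>R (\<integral>z. \<psi> (y + e n *\<^sub>R z) * complex_of_real ((1 / e n) ^ CARD('n) * gauss ((1 / e n) *\<^sub>R ((y + e n *\<^sub>R z) - y))) \<partial>lborel)"
      using integral_lborel_affine[of "\<lambda>x. \<psi> x * complex_of_real ((1 / e n) ^ CARD('n) * gauss ((1 / e n) *\<^sub>R (x - y)))" "e n" y] e[of n]
      by simp
    also have "\<dots> = ?R n"
      using e[of n] unfolding integral_scaleR_right[symmetric]
      by (intro Bochner_Integration.integral_cong) (auto simp: scaleR_conv_of_real[where 'a=complex] power_divide)
    finally show ?thesis .
  qed
  \<comment> \<open>Frequency side: the damping factor tends to 1, dominated by the integrable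
    |a|.\<close>
  have l1: "?L \<longlonglongrightarrow> (\<integral>\<xi>. complex_of_real 1 * (expi (- (\<xi> \<bullet> y)) * a \<xi>) \<partial>lborel)"
  proof (rule integral_dominated_convergence[where w="\<lambda>\<xi>. norm (a \<xi>)"])
    show "integrable lborel (\<lambda>\<xi>. norm (a \<xi>))" using schwartz_integrable[OF aS] by simp
    have "(\<lambda>n. gauss (e n *\<^sub>R \<xi>)) \<longlonglongrightarrow> 1" for \<xi> :: "real^'n"
    proof -
      have "(\<lambda>n. exp (- (norm (e n *\<^sub>R \<xi>))\<^sup>2 / 2)) \<longlonglongrightarrow> exp (- (norm (0 *\<^sub>R \<xi>))\<^sup>2 / 2)"
        by (intro tendsto_intros e0) auto
      then show ?thesis by (simp add: gauss_def)
    qed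
    then show "AE \<xi> in lborel. (\<lambda>n. complex_of_real (gauss (e n *\<^sub>R \<xi>)) * (expi (- (\<xi> \<bullet> y)) * a \<xi>))
       \<longlonglongrightarrow> complex_of_real 1 * (expi (- (\<xi> \<bullet> y)) * a \<xi>)"
      by (intro AE_I2 tendsto_intros)
    show "AE \<xi> in lborel. norm (complex_of_real (gauss (e n *\<^sub>R \<xi>)) * (expi (- (\<xi> \<bullet> y)) * a \<xi>)) \<le> norm (a \<xi>)" for n
      by (intro AE_I2) (simp add: norm_mult mult_left_le_one_le)
  qed measurable
  \<comment> \<open>Space side: the average of \<open>\<psi>\<close> around \<open>y\<close>
    concentrates at \<open>y\<close>.\<close>
  have l2: "?R \<longlonglongrightarrow> (\<integral>z. \<psi> y * complex_of_real (gauss (z::real^'n)) \<partial>lborel)"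
  proof (rule integral_dominated_convergence[where w="\<lambda>z. C * norm (complex_of_real (gauss z))"])
    show "integrable lborel (\<lambda>z::real^'n. C * norm (complex_of_real (gauss z)))"
      by (intro integrable_mult_right integrable_norm gi)
    show "AE z in lborel. (\<lambda>n. \<psi> (y + e n *\<^sub>R z) * complex_of_real (gauss z)) \<longlonglongrightarrow> \<psi> y * complex_of_real (gauss z)"
    proof (rule AE_I2)
      fix z :: "real^'n"
      have "(\<lambda>n. y + e n *\<^sub>R z) \<longlonglongrightarrow> y + 0 *\<^sub>R z" by (intro tendsto_intros e0)
      then have "(\<lambda>n. \<psi> (y + e n *\<^sub>R z)) \<longlonglongrightarrow> \<psi> y"
        using schwartz_continuous[OF S] by (intro continuous_on_tendsto_compose[of UNIV \<psi>]) auto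
      then show "(\<lambda>n. \<psi> (y + e n *\<^sub>R z) * complex_of_real (gauss z)) \<longlonglongrightarrow> \<psi> y * complex_of_real (gauss z)"
        by (intro tendsto_intros)
    qed
    show "AE z in lborel. norm (\<psi> (y + e n *\<^sub>R z) * complex_of_real (gauss z)) \<le> C * norm (complex_of_real (gauss z))" for n
      using C by (intro AE_I2) (auto simp: norm_mult intro: mult_right_mono)
  qed measurable
  have "(\<integral>\<xi>. complex_of_real 1 * (expi (- (\<xi> \<bullet> y)) * a \<xi>) \<partial>lborel) = (\<integral>z. \<psi> y * complex_of_real (gauss (z::real^'n)) \<partial>lborel)"
    using LIMSEQ_unique[OF l1 l2[folded eq]] .
  also have "\<dots> = \<psi> y / ?k"
    using gauss_transform(2)[of "0::real^'n"] by (simp add: gauss_def)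
  finally show "fourier (inv_fourier \<psi>) y = \<psi> y"
    using fourier_const_pos[where 'n='n] by (simp add: fourier_eq a_def)
qed

lemma inv_fourier_fourier:
  assumes S: "\<psi> \<in> schwartz"
  shows "inv_fourier (fourier \<psi>) = \<psi>"
proof -
  have "inv_fourier (fourier \<psi>) = fourier (\<lambda>x. fourier \<psi> (- x))"
    by (rule inv_fourier_reflect[OF schwartz_fourier[OF S]])
  also have "(\<lambda>x. fourier \<psi> (- x)) = inv_fourier \<psi>" by (simp add: inv_fourier_minus fun_eq_iff)
  finally show ?thesis by (simp add: fourier_inv_fourier[OF S])
qed

subsection \<open>Fourier multipliers\<close>

text \<open>The transpose of the operator on distributions: transposition reverses the order of the
  two transforms.\<close>

definition multiplier :: "(real^'n::finite \<Rightarrow> real) \<Rightarrow> (real^'n \<Rightarrow> complex) \<Rightarrow> real^'n \<Rightarrow> complex" where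
  "multiplier \<omega> \<psi> = fourier (\<lambda>\<xi>. \<omega> \<xi> *\<^sub>R inv_fourier \<psi> \<xi>)"

text \<open>Both transforms contribute a factor \<open>fourier_const\<close>; one sits inside
  \<open>inv_fourier\<close>, the other is written out. With this normalisation no constant remains
  in the convolution formula.\<close>

definition kernel :: "(real^'n::finite \<Rightarrow> real) \<Rightarrow> real^'n \<Rightarrow> complex" where
  "kernel \<omega> x = fourier_const TYPE('n) * inv_fourier (\<lambda>\<xi>. complex_of_real (\<omega> \<xi>)) x"

definition multiplier_distr :: "(real^'n::finite \<Rightarrow> real) \<Rightarrow> 'n functional \<Rightarrow> 'n functional" where
  "multiplier_distr \<omega> u = inv_fourier_distr (mult_distr \<omega> (fourier_distr u))"

lemma schwartz_multiplier: "\<omega> \<in> schwartz \<Longrightarrow> \<psi> \<in> schwartz \<Longrightarrow> multiplier \<omega> \<psi> \<in> schwartz"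
  unfolding multiplier_def by (intro schwartz_fourier schwartz_scaleR_fun schwartz_inv_fourier)

lemma multiplier_distr_apply:
  "\<omega> \<in> schwartz \<Longrightarrow> \<psi> \<in> schwartz \<Longrightarrow> multiplier_distr \<omega> u \<psi> = u (multiplier \<omega> \<psi>)"
  by (simp add: multiplier_distr_def inv_fourier_distr_def mult_distr_def fourier_distr_def multiplier_def
      schwartz_inv_fourier schwartz_scaleR_fun)

lemma schwartz_kernel: "\<omega> \<in> schwartz \<Longrightarrow> kernel \<omega> \<in> schwartz"
  unfolding kernel_def[abs_def] by (intro schwartz_cmult schwartz_inv_fourier schwartz_of_real)

text \<open>Fubini for the two nested transforms. The kernel is evaluated at \<open>x - y\<close>
  with \<open>x\<close> integrated, the reflected argument belonging to the transpose of the
  convolution.\<close>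

lemma multiplier_eq_convolution:
  fixes \<psi> :: "real^'n::finite \<Rightarrow> complex"
  assumes \<omega>: "\<omega> \<in> schwartz" and \<psi>: "\<psi> \<in> schwartz"
  shows "multiplier \<omega> \<psi> y = (\<integral>x. kernel \<omega> (x - y) * \<psi> x \<partial>lborel)"
proof -
  let ?k = "fourier_const TYPE('n)"
  let ?w = "\<lambda>\<xi>. complex_of_real (\<omega> \<xi>)"
  have [measurable]: "\<omega> \<in> borel_measurable borel" "\<psi> \<in> borel_measurable borel"
    using assms by (auto intro: schwartz_measurable)
  have "multiplier \<omega> \<psi> y = ?k * (\<integral>\<xi>. ?k * (?w \<xi> * (\<integral>x. expi ((x - y) \<bullet> \<xi>) * \<psi> x \<partial>lborel)) \<partial>lborel)"
    unfolding multiplier_def fourier_eq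
  proof (rule arg_cong2[where f="(*)", OF refl], rule Bochner_Integration.integral_cong[OF refl])
    fix \<xi> :: "real^'n"
    have "expi (- (\<xi> \<bullet> y)) * (\<integral>x. expi (x \<bullet> \<xi>) * \<psi> x \<partial>lborel) = (\<integral>x. expi ((x - y) \<bullet> \<xi>) * \<psi> x \<partial>lborel)"
      by (subst integral_mult_right_zero[symmetric])
        (simp add: inner_diff_left inner_commute[of \<xi> y] mult.assoc[symmetric] flip: expi_add)
    then show "expi (- (\<xi> \<bullet> y)) * (\<omega> \<xi> *\<^sub>R inv_fourier \<psi> \<xi>)
      = ?k * (?w \<xi> * (\<integral>x. expi ((x - y) \<bullet> \<xi>) * \<psi> x \<partial>lborel))"
      by (simp add: inv_fourier_eq scaleR_conv_of_real)
  qed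
  also have "(\<integral>\<xi>. ?k * (?w \<xi> * (\<integral>x. expi ((x - y) \<bullet> \<xi>) * \<psi> x \<partial>lborel)) \<partial>lborel)
     = ?k * (\<integral>\<xi>. ?w \<xi> * (\<integral>x. expi ((x - y) \<bullet> \<xi>) * \<psi> x \<partial>lborel) \<partial>lborel)"
    by simp
  also have "(\<integral>\<xi>. ?w \<xi> * (\<integral>x. expi ((x - y) \<bullet> \<xi>) * \<psi> x \<partial>lborel) \<partial>lborel)
      = (\<integral>x. \<psi> x * (\<integral>\<xi>. expi ((x - y) \<bullet> \<xi>) * ?w \<xi> \<partial>lborel) \<partial>lborel)"
    using fubini_bounded[OF schwartz_integrable[OF schwartz_of_real[OF \<omega>]] schwartz_integrable[OF \<psi>]
        measurable_expi_inner, of y 1]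
    by simp
  also have "?k * (?k * (\<integral>x. \<psi> x * (\<integral>\<xi>. expi ((x - y) \<bullet> \<xi>) * ?w \<xi> \<partial>lborel) \<partial>lborel))
      = (\<integral>x. kernel \<omega> (x - y) * \<psi> x \<partial>lborel)"
    by (simp only: integral_mult_right_zero[symmetric] kernel_def inv_fourier_eq)
      (simp add: mult_ac inner_commute)
  finally show ?thesis .
qed

lemma multiplier_multiplier:
  assumes "\<omega> \<in> schwartz" "\<omega>' \<in> schwartz" "\<psi> \<in> schwartz"
  shows "multiplier \<omega> (multiplier \<omega>' \<psi>) = multiplier (\<lambda>\<xi>. \<omega> \<xi> * \<omega>' \<xi>) \<psi>"
  using inv_fourier_fourier[of "\<lambda>\<xi>. \<omega>' \<xi> *\<^sub>R inv_fourier \<psi> \<xi>"] assms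
  by (simp add: multiplier_def schwartz_scaleR_fun schwartz_inv_fourier)

lemma fourier_add:
  fixes \<psi> \<theta> :: "real^'n::finite \<Rightarrow> complex"
  assumes "\<psi> \<in> schwartz" "\<theta> \<in> schwartz"
  shows "fourier (\<lambda>x. \<psi> x + \<theta> x) \<xi> = fourier \<psi> \<xi> + fourier \<theta> \<xi>"
proof -
  have "integrable lborel (\<lambda>x. expi (- (x \<bullet> \<xi>)) * \<psi> x)" "integrable lborel (\<lambda>x. expi (- (x \<bullet> \<xi>)) * \<theta> x)"
    by (rule integrable_expi_mult[OF schwartz_integrable[OF assms(1)]], measurable)
      (rule integrable_expi_mult[OF schwartz_integrable[OF assms(2)]], measurable)
  then show ?thesis by (simp add: fourier_eq distrib_left)
qed

lemma multiplier_add: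
  assumes "\<omega> \<in> schwartz" "\<omega>' \<in> schwartz" "\<psi> \<in> schwartz"
  shows "multiplier (\<lambda>\<xi>. \<omega> \<xi> + \<omega>' \<xi>) \<psi> = (\<lambda>x. multiplier \<omega> \<psi> x + multiplier \<omega>' \<psi> x)"
  using assms by (auto simp: multiplier_def scaleR_add_left schwartz_scaleR_fun schwartz_inv_fourier fourier_add)

text \<open>On the frequency side both operations are multiplications by functions and so commute.
  Seminorm estimates for a multiplier thereby reduce to weighted sup estimates of order
  zero.\<close>

lemma partial_deriv_multiplier:
  assumes "\<omega> \<in> schwartz" "\<psi> \<in> schwartz"
  shows "partial_deriv i (multiplier \<omega> \<psi>) = multiplier \<omega> (partial_deriv i \<psi>)"
proof -
  have "inv_fourier (partial_deriv i \<psi>) \<xi> = - \<i> * \<xi> $ i * inv_fourier \<psi> \<xi>" for \<xi>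
    by (simp add: inv_fourier_minus fourier_partial_deriv[OF assms(2)])
  then show ?thesis
    unfolding multiplier_def partial_deriv_fourier[OF schwartz_scaleR_fun[OF assms(1) schwartz_inv_fourier[OF assms(2)]]]
    by (intro arg_cong[where f=fourier]) (simp add: scaleR_conv_of_real mult_ac)
qed

lemma iter_deriv_multiplier:
  assumes "\<omega> \<in> schwartz" "\<psi> \<in> schwartz"
  shows "iter_deriv \<alpha> (multiplier \<omega> \<psi>) = multiplier \<omega> (iter_deriv \<alpha> \<psi>)"
  by (induction \<alpha>) (auto simp: iter_deriv_simps partial_deriv_multiplier schwartz_iter_deriv assms)

lemma inv_fourier_dilation:
  fixes \<psi> :: "real^'n::finite \<Rightarrow> complex"
  assumes S: "\<psi> \<in> schwartz" and c: "c > 0"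
  shows "inv_fourier (\<lambda>\<xi>. \<psi> ((1 / c) *\<^sub>R \<xi>)) x = c ^ CARD('n) * inv_fourier \<psi> (c *\<^sub>R x)"
proof -
  have [measurable]: "\<psi> \<in> borel_measurable borel" using S by (rule schwartz_measurable)
  have "(\<integral>\<xi>. expi (\<xi> \<bullet> x) * \<psi> ((1 / c) *\<^sub>R \<xi>) \<partial>lborel)
      = c ^ CARD('n) *\<^sub>R (\<integral>\<xi>. expi ((c *\<^sub>R \<xi>) \<bullet> x) * \<psi> ((1 / c) *\<^sub>R c *\<^sub>R \<xi>) \<partial>lborel)"
    using integral_lborel_affine[of "\<lambda>\<xi>. expi (\<xi> \<bullet> x) * \<psi> ((1 / c) *\<^sub>R \<xi>)" c 0] c by simp
  also have "\<dots> = c ^ CARD('n) * (\<integral>\<xi>. expi (\<xi> \<bullet> (c *\<^sub>R x)) * \<psi> \<xi> \<partial>lborel)"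
    unfolding scaleR_conv_of_real[where 'a=complex] using c by simp
  finally show ?thesis by (simp add: inv_fourier_eq mult_ac)
qed

lemma kernel_dilation:
  fixes \<omega> :: "real^'n::finite \<Rightarrow> real"
  assumes "\<omega> \<in> schwartz" and "c > 0"
  shows "kernel (\<lambda>\<xi>. \<omega> ((1 / c) *\<^sub>R \<xi>)) x = c ^ CARD('n) * kernel \<omega> (c *\<^sub>R x)"
  using inv_fourier_dilation[OF schwartz_of_real[OF assms(1)] assms(2)] by (simp add: kernel_def)

text \<open>Fourier inversion evaluated at frequency 0.\<close>

lemma integral_kernel:
  assumes "\<omega> \<in> schwartz"
  shows "(\<integral>x. kernel \<omega> x \<partial>lborel) = \<omega> 0"
  using fun_cong[OF fourier_inv_fourier[OF schwartz_of_real[OF assms]], of 0]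
  by (simp add: kernel_def fourier_eq)

subsection \<open>Uniqueness of representing functions\<close>

lemma gauss_has_derivative: "(gauss has_derivative (\<lambda>h. - (x \<bullet> h) * gauss x)) (at x)"
  unfolding gauss_def[abs_def] power2_norm_eq_inner
  by (auto intro!: derivative_eq_intros simp: inner_commute)

lemma power_le_exp: "0 \<le> t \<Longrightarrow> t ^ m \<le> real m ^ m * exp t"
proof (cases "m = 0")
  case False
  assume t: "0 \<le> t"
  have "t / m \<le> exp (t / m)" using exp_ge_add_one_self[of "t / m"] by linarith
  then have "(t / m) ^ m \<le> exp (t / m) ^ m" using t by (intro power_mono) auto
  also have "\<dots> = exp t" using False by (simp add: exp_of_nat_mult[symmetric])
  finally show ?thesis using False by (simp add: power_divide field_simps)
qed simp

lemma gauss_rapidly_decaying: "rapidly_decaying gauss"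
  unfolding rapidly_decaying_def
proof (intro allI exI)
  fix m :: nat and x :: 'a
  \<comment> \<open>Completing the square bounds 1 + t - t^2/2 by 3/2, so the Gaussian beats exp(1 +
    t), which in turn beats every power of 1 + t.\<close>
  have "(norm x - 1)\<^sup>2 \<ge> 0" by simp
  then have "(1 + norm x) + (- (norm x)\<^sup>2 / 2) \<le> 3 / 2"
    by (simp add: power2_diff)
  then have "exp (1 + norm x) * exp (- (norm x)\<^sup>2 / 2) \<le> exp (3 / 2)"
    by (simp only: exp_add[symmetric] exp_le_cancel_iff)
  then have "real m ^ m * (exp (1 + norm x) * gauss x) \<le> real m ^ m * exp (3 / 2)"
    by (intro mult_left_mono) (auto simp: gauss_def)
  moreover have "(1 + norm x) ^ m * gauss x \<le> (real m ^ m * exp (1 + norm x)) * gauss x"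
    by (intro mult_right_mono power_le_exp) (auto simp: gauss_def)
  ultimately have "(1 + norm x) ^ m * gauss x \<le> real m ^ m * exp (3 / 2)"
    by (simp only: mult.assoc)
  then show "(1 + norm x) ^ m * norm (gauss x) \<le> real m ^ m * exp (3 / 2)" by simp
qed

lemma schwartz_gauss: "gauss \<in> (schwartz :: (real^'n::finite \<Rightarrow> real) set)"
proof -
  have d: "gauss differentiable (at x)" for x :: "real^'n"
    using gauss_has_derivative differentiable_def by blast
  have "partial_deriv i gauss = (\<lambda>x::real^'n. x $ i *\<^sub>R (- gauss x))" for i
    by (rule ext, subst partial_deriv_eq[OF gauss_has_derivative]) (simp add: inner_axis)
  then have "schwartz_upto n (gauss :: real^'n \<Rightarrow> real)" for n
    by (induction n)
      (auto simp: d gauss_rapidly_decaying intro!: schwartz_upto_coord_mult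
        schwartz_upto_bounded_linear[OF bounded_linear_minus[OF bounded_linear_ident]]
        simp del: scaleR_minus_right real_scaleR_def)
  then show ?thesis by (simp add: schwartz_iff_upto)
qed

lemma integrable_mult_bounded:
  fixes f g :: "'a::euclidean_space \<Rightarrow> complex"
  assumes "integrable lborel f" "g \<in> borel_measurable borel" "AE x in lborel. norm (g x) \<le> B"
  shows "integrable lborel (\<lambda>x. f x * g x)" "integrable lborel (\<lambda>x. g x * f x)"
proof -
  have 1: "integrable lborel (\<lambda>x. B * norm (f x))" using assms(1) by auto
  have 2: "AE x in lborel. norm (f x * g x) \<le> norm (B * norm (f x))"
    using assms(3)
  proof eventually_elim
    case (elim x)
    then have "norm (f x) * norm (g x) \<le> \<bar>B\<bar> * norm (f x)"
      by (subst mult.commute) (intro mult_right_mono, auto)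
    then show ?case by (simp add: norm_mult abs_mult)
  qed
  show "integrable lborel (\<lambda>x. f x * g x)"
    by (rule Bochner_Integration.integrable_bound[OF 1 _ 2]) (use assms in \<open>auto dest: borel_measurable_integrable\<close>)
  then show "integrable lborel (\<lambda>x. g x * f x)" by (simp add: mult.commute)
qed

text \<open>Fubini turns the vanishing of \<open>D\<close> against translated Gaussians of width \<open>1/n\<close> into the
  vanishing of \<open>D\<close> against mollifications of \<open>b\<close>, which converge to \<open>b\<close>.\<close>

lemma integral_zero_continuous:
  fixes D :: "real^'n::finite \<Rightarrow> complex" and b :: "real^'n \<Rightarrow> complex"
  assumes D: "integrable lborel D" and z: "\<And>\<psi>. \<psi> \<in> schwartz \<Longrightarrow> (\<integral>x. D x * \<psi> x \<partial>lborel) = 0"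
    and b: "continuous_on UNIV b" "integrable lborel b" "\<And>x. norm (b x) \<le> K"
  shows "(\<integral>x. D x * b x \<partial>lborel) = 0"
proof -
  let ?g = "\<lambda>x::real^'n. complex_of_real (gauss x)"
  have [measurable]: "b \<in> borel_measurable borel" using b(1) by (rule borel_measurable_continuous_onI)
  have [measurable]: "D \<in> borel_measurable borel" using D by (auto dest: borel_measurable_integrable)
  have gS: "?g \<in> schwartz" by (intro schwartz_of_real schwartz_gauss)
  have gi: "integrable lborel ?g" by (rule schwartz_integrable[OF gS])
  define e where "e n = 1 / real (Suc n)" for n
  have e: "0 < e n" for n by (auto simp: e_def)
  have e0: "e \<longlonglongrightarrow> 0" unfolding e_def using LIMSEQ_inverse_real_of_nat by (simp add: inverse_eq_divide)
  have zero: "(\<integral>y. D y * (\<integral>v. ?g v * b (y + e n *\<^sub>R v) \<partial>lborel) \<partial>lborel) = 0" for n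
  proof -
    define N where "N = 1 / e n"
    have N: "N > 0" using e by (simp add: N_def)
    have gcont: "continuous_on UNIV (\<lambda>z::(real^'n) \<times> (real^'n). ?g (N *\<^sub>R (fst z - snd z)))"
      unfolding gauss_def by (intro continuous_intros) auto
    have inner: "(\<integral>y. ?g (N *\<^sub>R (x - y)) * D y \<partial>lborel) = 0" for x
    proof -
      have "(\<lambda>y. ?g ((- N) *\<^sub>R y + N *\<^sub>R x)) \<in> schwartz"
        using N by (intro schwartz_affine gS) auto
      from z[OF this] show ?thesis by (simp add: scaleR_diff_right mult.commute)
    qed
    have "(\<integral>y. D y * (\<integral>x. ?g (N *\<^sub>R (x - y)) * b x \<partial>lborel) \<partial>lborel)
        = (\<integral>x. b x * (\<integral>y. ?g (N *\<^sub>R (x - y)) * D y \<partial>lborel) \<partial>lborel)"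
      using fubini_bounded[OF b(2) D borel_measurable_continuous_onI[OF gcont], of 1] by simp
    then have "(\<integral>y. D y * (\<integral>x. ?g (N *\<^sub>R (x - y)) * b x \<partial>lborel) \<partial>lborel) = 0"
      by (simp add: inner)
    moreover have "(\<integral>x. ?g (N *\<^sub>R (x - y)) * b x \<partial>lborel) = (e n ^ CARD('n)) *\<^sub>R (\<integral>v. ?g v * b (y + e n *\<^sub>R v) \<partial>lborel)" for y
      using integral_lborel_affine[of "\<lambda>x. ?g (N *\<^sub>R (x - y)) * b x" "e n" y] e[of n] by (simp add: N_def)
    ultimately have "(e n ^ CARD('n)) *\<^sub>R (\<integral>y. D y * (\<integral>v. ?g v * b (y + e n *\<^sub>R v) \<partial>lborel) \<partial>lborel) = 0"
      by (simp only: mult_scaleR_right integral_scaleR_right)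
    then show ?thesis using e[of n] by simp
  qed
  have mm: "(\<lambda>y. \<integral>v. ?g v * b (y + e n *\<^sub>R v) \<partial>lborel) \<in> borel_measurable borel" for n
  proof -
    have "continuous_on UNIV (\<lambda>z::(real^'n) \<times> (real^'n). ?g (snd z) * b (fst z + e n *\<^sub>R snd z))"
      unfolding gauss_def by (intro continuous_intros continuous_on_compose2[OF b(1)]) auto
    then have [measurable]: "(\<lambda>z::(real^'n) \<times> (real^'n). ?g (snd z) * b (fst z + e n *\<^sub>R snd z)) \<in> borel_measurable (borel \<Otimes>\<^sub>M borel)"
      using borel_measurable_continuous_onI by (simp add: borel_prod)
    have "(\<lambda>y. \<integral>v. (\<lambda>z. ?g (snd z) * b (fst z + e n *\<^sub>R snd z)) (y, v) \<partial>lborel) \<in> borel_measurable borel"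
      by (rule lborel.borel_measurable_lebesgue_integral) measurable
    then show ?thesis by simp
  qed
  have K0: "0 \<le> K" using b(3) norm_ge_zero order.trans by blast
  have gb: "norm (?g v * b w) \<le> K * norm (?g v)" for v w
    using b(3) by (simp add: norm_mult mult.commute[of K] mult_left_mono)
  have lim: "(\<lambda>n. \<integral>v. ?g v * b (y + e n *\<^sub>R v) \<partial>lborel) \<longlonglongrightarrow> (\<integral>v. ?g v * b y \<partial>lborel)" for y
  proof (rule integral_dominated_convergence[where w="\<lambda>v. K * norm (?g v)"])
    show "integrable lborel (\<lambda>v. K * norm (?g v))" by (intro integrable_mult_right integrable_norm gi)
    show "AE v in lborel. (\<lambda>n. ?g v * b (y + e n *\<^sub>R v)) \<longlonglongrightarrow> ?g v * b y"
    proof (intro AE_I2 tendsto_intros)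
      fix v
      have "(\<lambda>n. y + e n *\<^sub>R v) \<longlonglongrightarrow> y + 0 *\<^sub>R v" by (intro tendsto_intros e0)
      then show "(\<lambda>n. b (y + e n *\<^sub>R v)) \<longlonglongrightarrow> b y"
        using b(1) by (intro continuous_on_tendsto_compose[of UNIV b]) auto
    qed
  qed (use gb in auto)
  have "(\<lambda>n. \<integral>y. D y * (\<integral>v. ?g v * b (y + e n *\<^sub>R v) \<partial>lborel) \<partial>lborel)
      \<longlonglongrightarrow> (\<integral>y. D y * (\<integral>v. ?g v * b y \<partial>lborel) \<partial>lborel)"
  proof (rule integral_dominated_convergence[where w="\<lambda>y. norm (D y) * (K * (\<integral>v. norm (?g v) \<partial>lborel))"])
    show "integrable lborel (\<lambda>y. norm (D y) * (K * (\<integral>v. norm (?g v) \<partial>lborel)))"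
      by (intro integrable_mult_left integrable_norm D)
    show "AE y in lborel. (\<lambda>n. D y * (\<integral>v. ?g v * b (y + e n *\<^sub>R v) \<partial>lborel)) \<longlonglongrightarrow> D y * (\<integral>v. ?g v * b y \<partial>lborel)"
      by (intro AE_I2 tendsto_intros lim)
    have "norm (\<integral>v. ?g v * b (y + e n *\<^sub>R v) \<partial>lborel) \<le> (\<integral>v. K * norm (?g v) \<partial>lborel)" for n y
    proof (rule Bochner_Integration.integral_norm_bound_integral)
      show "integrable lborel (\<lambda>v. ?g v * b (y + e n *\<^sub>R v))"
        by (rule integrable_mult_bounded[OF gi, where B=K]) (use b(3) in auto)
      show "integrable lborel (\<lambda>v. K * norm (?g v))" by (intro integrable_mult_right integrable_norm gi)
    qed (rule gb)
    then show "AE y in lborel. norm (D y * (\<integral>v. ?g v * b (y + e n *\<^sub>R v) \<partial>lborel))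
        \<le> norm (D y) * (K * (\<integral>v. norm (?g v) \<partial>lborel))" for n
      by (intro AE_I2) (simp add: norm_mult mult_left_mono)
    show "(\<lambda>y. D y * (\<integral>v. ?g v * b (y + e n *\<^sub>R v) \<partial>lborel)) \<in> borel_measurable lborel" for n
      using mm[of n] by measurable
  qed measurable
  then have "(\<integral>y. D y * (\<integral>v. ?g v * b y \<partial>lborel) \<partial>lborel) = 0"
    unfolding zero by (simp add: LIMSEQ_const_iff)
  moreover have "(\<integral>v. ?g v * b y \<partial>lborel) = b y / fourier_const TYPE('n)" for y
    using gauss_transform(2)[of "0::real^'n"] by (simp add: gauss_def)
  ultimately show ?thesis using fourier_const_pos[where 'n='n] by simp
qed

text \<open>Integrals over closed sets vanish by approximating indicators with continuous functions;
  Dynkin's theorem passes to Borel sets. \<open>D\<close> is first multiplied by a Gaussian because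
  the cut-offs themselves need not be integrable, whereas cut-off times Gaussian is; the Gaussian
  has no zeros, so nothing is lost.\<close>

lemma integrable_zero_AE:
  fixes D :: "real^'n::finite \<Rightarrow> complex"
  assumes D: "integrable lborel D" and z: "\<And>\<psi>. \<psi> \<in> schwartz \<Longrightarrow> (\<integral>x. D x * \<psi> x \<partial>lborel) = 0"
  shows "AE x in lborel. D x = 0"
proof -
  let ?g = "\<lambda>x::real^'n. complex_of_real (gauss x)"
  define E where "E x = D x * ?g x" for x
  have [measurable]: "D \<in> borel_measurable borel" using D by (auto dest: borel_measurable_integrable)
  have gi: "integrable lborel ?g" by (intro schwartz_integrable schwartz_of_real schwartz_gauss)
  have gb: "norm (?g x) \<le> 1" for x by simp
  have E: "integrable lborel E" unfolding E_def by (rule integrable_mult_bounded[OF D, where B=1]) (use gb in auto)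
  have closed: "(\<integral>x. indicator A x *\<^sub>R E x \<partial>lborel) = 0" if A: "closed A" for A
  proof (cases "A = {}")
    case False
    \<comment> \<open>Equal to 1 on \<open>A\<close>; off \<open>A\<close> it is eventually 0, as a
      point outside a closed set has positive distance to it.\<close>
    define b where "b m x = max 0 (1 - real m * infdist x A)" for m :: nat and x
    have b01: "0 \<le> b m x" "b m x \<le> 1" for m x using infdist_nonneg[of x A] by (auto simp: b_def)
    have [measurable]: "b m \<in> borel_measurable borel" for m
      unfolding b_def[abs_def] by (intro borel_measurable_continuous_onI continuous_intros)
    have [measurable]: "A \<in> sets borel" using A by auto
    have lim: "(\<lambda>m. b m x) \<longlonglongrightarrow> indicator A x" for x
    proof (cases "x \<in> A")
      case True
      then show ?thesis by (simp add: b_def)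
    next
      case nA: False
      then have "infdist x A > 0" using A False by (simp add: infdist_pos_not_in_closed)
      then obtain M :: nat where M: "1 < real M * infdist x A" using reals_Archimedean3 by blast
      have "b m x = 0" if "m \<ge> M" for m
      proof -
        have "real M * infdist x A \<le> real m * infdist x A"
          using that infdist_nonneg[of x A] by (intro mult_right_mono) auto
        then show ?thesis using M by (simp add: b_def)
      qed
      then have "\<forall>\<^sub>F m in sequentially. b m x = indicator A x"
        using nA by (auto simp: eventually_sequentially)
      then show ?thesis by (rule tendsto_eventually)
    qed
    have "(\<lambda>m. \<integral>x. b m x *\<^sub>R E x \<partial>lborel) \<longlonglongrightarrow> (\<integral>x. indicator A x *\<^sub>R E x \<partial>lborel)"
    proof (rule integral_dominated_convergence[where w="\<lambda>x. norm (E x)"])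
      show "AE x in lborel. norm (b m x *\<^sub>R E x) \<le> norm (E x)" for m
        using b01 by (intro AE_I2) (simp add: mult_left_le_one_le)
    qed (use E lim in \<open>auto intro!: tendsto_intros dest: borel_measurable_integrable\<close>)
    moreover have "(\<integral>x. b m x *\<^sub>R E x \<partial>lborel) = 0" for m
    proof -
      have "continuous_on UNIV (\<lambda>x. complex_of_real (b m x) * ?g x)"
        unfolding b_def gauss_def by (intro continuous_intros) auto
      moreover have "integrable lborel (\<lambda>x. complex_of_real (b m x) * ?g x)"
        by (rule integrable_mult_bounded[OF gi, where B=1]) (use b01 in auto)
      moreover have "norm (complex_of_real (b m x) * ?g x) \<le> 1" for x
        using b01[of m x] gb[of x] by (simp add: norm_mult mult_le_one)
      ultimately have "(\<integral>x. D x * (complex_of_real (b m x) * ?g x) \<partial>lborel) = 0"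
        using integral_zero_continuous[OF D z] by blast
      then show ?thesis by (simp add: E_def scaleR_conv_of_real mult_ac)
    qed
    ultimately show ?thesis by (simp add: LIMSEQ_const_iff)
  qed simp
  have "(\<integral>x. indicator A x *\<^sub>R E x \<partial>lborel) = 0" if "A \<in> sets borel" for A
  proof -
    \<comment> \<open>Closed sets form an intersection-stable generator of the Borel sets.\<close>
    have "Int_stable (Collect closed :: (real^'n) set set)" by (auto simp: Int_stable_def)
    moreover have "(Collect closed :: (real^'n) set set) \<subseteq> Pow UNIV" by simp
    moreover have "A \<in> sigma_sets UNIV (Collect closed)" using that by (simp add: borel_eq_closed)
    ultimately show ?thesis
    proof (induction rule: sigma_sets_induct_disjoint)
      case (compl A)
      have A[measurable]: "A \<in> sets borel" using compl by (simp add: borel_eq_closed)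
      have "(\<integral>x. indicator (UNIV - A) x *\<^sub>R E x \<partial>lborel) = (\<integral>x. indicator UNIV x *\<^sub>R E x - indicator A x *\<^sub>R E x \<partial>lborel)"
        by (intro Bochner_Integration.integral_cong) (auto simp: indicator_def)
      also have "\<dots> = (\<integral>x. indicator UNIV x *\<^sub>R E x \<partial>lborel) - (\<integral>x. indicator A x *\<^sub>R E x \<partial>lborel)"
        using E by (intro Bochner_Integration.integral_diff integrable_mult_indicator) auto
      also have "(\<integral>x. indicator UNIV x *\<^sub>R E x \<partial>lborel) = 0" by (rule closed) simp
      finally show ?case using compl by simp
    next
      case (union A)
      have A[measurable]: "A i \<in> sets borel" for i
        using union(2) by (auto simp: borel_eq_closed)
      have "(LINT x:(\<Union>i. A i)|lborel. E x) = (\<Sum>i. (LINT x:(A i)|lborel. E x))"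
        using union(1) E
        by (intro lebesgue_integral_countable_add)
          (auto simp: disjoint_family_on_def set_integrable_def intro!: integrable_mult_indicator)
      then show ?case using union(3) by (simp add: set_lebesgue_integral_def)
    next
      case (basic A)
      then show ?case using closed by simp
    qed simp
  qed
  then have "AE x in lborel. E x = 0"
    using E by (intro sigma_finite_measure.density_zero[OF sigma_finite_lborel]) (auto simp: set_lebesgue_integral_def)
  then show ?thesis
    by eventually_elim (simp add: E_def)
qed

lemma represents_measurable: "represents g u \<Longrightarrow> g \<in> borel_measurable borel"
  by (simp add: represents_def)

text \<open>The difference of \<open>g\<close> and \<open>g'\<close> need not be integrable; times a
  Gaussian it is, and a Gaussian times a test function is again a test function.\<close>

lemma represents_AE_eq:
  fixes g g' :: "real^'n::finite \<Rightarrow> complex"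
  assumes g: "represents g u" and g': "represents g' u"
  shows "AE x in lborel. g x = g' x"
proof -
  let ?g = "\<lambda>x::real^'n. complex_of_real (gauss x)"
  have gS: "?g \<in> schwartz" by (intro schwartz_of_real schwartz_gauss)
  have i: "integrable lborel (\<lambda>x. g x * \<psi> x)" "integrable lborel (\<lambda>x. g' x * \<psi> x)" if "\<psi> \<in> schwartz" for \<psi>
    using g g' that by (auto simp: represents_def)
  have "AE x in lborel. g x * ?g x - g' x * ?g x = 0"
  proof (rule integrable_zero_AE)
    show "integrable lborel (\<lambda>x. g x * ?g x - g' x * ?g x)" using i[OF gS] by auto
    fix \<psi> :: "real^'n \<Rightarrow> complex" assume "\<psi> \<in> schwartz"
    then have s: "(\<lambda>x. ?g x * \<psi> x) \<in> schwartz" by (intro schwartz_mult_fun gS)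
    have "(\<integral>x. g x * (?g x * \<psi> x) - g' x * (?g x * \<psi> x) \<partial>lborel) = 0"
      using i[OF s] g g' s by (subst Bochner_Integration.integral_diff) (auto simp: represents_def)
    then show "(\<integral>x. (g x * ?g x - g' x * ?g x) * \<psi> x \<partial>lborel) = 0"
      by (simp add: left_diff_distrib mult.assoc)
  qed
  then show ?thesis
    by eventually_elim (simp flip: left_diff_distrib)
qed

lemma Linf_norm_represents:
  assumes "represents g u"
  shows "Linf_norm u = esssup lborel (\<lambda>x. ennreal (norm (g x)))"
proof -
  have *: "esssup lborel (\<lambda>x. ennreal (norm (h x))) = esssup lborel (\<lambda>x. ennreal (norm (g x)))" if "represents h u" for h
  proof (rule esssup_AE_cong)
    show "AE x in lborel. ennreal (norm (h x)) = ennreal (norm (g x))"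
      using represents_AE_eq[OF that assms] by eventually_elim simp
  qed (use that[THEN represents_measurable] assms[THEN represents_measurable] in measurable)
  show ?thesis unfolding Linf_norm_def distr_norm_def
  proof (rule INF_eq_const)
    show "{g. represents g u} \<noteq> {}" using assms by blast
  qed (use * in blast)
qed

subsection \<open>Multipliers acting on represented distributions\<close>

definition convolve :: "('a::euclidean_space \<Rightarrow> complex) \<Rightarrow> ('a \<Rightarrow> complex) \<Rightarrow> 'a \<Rightarrow> complex" where
  "convolve k g x = (\<integral>y. k (x - y) * g y \<partial>lborel)"

lemma convolve_measurable [measurable]:
  assumes [measurable]: "k \<in> borel_measurable borel" "g \<in> borel_measurable borel"
  shows "convolve k g \<in> borel_measurable borel"
proof -
  have "(\<lambda>x. \<integral>y. (\<lambda>(x, y). k (x - y) * g y) (x, y) \<partial>lborel) \<in> borel_measurable borel"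
    by (rule lborel.borel_measurable_lebesgue_integral) measurable
  then show ?thesis by (simp add: convolve_def[abs_def])
qed

lemma integrable_reflect_shift:
  fixes f :: "'a::euclidean_space \<Rightarrow> 'b::{banach, second_countable_topology}"
  assumes "integrable lborel f"
  shows "integrable lborel (\<lambda>y. f (x - y))"
  using integrable_lborel_affine[OF assms, of "-1" x] by simp

lemma convolve_bound:
  assumes k: "integrable lborel k" and g: "g \<in> borel_measurable borel" "AE y in lborel. norm (g y) \<le> B"
  shows "norm (convolve k g x) \<le> B * (\<integral>y. norm (k y) \<partial>lborel)"
proof -
  have ki: "integrable lborel (\<lambda>y. k (x - y))" by (rule integrable_reflect_shift[OF k])
  have km[measurable]: "k \<in> borel_measurable borel" using k by (auto dest: borel_measurable_integrable)
  have "norm (convolve k g x) \<le> (\<integral>y. norm (k (x - y) * g y) \<partial>lborel)"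
    unfolding convolve_def by (rule integral_norm_bound)
  also have "\<dots> \<le> (\<integral>y. norm (k (x - y)) * B \<partial>lborel)"
  proof (rule integral_mono_AE)
    show "integrable lborel (\<lambda>y. norm (k (x - y) * g y))" using integrable_mult_bounded[OF ki g] by simp
    show "integrable lborel (\<lambda>y. norm (k (x - y)) * B)" using ki by auto
    show "AE y in lborel. norm (k (x - y) * g y) \<le> norm (k (x - y)) * B"
      using g(2) by eventually_elim (simp add: norm_mult mult_left_mono)
  qed
  also have "\<dots> = B * (\<integral>y. norm (k (x - y)) \<partial>lborel)" by simp
  also have "(\<integral>y. norm (k (x - y)) \<partial>lborel) = (\<integral>y. norm (k y) \<partial>lborel)"
    by (rule integral_lborel_reflect) measurable
  finally show ?thesis .
qed

text \<open>Here \<open>g\<close> is bounded rather than integrable, so absolute convergence for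
  Fubini comes from the kernel and the test function instead.\<close>

lemma multiplier_represents:
  fixes g :: "real^'n::finite \<Rightarrow> complex"
  assumes g: "represents g u" and b: "AE y in lborel. norm (g y) \<le> B" and \<omega>: "\<omega> \<in> schwartz"
  shows "represents (convolve (kernel \<omega>) g) (multiplier_distr \<omega> u)"
proof -
  let ?k = "kernel \<omega>"
  have ki: "integrable lborel ?k" by (intro schwartz_integrable schwartz_kernel \<omega>)
  have [measurable]: "?k \<in> borel_measurable borel" by (intro schwartz_measurable schwartz_kernel \<omega>)
  have gm[measurable]: "g \<in> borel_measurable borel" using g by (simp add: represents_def)
  show ?thesis
    unfolding represents_def
  proof (intro conjI ballI)
    show "convolve ?k g \<in> borel_measurable lborel" by measurable
    fix \<psi> :: "real^'n \<Rightarrow> complex" assume \<psi>: "\<psi> \<in> schwartz"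
    have [measurable]: "\<psi> \<in> borel_measurable borel" using \<psi> by (rule schwartz_measurable)
    have \<psi>i: "integrable lborel \<psi>" by (rule schwartz_integrable[OF \<psi>])
    show "integrable lborel (\<lambda>x. convolve ?k g x * \<psi> x)"
      by (rule integrable_mult_bounded[OF \<psi>i]) (use convolve_bound[OF ki gm b] in auto)
    let ?f = "\<lambda>(x, y). \<psi> x * (?k (x - y) * g y)"
    have sec: "integrable lborel (\<lambda>y. ?k (x - y) * g y)" for x
      by (rule integrable_mult_bounded[OF integrable_reflect_shift[OF ki] gm b])
    have "integrable (lborel \<Otimes>\<^sub>M lborel) ?f"
    proof (rule lborel_pair.Fubini_integrable)
      show "?f \<in> borel_measurable (lborel \<Otimes>\<^sub>M lborel)" by measurable
      show "AE x in lborel. integrable lborel (\<lambda>y. ?f (x, y))" using sec by auto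
      show "integrable lborel (\<lambda>x. \<integral>y. norm (?f (x, y)) \<partial>lborel)"
      proof (rule Bochner_Integration.integrable_bound[of _ "\<lambda>x. norm (\<psi> x) * (B * (\<integral>y. norm (?k y) \<partial>lborel))"])
        show "integrable lborel (\<lambda>x. norm (\<psi> x) * (B * (\<integral>y. norm (?k y) \<partial>lborel)))" using \<psi>i by auto
        have "(\<integral>y. norm (\<psi> x * (?k (x - y) * g y)) \<partial>lborel)
            \<le> norm (\<psi> x) * (B * (\<integral>y. norm (?k y) \<partial>lborel))" for x
        proof -
          have "(\<integral>y. norm (\<psi> x * (?k (x - y) * g y)) \<partial>lborel) \<le> (\<integral>y. norm (\<psi> x) * (B * norm (?k (x - y))) \<partial>lborel)"
          proof (rule integral_mono_AE)
            show "integrable lborel (\<lambda>y. norm (\<psi> x * (?k (x - y) * g y)))"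
              using sec by (intro integrable_norm integrable_mult_right)
            show "integrable lborel (\<lambda>y. norm (\<psi> x) * (B * norm (?k (x - y))))"
              using integrable_reflect_shift[OF ki] by (intro integrable_mult_right integrable_norm)
            show "AE y in lborel. norm (\<psi> x * (?k (x - y) * g y)) \<le> norm (\<psi> x) * (B * norm (?k (x - y)))"
              using b by eventually_elim (simp add: norm_mult mult.commute[of B] mult_left_mono)
          qed
          also have "\<dots> = norm (\<psi> x) * (B * (\<integral>y. norm (?k (x - y)) \<partial>lborel))" by simp
          also have "(\<integral>y. norm (?k (x - y)) \<partial>lborel) = (\<integral>y. norm (?k y) \<partial>lborel)"
            by (rule integral_lborel_reflect) measurable
          finally show ?thesis .
        qed
        then show "AE x in lborel. norm (\<integral>y. norm (?f (x, y)) \<partial>lborel)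
            \<le> norm (norm (\<psi> x) * (B * (\<integral>y. norm (?k y) \<partial>lborel)))"
          by (auto simp: Bochner_Integration.integral_nonneg intro: order.trans[OF _ abs_ge_self])
      qed measurable
    qed
    from lborel_pair.Fubini_integral[OF this[simplified]]
    have F: "(\<integral>y. (\<integral>x. \<psi> x * (?k (x - y) * g y) \<partial>lborel) \<partial>lborel) =
       (\<integral>x. (\<integral>y. \<psi> x * (?k (x - y) * g y) \<partial>lborel) \<partial>lborel)" by simp
    have "multiplier_distr \<omega> u \<psi> = (\<integral>y. g y * multiplier \<omega> \<psi> y \<partial>lborel)"
      using g schwartz_multiplier[OF \<omega> \<psi>] by (simp add: multiplier_distr_apply \<omega> \<psi> represents_def)
    also have "\<dots> = (\<integral>y. (\<integral>x. \<psi> x * (?k (x - y) * g y) \<partial>lborel) \<partial>lborel)"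
      by (simp add: multiplier_eq_convolution[OF \<omega> \<psi>] mult_ac flip: integral_mult_right_zero)
    also have "\<dots> = (\<integral>x. convolve ?k g x * \<psi> x \<partial>lborel)"
      unfolding F convolve_def by (simp add: mult_ac)
    finally show "multiplier_distr \<omega> u \<psi> = (\<integral>x. convolve ?k g x * \<psi> x \<partial>lborel)" .
  qed
qed

subsection \<open>The dyadic resolution\<close>

lemma resolution_pair_schwartz:
  assumes "resolution_pair \<eta>0 \<eta>"
  shows "\<eta>0 \<in> schwartz" "\<eta> \<in> schwartz" "eta \<eta>0 \<eta> j \<in> schwartz"
proof -
  show *: "\<eta>0 \<in> schwartz" "\<eta> \<in> schwartz" using assms by (auto simp: resolution_pair_def)
  show "eta \<eta>0 \<eta> j \<in> schwartz"
    using * schwartz_dilation[of "1 / 2 ^ j" \<eta>] by (simp add: eta_def)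
qed

lemma eta_nonneg: "resolution_pair \<eta>0 \<eta> \<Longrightarrow> 0 \<le> eta \<eta>0 \<eta> j x"
  by (simp add: resolution_pair_def eta_def)

text \<open>Compact supports give the outer radius, and 0 lying off the closed support of
  \<open>\<eta>\<close> gives the inner one. The inner bound is restricted to \<open>j > 0\<close>
  because \<open>\<eta>0\<close> is positive at the origin.\<close>

lemma eta_support:
  assumes "resolution_pair \<eta>0 \<eta>"
  obtains R r where "0 < R" "0 < r"
    "\<And>x. \<eta>0 x \<noteq> 0 \<Longrightarrow> norm x \<le> R" "\<And>x. \<eta> x \<noteq> 0 \<Longrightarrow> norm x \<le> R" "\<And>x. \<eta> x \<noteq> 0 \<Longrightarrow> r \<le> norm x"
    "\<And>j x. eta \<eta>0 \<eta> j x \<noteq> 0 \<Longrightarrow> norm x \<le> 2 ^ j * R"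
    "\<And>j x. eta \<eta>0 \<eta> j x \<noteq> 0 \<Longrightarrow> j > 0 \<Longrightarrow> 2 ^ j * r \<le> norm x"
proof -
  have c: "bounded (closure {x. \<eta>0 x \<noteq> 0})" "bounded (closure {x. \<eta> x \<noteq> 0})"
    using assms by (auto simp: resolution_pair_def compact_imp_bounded)
  obtain R0 where R0: "\<And>x. x \<in> closure {x. \<eta>0 x \<noteq> 0} \<Longrightarrow> norm x \<le> R0" using c(1) by (auto simp: bounded_iff)
  obtain R1 where R1: "\<And>x. x \<in> closure {x. \<eta> x \<noteq> 0} \<Longrightarrow> norm x \<le> R1" using c(2) by (auto simp: bounded_iff)
  define R where "R = max 1 (max R0 R1)"
  have R: "\<And>x. \<eta>0 x \<noteq> 0 \<Longrightarrow> norm x \<le> R" "\<And>x. \<eta> x \<noteq> 0 \<Longrightarrow> norm x \<le> R"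
    using R0 R1 closure_subset[of "{x. \<eta>0 x \<noteq> 0}"] closure_subset[of "{x. \<eta> x \<noteq> 0}"]
    by (force simp: R_def le_max_iff_disj)+
  have "open (- closure {x. \<eta> x \<noteq> 0})" "0 \<in> - closure {x. \<eta> x \<noteq> 0}"
    using assms by (auto simp: resolution_pair_def)
  then obtain r where r: "r > 0" "ball 0 r \<subseteq> - closure {x. \<eta> x \<noteq> 0}" by (meson openE)
  have r': "r \<le> norm x" if "\<eta> x \<noteq> 0" for x
    using r(2) that closure_subset[of "{x. \<eta> x \<noteq> 0}"] by (force simp: subset_iff not_less[symmetric])
  show ?thesis
  proof (rule that[of R r])
    show "norm x \<le> 2 ^ j * R" if "eta \<eta>0 \<eta> j x \<noteq> 0" for j x
      using that R(1)[of x] R(2)[of "(1 / 2 ^ j) *\<^sub>R x"]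
      by (auto simp: eta_def divide_le_eq mult.commute split: if_splits)
    show "2 ^ j * r \<le> norm x" if "eta \<eta>0 \<eta> j x \<noteq> 0" "j > 0" for j x
      using that r'[of "(1 / 2 ^ j) *\<^sub>R x"]
      by (auto simp: eta_def le_divide_eq mult.commute split: if_splits)
  qed (use R r r' in \<open>auto simp: R_def\<close>)
qed

text \<open>The shell between the cubes of half-side 2^n and 2^(n+1) is the dilate of the region
  where \<open>\<eta>\<close> is assumed positive; induction adds one shell at a time. The
  coordinate \<open>i0\<close> makes the base case contradictory.\<close>

lemma eta_sum_pos_annulus:
  assumes "resolution_pair \<eta>0 \<eta>" and "\<And>i. \<bar>x $ i\<bar> \<le> 2 ^ n" and "1 < \<bar>x $ i0\<bar>"
  shows "0 < (\<Sum>j=1..n. eta \<eta>0 \<eta> j x)"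
  using assms(2)
proof (induction n)
  case 0
  then show ?case using assms(3) by (metis not_le power_0)
next
  case (Suc n)
  have nn: "0 \<le> (\<Sum>j=1..n. eta \<eta>0 \<eta> j x)" by (intro sum_nonneg eta_nonneg assms)
  show ?case
  proof (cases "\<forall>i. \<bar>x $ i\<bar> \<le> 2 ^ n")
    case True
    then show ?thesis using Suc.IH eta_nonneg[OF assms(1), of "Suc n" x] by (simp add: add_pos_nonneg)
  next
    case False
    then obtain i where i: "\<bar>x $ i\<bar> > 2 ^ n" by (auto simp: not_le)
    have "(1 / 2 ^ Suc n) *\<^sub>R x \<in> centred_cube 2"
      using Suc.prems by (auto simp: centred_cube_def abs_mult divide_le_eq abs_divide)
    moreover have "(1 / 2 ^ Suc n) *\<^sub>R x \<notin> centred_cube 1"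
      using i by (auto simp: centred_cube_def abs_mult abs_divide not_le less_divide_eq intro!: exI[of _ i])
    ultimately have "\<eta> ((1 / 2 ^ Suc n) *\<^sub>R x) > 0"
      using assms(1) unfolding resolution_pair_def by blast
    then have "eta \<eta>0 \<eta> (Suc n) x > 0" by (simp add: eta_def)
    then show ?thesis using nn by simp
  qed
qed

lemma eta_sum_pos:
  assumes "resolution_pair \<eta>0 \<eta>" and "\<And>i. \<bar>x $ i\<bar> \<le> 2 ^ n"
  shows "0 < (\<Sum>j\<le>n. eta \<eta>0 \<eta> j x)"
proof -
  have split: "(\<Sum>j\<le>n. eta \<eta>0 \<eta> j x) = eta \<eta>0 \<eta> 0 x + (\<Sum>j=1..n. eta \<eta>0 \<eta> j x)"
    by (simp add: atMost_atLeast0 sum.atLeast_Suc_atMost)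
  show ?thesis
  proof (cases "\<exists>i. 1 < \<bar>x $ i\<bar>")
    case True
    then show ?thesis
      using eta_sum_pos_annulus[OF assms] eta_nonneg[OF assms(1), of 0 x] unfolding split by (auto intro: add_nonneg_pos)
  next
    case False
    then have "0 < eta \<eta>0 \<eta> 0 x"
      using assms(1) by (auto simp: resolution_pair_def eta_def centred_cube_def not_less)
    then show ?thesis
      unfolding split by (intro add_pos_nonneg sum_nonneg eta_nonneg assms)
  qed
qed

lemma schwartz_quotient_pos:
  fixes a b :: "real^'n::finite \<Rightarrow> real"
  assumes "a \<in> schwartz" "b \<in> schwartz" "closed S" "bounded S" "\<And>x. a x \<noteq> 0 \<Longrightarrow> x \<in> S" "\<And>x. x \<in> S \<Longrightarrow> b x \<noteq> 0"
  shows "(\<lambda>x. a x / b x) \<in> schwartz"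
proof (rule schwartz_divide)
  have cl: "closure {x. a x \<noteq> 0} \<subseteq> S" using assms(3,5) by (intro closure_minimal) auto
  then show "compact (closure {x. a x \<noteq> 0})"
    using assms(4) bounded_subset by (auto simp: compact_eq_bounded_closed)
  show "\<And>x. x \<in> closure {x. a x \<noteq> 0} \<Longrightarrow> b x \<noteq> 0" using cl assms(6) by blast
qed (use assms in auto)

text \<open>The bump is a quotient \<open>T a / T b\<close> of two partial sums: \<open>b\<close> is
  so large that \<open>T b\<close> is positive on the support of \<open>T a\<close>, and near the
  origin the blocks between \<open>a\<close> and \<open>b\<close> vanish, which makes the quotient
  1.\<close>

lemma resolution_bump:
  fixes \<eta>0 \<eta> :: "real^'n::finite \<Rightarrow> real"
  assumes P: "resolution_pair \<eta>0 \<eta>"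
  obtains X \<rho>' where "X \<in> (schwartz :: (real^'n \<Rightarrow> real) set)" "\<And>x. norm x \<le> \<rho> \<Longrightarrow> X x = 1"
    "\<And>x. X x \<noteq> 0 \<Longrightarrow> norm x \<le> \<rho>'"
proof -
  obtain R r where Rr: "0 < R" "0 < r"
    "\<And>j x. eta \<eta>0 \<eta> j x \<noteq> 0 \<Longrightarrow> norm x \<le> 2 ^ j * R"
    "\<And>j x. eta \<eta>0 \<eta> j x \<noteq> 0 \<Longrightarrow> j > 0 \<Longrightarrow> 2 ^ j * r \<le> norm x"
    using eta_support[OF P] by metis
  define T where "T n x = (\<Sum>j\<le>n. eta \<eta>0 \<eta> j x)" for n :: nat and x :: "real^'n"
  have T: "T n \<in> schwartz" for n
    unfolding T_def[abs_def] by (intro schwartz_sum resolution_pair_schwartz P)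
  \<comment> \<open>Blocks with index above \<open>a\<close> live at distance at least 2^a r >
    \<open>\<rho>\<close> from the origin.\<close>
  obtain a where a: "\<rho> / r < 2 ^ a" using real_arch_pow[of 2] by auto
  \<comment> \<open>The cube on which \<open>T b\<close> is positive must contain both the ball of
    radius \<open>\<rho>\<close> and the support of \<open>T a\<close>.\<close>
  obtain b0 where b0: "max \<rho> (2 ^ a * R) < 2 ^ b0" using real_arch_pow[of 2 "max \<rho> (2 ^ a * R)"] by fastforce
  define b where "b = max a b0"
  have b2: "(2::real) ^ b0 \<le> 2 ^ b" by (simp add: b_def)
  have b: "\<rho> < 2 ^ b" "2 ^ a * R < 2 ^ b" "a \<le> b" using b0 b2 unfolding max_less_iff_conj by (linarith, linarith, simp add: b_def)
  have Tpos: "T b x > 0" if "norm x \<le> 2 ^ b" for x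
    unfolding T_def using that component_le_norm_cart[of x] by (intro eta_sum_pos[OF P]) (meson order.trans)
  have Ts: "norm x \<le> 2 ^ a * R" if nz: "T a x \<noteq> 0" for x
  proof -
    obtain j where j: "j \<le> a" "eta \<eta>0 \<eta> j x \<noteq> 0"
      using nz sum.neutral[of "{..a}" "\<lambda>j. eta \<eta>0 \<eta> j x"] unfolding T_def by blast
    then have "norm x \<le> 2 ^ j * R" by (auto intro: Rr)
    also have "\<dots> \<le> 2 ^ a * R" using j Rr by (intro mult_right_mono) auto
    finally show ?thesis .
  qed
  show ?thesis
  proof (rule that[of "\<lambda>x. T a x / T b x" "2 ^ a * R"])
    show "(\<lambda>x. T a x / T b x) \<in> schwartz"
    proof (rule schwartz_quotient_pos[OF T T])
      show "x \<in> cball 0 (2 ^ a * R)" if "T a x \<noteq> 0" for x using Ts[OF that] by simp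
      show "T b x \<noteq> 0" if "x \<in> cball 0 (2 ^ a * R)" for x
        using Tpos[of x] that b by simp
    qed auto
    show "norm x \<le> 2 ^ a * R" if "T a x / T b x \<noteq> 0" for x using that Ts by auto
    fix x :: "real^'n" assume x: "norm x \<le> \<rho>"
    have "T b x = T a x"
      unfolding T_def
    proof (rule sum.mono_neutral_right)
      show "\<forall>j\<in>{..b} - {..a}. eta \<eta>0 \<eta> j x = 0"
      proof (intro ballI, rule ccontr)
        fix j assume j: "j \<in> {..b} - {..a}" "eta \<eta>0 \<eta> j x \<noteq> 0"
        then have "2 ^ j * r \<le> norm x" by (intro Rr) auto
        moreover have "(2::real) ^ a * r \<le> 2 ^ j * r" using j Rr by (intro mult_right_mono power_increasing) auto
        moreover have "\<rho> < 2 ^ a * r" using a Rr by (simp add: divide_less_eq)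
        ultimately show False using x by linarith
      qed
    qed (use b in auto)
    then show "T a x / T b x = 1" using Tpos[of x] x b by simp
  qed
qed

subsection \<open>Averages over dyadic cubes\<close>

lemma dyadic_cube_measurable [measurable]: "dyadic_cube j k \<in> sets borel"
  unfolding dyadic_cube_def by measurable

lemma emeasure_dyadic_cube:
  "emeasure lborel (dyadic_cube j k :: (real^'n::finite) set) = ennreal ((2 powi (- j)) ^ CARD('n))"
proof -
  let ?c = "(2::real) powi (- j)"
  define a b :: "real^'n" where "a = (\<chi> i. ?c * of_int (k $ i))" and "b = (\<chi> i. ?c * (of_int (k $ i) + 1))"
  have c: "?c > 0" by simp
  have d: "(b - a) \<bullet> e = ?c" "a \<bullet> e \<le> b \<bullet> e" if "e \<in> Basis" for e
    using that c by (auto simp: Basis_vec_def a_def b_def inner_axis distrib_left)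
  have prod: "(\<Prod>e\<in>Basis. (b - a) \<bullet> e) = ?c ^ CARD('n)" using d by simp
  have "box a b \<subseteq> dyadic_cube j k" "dyadic_cube j k \<subseteq> cbox a b"
    by (auto simp: dyadic_cube_def mem_box_cart a_def b_def less_imp_le)
  then have "emeasure lborel (box a b) \<le> emeasure lborel (dyadic_cube j k :: (real^'n) set)"
    "emeasure lborel (dyadic_cube j k :: (real^'n) set) \<le> emeasure lborel (cbox a b)"
    by (auto intro!: emeasure_mono)
  then show ?thesis
    using d by (simp add: emeasure_lborel_cbox_eq prod)
qed

lemma dyadic_cubes_disjoint: "disjoint_family_on (dyadic_cube j) UNIV"
  unfolding disjoint_family_on_def
proof (intro ballI impI)
  fix k k' :: "int^'a" assume "k \<noteq> k'"
  show "dyadic_cube j k \<inter> dyadic_cube j k' = {}"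
  proof (rule ccontr)
    assume "dyadic_cube j k \<inter> dyadic_cube j k' \<noteq> {}"
    then obtain x where x: "x \<in> dyadic_cube j k" "x \<in> dyadic_cube j k'" by blast
    have "k $ i = k' $ i" for i
    proof -
      let ?c = "(2::real) powi (- j)"
      have c: "?c > 0" by simp
      have *: "?c * of_int (k $ i) \<le> x $ i" "x $ i < ?c * (of_int (k' $ i) + 1)"
        "?c * of_int (k' $ i) \<le> x $ i" "x $ i < ?c * (of_int (k $ i) + 1)"
        using x by (auto simp: dyadic_cube_def)
      have "real_of_int (k $ i) < of_int (k' $ i) + 1" "real_of_int (k' $ i) < of_int (k $ i) + 1"
        using le_less_trans[OF *(1,2)] le_less_trans[OF *(3,4)] by (simp_all only: mult_less_cancel_left_pos[OF c])
      then show ?thesis by linarith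
    qed
    then show False using \<open>k \<noteq> k'\<close> by (simp add: vec_eq_iff)
  qed
qed

lemma dyadic_cubes_cover: "(\<Union>k. dyadic_cube j k) = (UNIV :: (real^'n::finite) set)"
proof -
  have "x \<in> dyadic_cube j (\<chi> i. \<lfloor>x $ i / 2 powi (- j)\<rfloor>)" for x :: "real^'n"
  proof -
    have c: "(2::real) powi (- j) > 0" by simp
    have "2 powi (- j) * of_int \<lfloor>x $ i / 2 powi (- j)\<rfloor> \<le> x $ i" for i
      using of_int_floor_le[of "x $ i / 2 powi (- j)"] unfolding pos_le_divide_eq[OF c] by (simp only: mult.commute)
    moreover have "x $ i < 2 powi (- j) * (of_int \<lfloor>x $ i / 2 powi (- j)\<rfloor> + 1)" for i
    proof -
      have "x $ i / 2 powi (- j) < of_int \<lfloor>x $ i / 2 powi (- j)\<rfloor> + 1" by linarith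
      then show ?thesis unfolding pos_divide_less_eq[OF c] by (simp only: mult.commute)
    qed
    ultimately show ?thesis by (simp add: dyadic_cube_def)
  qed
  then show ?thesis by blast
qed

lemma nn_integral_dyadic_cubes:
  fixes f :: "real^'n::finite \<Rightarrow> ennreal"
  assumes [measurable]: "f \<in> borel_measurable borel"
  shows "(\<integral>\<^sup>+x. f x \<partial>lborel) = (\<integral>\<^sup>+k. (\<integral>\<^sup>+x\<in>dyadic_cube j k. f x \<partial>lborel) \<partial>count_space UNIV)"
proof -
  have "(\<integral>\<^sup>+x. f x \<partial>lborel) = emeasure (density lborel f) (\<Union>k. dyadic_cube j k)"
    by (simp add: dyadic_cubes_cover emeasure_density)
  also have "\<dots> = (\<integral>\<^sup>+k. emeasure (density lborel f) (dyadic_cube j k) \<partial>count_space UNIV)"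
    by (intro emeasure_UN_countable dyadic_cubes_disjoint) auto
  finally show ?thesis by (simp add: emeasure_density)
qed

text \<open>Two points of a cube of side 2^(-j) differ by at most d 2^(-j) in norm, by comparison
  with the l1 norm, so the scaled arguments differ by at most d and the weight by a fixed
  factor.\<close>

lemma weight_dyadic_cube:
  fixes x y z :: "real^'n::finite"
  assumes "y \<in> dyadic_cube (int j) k" "z \<in> dyadic_cube (int j) k"
  shows "weight (2 ^ j *\<^sub>R (x - y)) \<le> (1 + real CARD('n)) ^ (2 * CARD('n)) * weight (2 ^ j *\<^sub>R (x - z))"
proof -
  let ?d = "real CARD('n)" and ?c = "(2::real) powi (- int j)"
  have "\<bar>(y - z) $ i\<bar> \<le> ?c" for i
    using assms unfolding dyadic_cube_def mem_Collect_eq distrib_left vector_minus_component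
    by (smt (verit) mult.right_neutral)
  then have "norm (y - z) \<le> (\<Sum>i\<in>(UNIV::'n set). ?c)"
    using norm_le_l1_cart[of "y - z"] by (meson order.trans sum_mono)
  then have yz: "2 ^ j * norm (y - z) \<le> ?d"
    by (simp add: power_int_minus field_simps)
  have "x - z = (x - y) + (y - z)" by simp
  then have "norm (x - z) \<le> norm (x - y) + norm (y - z)" by (metis norm_triangle_ineq)
  then have "2 ^ j * norm (x - z) \<le> 2 ^ j * norm (x - y) + 2 ^ j * norm (y - z)"
    unfolding distrib_left[symmetric] by (intro mult_left_mono) auto
  moreover have "0 \<le> ?d * (2 ^ j * norm (x - y))" by simp
  ultimately have "1 + 2 ^ j * norm (x - z) \<le> (1 + ?d) * (1 + 2 ^ j * norm (x - y))"
    using yz unfolding distrib_left distrib_right by linarith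
  then have le: "(1 + norm (2 ^ j *\<^sub>R (x - z))) ^ (2 * CARD('n))
      \<le> (1 + ?d) ^ (2 * CARD('n)) * (1 + norm (2 ^ j *\<^sub>R (x - y))) ^ (2 * CARD('n))"
    unfolding power_mult_distrib[symmetric] by (intro power_mono) (auto simp: add_nonneg_nonneg)
  have "0 < (1 + norm (2 ^ j *\<^sub>R (x - z))) ^ (2 * CARD('n))" "0 < (1 + norm (2 ^ j *\<^sub>R (x - y))) ^ (2 * CARD('n))"
    by (intro zero_less_power add_pos_nonneg; simp)+
  then show ?thesis using le by (simp add: weight_def field_simps)
qed

text \<open>On each cube of side 2^(-j) the scaled weight is essentially constant, so
  \<open>h\<close> may be replaced by its mean there. Summing over the cubes leaves the total mass
  of the weight, which depends neither on \<open>j\<close> nor on \<open>x\<close>.\<close>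

lemma weighted_average_bound:
  fixes h :: "real^'n::finite \<Rightarrow> ennreal"
  assumes [measurable]: "h \<in> borel_measurable borel"
    and avg: "\<And>k. (\<integral>\<^sup>+y\<in>dyadic_cube (int j) k. h y \<partial>lborel) \<le> A * emeasure lborel (dyadic_cube (int j) k :: (real^'n) set)"
  shows "(\<integral>\<^sup>+y. ennreal ((2 ^ j) ^ CARD('n) * weight (2 ^ j *\<^sub>R (x - y))) * h y \<partial>lborel)
    \<le> ennreal ((1 + real CARD('n)) ^ (2 * CARD('n)) * (\<integral>y. weight (y :: real^'n) \<partial>lborel)) * A"
proof -
  let ?Q = "\<lambda>k. dyadic_cube (int j) k :: (real^'n) set" and ?C = "(1 + real CARD('n)) ^ (2 * CARD('n))"
  define w where "w y = ennreal ((2 ^ j) ^ CARD('n) * weight (2 ^ j *\<^sub>R (x - y)))" for y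
  have [measurable]: "w \<in> borel_measurable borel" unfolding w_def[abs_def] by measurable
  have wsum: "(\<integral>\<^sup>+y. w y \<partial>lborel) = ennreal (\<integral>y. weight (y :: real^'n) \<partial>lborel)"
  proof -
    have "(\<integral>\<^sup>+y. ennreal (weight (y :: real^'n)) \<partial>lborel) = ennreal ((2 ^ j) ^ CARD('n)) * (\<integral>\<^sup>+y. ennreal (weight (2 ^ j *\<^sub>R x + (- (2 ^ j)) *\<^sub>R y)) \<partial>lborel)"
      using nn_integral_lborel_affine[of "\<lambda>y::real^'n. ennreal (weight y)" "- (2 ^ j)" "2 ^ j *\<^sub>R x"] by simp
    also have "\<dots> = (\<integral>\<^sup>+y. w y \<partial>lborel)"
      by (subst nn_integral_cmult[symmetric]) (auto simp: w_def[abs_def] ennreal_mult' scaleR_diff_right)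
    finally show ?thesis
      using integrable_weight weight_pos by (subst nn_integral_eq_integral[symmetric]) (auto intro!: AE_I2 less_imp_le)
  qed
  have cube: "(\<integral>\<^sup>+y\<in>?Q k. w y * h y \<partial>lborel) \<le> ennreal ?C * A * (\<integral>\<^sup>+y\<in>?Q k. w y \<partial>lborel)" for k
  proof -
    let ?m = "emeasure lborel (?Q k)" and ?I = "\<integral>\<^sup>+y\<in>?Q k. w y \<partial>lborel"
    have m: "0 < ?m" "?m < \<infinity>" unfolding emeasure_dyadic_cube by (auto simp: ennreal_less_top)
    \<comment> \<open>The value at one point against the mean over the cube, written without
      division.\<close>
    have le: "?m * w y \<le> ennreal ?C * ?I" if y: "y \<in> ?Q k" for y
    proof -
      have "?m * w y = (\<integral>\<^sup>+z\<in>?Q k. w y \<partial>lborel)"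
        by (simp add: nn_integral_cmult_indicator mult.commute)
      also have "\<dots> \<le> (\<integral>\<^sup>+z. ennreal ?C * (w z * indicator (?Q k) z) \<partial>lborel)"
      proof (intro nn_integral_mono)
        fix z
        show "w y * indicator (?Q k) z \<le> ennreal ?C * (w z * indicator (?Q k) z)"
        proof (cases "z \<in> ?Q k")
          case True
          have "(2 ^ j) ^ CARD('n) * weight (2 ^ j *\<^sub>R (x - y)) \<le> (2 ^ j) ^ CARD('n) * (?C * weight (2 ^ j *\<^sub>R (x - z)))"
            by (intro mult_left_mono weight_dyadic_cube[OF y True]) auto
          then show ?thesis using True unfolding w_def
            by (auto simp: mult.left_commute ennreal_leI simp flip: ennreal_mult')
        qed simp
      qed
      also have "\<dots> = ennreal ?C * ?I" by (rule nn_integral_cmult) measurable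
      finally show ?thesis .
    qed
    \<comment> \<open>The estimate is carried out after multiplication by the volume, which is
      positive and finite and so can be cancelled at the end.\<close>
    have "?m * (\<integral>\<^sup>+y\<in>?Q k. w y * h y \<partial>lborel) = (\<integral>\<^sup>+y. ?m * (w y * h y * indicator (?Q k) y) \<partial>lborel)"
      by (rule nn_integral_cmult[symmetric]) measurable
    also have "\<dots> \<le> (\<integral>\<^sup>+y. ennreal ?C * ?I * (h y * indicator (?Q k) y) \<partial>lborel)"
    proof (intro nn_integral_mono)
      fix y
      show "?m * (w y * h y * indicator (?Q k) y) \<le> ennreal ?C * ?I * (h y * indicator (?Q k) y)"
      proof (cases "y \<in> ?Q k")
        case True
        show ?thesis using mult_right_mono[OF le[OF True], of "h y"] True by (simp add: mult.assoc)
      qed simp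
    qed
    also have "\<dots> = ennreal ?C * ?I * (\<integral>\<^sup>+y\<in>?Q k. h y \<partial>lborel)" by (rule nn_integral_cmult) measurable
    also have "\<dots> \<le> ennreal ?C * ?I * (A * ?m)" by (intro mult_left_mono avg) auto
    finally have "?m * (\<integral>\<^sup>+y\<in>?Q k. w y * h y \<partial>lborel) \<le> ?m * (ennreal ?C * A * ?I)"
      by (simp add: mult_ac)
    then show ?thesis using m by (subst (asm) ennreal_mult_le_mult_iff) auto
  qed
  have "(\<integral>\<^sup>+y. w y * h y \<partial>lborel) = (\<integral>\<^sup>+k. (\<integral>\<^sup>+y\<in>?Q k. w y * h y \<partial>lborel) \<partial>count_space UNIV)"
    by (rule nn_integral_dyadic_cubes) measurable
  also have "\<dots> \<le> (\<integral>\<^sup>+k. ennreal ?C * A * (\<integral>\<^sup>+y\<in>?Q k. w y \<partial>lborel) \<partial>count_space UNIV)"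
    by (intro nn_integral_mono cube)
  also have "\<dots> = ennreal ?C * A * (\<integral>\<^sup>+k. (\<integral>\<^sup>+y\<in>?Q k. w y \<partial>lborel) \<partial>count_space UNIV)"
    by (rule nn_integral_cmult) simp
  also have "(\<integral>\<^sup>+k. (\<integral>\<^sup>+y\<in>?Q k. w y \<partial>lborel) \<partial>count_space UNIV) = (\<integral>\<^sup>+y. w y \<partial>lborel)"
    by (rule nn_integral_dyadic_cubes[symmetric]) measurable
  finally show ?thesis
    unfolding wsum by (simp add: w_def ennreal_mult mult_ac integral_nonneg_AE weight_pos less_imp_le)
qed

subsection \<open>The Plancherel--Polya--Nikolskii inequality\<close>

text \<open>Only averages of \<open>|G|\<^sup>p\<close> are controlled, so \<open>|G|\<close> is traded for \<open>|G|\<^sup>p\<close> inside \<open>|G| \<le> |K| * |G|\<close>: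
  by \<open>a \<le> \<lambda> + \<lambda>\<^sup>1\<^sup>-\<^sup>p a\<^sup>p\<close> if \<open>p \<ge> 1\<close>, and by \<open>a \<le> S\<^sup>1\<^sup>-\<^sup>p a\<^sup>p\<close> with \<open>S\<close> the essential supremum if \<open>p < 1\<close>. The latter
  needs \<open>S < \<infinity>\<close> beforehand, whence the assumption that \<open>G\<close> is integrable.\<close>

lemma AE_norm_le_powr_average:
  fixes G :: "real^'n::finite \<Rightarrow> complex"
  assumes p: "0 < p" and lam: "0 < lam" and C2: "0 < C2"
    and G: "integrable lborel G" and K: "integrable lborel K" "\<And>z. norm (K z) \<le> C2 * ((2 ^ j) ^ CARD('n) * weight (2 ^ j *\<^sub>R z))"
    and GK: "AE x in lborel. G x = convolve K G x"
    and avg: "\<And>k. (\<integral>\<^sup>+y\<in>dyadic_cube (int j) k. ennreal (norm (G y) powr p) \<partial>lborel)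
      \<le> ennreal (lam powr p) * emeasure lborel (dyadic_cube (int j) k :: (real^'n) set)"
    and C1: "C1 = C2 * ((1 + real CARD('n)) ^ (2 * CARD('n)) * (\<integral>y. weight (y :: real^'n) \<partial>lborel))"
  shows "AE x in lborel. norm (G x) \<le> (2 * C1 + C1 powr (1 / p)) * lam"
proof -
  let ?W = "\<integral>y. weight (y :: real^'n) \<partial>lborel"
  have [measurable]: "G \<in> borel_measurable borel" "K \<in> borel_measurable borel"
    using G K by (auto dest: borel_measurable_integrable)
  have W0: "0 \<le> ?W" by (intro Bochner_Integration.integral_nonneg less_imp_le weight_pos)
  have C10: "0 \<le> C1" using W0 C2 by (simp add: C1)
  define w where "w x y = (2 ^ j) ^ CARD('n) * weight (2 ^ j *\<^sub>R (x - y))" for x y :: "real^'n"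
  have w0: "0 \<le> w x y" for x y unfolding w_def using weight_pos[of "2 ^ j *\<^sub>R (x - y)"] by simp
  have [measurable]: "w x \<in> borel_measurable borel" for x unfolding w_def[abs_def] by measurable
  have Kp: "(\<integral>\<^sup>+y. ennreal (norm (K (x - y)) * norm (G y) powr p) \<partial>lborel) \<le> ennreal (C1 * lam powr p)" for x
  proof -
    have "(\<integral>\<^sup>+y. ennreal (norm (K (x - y)) * norm (G y) powr p) \<partial>lborel)
      \<le> (\<integral>\<^sup>+y. ennreal C2 * (ennreal (w x y) * ennreal (norm (G y) powr p)) \<partial>lborel)"
    proof (rule nn_integral_mono)
      fix y
      have "norm (K (x - y)) * norm (G y) powr p \<le> (C2 * w x y) * norm (G y) powr p"
        using K(2)[of "x - y"] by (intro mult_right_mono) (auto simp: w_def)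
      then show "ennreal (norm (K (x - y)) * norm (G y) powr p) \<le> ennreal C2 * (ennreal (w x y) * ennreal (norm (G y) powr p))"
        using C2 w0 by (simp add: mult.assoc ennreal_leI flip: ennreal_mult)
    qed
    also have "\<dots> = ennreal C2 * (\<integral>\<^sup>+y. ennreal (w x y) * ennreal (norm (G y) powr p) \<partial>lborel)"
      by (rule nn_integral_cmult) measurable
    also have "\<dots> \<le> ennreal C2 * (ennreal ((1 + real CARD('n)) ^ (2 * CARD('n)) * ?W) * ennreal (lam powr p))"
      unfolding w_def by (intro mult_left_mono weighted_average_bound avg) auto
    also have "\<dots> = ennreal (C1 * lam powr p)"
      using C2 W0 by (simp add: C1 mult.assoc flip: ennreal_mult)
    finally show ?thesis .
  qed
  have K1: "(\<integral>\<^sup>+y. ennreal (norm (K (x - y))) \<partial>lborel) \<le> ennreal C1" for x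
  proof -
    have "(\<integral>\<^sup>+y. ennreal (norm (K (x - y))) \<partial>lborel) \<le> (\<integral>\<^sup>+y. ennreal C2 * (ennreal (w x y) * 1) \<partial>lborel)"
      using K(2) C2 w0 by (intro nn_integral_mono) (auto simp: w_def ennreal_leI simp flip: ennreal_mult)
    also have "\<dots> = ennreal C2 * (\<integral>\<^sup>+y. ennreal (w x y) * 1 \<partial>lborel)" by (rule nn_integral_cmult) measurable
    also have "\<dots> \<le> ennreal C2 * (ennreal ((1 + real CARD('n)) ^ (2 * CARD('n)) * ?W) * 1)"
      unfolding w_def by (intro mult_left_mono weighted_average_bound) (auto simp: nn_integral_indicator)
    also have "\<dots> = ennreal C1" using C2 W0 by (simp add: C1 flip: ennreal_mult)
    finally show ?thesis .
  qed
  \<comment> \<open>Finiteness of the absolute integral has to be shown along with the bound, since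
    a non-integrable integrand would make \<open>convolve\<close> a default value.\<close>
  have bd: "norm (convolve K G x) \<le> B"
    if B: "0 \<le> B" "(\<integral>\<^sup>+y. ennreal (norm (K (x - y)) * norm (G y)) \<partial>lborel) \<le> ennreal B" for x B
  proof -
    have m: "(\<lambda>y. K (x - y) * G y) \<in> borel_measurable lborel" by measurable
    have "integrable lborel (\<lambda>y. K (x - y) * G y)"
      using B by (intro integrableI_bounded m) (auto simp: norm_mult intro: le_less_trans)
    from integral_norm_bound_ennreal[OF this] have "ennreal (norm (convolve K G x)) \<le> ennreal B"
      using B(2) by (auto simp: convolve_def norm_mult intro: order.trans)
    then show ?thesis using B by (simp add: ennreal_le_iff)
  qed
  show ?thesis
  \<comment> \<open>The constant claimed is the sum of the constants of the two cases.\<close>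
  proof (cases "p \<ge> 1")
    case True
    have le: "a \<le> lam + lam powr (1 - p) * a powr p" if a: "0 \<le> a" for a
    proof (cases "a \<le> lam")
      case False
      have "lam powr (1 - p) * a powr p \<ge> a powr (1 - p) * a powr p"
        using False lam True by (intro mult_right_mono powr_mono2') auto
      moreover have "a powr (1 - p) * a powr p = a" using False lam by (simp flip: powr_add)
      ultimately show ?thesis using lam by linarith
    qed (use lam in \<open>simp add: add_increasing2\<close>)
    have "norm (convolve K G x) \<le> 2 * C1 * lam" for x
    proof (rule bd)
      have "(\<integral>\<^sup>+y. ennreal (norm (K (x - y)) * norm (G y)) \<partial>lborel)
        \<le> (\<integral>\<^sup>+y. ennreal lam * ennreal (norm (K (x - y))) + ennreal (lam powr (1 - p)) * ennreal (norm (K (x - y)) * norm (G y) powr p) \<partial>lborel)"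
      proof (rule nn_integral_mono)
        fix y
        have "norm (K (x - y)) * norm (G y) \<le> norm (K (x - y)) * (lam + lam powr (1 - p) * norm (G y) powr p)"
          by (intro mult_left_mono le) auto
        also have "\<dots> = lam * norm (K (x - y)) + lam powr (1 - p) * (norm (K (x - y)) * norm (G y) powr p)"
          by (simp add: algebra_simps)
        finally show "ennreal (norm (K (x - y)) * norm (G y)) \<le> ennreal lam * ennreal (norm (K (x - y))) + ennreal (lam powr (1 - p)) * ennreal (norm (K (x - y)) * norm (G y) powr p)"
          using lam by (simp add: ennreal_leI flip: ennreal_mult ennreal_plus)
      qed
      also have "\<dots> = ennreal lam * (\<integral>\<^sup>+y. ennreal (norm (K (x - y))) \<partial>lborel) + ennreal (lam powr (1 - p)) * (\<integral>\<^sup>+y. ennreal (norm (K (x - y)) * norm (G y) powr p) \<partial>lborel)"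
        by (simp add: nn_integral_add nn_integral_cmult)
      also have "\<dots> \<le> ennreal lam * ennreal C1 + ennreal (lam powr (1 - p)) * ennreal (C1 * lam powr p)"
        by (intro add_mono mult_left_mono Kp K1) auto
      also have "\<dots> = ennreal (lam * C1 + lam powr (1 - p) * (C1 * lam powr p))"
        using lam C10 by (simp flip: ennreal_mult ennreal_plus)
      \<comment> \<open>The powers of \<open>lam\<close> recombine; the truncated part and the power
        part each contribute \<open>C1 * lam\<close>.\<close>
      also have "lam * C1 + lam powr (1 - p) * (C1 * lam powr p) = 2 * C1 * lam"
        using lam by (simp add: mult.left_commute flip: powr_add)
      finally show "(\<integral>\<^sup>+y. ennreal (norm (K (x - y)) * norm (G y)) \<partial>lborel) \<le> ennreal (2 * C1 * lam)" .
    qed (use C10 lam in auto)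
    moreover have "2 * C1 * lam \<le> (2 * C1 + C1 powr (1 / p)) * lam"
      using lam by (intro mult_right_mono) auto
    ultimately have "norm (convolve K G x) \<le> (2 * C1 + C1 powr (1 / p)) * lam" for x
      using order.trans by blast
    then show ?thesis using GK by (auto elim!: eventually_mono)
  next
    case False
    define S where "S = enn2real (esssup lborel (\<lambda>x. ennreal (norm (G x))))"
    have AEle: "enn2real (esssup lborel (\<lambda>x. ennreal (norm (G x)))) \<le> B" if "0 \<le> B" "\<And>x. norm (convolve K G x) \<le> B" for B
    proof -
      have "AE x in lborel. ennreal (norm (G x)) \<le> ennreal B"
        using GK by eventually_elim (use that in \<open>auto intro!: ennreal_leI\<close>)
      then have "esssup lborel (\<lambda>x. ennreal (norm (G x))) \<le> ennreal B" by (intro esssup_I) auto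
      then show ?thesis using that(1) by (simp add: enn2real_leI)
    qed
    have wb: "w x y \<le> (2 ^ j) ^ CARD('n)" for x y
    proof -
      have "weight z \<le> 1" for z :: "real^'n" by (simp add: weight_def divide_le_eq one_le_power)
      then show ?thesis unfolding w_def by (simp add: mult_left_le)
    qed
    \<comment> \<open>A crude bound that depends on \<open>G\<close> and \<open>j\<close>; its only
      purpose is to make the essential supremum finite.\<close>
    define B0 where "B0 = C2 * (2 ^ j) ^ CARD('n) * (\<integral>y. norm (G y) \<partial>lborel)"
    have cB0: "norm (convolve K G x) \<le> B0" for x
    proof (rule bd)
      show "0 \<le> B0" using C2 by (simp add: B0_def)
      have "(\<integral>\<^sup>+y. ennreal (norm (K (x - y)) * norm (G y)) \<partial>lborel) \<le> (\<integral>\<^sup>+y. ennreal (C2 * (2 ^ j) ^ CARD('n) * norm (G y)) \<partial>lborel)"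
      proof (intro nn_integral_mono ennreal_leI mult_right_mono)
        fix y
        have "norm (K (x - y)) \<le> C2 * w x y" using K(2)[of "x - y"] by (simp add: w_def)
        also have "\<dots> \<le> C2 * (2 ^ j) ^ CARD('n)" using C2 by (intro mult_left_mono wb) auto
        finally show "norm (K (x - y)) \<le> C2 * (2 ^ j) ^ CARD('n)" .
      qed simp
      also have "\<dots> = ennreal B0"
        unfolding B0_def using G C2 by (subst nn_integral_eq_integral) auto
      finally show "(\<integral>\<^sup>+y. ennreal (norm (K (x - y)) * norm (G y)) \<partial>lborel) \<le> ennreal B0" .
    qed
    have fin: "AE x in lborel. norm (G x) \<le> B0" using GK by eventually_elim (use cB0 in auto)
    have "esssup lborel (\<lambda>x. ennreal (norm (G x))) \<le> ennreal B0"
      using fin by (intro esssup_I) (auto elim!: eventually_mono intro: ennreal_leI)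
    then have "esssup lborel (\<lambda>x. ennreal (norm (G x))) < \<infinity>" by (rule le_less_trans) simp
    then have eS: "esssup lborel (\<lambda>x. ennreal (norm (G x))) = ennreal S" by (simp add: S_def)
    have S0: "0 \<le> S" by (simp add: S_def)
    have GS: "AE x in lborel. norm (G x) \<le> S"
      using esssup_AE[of "\<lambda>x. ennreal (norm (G x))" lborel] unfolding eS by eventually_elim (use S0 in simp)
    have "norm (convolve K G x) \<le> S powr (1 - p) * (C1 * lam powr p)" for x
    proof (rule bd)
      have "(\<integral>\<^sup>+y. ennreal (norm (K (x - y)) * norm (G y)) \<partial>lborel)
        \<le> (\<integral>\<^sup>+y. ennreal (S powr (1 - p)) * ennreal (norm (K (x - y)) * norm (G y) powr p) \<partial>lborel)"
      proof (rule nn_integral_mono_AE)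
        show "AE y in lborel. ennreal (norm (K (x - y)) * norm (G y))
          \<le> ennreal (S powr (1 - p)) * ennreal (norm (K (x - y)) * norm (G y) powr p)"
          using GS
        proof eventually_elim
          case (elim y)
          have "norm (G y) = norm (G y) powr (1 - p) * norm (G y) powr p"
            by (cases "G y = 0") (simp_all flip: powr_add)
          also have "\<dots> \<le> S powr (1 - p) * norm (G y) powr p"
            using elim False by (intro mult_right_mono powr_mono2) auto
          finally have "norm (K (x - y)) * norm (G y) \<le> norm (K (x - y)) * (S powr (1 - p) * norm (G y) powr p)"
            by (intro mult_left_mono) auto
          then show ?case by (simp add: ennreal_leI mult.left_commute flip: ennreal_mult)
        qed
      qed
      also have "\<dots> = ennreal (S powr (1 - p)) * (\<integral>\<^sup>+y. ennreal (norm (K (x - y)) * norm (G y) powr p) \<partial>lborel)"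
        by (rule nn_integral_cmult) measurable
      also have "\<dots> \<le> ennreal (S powr (1 - p)) * ennreal (C1 * lam powr p)" by (intro mult_left_mono Kp) auto
      finally show "(\<integral>\<^sup>+y. ennreal (norm (K (x - y)) * norm (G y)) \<partial>lborel) \<le> ennreal (S powr (1 - p) * (C1 * lam powr p))"
        using C10 by (simp flip: ennreal_mult)
    qed (use C10 in auto)
    then have S: "S \<le> S powr (1 - p) * (C1 * lam powr p)"
      unfolding S_def[symmetric] using AEle C10 by (simp add: S_def)
    have "S \<le> C1 powr (1 / p) * lam"
    proof (cases "S = 0")
      case False
      then have Sp: "S > 0" using S0 by simp
      \<comment> \<open>Both sides of the estimate contain \<open>S powr (1 - p)\<close>, which
        cancels because S is positive and finite; what remains bounds S without reference to
        \<open>B0\<close>.\<close>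
      have "S = S powr (1 - p) * S powr p" using Sp by (simp flip: powr_add)
      with S have "S powr (1 - p) * S powr p \<le> S powr (1 - p) * (C1 * lam powr p)" by simp
      then have "S powr p \<le> C1 * lam powr p" using Sp by (simp add: mult_le_cancel_left_pos)
      then have "(S powr p) powr (1 / p) \<le> (C1 * lam powr p) powr (1 / p)" using p by (intro powr_mono2) auto
      then show ?thesis using p Sp lam C10 by (simp add: powr_powr powr_mult)
    qed (use lam in auto)
    also have "\<dots> \<le> (2 * C1 + C1 powr (1 / p)) * lam"
      using lam C10 by (intro mult_right_mono) auto
    finally have "S \<le> (2 * C1 + C1 powr (1 / p)) * lam" .
    then show ?thesis using GS by (auto elim!: eventually_mono)
  qed
qed

lemma integral_pos_of_continuous:
  fixes f :: "'a::euclidean_space \<Rightarrow> real"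
  assumes "continuous_on UNIV f" "integrable lborel f" "\<And>x. 0 \<le> f x" "0 < f x0"
  shows "0 < (\<integral>x. f x \<partial>lborel)"
proof (rule ccontr)
  assume "\<not> 0 < (\<integral>x. f x \<partial>lborel)"
  then have "(\<integral>x. f x \<partial>lborel) = 0"
    using Bochner_Integration.integral_nonneg[where f=f and M=lborel] assms(3) by (simp add: not_less order.antisym)
  then have ae: "AE x in lborel. f x = 0"
    using integral_nonneg_eq_0_iff_AE[OF assms(2)] assms(3) by auto
  have "open {x. 0 < f x}" using assms(1) by (intro open_Collect_less continuous_on_const)
  then obtain e where e: "e > 0" "ball x0 e \<subseteq> {x. 0 < f x}" using assms(4) openE[of "{x. 0 < f x}" x0] by blast
  have "AE x in lborel. x \<notin> ball x0 e"
    using ae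
  proof eventually_elim
    case (elim x)
    then show ?case using subsetD[OF e(2), of x] by force
  qed
  then have "emeasure lborel (ball x0 e) = 0"
    by (subst (asm) AE_iff_measurable[of "ball x0 e"]) auto
  then show False using content_ball_pos[OF e(1), of x0] by (simp add: measure_def)
qed

text \<open>For nonnegative \<open>\<eta>\<close> all phases agree at the origin, so the modulus of
  the inverse transform is maximal there. This normalises the damping factor and gives the lower
  bound for the test functions.\<close>

lemma inv_fourier_nonneg_bound:
  fixes \<eta> :: "real^'n::finite \<Rightarrow> real"
  assumes \<eta>: "\<eta> \<in> schwartz" "\<And>x. 0 \<le> \<eta> x" "0 < \<eta> x0"
  obtains m where "0 < m" "inv_fourier (\<lambda>\<xi>. complex_of_real (\<eta> \<xi>)) 0 = of_real m"
    "\<And>x. norm (inv_fourier (\<lambda>\<xi>. complex_of_real (\<eta> \<xi>)) x) \<le> m"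
proof -
  let ?m = "fourier_const TYPE('n) * (\<integral>x. \<eta> x \<partial>lborel)"
  have "0 < (\<integral>x. \<eta> x \<partial>lborel)"
    using assms by (intro integral_pos_of_continuous schwartz_continuous schwartz_integrable)
  then have m: "0 < ?m" using fourier_const_pos[where 'n='n] by simp
  moreover have "inv_fourier (\<lambda>\<xi>. complex_of_real (\<eta> \<xi>)) 0 = of_real ?m"
    by (simp add: inv_fourier_eq)
  moreover have "norm (inv_fourier (\<lambda>\<xi>. complex_of_real (\<eta> \<xi>)) x) \<le> ?m" for x
    using fourier_bounded[of "\<lambda>\<xi>. complex_of_real (\<eta> \<xi>)" "- x"] \<eta>(2) by (simp add: inv_fourier_minus)
  ultimately show ?thesis using that by blast
qed

text \<open>Multiplication by a function with Fourier transform in a small ball spreads frequencies only slightly.\<close>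

lemma inv_fourier_mult_dilated:
  fixes \<psi> :: "real^'n::finite \<Rightarrow> complex" and \<eta> :: "real^'n \<Rightarrow> real"
  assumes \<psi>: "\<psi> \<in> schwartz" and \<eta>: "\<eta> \<in> schwartz"
  shows "inv_fourier (\<lambda>x. inv_fourier (\<lambda>\<xi>. complex_of_real (\<eta> \<xi>)) (e *\<^sub>R x) * \<psi> x) \<xi>
    = fourier_const TYPE('n) * (\<integral>\<zeta>. complex_of_real (\<eta> \<zeta>) * inv_fourier \<psi> (\<xi> + e *\<^sub>R \<zeta>) \<partial>lborel)"
proof -
  let ?k = "fourier_const TYPE('n)" and ?h = "\<lambda>\<zeta>. complex_of_real (\<eta> \<zeta>)"
  have hi: "integrable lborel ?h" by (intro schwartz_integrable schwartz_of_real \<eta>)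
  have [measurable]: "\<psi> \<in> borel_measurable borel" "\<eta> \<in> borel_measurable borel"
    using \<psi> \<eta> by (auto intro: schwartz_measurable)
  have Bm: "(\<lambda>z::(real^'n) \<times> (real^'n). expi (fst z \<bullet> (\<xi> + e *\<^sub>R snd z))) \<in> borel_measurable borel"
    by (intro borel_measurable_continuous_onI continuous_intros)
  have "(\<integral>x. expi (x \<bullet> \<xi>) * (inv_fourier ?h (e *\<^sub>R x) * \<psi> x) \<partial>lborel)
      = (\<integral>x. ?k * (\<psi> x * (\<integral>\<zeta>. expi (x \<bullet> (\<xi> + e *\<^sub>R \<zeta>)) * ?h \<zeta> \<partial>lborel)) \<partial>lborel)"
  proof (rule Bochner_Integration.integral_cong[OF refl])
    fix x :: "real^'n"
    have "expi (x \<bullet> \<xi>) * (\<integral>\<zeta>. expi (\<zeta> \<bullet> (e *\<^sub>R x)) * ?h \<zeta> \<partial>lborel) = (\<integral>\<zeta>. expi (x \<bullet> (\<xi> + e *\<^sub>R \<zeta>)) * ?h \<zeta> \<partial>lborel)"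
      by (subst integral_mult_right_zero[symmetric])
        (simp add: inner_add_right inner_commute mult.assoc[symmetric] expi_add)
    then show "expi (x \<bullet> \<xi>) * (inv_fourier ?h (e *\<^sub>R x) * \<psi> x)
      = ?k * (\<psi> x * (\<integral>\<zeta>. expi (x \<bullet> (\<xi> + e *\<^sub>R \<zeta>)) * ?h \<zeta> \<partial>lborel))"
      unfolding inv_fourier_eq by (simp add: mult_ac)
  qed
  also have "\<dots> = ?k * (\<integral>x. \<psi> x * (\<integral>\<zeta>. expi (x \<bullet> (\<xi> + e *\<^sub>R \<zeta>)) * ?h \<zeta> \<partial>lborel) \<partial>lborel)"
    by simp
  also have "(\<integral>x. \<psi> x * (\<integral>\<zeta>. expi (x \<bullet> (\<xi> + e *\<^sub>R \<zeta>)) * ?h \<zeta> \<partial>lborel) \<partial>lborel)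
     = (\<integral>\<zeta>. ?h \<zeta> * (\<integral>x. expi (x \<bullet> (\<xi> + e *\<^sub>R \<zeta>)) * \<psi> x \<partial>lborel) \<partial>lborel)"
    using fubini_bounded[OF schwartz_integrable[OF \<psi>] hi Bm, of 1] by simp
  also have "?k * \<dots> = (\<integral>\<zeta>. ?h \<zeta> * inv_fourier \<psi> (\<xi> + e *\<^sub>R \<zeta>) \<partial>lborel)"
    unfolding inv_fourier_eq integral_mult_right_zero[symmetric] by (simp add: mult_ac)
  finally show ?thesis by (simp add: inv_fourier_eq[of "\<lambda>x. inv_fourier ?h (e *\<^sub>R x) * \<psi> x"])
qed

text \<open>The constant is uniform in \<open>j\<close> because the reproducing kernel at level
  \<open>j\<close> is the 2^j-dilate of the fixed \<open>kernel X\<close>, matched to cubes of side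
  2^(-j).\<close>

lemma plancherel_polya_nikolskii:
  fixes \<eta>0 \<eta> :: "real^'n::finite \<Rightarrow> real"
  assumes P: "resolution_pair \<eta>0 \<eta>" and p: "0 < p"
  obtains C where "0 < C"
    "\<And>j f g lam. represents g (multiplier_distr (eta \<eta>0 \<eta> j) f) \<Longrightarrow> 0 < lam \<Longrightarrow>
      (\<And>k. (\<integral>\<^sup>+y\<in>dyadic_cube (int j) k. ennreal (norm (g y) powr p) \<partial>lborel)
        \<le> ennreal (lam powr p) * emeasure lborel (dyadic_cube (int j) k :: (real^'n) set)) \<Longrightarrow>
      AE x in lborel. norm (g x) \<le> C * lam"
proof -
  obtain R where R: "0 < R" "\<And>x. \<eta>0 x \<noteq> 0 \<Longrightarrow> norm x \<le> R"
    "\<And>j x. eta \<eta>0 \<eta> j x \<noteq> 0 \<Longrightarrow> norm x \<le> 2 ^ j * R"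
    using eta_support[OF P] by metis
  \<comment> \<open>The extra 1 in the radius leaves room for the frequency spread
    \<open>e * R\<close>, at most 1, caused by the damping factor.\<close>
  obtain X :: "real^'n \<Rightarrow> real" where X: "X \<in> schwartz" "\<And>x. norm x \<le> R + 1 \<Longrightarrow> X x = 1"
    using resolution_bump[OF P, of "R + 1"] by metis
  obtain C2 where C2: "C2 > 0" "\<And>x. norm (kernel X x) \<le> C2 * weight x"
    using rapidly_decaying_le_weight[OF schwartz_rapidly_decaying[OF schwartz_kernel[OF X(1)]]] by metis
  define C1 where "C1 = C2 * ((1 + real CARD('n)) ^ (2 * CARD('n)) * (\<integral>y. weight (y :: real^'n) \<partial>lborel))"
  have \<eta>0: "\<eta>0 \<in> schwartz" "\<And>x. 0 \<le> \<eta>0 x" "0 < \<eta>0 0"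
    using P by (auto simp: resolution_pair_def centred_cube_def)
  let ?h = "\<lambda>\<xi>. complex_of_real (\<eta>0 \<xi>)"
  obtain m where m: "0 < m" "inv_fourier ?h 0 = of_real m" "\<And>x. norm (inv_fourier ?h x) \<le> m"
    using inv_fourier_nonneg_bound[OF \<eta>0] by blast
  \<comment> \<open>Normalised to have value 1 at the origin and modulus at most 1; its frequencies
    lie in a ball of radius \<open>e * R\<close>.\<close>
  define \<Phi> where "\<Phi> e x = inv_fourier ?h (e *\<^sub>R x) / of_real m" for e :: real and x :: "real^'n"
  have \<Phi>1: "norm (\<Phi> e x) \<le> 1" for e x using m by (simp add: \<Phi>_def norm_divide)
  have \<Phi>S: "\<Phi> e \<in> schwartz" if "e \<noteq> 0" for e
  proof -
    have "(\<lambda>x. (1 / of_real m) * inv_fourier ?h (e *\<^sub>R x)) \<in> schwartz"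
      using that by (intro schwartz_cmult schwartz_dilation schwartz_inv_fourier schwartz_of_real \<eta>0)
    then show ?thesis by (simp add: \<Phi>_def[abs_def])
  qed
  \<comment> \<open>Multiplying by \<open>\<Phi> e\<close> makes \<open>g\<close> integrable and enlarges its frequency support by at most 1, so that
    \<open>g \<Phi>\<close> is still reproduced by \<open>kernel Xj\<close>; finally \<open>e \<rightarrow> 0\<close>.\<close>
  have main: "AE x in lborel. norm (g x * \<Phi> e x) \<le> (2 * C1 + C1 powr (1 / p)) * lam"
    if g: "represents g (multiplier_distr (eta \<eta>0 \<eta> j) f)" and lam: "0 < lam"
      and avg: "\<And>k. (\<integral>\<^sup>+y\<in>dyadic_cube (int j) k. ennreal (norm (g y) powr p) \<partial>lborel)
        \<le> ennreal (lam powr p) * emeasure lborel (dyadic_cube (int j) k :: (real^'n) set)"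
      and e: "0 < e" "e * R \<le> 1" for j f g lam e
  proof -
    define G where "G x = g x * \<Phi> e x" for x
    define Xj where "Xj \<xi> = X ((1 / 2 ^ j) *\<^sub>R \<xi>)" for \<xi>
    have XjS: "Xj \<in> schwartz" unfolding Xj_def[abs_def] by (intro schwartz_dilation X) simp
    have eS: "eta \<eta>0 \<eta> j \<in> schwartz" by (rule resolution_pair_schwartz[OF P])
    have Pe: "\<Phi> e \<in> schwartz" using \<Phi>S e by simp
    have [measurable]: "g \<in> borel_measurable borel" by (rule represents_measurable[OF g])
    have [measurable]: "\<Phi> e \<in> borel_measurable borel" by (rule schwartz_measurable[OF Pe])
    have Gi: "integrable lborel G" using g Pe by (auto simp: represents_def G_def[abs_def])
    have Xj1: "Xj \<zeta> = 1" if "norm \<zeta> \<le> 2 ^ j * R + 1" for \<zeta>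
    proof -
      have "2 ^ j * R + 1 \<le> 2 ^ j * (R + 1)" by (simp add: distrib_left)
      with that have "norm \<zeta> \<le> 2 ^ j * (R + 1)" by linarith
      then show ?thesis unfolding Xj_def by (intro X) (simp add: divide_le_eq mult.commute)
    qed
    have Gpsi: "(\<integral>x. G x * \<psi> x \<partial>lborel) = f (multiplier (eta \<eta>0 \<eta> j) (\<lambda>x. \<Phi> e x * \<psi> x))"
      if "\<psi> \<in> schwartz" for \<psi>
    proof -
      have s: "(\<lambda>x. \<Phi> e x * \<psi> x) \<in> schwartz" by (intro schwartz_mult_fun Pe that)
      then show ?thesis using g by (simp add: represents_def multiplier_distr_apply[OF eS] G_def mult.assoc)
    qed
    \<comment> \<open>At a frequency where \<open>eta \<eta>0 \<eta> j\<close> is nonzero, the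
      transform of \<open>\<Phi> e * \<psi>\<close> involves that of \<open>\<psi>\<close> only at
      frequencies where \<open>Xj\<close> is 1, so inserting the multiplier changes nothing.\<close>
    have rep: "(\<integral>x. G x * \<psi> x \<partial>lborel) = (\<integral>x. G x * multiplier Xj \<psi> x \<partial>lborel)" if \<psi>: "\<psi> \<in> schwartz" for \<psi>
    proof -
      have TS: "multiplier Xj \<psi> \<in> schwartz" by (intro schwartz_multiplier XjS \<psi>)
      have "eta \<eta>0 \<eta> j \<xi> *\<^sub>R inv_fourier (\<lambda>x. \<Phi> e x * \<psi> x) \<xi>
        = eta \<eta>0 \<eta> j \<xi> *\<^sub>R inv_fourier (\<lambda>x. \<Phi> e x * multiplier Xj \<psi> x) \<xi>" for \<xi>
      proof (cases "eta \<eta>0 \<eta> j \<xi> = 0")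
        case False
        have inv: "inv_fourier (\<lambda>x. \<Phi> e x * \<theta> x) \<xi>
            = (fourier_const TYPE('n) / of_real m) * (\<integral>\<zeta>. ?h \<zeta> * inv_fourier \<theta> (\<xi> + e *\<^sub>R \<zeta>) \<partial>lborel)" if "\<theta> \<in> schwartz" for \<theta>
        proof -
          have "inv_fourier (\<lambda>x. \<Phi> e x * \<theta> x) \<xi> = fourier (\<lambda>x. (1 / of_real m) * (inv_fourier ?h (e *\<^sub>R x) * \<theta> x)) (- \<xi>)"
            by (simp add: inv_fourier_minus[symmetric] \<Phi>_def)
          also have "\<dots> = (1 / of_real m) * inv_fourier (\<lambda>x. inv_fourier ?h (e *\<^sub>R x) * \<theta> x) \<xi>"
            by (simp only: fourier_cmult inv_fourier_minus[symmetric])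
          finally show ?thesis by (simp add: inv_fourier_mult_dilated[OF that \<eta>0(1)])
        qed
        have "(\<integral>\<zeta>. ?h \<zeta> * inv_fourier \<psi> (\<xi> + e *\<^sub>R \<zeta>) \<partial>lborel)
            = (\<integral>\<zeta>. ?h \<zeta> * inv_fourier (multiplier Xj \<psi>) (\<xi> + e *\<^sub>R \<zeta>) \<partial>lborel)"
        proof (intro Bochner_Integration.integral_cong refl)
          fix \<zeta> :: "real^'n"
          show "?h \<zeta> * inv_fourier \<psi> (\<xi> + e *\<^sub>R \<zeta>) = ?h \<zeta> * inv_fourier (multiplier Xj \<psi>) (\<xi> + e *\<^sub>R \<zeta>)"
          proof (cases "\<eta>0 \<zeta> = 0")
            case nz: False
            have "norm (\<xi> + e *\<^sub>R \<zeta>) \<le> norm \<xi> + e * norm \<zeta>" using norm_triangle_ineq[of \<xi> "e *\<^sub>R \<zeta>"] e by simp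
            also have "\<dots> \<le> 2 ^ j * R + e * R"
              using R(3)[OF False] R(2)[OF nz] e by (intro add_mono mult_left_mono) auto
            also have "\<dots> \<le> 2 ^ j * R + 1" using e by simp
            finally have "Xj (\<xi> + e *\<^sub>R \<zeta>) = 1" by (rule Xj1)
            then show ?thesis
              by (simp add: multiplier_def inv_fourier_fourier schwartz_scaleR_fun XjS schwartz_inv_fourier \<psi>)
          qed simp
        qed
        then show ?thesis by (simp add: inv[OF \<psi>] inv[OF TS])
      qed simp
      then have "multiplier (eta \<eta>0 \<eta> j) (\<lambda>x. \<Phi> e x * \<psi> x) = multiplier (eta \<eta>0 \<eta> j) (\<lambda>x. \<Phi> e x * multiplier Xj \<psi> x)"
        unfolding multiplier_def[of "eta \<eta>0 \<eta> j"] by (rule arg_cong[where f=fourier, OF ext])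
      then show ?thesis by (simp add: Gpsi \<psi> TS)
    qed
    have KS: "kernel Xj \<in> schwartz" by (intro schwartz_kernel XjS)
    have Kb: "norm (kernel Xj z) \<le> C2 * ((2 ^ j) ^ CARD('n) * weight (2 ^ j *\<^sub>R z))" for z
    proof -
      have "kernel Xj z = (2 ^ j) ^ CARD('n) * kernel X (2 ^ j *\<^sub>R z)"
        using kernel_dilation[OF X(1), of "2 ^ j" z] by (simp add: Xj_def[abs_def])
      then have "norm (kernel Xj z) = (2 ^ j) ^ CARD('n) * norm (kernel X (2 ^ j *\<^sub>R z))"
        by (simp add: norm_mult norm_power)
      also have "\<dots> \<le> (2 ^ j) ^ CARD('n) * (C2 * weight (2 ^ j *\<^sub>R z))" by (intro mult_left_mono C2) auto
      finally show ?thesis by (simp add: mult_ac)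
    qed
    obtain B where B: "\<And>z. norm (kernel Xj z) \<le> B"
      using rapidly_decayingE[OF schwartz_rapidly_decaying[OF KS], of 0] by auto
    have [measurable]: "kernel Xj \<in> borel_measurable borel" by (rule schwartz_measurable[OF KS])
    have cb: "norm (convolve (kernel Xj) G x) \<le> B * (\<integral>y. norm (G y) \<partial>lborel)" for x
    proof -
      have "norm (convolve (kernel Xj) G x) \<le> (\<integral>y. B * norm (G y) \<partial>lborel)"
        unfolding convolve_def
      proof (rule Bochner_Integration.integral_norm_bound_integral)
        show "integrable lborel (\<lambda>y. kernel Xj (x - y) * G y)"
          by (rule integrable_mult_bounded(2)[OF Gi, where B=B]) (use B in auto)
      qed (use Gi B in \<open>auto simp: norm_mult intro: mult_right_mono\<close>)
      then show ?thesis by simp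
    qed
    \<comment> \<open>One functional represented both by \<open>G\<close> and by its convolution;
      uniqueness of representing functions then gives the reproducing identity almost
      everywhere.\<close>
    define v where "v \<psi> = (\<integral>x. G x * \<psi> x \<partial>lborel)" for \<psi> :: "real^'n \<Rightarrow> complex"
    have Gm[measurable]: "G \<in> borel_measurable borel" using Gi by (auto dest: borel_measurable_integrable)
    have "represents G v"
      unfolding represents_def v_def
    proof (intro conjI ballI refl)
      fix \<psi> :: "real^'n \<Rightarrow> complex" assume \<psi>: "\<psi> \<in> schwartz"
      obtain B' where "\<And>z. norm (\<psi> z) \<le> B'"
        using rapidly_decayingE[OF schwartz_rapidly_decaying[OF \<psi>], of 0] by auto
      then show "integrable lborel (\<lambda>x. G x * \<psi> x)"
        by (intro integrable_mult_bounded(1)[OF Gi, where B=B'] schwartz_measurable \<psi>) auto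
    qed simp
    moreover have "represents (convolve (kernel Xj) G) v"
      unfolding represents_def
    proof (intro conjI ballI)
      show "convolve (kernel Xj) G \<in> borel_measurable lborel" by measurable
      fix \<psi> :: "real^'n \<Rightarrow> complex" assume \<psi>: "\<psi> \<in> schwartz"
      show "integrable lborel (\<lambda>x. convolve (kernel Xj) G x * \<psi> x)"
        by (rule integrable_mult_bounded(2)[OF schwartz_integrable[OF \<psi>]]) (use cb in auto)
      have c: "continuous_on UNIV (\<lambda>z::(real^'n) \<times> (real^'n). kernel Xj (snd z - fst z))"
        by (rule continuous_on_compose2[OF schwartz_continuous[OF KS]]) (auto intro!: continuous_intros)
      have "v \<psi> = (\<integral>y. G y * (\<integral>x. kernel Xj (x - y) * \<psi> x \<partial>lborel) \<partial>lborel)"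
        unfolding v_def rep[OF \<psi>] by (simp add: multiplier_eq_convolution[OF XjS \<psi>])
      also have "\<dots> = (\<integral>x. \<psi> x * (\<integral>y. kernel Xj (x - y) * G y \<partial>lborel) \<partial>lborel)"
        using fubini_bounded[OF Gi schwartz_integrable[OF \<psi>] borel_measurable_continuous_onI[OF c], of B] B by simp
      finally show "v \<psi> = (\<integral>x. convolve (kernel Xj) G x * \<psi> x \<partial>lborel)"
        by (simp add: convolve_def mult.commute)
    qed
    ultimately have "AE x in lborel. G x = convolve (kernel Xj) G x" by (rule represents_AE_eq)
    then have "AE x in lborel. norm (G x) \<le> (2 * C1 + C1 powr (1 / p)) * lam"
    proof (rule AE_norm_le_powr_average[OF p lam C2(1) Gi schwartz_integrable[OF KS] Kb _ _ C1_def])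
      fix k
      \<comment> \<open>Damping has modulus at most 1 and only lowers the averages.\<close>
      have "norm (G y) powr p \<le> norm (g y) powr p" for y
        using p \<Phi>1[of e y] by (intro powr_mono2) (auto simp: G_def norm_mult mult_left_le)
      then have "(\<integral>\<^sup>+y\<in>dyadic_cube (int j) k. ennreal (norm (G y) powr p) \<partial>lborel)
        \<le> (\<integral>\<^sup>+y\<in>dyadic_cube (int j) k. ennreal (norm (g y) powr p) \<partial>lborel)"
        by (intro nn_integral_mono mult_right_mono ennreal_leI) auto
      also note avg
      finally show "(\<integral>\<^sup>+y\<in>dyadic_cube (int j) k. ennreal (norm (G y) powr p) \<partial>lborel)
        \<le> ennreal (lam powr p) * emeasure lborel (dyadic_cube (int j) k :: (real^'n) set)" .
    qed
    then show ?thesis by (simp add: G_def)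
  qed
  show ?thesis
  proof (rule that[of "2 * C1 + C1 powr (1 / p) + 1"])
    have W0: "0 \<le> (\<integral>y. weight (y :: real^'n) \<partial>lborel)"
      by (intro Bochner_Integration.integral_nonneg less_imp_le weight_pos)
    then show "0 < 2 * C1 + C1 powr (1 / p) + 1" using C2 by (simp add: C1_def add_nonneg_pos)
    fix j f and g :: "real^'n \<Rightarrow> complex" and lam
    assume g: "represents g (multiplier_distr (eta \<eta>0 \<eta> j) f)" and lam: "0 < lam"
      and avg: "\<And>k. (\<integral>\<^sup>+y\<in>dyadic_cube (int j) k. ennreal (norm (g y) powr p) \<partial>lborel)
        \<le> ennreal (lam powr p) * emeasure lborel (dyadic_cube (int j) k :: (real^'n) set)"
    define e where "e n = (1 / R) * (1 / real (Suc n))" for n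
    have e: "0 < e n" "e n * R \<le> 1" for n using R(1) by (auto simp: e_def divide_le_eq)
    have e0: "e \<longlonglongrightarrow> 0"
      unfolding e_def using tendsto_mult_right_zero[OF LIMSEQ_inverse_real_of_nat, of "1 / R"] by (simp add: inverse_eq_divide)
    \<comment> \<open>Countably many values of \<open>e\<close> are used, so that a single null set
      serves for the limit.\<close>
    have "AE x in lborel. \<forall>n. norm (g x * \<Phi> (e n) x) \<le> (2 * C1 + C1 powr (1 / p)) * lam"
      unfolding AE_all_countable
    proof
      fix n
      show "AE x in lborel. norm (g x * \<Phi> (e n) x) \<le> (2 * C1 + C1 powr (1 / p)) * lam"
        by (rule main[OF g lam avg e[of n]])
    qed
    then show "AE x in lborel. norm (g x) \<le> (2 * C1 + C1 powr (1 / p) + 1) * lam"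
    proof eventually_elim
      case (elim x)
      have "continuous_on UNIV (inv_fourier ?h)"
        by (intro schwartz_continuous schwartz_inv_fourier schwartz_of_real \<eta>0)
      moreover have "(\<lambda>n. e n *\<^sub>R x) \<longlonglongrightarrow> 0 *\<^sub>R x" by (intro tendsto_intros e0)
      ultimately have "(\<lambda>n. inv_fourier ?h (e n *\<^sub>R x)) \<longlonglongrightarrow> inv_fourier ?h 0"
        by (intro continuous_on_tendsto_compose[of UNIV "inv_fourier ?h"]) auto
      then have "(\<lambda>n. \<Phi> (e n) x) \<longlonglongrightarrow> inv_fourier ?h 0 / of_real m"
        unfolding \<Phi>_def using m by (intro tendsto_intros) auto
      then have "(\<lambda>n. \<Phi> (e n) x) \<longlonglongrightarrow> 1" using m by simp
      then have "(\<lambda>n. norm (g x * \<Phi> (e n) x)) \<longlonglongrightarrow> norm (g x * 1)" by (intro tendsto_intros)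
      then have "norm (g x * 1) \<le> (2 * C1 + C1 powr (1 / p)) * lam"
        by (rule LIMSEQ_le_const2) (use elim in auto)
      then show ?case using lam by (simp add: distrib_right)
    qed
  qed
qed

subsection \<open>Seminorm estimates\<close>

text \<open>A real supremum is meaningful only for sets bounded above. There are finitely many
  derivative lists of length at most \<open>N\<close>, each with its own bound.\<close>

lemma schwartz_seminorm_bdd:
  fixes \<psi> :: "real^'n::finite \<Rightarrow> 'b::real_normed_vector"
  assumes "\<psi> \<in> schwartz"
  shows "bdd_above ((\<lambda>(\<alpha>, x). (1 + norm x) ^ N * norm (iter_deriv \<alpha> \<psi> x)) ` ({\<alpha>. length \<alpha> \<le> N} \<times> UNIV))"
proof -
  have "\<exists>C. \<forall>x. (1 + norm x) ^ N * norm (iter_deriv \<alpha> \<psi> x) \<le> C" for \<alpha>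
    using schwartz_rapidly_decaying[OF schwartz_iter_deriv[OF assms]] by (simp add: rapidly_decaying_def)
  then obtain C where C: "\<And>\<alpha> x. (1 + norm x) ^ N * norm (iter_deriv \<alpha> \<psi> x) \<le> C \<alpha>" by metis
  have fin: "finite {\<alpha>::'n list. length \<alpha> \<le> N}"
    using finite_lists_length_le[of "UNIV :: 'n set" N] by simp
  have "(1 + norm x) ^ N * norm (iter_deriv \<alpha> \<psi> x) \<le> (\<Sum>\<alpha>\<in>{\<alpha>. length \<alpha> \<le> N}. \<bar>C \<alpha>\<bar>)" if "length \<alpha> \<le> N" for \<alpha> x
  proof -
    have "C \<alpha> \<le> \<bar>C \<alpha>\<bar>" by simp
    also have "\<dots> \<le> (\<Sum>\<alpha>\<in>{\<alpha>. length \<alpha> \<le> N}. \<bar>C \<alpha>\<bar>)" using that fin by (intro member_le_sum) auto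
    finally show ?thesis using C order.trans by blast
  qed
  then show ?thesis by (intro bdd_aboveI2[where M="\<Sum>\<alpha>\<in>{\<alpha>. length \<alpha> \<le> N}. \<bar>C \<alpha>\<bar>"]) auto
qed

lemma schwartz_seminorm_upper:
  assumes "\<psi> \<in> schwartz" "length \<alpha> \<le> N"
  shows "(1 + norm x) ^ N * norm (iter_deriv \<alpha> \<psi> x) \<le> schwartz_seminorm N \<psi>"
  unfolding schwartz_seminorm_def
  using cSUP_upper[OF _ schwartz_seminorm_bdd[OF assms(1), of N], of "(\<alpha>, x)"] assms(2) by simp

lemma schwartz_seminorm_nonneg: "\<psi> \<in> schwartz \<Longrightarrow> 0 \<le> schwartz_seminorm N \<psi>"
  using schwartz_seminorm_upper[of \<psi> "[]" N 0] by (auto intro: order.trans[rotated])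

lemma schwartz_seminorm_least:
  fixes \<psi> :: "real^'n::finite \<Rightarrow> 'b::real_normed_vector"
  assumes "\<And>\<alpha> x. length \<alpha> \<le> N \<Longrightarrow> (1 + norm x) ^ N * norm (iter_deriv \<alpha> \<psi> x) \<le> B"
  shows "schwartz_seminorm N \<psi> \<le> B"
proof -
  have "{\<alpha>::'n list. length \<alpha> \<le> N} \<times> (UNIV :: (real^'n) set) \<noteq> {}" by (auto intro: exI[of _ "[]"])
  then show ?thesis unfolding schwartz_seminorm_def by (rule cSUP_least) (use assms in auto)
qed

lemma tempered_add:
  "u \<in> tempered \<Longrightarrow> \<psi> \<in> schwartz \<Longrightarrow> \<theta> \<in> schwartz \<Longrightarrow> u (\<lambda>x. \<psi> x + \<theta> x) = u \<psi> + u \<theta>"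
  by (simp add: tempered_def)

lemma tempered_cmult: "u \<in> tempered \<Longrightarrow> \<psi> \<in> schwartz \<Longrightarrow> u (\<lambda>x. c * \<psi> x) = c * u \<psi>"
  by (simp add: tempered_def)

lemma tempered_diff:
  assumes "u \<in> tempered" "\<psi> \<in> schwartz" "\<theta> \<in> schwartz"
  shows "u (\<lambda>x. \<psi> x - \<theta> x) = u \<psi> - u \<theta>"
  using tempered_add[OF assms(1,2) schwartz_cmult[OF assms(3), of "-1"]] tempered_cmult[OF assms(1,3), of "-1"]
  by simp

lemma tempered_sum:
  assumes "u \<in> tempered" "\<And>i. i \<in> I \<Longrightarrow> \<psi> i \<in> schwartz"
  shows "u (\<lambda>x. \<Sum>i\<in>I. \<psi> i x) = (\<Sum>i\<in>I. u (\<psi> i))"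
  using assms(2)
proof (induction I rule: infinite_finite_induct)
  case (insert i I)
  then show ?case using tempered_add[OF assms(1) insert.prems(1) schwartz_sum, of i I \<psi>] by simp
qed (use tempered_cmult[OF assms(1) schwartz_zero, of 0] in auto)

text \<open>The multiplier averages \<open>\<theta> (y + e *\<^sub>R v)\<close> with e = 2^(-J)
  against a kernel of integral \<open>X 0\<close>, that is 1. The difference is thus an average of
  increments, each of order e.\<close>

lemma multiplier_dilation_estimate:
  fixes \<theta> :: "real^'n::finite \<Rightarrow> complex"
  assumes X: "X \<in> schwartz" "X 0 = 1" and \<theta>: "\<theta> \<in> schwartz"
  obtains C where "0 \<le> C"
    "\<And>J y. (1 + norm y) ^ N * norm (multiplier (\<lambda>\<xi>. X ((1 / 2 ^ J) *\<^sub>R \<xi>)) \<theta> y - \<theta> y) \<le> C / 2 ^ J"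
proof -
  obtain C where C: "C > 0" "\<And>x v. (1 + norm x) ^ N * norm (\<theta> (x + v) - \<theta> x) \<le> C * (norm v * (1 + norm v) ^ N)"
    using schwartz_increment[OF \<theta>] by blast
  let ?k = "kernel X"
  have kS: "?k \<in> schwartz" by (rule schwartz_kernel[OF X(1)])
  have ki: "integrable lborel ?k" by (rule schwartz_integrable[OF kS])
  have [measurable]: "?k \<in> borel_measurable borel" "\<theta> \<in> borel_measurable borel"
    using kS \<theta> by (auto intro: schwartz_measurable)
  \<comment> \<open>Order \<open>N + 1\<close>: the increment estimate produces |v| once and (1 +
    |v|)^N from shifting the weight.\<close>
  have wi: "integrable lborel (\<lambda>v. (1 + norm v) ^ (N + 1) * norm (?k v))"
  proof (rule rapidly_decaying_integrable)
    show "rapidly_decaying (\<lambda>v. (1 + norm v) ^ (N + 1) * norm (?k v))"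
      by (rule rapidly_decaying_dominated[OF schwartz_rapidly_decaying[OF kS], where K=1 and l="N + 1"])
        (simp add: abs_mult)
  qed measurable
  obtain B where B: "\<And>x. norm (\<theta> x) \<le> B"
    using rapidly_decayingE[OF schwartz_rapidly_decaying[OF \<theta>], of 0] by auto
  define A where "A = C * (\<integral>v. (1 + norm v) ^ (N + 1) * norm (?k v) \<partial>lborel)"
  show ?thesis
  proof (rule that[of A])
    show "0 \<le> A" unfolding A_def using C(1) by (intro mult_nonneg_nonneg Bochner_Integration.integral_nonneg) auto
    fix J and y :: "real^'n"
    define e where "e = (1 :: real) / 2 ^ J"
    have e: "0 < e" "e \<le> 1" by (auto simp: e_def)
    have XS: "(\<lambda>\<xi>. X ((1 / 2 ^ J) *\<^sub>R \<xi>)) \<in> schwartz" by (intro schwartz_dilation X) simp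
    have "multiplier (\<lambda>\<xi>. X ((1 / 2 ^ J) *\<^sub>R \<xi>)) \<theta> y = (\<integral>x. kernel (\<lambda>\<xi>. X ((1 / 2 ^ J) *\<^sub>R \<xi>)) (x - y) * \<theta> x \<partial>lborel)"
      by (rule multiplier_eq_convolution[OF XS \<theta>])
    also have "\<dots> = (\<integral>x. (2 ^ J) ^ CARD('n) * ?k (2 ^ J *\<^sub>R (x - y)) * \<theta> x \<partial>lborel)"
      using kernel_dilation[OF X(1), of "2 ^ J"] by simp
    also have "\<dots> = (e ^ CARD('n)) *\<^sub>R (\<integral>v. (2 ^ J) ^ CARD('n) * ?k (2 ^ J *\<^sub>R ((y + e *\<^sub>R v) - y)) * \<theta> (y + e *\<^sub>R v) \<partial>lborel)"
      using integral_lborel_affine[of "\<lambda>x. (2 ^ J) ^ CARD('n) * ?k (2 ^ J *\<^sub>R (x - y)) * \<theta> x" e y] e by simp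
    also have "\<dots> = (\<integral>v. ?k v * \<theta> (y + e *\<^sub>R v) \<partial>lborel)"
      unfolding integral_scaleR_right[symmetric]
      by (intro Bochner_Integration.integral_cong) (auto simp: e_def scaleR_conv_of_real[where 'a=complex] power_divide)
    finally have T: "multiplier (\<lambda>\<xi>. X ((1 / 2 ^ J) *\<^sub>R \<xi>)) \<theta> y = (\<integral>v. ?k v * \<theta> (y + e *\<^sub>R v) \<partial>lborel)" .
    have i1: "integrable lborel (\<lambda>v. ?k v * \<theta> (y + e *\<^sub>R v))"
      by (rule integrable_mult_bounded[OF ki, where B=B]) (use B in auto)
    have "\<theta> y = (\<integral>v. ?k v * \<theta> y \<partial>lborel)" using integral_kernel[OF X(1)] X(2) by simp
    then have "multiplier (\<lambda>\<xi>. X ((1 / 2 ^ J) *\<^sub>R \<xi>)) \<theta> y - \<theta> y = (\<integral>v. ?k v * \<theta> (y + e *\<^sub>R v) \<partial>lborel) - (\<integral>v. ?k v * \<theta> y \<partial>lborel)"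
      using T by simp
    also have "\<dots> = (\<integral>v. ?k v * (\<theta> (y + e *\<^sub>R v) - \<theta> y) \<partial>lborel)"
      using i1 ki by (subst Bochner_Integration.integral_diff[symmetric]) (auto simp: right_diff_distrib)
    finally have "(1 + norm y) ^ N * norm (multiplier (\<lambda>\<xi>. X ((1 / 2 ^ J) *\<^sub>R \<xi>)) \<theta> y - \<theta> y)
      = norm (\<integral>v. (1 + norm y) ^ N *\<^sub>R (?k v * (\<theta> (y + e *\<^sub>R v) - \<theta> y)) \<partial>lborel)"
      by (simp add: abs_of_nonneg)
    also have "\<dots> \<le> (\<integral>v. (C * e) * ((1 + norm v) ^ (N + 1) * norm (?k v)) \<partial>lborel)"
    proof (rule Bochner_Integration.integral_norm_bound_integral)
      show "integrable lborel (\<lambda>v. (1 + norm y) ^ N *\<^sub>R (?k v * (\<theta> (y + e *\<^sub>R v) - \<theta> y)))"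
        using i1 ki by (auto simp: right_diff_distrib)
      show "integrable lborel (\<lambda>v. (C * e) * ((1 + norm v) ^ (N + 1) * norm (?k v)))"
        by (rule integrable_mult_right[OF wi])
      fix v :: "real^'n"
      have "norm (e *\<^sub>R v) \<le> norm v" using e by (simp add: mult_left_le_one_le)
      then have "(1 + norm (e *\<^sub>R v)) ^ N \<le> (1 + norm v) ^ N" by (intro power_mono) auto
      then have "norm (e *\<^sub>R v) * (1 + norm (e *\<^sub>R v)) ^ N \<le> (e * (1 + norm v)) * (1 + norm v) ^ N"
        using e by (intro mult_mono) (auto simp: abs_of_pos)
      then have "C * (norm (e *\<^sub>R v) * (1 + norm (e *\<^sub>R v)) ^ N) \<le> (C * e) * (1 + norm v) ^ (N + 1)"
        using C(1) by (simp add: mult.assoc)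
      with C(2)[of y "e *\<^sub>R v"] have "(1 + norm y) ^ N * norm (\<theta> (y + e *\<^sub>R v) - \<theta> y) \<le> (C * e) * (1 + norm v) ^ (N + 1)"
        by linarith
      then have "norm (?k v) * ((1 + norm y) ^ N * norm (\<theta> (y + e *\<^sub>R v) - \<theta> y)) \<le> norm (?k v) * ((C * e) * (1 + norm v) ^ (N + 1))"
        by (intro mult_left_mono) auto
      then show "norm ((1 + norm y) ^ N *\<^sub>R (?k v * (\<theta> (y + e *\<^sub>R v) - \<theta> y)))
          \<le> (C * e) * ((1 + norm v) ^ (N + 1) * norm (?k v))"
        by (simp add: norm_mult mult_ac)
    qed
    also have "\<dots> = A / 2 ^ J" by (simp add: A_def e_def)
    finally show "(1 + norm y) ^ N * norm (multiplier (\<lambda>\<xi>. X ((1 / 2 ^ J) *\<^sub>R \<xi>)) \<theta> y - \<theta> y) \<le> A / 2 ^ J" .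
  qed
qed

lemma iter_deriv_diff:
  "\<psi> \<in> schwartz \<Longrightarrow> \<theta> \<in> schwartz \<Longrightarrow>
    iter_deriv \<alpha> (\<lambda>x. \<psi> x - \<theta> x) = (\<lambda>x. iter_deriv \<alpha> \<psi> x - iter_deriv \<alpha> \<theta> x)"
proof (induction \<alpha>)
  case (Cons i \<alpha>)
  have "partial_deriv i (\<lambda>x. iter_deriv \<alpha> \<psi> x + - iter_deriv \<alpha> \<theta> x) x
     = partial_deriv i (iter_deriv \<alpha> \<psi>) x + - partial_deriv i (iter_deriv \<alpha> \<theta>) x" for x
    using partial_deriv_bounded_linear[OF bounded_linear_minus[OF bounded_linear_ident]
        schwartz_differentiable[OF schwartz_iter_deriv[OF Cons.prems(2)]], of i \<alpha> x]
    by (subst partial_deriv_add)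
      (auto intro!: schwartz_differentiable schwartz_iter_deriv schwartz_minus Cons.prems)
  then show ?case by (simp add: iter_deriv_simps Cons.IH[OF Cons.prems])
qed (simp add: iter_deriv_simps)

text \<open>Temperedness reduces the claim to one seminorm. Multipliers commute with derivatives, so
  the dilation estimate is applied to each of finitely many derivatives of
  \<open>\<psi>\<close>.\<close>

lemma tempered_multiplier_tendsto:
  fixes u :: "'n::finite functional"
  assumes u: "u \<in> tempered" and X: "X \<in> schwartz" "X 0 = 1" and \<psi>: "\<psi> \<in> schwartz"
  shows "(\<lambda>J. u (multiplier (\<lambda>\<xi>. X ((1 / 2 ^ J) *\<^sub>R \<xi>)) \<psi>)) \<longlonglongrightarrow> u \<psi>"
proof -
  obtain C N where C: "\<And>\<psi>. \<psi> \<in> schwartz \<Longrightarrow> norm (u \<psi>) \<le> C * schwartz_seminorm N \<psi>"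
    using u unfolding tempered_def by blast
  let ?T = "\<lambda>J. multiplier (\<lambda>\<xi>. X ((1 / 2 ^ J) *\<^sub>R \<xi>))"
  have XS: "(\<lambda>\<xi>. X ((1 / 2 ^ J) *\<^sub>R \<xi>)) \<in> schwartz" for J :: nat by (intro schwartz_dilation X) simp
  have "\<exists>B\<ge>0. \<forall>J y. (1 + norm y) ^ N * norm (?T J (iter_deriv \<alpha> \<psi>) y - iter_deriv \<alpha> \<psi> y) \<le> B / 2 ^ J" for \<alpha>
    using multiplier_dilation_estimate[OF X schwartz_iter_deriv[OF \<psi>]] by metis
  then obtain B where B: "\<And>\<alpha>. 0 \<le> B \<alpha>"
    "\<And>\<alpha> J y. (1 + norm y) ^ N * norm (?T J (iter_deriv \<alpha> \<psi>) y - iter_deriv \<alpha> \<psi> y) \<le> B \<alpha> / 2 ^ J" by metis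
  define S where "S = (\<Sum>\<alpha>\<in>{\<alpha>. length \<alpha> \<le> N}. B \<alpha>)"
  have fin: "finite {\<alpha>::'n list. length \<alpha> \<le> N}"
    using finite_lists_length_le[of "UNIV :: 'n set" N] by simp
  have bd: "norm (u (?T J \<psi>) - u \<psi>) \<le> (\<bar>C\<bar> * S) / 2 ^ J" for J
  proof -
    have TS: "?T J \<psi> \<in> schwartz" by (intro schwartz_multiplier XS \<psi>)
    have dS: "(\<lambda>x. ?T J \<psi> x - \<psi> x) \<in> schwartz" by (intro schwartz_diff TS \<psi>)
    have sn: "schwartz_seminorm N (\<lambda>x. ?T J \<psi> x - \<psi> x) \<le> S / 2 ^ J"
    proof (rule schwartz_seminorm_least)
      fix \<alpha> :: "'n list" and x :: "real^'n" assume "length \<alpha> \<le> N"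
      then have "B \<alpha> \<le> S" unfolding S_def using fin B(1) by (intro member_le_sum) auto
      then have "B \<alpha> / 2 ^ J \<le> S / 2 ^ J" by (intro divide_right_mono) auto
      then show "(1 + norm x) ^ N * norm (iter_deriv \<alpha> (\<lambda>x. ?T J \<psi> x - \<psi> x) x) \<le> S / 2 ^ J"
        using B(2)[of x J \<alpha>] by (simp add: iter_deriv_diff TS \<psi> iter_deriv_multiplier XS)
    qed
    have "norm (u (?T J \<psi>) - u \<psi>) = norm (u (\<lambda>x. ?T J \<psi> x - \<psi> x))"
      by (simp add: tempered_diff[OF u TS \<psi>])
    also have "\<dots> \<le> C * schwartz_seminorm N (\<lambda>x. ?T J \<psi> x - \<psi> x)" by (rule C[OF dS])
    also have "\<dots> \<le> \<bar>C\<bar> * schwartz_seminorm N (\<lambda>x. ?T J \<psi> x - \<psi> x)"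
      by (intro mult_right_mono schwartz_seminorm_nonneg dS) auto
    also have "\<dots> \<le> \<bar>C\<bar> * (S / 2 ^ J)" by (intro mult_left_mono sn) auto
    finally show ?thesis by simp
  qed
  have "(\<lambda>J. u (?T J \<psi>) - u \<psi>) \<longlonglongrightarrow> 0"
  proof (rule Lim_null_comparison)
    show "\<forall>\<^sub>F J in sequentially. norm (u (?T J \<psi>) - u \<psi>) \<le> (\<bar>C\<bar> * S) * (1 / 2) ^ J"
      using bd by (simp add: power_divide)
    show "(\<lambda>J. (\<bar>C\<bar> * S) * (1 / 2) ^ J) \<longlonglongrightarrow> 0"
      by (intro tendsto_mult_right_zero LIMSEQ_realpow_zero) auto
  qed
  then show ?thesis by (simp only: LIM_zero_iff)
qed

subsection \<open>Reassembling a distribution from its frequency blocks\<close>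

lemma represents_sum:
  assumes "finite I" "\<And>i. i \<in> I \<Longrightarrow> represents (g i) (u i)"
  shows "represents (\<lambda>x. \<Sum>i\<in>I. g i x) (\<lambda>\<psi>. \<Sum>i\<in>I. u i \<psi>)"
  unfolding represents_def
proof (intro conjI ballI)
  show "(\<lambda>x. \<Sum>i\<in>I. g i x) \<in> borel_measurable lborel"
    using assms(2) represents_measurable by (intro borel_measurable_sum) auto
qed (use assms in \<open>auto simp: represents_def sum_distrib_right Bochner_Integration.integral_sum\<close>)

lemma represents_cong:
  "represents g u \<Longrightarrow> (\<And>\<psi>. \<psi> \<in> schwartz \<Longrightarrow> u \<psi> = v \<psi>) \<Longrightarrow> represents g v"
  by (auto simp: represents_def)

text \<open>Substitution: the volume factor of the dilated kernel cancels the Jacobian, so one L1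
  bound serves every level.\<close>

lemma kernel_dilation_L1:
  fixes \<omega> :: "real^'n::finite \<Rightarrow> real"
  assumes \<omega>: "\<omega> \<in> schwartz"
  shows "(\<integral>x. norm (kernel (\<lambda>\<xi>. \<omega> ((1 / 2 ^ j) *\<^sub>R \<xi>)) x) \<partial>lborel) = (\<integral>x. norm (kernel \<omega> x) \<partial>lborel)"
proof -
  have [measurable]: "kernel \<omega> \<in> borel_measurable borel" by (intro schwartz_measurable schwartz_kernel \<omega>)
  have "(\<integral>x. norm (kernel (\<lambda>\<xi>. \<omega> ((1 / 2 ^ j) *\<^sub>R \<xi>)) x) \<partial>lborel) = (2 ^ j) ^ CARD('n) * (\<integral>x. norm (kernel \<omega> (2 ^ j *\<^sub>R x)) \<partial>lborel)"
    using kernel_dilation[OF \<omega>, of "2 ^ j"] by (simp add: norm_mult norm_power)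
  also have "\<dots> = (\<integral>x. norm (kernel \<omega> x) \<partial>lborel)"
    using integral_lborel_affine[of "\<lambda>x. norm (kernel \<omega> x)" "2 ^ j" 0] by simp
  finally show ?thesis .
qed

text \<open>A substitute for a smooth partition of unity: \<open>X(2\<^sup>-\<^sup>J\<xi>) \<rightarrow> 1\<close>, and its telescoping increments lie in
  annuli on which finitely many \<open>\<eta>\<^sub>i\<close> have a positive sum and can be divided out.\<close>

lemma resolution_reproducing:
  fixes \<eta>0 \<eta> :: "real^'n::finite \<Rightarrow> real"
  assumes P: "resolution_pair \<eta>0 \<eta>"
  obtains X \<kappa> :: "real^'n \<Rightarrow> real" and \<omega> :: "real^'n \<Rightarrow> real" and M :: nat
  where "X \<in> schwartz" "X 0 = 1" "\<kappa> \<in> schwartz" "\<omega> \<in> schwartz"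
    "\<And>\<xi>. X \<xi> = \<kappa> \<xi> * (\<Sum>i\<le>M. eta \<eta>0 \<eta> i \<xi>)"
    "\<And>j \<xi>. X ((1 / 2 ^ Suc j) *\<^sub>R \<xi>) - X ((1 / 2 ^ j) *\<^sub>R \<xi>)
       = \<omega> ((1 / 2 ^ Suc j) *\<^sub>R \<xi>) * (\<Sum>i=1..M. eta \<eta>0 \<eta> (Suc j + i) \<xi>)"
proof -
  let ?d = "real CARD('n)"
  \<comment> \<open>Half of \<open>\<rho>\<close> exceeds the dimension, so a point of norm at least
    \<open>\<rho> / 2\<close> has a coordinate larger than 1, as positivity of the annular sum
    demands.\<close>
  define \<rho> where "\<rho> = 2 * ?d + 2"
  have rho: "\<rho> > 0" by (simp add: \<rho>_def)
  obtain X \<rho>' where X: "X \<in> (schwartz :: (real^'n \<Rightarrow> real) set)" "\<And>x. norm x \<le> \<rho> \<Longrightarrow> X x = 1"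
    "\<And>x. X x \<noteq> 0 \<Longrightarrow> norm x \<le> \<rho>'"
    using resolution_bump[OF P, of \<rho>] by blast
  obtain M where M: "\<rho>' < 2 ^ M" using real_arch_pow[of 2 \<rho>'] by auto
  define \<Theta> where "\<Theta> \<xi> = (\<Sum>i\<le>M. eta \<eta>0 \<eta> i \<xi>)" for \<xi>
  define \<Xi> where "\<Xi> \<xi> = (\<Sum>i=1..M. eta \<eta>0 \<eta> i \<xi>)" for \<xi>
  \<comment> \<open>All telescoping increments are dilates of this one function.\<close>
  define Y where "Y \<xi> = X \<xi> - X (2 *\<^sub>R \<xi>)" for \<xi>
  have eS: "eta \<eta>0 \<eta> i \<in> schwartz" for i by (rule resolution_pair_schwartz[OF P])
  have TS: "\<Theta> \<in> schwartz" "\<Xi> \<in> schwartz" unfolding \<Theta>_def[abs_def] \<Xi>_def[abs_def] by (intro schwartz_sum eS)+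
  have YS: "Y \<in> schwartz" unfolding Y_def[abs_def] by (intro schwartz_diff schwartz_dilation X) simp
  have comp: "\<bar>x $ i\<bar> \<le> 2 ^ M" if "norm x \<le> \<rho>'" for x :: "real^'n" and i
    using component_le_norm_cart[of x i] that M by linarith
  have Th: "\<Theta> x \<noteq> 0" if "norm x \<le> \<rho>'" for x
    using eta_sum_pos[OF P comp[OF that]] by (simp add: \<Theta>_def)
  have Xi: "\<Xi> x \<noteq> 0" if "\<rho> / 2 \<le> norm x" "norm x \<le> \<rho>'" for x
  proof -
    have "\<exists>i. 1 < \<bar>x $ i\<bar>"
    proof (rule ccontr)
      assume "\<not> (\<exists>i. 1 < \<bar>x $ i\<bar>)"
      then have "(\<Sum>i\<in>UNIV. \<bar>x $ i\<bar>) \<le> (\<Sum>i\<in>(UNIV::'n set). 1)" by (intro sum_mono) (auto simp: not_less)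
      then show False using norm_le_l1_cart[of x] that(1) by (simp add: \<rho>_def)
    qed
    then show ?thesis using eta_sum_pos_annulus[OF P comp[OF that(2)]] by (auto simp: \<Xi>_def less_imp_neq)
  qed
  have Ysupp: "\<rho> / 2 \<le> norm x \<and> norm x \<le> \<rho>'" if "Y x \<noteq> 0" for x
  proof
    show "\<rho> / 2 \<le> norm x"
    proof (rule ccontr)
      assume "\<not> \<rho> / 2 \<le> norm x"
      then have "norm x < \<rho> / 2" by simp
      then have "norm x \<le> \<rho>" "norm (2 *\<^sub>R x) \<le> \<rho>" using rho by auto
      then show False using that X(2) by (simp add: Y_def)
    qed
    show "norm x \<le> \<rho>'"
    proof (rule ccontr)
      assume n: "\<not> norm x \<le> \<rho>'"
      then have "\<not> 2 * norm x \<le> \<rho>'" using norm_ge_zero[of x] by linarith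
      then have "\<not> norm (2 *\<^sub>R x) \<le> \<rho>'" by simp
      then have "X (2 *\<^sub>R x) = 0" "X x = 0" using n X(3) by blast+
      then show False using that by (simp add: Y_def)
    qed
  qed
  have Yeq: "X ((1 / 2 ^ Suc j) *\<^sub>R \<xi>) - X ((1 / 2 ^ j) *\<^sub>R \<xi>) = Y ((1 / 2 ^ Suc j) *\<^sub>R \<xi>)" for j \<xi>
    by (simp add: Y_def)
  have \<Xi>eq: "\<Xi> ((1 / 2 ^ Suc j) *\<^sub>R \<xi>) = (\<Sum>i=1..M. eta \<eta>0 \<eta> (Suc j + i) \<xi>)" for j \<xi>
    unfolding \<Xi>_def by (intro sum.cong refl) (auto simp: eta_def power_add mult_ac)
  show ?thesis
  proof (rule that[of X "\<lambda>\<xi>. X \<xi> / \<Theta> \<xi>" "\<lambda>\<xi>. Y \<xi> / \<Xi> \<xi>" M])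
    show "X \<in> schwartz" by (rule X)
    show "X 0 = 1" using X(2)[of 0] rho by simp
    show "(\<lambda>\<xi>. X \<xi> / \<Theta> \<xi>) \<in> schwartz"
      by (rule schwartz_quotient_pos[OF X(1) TS(1), of "cball 0 \<rho>'"]) (use X(3) Th in auto)
    show "(\<lambda>\<xi>. Y \<xi> / \<Xi> \<xi>) \<in> schwartz"
    proof (rule schwartz_quotient_pos[OF YS TS(2), of "cball 0 \<rho>' - ball 0 (\<rho> / 2)"])
      show "bounded (cball 0 \<rho>' - ball (0::real^'n) (\<rho> / 2))" by (rule bounded_diff) simp
      show "x \<in> cball 0 \<rho>' - ball 0 (\<rho> / 2)" if "Y x \<noteq> 0" for x
        using Ysupp[OF that] by simp
      show "\<Xi> x \<noteq> 0" if "x \<in> cball 0 \<rho>' - ball 0 (\<rho> / 2)" for x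
        using that by (intro Xi) auto
    qed auto
    show "X \<xi> = X \<xi> / \<Theta> \<xi> * (\<Sum>i\<le>M. eta \<eta>0 \<eta> i \<xi>)" for \<xi>
      using X(3)[of \<xi>] Th[of \<xi>] by (cases "X \<xi> = 0") (auto simp: \<Theta>_def)
    show "X ((1 / 2 ^ Suc j) *\<^sub>R \<xi>) - X ((1 / 2 ^ j) *\<^sub>R \<xi>)
       = Y ((1 / 2 ^ Suc j) *\<^sub>R \<xi>) / \<Xi> ((1 / 2 ^ Suc j) *\<^sub>R \<xi>) * (\<Sum>i=1..M. eta \<eta>0 \<eta> (Suc j + i) \<xi>)" for j \<xi>
      unfolding Yeq \<Xi>eq[symmetric] using Ysupp[of "(1 / 2 ^ Suc j) *\<^sub>R \<xi>"] Xi[of "(1 / 2 ^ Suc j) *\<^sub>R \<xi>"] by auto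
  qed
qed

text \<open>Composing the block multipliers with \<open>\<kappa>\<close> multiplies the symbols, so
  convolving bounded blocks with one kernel represents the product symbol; each block costs the L1
  norm of that kernel.\<close>

lemma block_represents:
  fixes f :: "'n::finite functional" and \<eta>0 \<eta> :: "real^'n \<Rightarrow> real"
  assumes P: "resolution_pair \<eta>0 \<eta>" and f: "f \<in> tempered" and fin: "finite I"
    and g: "\<And>i. i \<in> I \<Longrightarrow> represents (g i) (multiplier_distr (eta \<eta>0 \<eta> i) f)"
    and b: "\<And>i. i \<in> I \<Longrightarrow> AE x in lborel. norm (g i x) \<le> b i"
    and \<kappa>: "\<kappa> \<in> schwartz" and L: "(\<integral>x. norm (kernel \<kappa> x) \<partial>lborel) \<le> L" and b0: "\<And>i. i \<in> I \<Longrightarrow> 0 \<le> b i"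
  obtains E where "represents E (\<lambda>\<psi>. f (multiplier (\<lambda>\<xi>. \<kappa> \<xi> * (\<Sum>i\<in>I. eta \<eta>0 \<eta> i \<xi>)) \<psi>))"
    "\<And>x. norm (E x) \<le> L * (\<Sum>i\<in>I. b i)"
proof (rule that[of "\<lambda>x. \<Sum>i\<in>I. convolve (kernel \<kappa>) (g i) x"])
  have eS: "eta \<eta>0 \<eta> i \<in> schwartz" for i by (rule resolution_pair_schwartz[OF P])
  have "represents (\<lambda>x. \<Sum>i\<in>I. convolve (kernel \<kappa>) (g i) x) (\<lambda>\<psi>. \<Sum>i\<in>I. multiplier_distr \<kappa> (multiplier_distr (eta \<eta>0 \<eta> i) f) \<psi>)"
    by (intro represents_sum fin multiplier_represents[OF g b \<kappa>])
  then show "represents (\<lambda>x. \<Sum>i\<in>I. convolve (kernel \<kappa>) (g i) x) (\<lambda>\<psi>. f (multiplier (\<lambda>\<xi>. \<kappa> \<xi> * (\<Sum>i\<in>I. eta \<eta>0 \<eta> i \<xi>)) \<psi>))"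
  proof (rule represents_cong)
    fix \<psi> :: "real^'n \<Rightarrow> complex" assume \<psi>: "\<psi> \<in> schwartz"
    have eq: "multiplier_distr \<kappa> (multiplier_distr (eta \<eta>0 \<eta> i) f) \<psi> = f (multiplier (\<lambda>\<xi>. \<kappa> \<xi> * eta \<eta>0 \<eta> i \<xi>) \<psi>)" for i
      by (simp add: multiplier_distr_apply \<kappa> eS \<psi> schwartz_multiplier multiplier_multiplier mult.commute)
    have add: "multiplier (\<lambda>\<xi>. \<Sum>i\<in>J. \<kappa> \<xi> * eta \<eta>0 \<eta> i \<xi>) \<psi> = (\<lambda>x. \<Sum>i\<in>J. multiplier (\<lambda>\<xi>. \<kappa> \<xi> * eta \<eta>0 \<eta> i \<xi>) \<psi> x)"
      if "finite J" for J
      using that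
    proof (induction J)
      case empty
      show ?case by (simp add: multiplier_def fourier_eq fun_eq_iff)
    next
      case (insert i J)
      have "multiplier (\<lambda>\<xi>. \<kappa> \<xi> * eta \<eta>0 \<eta> i \<xi> + (\<Sum>i\<in>J. \<kappa> \<xi> * eta \<eta>0 \<eta> i \<xi>)) \<psi>
          = (\<lambda>x. multiplier (\<lambda>\<xi>. \<kappa> \<xi> * eta \<eta>0 \<eta> i \<xi>) \<psi> x + multiplier (\<lambda>\<xi>. \<Sum>i\<in>J. \<kappa> \<xi> * eta \<eta>0 \<eta> i \<xi>) \<psi> x)"
        by (intro multiplier_add schwartz_mult_fun schwartz_sum \<kappa> eS \<psi>)
      then show ?case using insert by simp
    qed
    show "(\<Sum>i\<in>I. multiplier_distr \<kappa> (multiplier_distr (eta \<eta>0 \<eta> i) f) \<psi>) = f (multiplier (\<lambda>\<xi>. \<kappa> \<xi> * (\<Sum>i\<in>I. eta \<eta>0 \<eta> i \<xi>)) \<psi>)"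
      unfolding eq sum_distrib_left add[OF fin]
      by (intro tempered_sum[OF f, symmetric] schwartz_multiplier schwartz_mult_fun \<kappa> eS \<psi>)
  qed
  fix x
  have "norm (\<Sum>i\<in>I. convolve (kernel \<kappa>) (g i) x) \<le> (\<Sum>i\<in>I. b i * L)"
  proof (rule sum_norm_le)
    fix i assume i: "i \<in> I"
    have "norm (convolve (kernel \<kappa>) (g i) x) \<le> b i * (\<integral>x. norm (kernel \<kappa> x) \<partial>lborel)"
      using g[OF i] b[OF i] by (intro convolve_bound schwartz_integrable schwartz_kernel \<kappa>) (auto simp: represents_def)
    also have "\<dots> \<le> b i * L" using b0[OF i] L by (intro mult_left_mono)
    finally show "norm (convolve (kernel \<kappa>) (g i) x) \<le> b i * L" .
  qed
  then show "norm (\<Sum>i\<in>I. convolve (kernel \<kappa>) (g i) x) \<le> L * (\<Sum>i\<in>I. b i)"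
    by (simp add: sum_distrib_left mult.commute)
qed

lemma reassemble:
  fixes \<eta>0 \<eta> :: "real^'n::finite \<Rightarrow> real"
  assumes P: "resolution_pair \<eta>0 \<eta>"
  obtains C where "0 < C"
    "\<And>f g b. f \<in> tempered \<Longrightarrow> (\<And>i. represents (g i) (multiplier_distr (eta \<eta>0 \<eta> i) f)) \<Longrightarrow>
      (\<And>i. AE x in lborel. norm (g i x) \<le> b i) \<Longrightarrow> (\<And>i. 0 \<le> b i) \<Longrightarrow> summable b \<Longrightarrow>
      \<exists>h. represents h f \<and> (\<forall>x. norm (h x) \<le> C * (\<Sum>i. b i))"
proof -
  obtain X \<kappa> \<omega> :: "real^'n \<Rightarrow> real" and M :: nat
    where X: "X \<in> schwartz" "X 0 = 1" and \<kappa>: "\<kappa> \<in> schwartz" and \<omega>: "\<omega> \<in> schwartz"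
    and X\<kappa>: "\<And>\<xi>. X \<xi> = \<kappa> \<xi> * (\<Sum>i\<le>M. eta \<eta>0 \<eta> i \<xi>)"
    and X\<omega>: "\<And>j \<xi>. X ((1 / 2 ^ Suc j) *\<^sub>R \<xi>) - X ((1 / 2 ^ j) *\<^sub>R \<xi>)
       = \<omega> ((1 / 2 ^ Suc j) *\<^sub>R \<xi>) * (\<Sum>i=1..M. eta \<eta>0 \<eta> (Suc j + i) \<xi>)"
    using resolution_reproducing[OF P] by blast
  define L where "L = (\<integral>x. norm (kernel \<kappa> x) \<partial>lborel) + (\<integral>x. norm (kernel \<omega> x) \<partial>lborel)"
  have L: "(\<integral>x. norm (kernel \<kappa> x) \<partial>lborel) \<le> L" "(\<integral>x. norm (kernel \<omega> x) \<partial>lborel) \<le> L" "0 \<le> L"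
    by (auto simp: L_def)
  show ?thesis
  proof (rule that[of "L * (real M + 1) + 1"])
    show "0 < L * (real M + 1) + 1" using L(3) by (simp add: add_nonneg_pos)
    fix f :: "'n functional" and g :: "nat \<Rightarrow> real^'n \<Rightarrow> complex" and b
    assume f: "f \<in> tempered" and g: "\<And>i. represents (g i) (multiplier_distr (eta \<eta>0 \<eta> i) f)"
      and b: "\<And>i. AE x in lborel. norm (g i x) \<le> b i" "\<And>i. 0 \<le> b i" "summable b"
    let ?XJ = "\<lambda>J::nat. \<lambda>\<xi>. X ((1 / 2 ^ J) *\<^sub>R \<xi>)"
    have XS: "?XJ J \<in> schwartz" for J by (intro schwartz_dilation X) simp
    have wS: "(\<lambda>\<xi>. \<omega> ((1 / 2 ^ j) *\<^sub>R \<xi>)) \<in> schwartz" for j :: nat by (intro schwartz_dilation \<omega>) simp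
    \<comment> \<open>The telescoping summands: their partial sums up to \<open>J\<close> give
      \<open>?XJ J\<close>.\<close>
    define D where "D j = (case j of 0 \<Rightarrow> ?XJ 0 | Suc j \<Rightarrow> (\<lambda>\<xi>. ?XJ (Suc j) \<xi> - ?XJ j \<xi>))" for j
    \<comment> \<open>Collects the bounds of all blocks that can meet the \<open>j\<close>-th
      increment; each \<open>b i\<close> is counted at most \<open>M + 1\<close> times in the sum
      over \<open>j\<close>.\<close>
    define \<beta> where "\<beta> j = (\<Sum>i\<le>M. b (j + i))" for j
    have DS: "D j \<in> schwartz" for j unfolding D_def by (cases j) (simp_all only: nat.case XS schwartz_diff)
    have "\<exists>E. represents E (\<lambda>\<psi>. f (multiplier (D j) \<psi>)) \<and> (\<forall>x. norm (E x) \<le> L * \<beta> j)" for j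
    proof (cases j)
      case 0
      obtain E where E: "represents E (\<lambda>\<psi>. f (multiplier (\<lambda>\<xi>. \<kappa> \<xi> * (\<Sum>i\<in>{..M}. eta \<eta>0 \<eta> i \<xi>)) \<psi>))"
        "\<And>x. norm (E x) \<le> L * (\<Sum>i\<in>{..M}. b i)"
        using block_represents[where I="{..M}" and g=g and b=b, OF P f finite_atMost g b(1) \<kappa> L(1) b(2)] by blast
      have "D 0 = (\<lambda>\<xi>. \<kappa> \<xi> * (\<Sum>i\<in>{..M}. eta \<eta>0 \<eta> i \<xi>))" using X\<kappa> by (simp add: D_def fun_eq_iff)
      then show ?thesis using E 0 by (auto simp: \<beta>_def)
    next
      case (Suc k)
      let ?I = "{Suc k + 1..Suc k + M}"
      have L': "(\<integral>x. norm (kernel (\<lambda>\<xi>. \<omega> ((1 / 2 ^ Suc k) *\<^sub>R \<xi>)) x) \<partial>lborel) \<le> L"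
        unfolding kernel_dilation_L1[OF \<omega>] by (rule L(2))
      obtain E where E: "represents E (\<lambda>\<psi>. f (multiplier (\<lambda>\<xi>. \<omega> ((1 / 2 ^ Suc k) *\<^sub>R \<xi>) * (\<Sum>i\<in>?I. eta \<eta>0 \<eta> i \<xi>)) \<psi>))"
        "\<And>x. norm (E x) \<le> L * (\<Sum>i\<in>?I. b i)"
        using block_represents[where I="?I" and g=g and b=b, OF P f finite_atLeastAtMost g b(1) wS L' b(2)] by blast
      have sh: "(\<Sum>i\<in>?I. h i) = (\<Sum>i=1..M. h (Suc k + i))" for h :: "nat \<Rightarrow> real"
        using sum.shift_bounds_cl_nat_ivl[of h 1 "Suc k" M] by (simp add: add.commute)
      have "D (Suc k) = (\<lambda>\<xi>. \<omega> ((1 / 2 ^ Suc k) *\<^sub>R \<xi>) * (\<Sum>i\<in>?I. eta \<eta>0 \<eta> i \<xi>))"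
        unfolding sh D_def using X\<omega> by (simp add: fun_eq_iff)
      moreover have "(\<Sum>i\<in>?I. b i) \<le> \<beta> (Suc k)"
        unfolding sh \<beta>_def using b(2) by (intro sum_mono2) auto
      then have "L * (\<Sum>i\<in>?I. b i) \<le> L * \<beta> (Suc k)" using L(3) by (intro mult_left_mono)
      ultimately show ?thesis using E Suc order.trans by metis
    qed
    then obtain E where E: "\<And>j. represents (E j) (\<lambda>\<psi>. f (multiplier (D j) \<psi>))"
      "\<And>j x. norm (E j x) \<le> L * \<beta> j" by metis
    have bsh: "summable (\<lambda>j. b (j + i))" "(\<Sum>j. b (j + i)) \<le> (\<Sum>j. b j)" for i
      using b(2,3) summable_iff_shift[of b i] suminf_split_initial_segment[of b i] sum_nonneg[of "{..<i}" b] by auto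
    have \<beta>s: "summable \<beta>" "(\<Sum>j. \<beta> j) \<le> (real M + 1) * (\<Sum>j. b j)"
    proof -
      show "summable \<beta>" unfolding \<beta>_def[abs_def] by (intro summable_sum bsh)
      have "(\<Sum>j. \<beta> j) = (\<Sum>i\<le>M. (\<Sum>j. b (j + i)))" unfolding \<beta>_def by (intro suminf_sum bsh)
      also have "\<dots> \<le> (\<Sum>i\<le>M. (\<Sum>j. b j))" by (intro sum_mono bsh)
      finally show "(\<Sum>j. \<beta> j) \<le> (real M + 1) * (\<Sum>j. b j)" by (simp add: algebra_simps)
    qed
    have L\<beta>: "summable (\<lambda>j. L * \<beta> j)" by (intro summable_mult \<beta>s)
    have nE: "summable (\<lambda>j. norm (E j x))" for x
      by (rule summable_comparison_test[OF _ L\<beta>]) (use E(2) in auto)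
    define h where "h x = (\<Sum>j. E j x)" for x
    have Elim: "(\<lambda>J. \<Sum>j\<le>J. E j x) \<longlonglongrightarrow> h x" for x
      using summable_LIMSEQ'[OF summable_norm_cancel[OF nE]] by (simp add: h_def)
    define A where "A = (\<Sum>j. L * \<beta> j)"
    have A: "A \<le> L * (real M + 1) * (\<Sum>j. b j)"
      unfolding A_def suminf_mult[OF \<beta>s(1)] using mult_left_mono[OF \<beta>s(2) L(3)] by (simp add: mult.assoc)
    have \<beta>0: "0 \<le> L * \<beta> j" for j using L(3) b(2) by (simp add: \<beta>_def sum_nonneg)
    have part: "norm (\<Sum>j\<le>J. E j x) \<le> A" for J x
    proof -
      have "norm (\<Sum>j\<le>J. E j x) \<le> (\<Sum>j\<le>J. L * \<beta> j)" by (intro sum_norm_le E)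
      also have "\<dots> \<le> A" unfolding A_def by (intro sum_le_suminf L\<beta>) (use \<beta>0 in auto)
      finally show ?thesis .
    qed
    have hA: "norm (h x) \<le> A" for x
      by (rule LIMSEQ_le_const2[OF tendsto_norm[OF Elim]]) (use part in auto)
    have Em[measurable]: "E j \<in> borel_measurable borel" for j using represents_measurable[OF E(1)] .
    have hm[measurable]: "h \<in> borel_measurable borel"
      by (rule borel_measurable_LIMSEQ_metric[OF _ Elim]) measurable
    have "represents h f"
      unfolding represents_def
    proof (intro conjI ballI)
      show "h \<in> borel_measurable lborel" by simp
      fix \<psi> :: "real^'n \<Rightarrow> complex" assume \<psi>: "\<psi> \<in> schwartz"
      have \<psi>i: "integrable lborel \<psi>" by (rule schwartz_integrable[OF \<psi>])
      have [measurable]: "\<psi> \<in> borel_measurable borel" by (rule schwartz_measurable[OF \<psi>])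
      show "integrable lborel (\<lambda>x. h x * \<psi> x)"
        by (rule integrable_mult_bounded(2)[OF \<psi>i, where B=A]) (use hA in auto)
      have "(\<lambda>J. \<integral>x. (\<Sum>j\<le>J. E j x) * \<psi> x \<partial>lborel) \<longlonglongrightarrow> (\<integral>x. h x * \<psi> x \<partial>lborel)"
      proof (rule integral_dominated_convergence[where w="\<lambda>x. A * norm (\<psi> x)"])
        show "integrable lborel (\<lambda>x. A * norm (\<psi> x))" by (intro integrable_mult_right integrable_norm \<psi>i)
        show "AE x in lborel. (\<lambda>J. (\<Sum>j\<le>J. E j x) * \<psi> x) \<longlonglongrightarrow> h x * \<psi> x"
          by (intro AE_I2 tendsto_mult Elim tendsto_const)
        show "AE x in lborel. norm ((\<Sum>j\<le>J. E j x) * \<psi> x) \<le> A * norm (\<psi> x)" for J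
          using part by (intro AE_I2) (simp add: norm_mult mult_right_mono)
      qed measurable
      moreover have "(\<integral>x. (\<Sum>j\<le>J. E j x) * \<psi> x \<partial>lborel) = f (multiplier (?XJ J) \<psi>)" for J
      proof -
        have "(\<integral>x. (\<Sum>j\<le>J. E j x) * \<psi> x \<partial>lborel) = (\<Sum>j\<le>J. f (multiplier (D j) \<psi>))"
          using E(1) \<psi> unfolding sum_distrib_right represents_def
          by (subst Bochner_Integration.integral_sum) auto
        also have "\<dots> = f (multiplier (?XJ J) \<psi>)"
        proof (induction J)
          case 0
          show ?case by (simp add: D_def)
        next
          case (Suc J)
          have "multiplier (?XJ (Suc J)) \<psi> = multiplier (\<lambda>\<xi>. ?XJ J \<xi> + D (Suc J) \<xi>) \<psi>" by (simp add: D_def)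
          also have "\<dots> = (\<lambda>x. multiplier (?XJ J) \<psi> x + multiplier (D (Suc J)) \<psi> x)"
            by (intro multiplier_add XS DS \<psi>)
          finally have "f (multiplier (?XJ (Suc J)) \<psi>) = f (multiplier (?XJ J) \<psi>) + f (multiplier (D (Suc J)) \<psi>)"
            using tempered_add[OF f schwartz_multiplier[OF XS \<psi>] schwartz_multiplier[OF DS \<psi>]] by simp
          then show ?case using Suc by simp
        qed
        finally show ?thesis .
      qed
      \<comment> \<open>Uniform convergence of the partial sums gives one limit, temperedness of
        \<open>f\<close> the other; their equality is the representation of
        \<open>f\<close>.\<close>
      ultimately have "(\<lambda>J. f (multiplier (?XJ J) \<psi>)) \<longlonglongrightarrow> (\<integral>x. h x * \<psi> x \<partial>lborel)" by simp
      then show "f \<psi> = (\<integral>x. h x * \<psi> x \<partial>lborel)"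
        using LIMSEQ_unique tempered_multiplier_tendsto[OF f X \<psi>] by blast
    qed
    moreover have "norm (h x) \<le> (L * (real M + 1) + 1) * (\<Sum>i. b i)" for x
    proof -
      have "0 \<le> (\<Sum>i. b i)" by (rule suminf_nonneg[OF b(3,2)])
      then show ?thesis using hA[of x] A by (simp add: distrib_right)
    qed
    ultimately show "\<exists>h. represents h f \<and> (\<forall>x. norm (h x) \<le> (L * (real M + 1) + 1) * (\<Sum>i. b i))" by blast
  qed
qed

subsection \<open>Sequence spaces\<close>

lemma ennpowr_ennreal: "0 \<le> x \<Longrightarrow> ennpowr (ennreal x) a = ennreal (x powr a)"
  by (simp add: ennpowr_def)

lemma ennpowr_le_iff:
  assumes a: "0 < a" and B: "0 \<le> B"
  shows "ennpowr x (1 / a) \<le> ennreal B \<longleftrightarrow> x \<le> ennreal (B powr a)"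
proof (cases x)
  case (real r)
  have "r powr (1 / a) \<le> B \<longleftrightarrow> r \<le> B powr a"
  proof
    assume "r powr (1 / a) \<le> B"
    then have "(r powr (1 / a)) powr a \<le> B powr a" using a by (intro powr_mono2) auto
    then show "r \<le> B powr a" using a real by (simp add: powr_powr)
  next
    assume "r \<le> B powr a"
    then have "r powr (1 / a) \<le> (B powr a) powr (1 / a)" using a real by (intro powr_mono2) auto
    then show "r powr (1 / a) \<le> B" using a B by (simp add: powr_powr)
  qed
  then show ?thesis using real B by (simp add: ennpowr_ennreal ennreal_le_iff)
qed (simp add: ennpowr_def top_unique)

lemma suminf_ennreal_le_iff:
  assumes "\<And>j. 0 \<le> c j" "0 \<le> K"
  shows "(\<Sum>j. ennreal (c j)) \<le> ennreal K \<longleftrightarrow> (\<forall>n. (\<Sum>j<n. c j) \<le> K)"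
  using assms by (simp add: suminf_eq_SUP SUP_le_iff sum_ennreal ennreal_le_iff)

text \<open>Translates the extended-valued quasi-norm into bounds for finite real sums, the form in
  which the inequalities below are proved.\<close>

lemma lq_norm_le_iff:
  assumes q: "0 < q" and x: "\<And>j. 0 \<le> x j" and A: "0 \<le> A"
  shows "lq_norm (ereal q) (\<lambda>j. ennreal (x j)) \<le> ennreal A \<longleftrightarrow> (\<forall>n. (\<Sum>j<n. x j powr q) \<le> A powr q)"
  using q x A by (simp add: lq_norm_def ennpowr_ennreal ennpowr_le_iff suminf_ennreal_le_iff)

lemma lq_norm_infinity_le_iff:
  assumes "\<And>j. 0 \<le> x j" "0 \<le> A"
  shows "lq_norm \<infinity> (\<lambda>j. ennreal (x j)) \<le> ennreal A \<longleftrightarrow> (\<forall>j. x j \<le> A)"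
  using assms by (simp add: lq_norm_def SUP_le_iff ennreal_le_iff)

lemma lq_norm_finite:
  assumes "0 < q" "lq_norm q a < \<infinity>"
  shows "a j < \<infinity>"
proof (cases "q = \<infinity>")
  case True
  have "a j \<le> lq_norm q a" using True by (auto simp: lq_norm_def intro: SUP_upper)
  then show ?thesis using assms(2) by (rule le_less_trans)
next
  case False
  then have "(\<Sum>j. ennpowr (a j) (real_of_ereal q)) \<noteq> \<infinity>"
    using assms(2) by (auto simp: lq_norm_def ennpowr_def)
  then have "ennpowr (a j) (real_of_ereal q) \<noteq> \<infinity>"
    using ennreal_suminf_lessD[of "\<lambda>j. ennpowr (a j) (real_of_ereal q)" \<infinity> j] by (auto simp: less_top)
  then show ?thesis by (auto simp: ennpowr_def less_top split: if_splits)
qed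

lemma lq_bounded:
  assumes "b \<in> lq q" "\<And>j. 0 \<le> b j"
  obtains B where "0 \<le> B" "lq_norm q (\<lambda>j. ennreal (b j)) \<le> ennreal B"
proof -
  have "lq_norm q (\<lambda>j. ennreal (b j)) < \<infinity>" using assms by (simp add: lq_def)
  then obtain B where "0 \<le> B" "lq_norm q (\<lambda>j. ennreal (b j)) = ennreal B"
    by (cases "lq_norm q (\<lambda>j. ennreal (b j))") auto
  then show ?thesis using that[of B] by simp
qed

text \<open>The reciprocal alone does not fix \<open>q'\<close> in the extended reals, since minus
  infinity also has reciprocal 0; the bound \<open>1 \<le> q'\<close> singles out the intended
  solution.\<close>

lemma conjugate_exponent_cases:
  assumes "0 < q" "1 \<le> q'" "1 / q' = max (1 - 1 / q) (0::ereal)"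
  obtains "q = \<infinity>" "q' = ereal 1"
  | r where "q = ereal r" "0 < r" "r \<le> 1" "q' = \<infinity>"
  | r where "q = ereal r" "1 < r" "q' = ereal (r / (r - 1))"
proof (cases q)
  case PInf
  show ?thesis
  proof (cases q')
    case (real t)
    then have "t = 1" using assms PInf by (auto simp: one_ereal_def zero_ereal_def)
    then show ?thesis using that(1) real PInf by simp
  qed (use assms PInf in \<open>auto simp: one_ereal_def zero_ereal_def\<close>)
next
  case (real r)
  then have r: "0 < r" using assms by simp
  have "1 / q = ereal (1 / r)" using real r by (simp add: one_ereal_def)
  then have d: "1 - 1 / q = ereal (1 - 1 / r)" by (simp add: one_ereal_def)
  show ?thesis
  proof (cases "r \<le> 1")
    case True
    then have "max (1 - 1 / q) (0::ereal) = 0"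
      using r unfolding d zero_ereal_def by (simp add: max_def)
    then have "1 / q' = 0" using assms(3) by simp
    then have "q' = \<infinity>" using assms(2) by (cases q') (auto simp: one_ereal_def zero_ereal_def)
    then show ?thesis using that(2) real r True by simp
  next
    case False
    then have m: "max (1 - 1 / q) (0::ereal) = ereal (1 - 1 / r)"
      unfolding d zero_ereal_def by (simp add: max_def)
    show ?thesis
    proof (cases q')
      case (real t)
      then have t: "1 \<le> t" using assms(2) by (simp add: one_ereal_def)
      then have "1 / t = 1 - 1 / r" using assms(3) real unfolding m by (simp add: one_ereal_def)
      then have "t = r / (r - 1)" using t False by (simp add: field_simps)
      then show ?thesis using that(3) real \<open>q = ereal r\<close> False by simp
    qed (use assms m False in \<open>auto simp: one_ereal_def zero_ereal_def\<close>)
  qed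
qed (use assms in auto)

text \<open>Young's inequality for sequences normalised by \<open>A\<close> and \<open>B\<close>. If
  one of these is 0, the corresponding sequence vanishes on the range summed.\<close>

lemma hoelder_sum:
  fixes x b :: "nat \<Rightarrow> real"
  assumes r: "1 < r" and x: "\<And>j. 0 \<le> x j" and b: "\<And>j. 0 \<le> b j" and A: "0 \<le> A" and B: "0 \<le> B"
    and xs: "(\<Sum>j<n. x j powr r) \<le> A powr r" and bs: "(\<Sum>j<n. b j powr (r / (r - 1))) \<le> B powr (r / (r - 1))"
  shows "(\<Sum>j<n. x j * b j) \<le> A * B"
proof -
  let ?t = "r / (r - 1)"
  have t: "1 < ?t" "1 / r + 1 / ?t = 1" using r by (auto simp: field_simps)
  have zero: "y j = 0" if "(\<Sum>j<n. y j powr s) \<le> 0 powr s" "\<And>j. 0 \<le> y j" "j < n" for y :: "nat \<Rightarrow> real" and s j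
  proof -
    have "(\<Sum>j<n. y j powr s) = 0" using that(1) by (intro antisym sum_nonneg) auto
    then have "y j powr s = 0" using that(3) by (subst (asm) sum_nonneg_eq_0_iff) auto
    then show ?thesis by simp
  qed
  consider "A = 0" | "B = 0" | "0 < A" "0 < B" using A B by fastforce
  then show ?thesis
  proof cases
    case 1
    then have "(\<Sum>j<n. x j * b j) = 0" using zero[of x r] xs x by (intro sum.neutral) auto
    then show ?thesis using 1 by simp
  next
    case 2
    then have "(\<Sum>j<n. x j * b j) = 0" using zero[of b ?t] bs b by (intro sum.neutral) auto
    then show ?thesis using 2 by simp
  next
    case 3
    have "(\<Sum>j<n. (x j / A) * (b j / B)) \<le> (\<Sum>j<n. (x j powr r / A powr r) / r + (b j powr ?t / B powr ?t) / ?t)"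
    proof (rule sum_mono)
      fix j
      have "(x j / A) * (b j / B) \<le> (x j / A) powr r / r + (b j / B) powr ?t / ?t"
        using x b 3 r t by (intro Youngs_inequality) auto
      then show "(x j / A) * (b j / B) \<le> (x j powr r / A powr r) / r + (b j powr ?t / B powr ?t) / ?t"
        using x b 3 by (simp add: powr_divide)
    qed
    also have "\<dots> = ((\<Sum>j<n. x j powr r) / A powr r) / r + ((\<Sum>j<n. b j powr ?t) / B powr ?t) / ?t"
      by (simp only: sum.distrib sum_divide_distrib)
    also have "\<dots> \<le> 1 / r + 1 / ?t"
      using xs bs 3 r t by (intro add_mono divide_right_mono) (auto simp: divide_le_eq)
    finally have "(\<Sum>j<n. (x j / A) * (b j / B)) \<le> 1" using t by simp
    moreover have "(\<Sum>j<n. (x j / A) * (b j / B)) = (\<Sum>j<n. x j * b j) / (A * B)"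
      by (simp add: sum_divide_distrib)
    ultimately show ?thesis using 3 by (simp add: divide_le_eq)
  qed
qed

text \<open>Every term is at most \<open>A\<close>, so \<open>x j\<close> is at most
  \<open>x j powr r * A powr (1 - r)\<close>, and the exponents of \<open>A\<close> add up to 1
  after summation.\<close>

lemma l1_le_lq:
  fixes x :: "nat \<Rightarrow> real"
  assumes r: "0 < r" "r \<le> 1" and x: "\<And>j. 0 \<le> x j" and A: "0 \<le> A" and xs: "(\<Sum>j<n. x j powr r) \<le> A powr r"
  shows "(\<Sum>j<n. x j) \<le> A"
proof -
  have le: "x j \<le> x j powr r * A powr (1 - r)" if "j < n" for j
  proof -
    have "x j powr r \<le> (\<Sum>j<n. x j powr r)" using that by (intro member_le_sum) auto
    with xs have "x j powr r \<le> A powr r" by linarith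
    then have "(x j powr r) powr (1 / r) \<le> (A powr r) powr (1 / r)" using r by (intro powr_mono2[of "1 / r"]) auto
    then have "x j \<le> A" using r x A by (simp add: powr_powr)
    then have "x j powr r * x j powr (1 - r) \<le> x j powr r * A powr (1 - r)"
      using x r by (intro mult_left_mono powr_mono2) auto
    moreover have "x j powr r * x j powr (1 - r) = x j" using x[of j] by (cases "x j = 0") (simp_all flip: powr_add)
    ultimately show ?thesis by simp
  qed
  have "(\<Sum>j<n. x j) \<le> (\<Sum>j<n. x j powr r) * A powr (1 - r)"
    unfolding sum_distrib_right using le by (intro sum_mono) auto
  also have "\<dots> \<le> A powr r * A powr (1 - r)" using xs by (intro mult_right_mono) auto
  also have "\<dots> = A" using A by (cases "A = 0") (simp_all flip: powr_add)
  finally show ?thesis .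
qed

lemma hoelder_lq:
  fixes b :: "nat \<Rightarrow> real"
  assumes q: "0 < q" "1 \<le> q'" "1 / q' = max (1 - 1 / q) (0::ereal)" and b: "b \<in> lq q'" "\<And>j. 0 \<le> b j"
  obtains C where "0 < C" "\<And>x A n. (\<And>j. 0 \<le> x j) \<Longrightarrow> 0 \<le> A \<Longrightarrow>
    lq_norm q (\<lambda>j. ennreal (x j)) \<le> ennreal A \<Longrightarrow> (\<Sum>j<n. x j * b j) \<le> C * A"
proof -
  obtain B where B: "0 \<le> B" "lq_norm q' (\<lambda>j. ennreal (b j)) \<le> ennreal B" using lq_bounded[OF b] by metis
  have main: "(\<Sum>j<n. x j * b j) \<le> B * A"
    if x: "\<And>j. 0 \<le> x j" and A: "0 \<le> A" "lq_norm q (\<lambda>j. ennreal (x j)) \<le> ennreal A" for x A n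
    using q
  proof (cases rule: conjugate_exponent_cases)
    case 1
    have xA: "x j \<le> A" for j using A x unfolding 1 by (simp add: lq_norm_infinity_le_iff)
    have bB: "(\<Sum>j<n. b j powr 1) \<le> B powr 1" using B b unfolding 1 by (subst (asm) lq_norm_le_iff) auto
    have "(\<Sum>j<n. x j * b j) \<le> (\<Sum>j<n. A * b j)" using xA b by (intro sum_mono mult_right_mono) auto
    also have "\<dots> = A * (\<Sum>j<n. b j)" by (simp add: sum_distrib_left)
    also have "\<dots> \<le> A * B" using bB B b A by (intro mult_left_mono) auto
    finally show ?thesis by (simp add: mult.commute)
  next
    case (2 r)
    have bB: "b j \<le> B" for j using B b unfolding 2 by (simp add: lq_norm_infinity_le_iff)
    have xA: "(\<Sum>j<n. x j powr r) \<le> A powr r" using A x 2 by (simp add: lq_norm_le_iff)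
    have "(\<Sum>j<n. x j * b j) \<le> (\<Sum>j<n. x j * B)" using bB x by (intro sum_mono mult_left_mono) auto
    also have "\<dots> = (\<Sum>j<n. x j) * B" by (simp add: sum_distrib_right)
    also have "\<dots> \<le> A * B" using l1_le_lq[OF 2(2,3) x A(1) xA] B by (intro mult_right_mono) auto
    finally show ?thesis by (simp add: mult.commute)
  next
    case (3 r)
    have xA: "(\<Sum>j<n. x j powr r) \<le> A powr r" using A x 3 by (simp add: lq_norm_le_iff)
    have bB: "(\<Sum>j<n. b j powr (r / (r - 1))) \<le> B powr (r / (r - 1))" using B b 3 by (simp add: lq_norm_le_iff)
    show ?thesis using hoelder_sum[OF 3(2) x b(2) A(1) B(1) xA bB] by (simp add: mult.commute)
  qed
  show ?thesis
  \<comment> \<open>The added 1 only makes the constant positive.\<close>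
  proof (rule that[of "B + 1"])
    show "0 < B + 1" using B by simp
    fix x A n assume "\<And>j. 0 \<le> x j" "0 \<le> (A::real)" "lq_norm q (\<lambda>j. ennreal (x j)) \<le> ennreal A"
    then show "(\<Sum>j<n. x j * b j) \<le> (B + 1) * A" using main[of x A n] by (simp add: distrib_right)
  qed
qed

subsection \<open>Sufficiency\<close>

lemma morrey_norm_average:
  fixes g :: "real^'n::finite \<Rightarrow> complex"
  assumes p: "0 < p" and \<phi>: "0 < \<phi> (2 powi (- j))" and lam: "0 \<le> lam"
    and m: "morrey_norm \<phi> p g \<le> ennreal (\<phi> (2 powi (- j)) * lam)"
  shows "(\<integral>\<^sup>+y\<in>dyadic_cube j k. ennreal (norm (g y) powr p) \<partial>lborel)
    \<le> ennreal (lam powr p) * emeasure lborel (dyadic_cube j k :: (real^'n) set)"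
proof -
  let ?I = "\<integral>\<^sup>+y\<in>dyadic_cube j k. ennreal (norm (g y) powr p) \<partial>lborel"
  let ?m = "emeasure lborel (dyadic_cube j k :: (real^'n) set)" and ?f = "\<phi> (2 powi (- j))"
  have mpos: "0 < ?m" "?m < \<infinity>" unfolding emeasure_dyadic_cube by (auto simp: ennreal_less_top)
  have "ennreal ?f * ennpowr (?I / ?m) (1 / p) \<le> morrey_norm \<phi> p g"
    unfolding morrey_norm_def by (rule SUP_upper2[of "(j, k)"]) auto
  also note m
  finally have "ennreal ?f * ennpowr (?I / ?m) (1 / p) \<le> ennreal ?f * ennreal lam"
    using \<phi> lam by (simp add: ennreal_mult)
  then have "ennpowr (?I / ?m) (1 / p) \<le> ennreal lam"
    using \<phi> by (subst (asm) ennreal_mult_le_mult_iff) auto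
  then have le: "?I / ?m \<le> ennreal (lam powr p)" using p lam by (simp add: ennpowr_le_iff)
  have "?I = ?I / ?m * ?m" using mpos by (simp add: ennreal_divide_times ennreal_mult_divide_eq less_top)
  also have "\<dots> \<le> ennreal (lam powr p) * ?m" by (intro mult_right_mono le) auto
  finally show ?thesis .
qed

lemma Linf_norm_le_besov_morrey_norm:
  fixes s p :: real and q q' :: ereal and \<phi> :: "real \<Rightarrow> real"
    and \<eta>0 \<eta> :: "real^'n::finite \<Rightarrow> real"
  assumes p: "0 < p" and q: "0 < q" "1 \<le> q'" "1 / q' = max (1 - 1 / q) 0"
    and \<phi>: "\<phi> \<in> morrey_class CARD('n) p" and P: "resolution_pair \<eta>0 \<eta>"
    and b: "(\<lambda>j::nat. 2 powr (- (real j * s)) * inverse (\<phi> (2 powr (- real j)))) \<in> lq q'"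
  obtains C where "0 < C"
    "\<And>f. f \<in> tempered \<Longrightarrow> Linf_norm f \<le> ennreal C * besov_morrey_norm \<eta>0 \<eta> s \<phi> p q f"
proof -
  define \<beta> where "\<beta> j = 2 powr (- (real j * s)) * inverse (\<phi> (2 powr (- real j)))" for j :: nat
  define F where "F j = \<phi> (2 powi (- int j))" for j :: nat
  have pow: "2 powi (- int j) = 2 powr (- real j)" for j :: nat
    by (simp add: power_int_minus powr_minus powr_realpow)
  have F: "0 < F j" for j using \<phi> by (simp add: morrey_class_def F_def)
  have \<beta>: "\<beta> j = 2 powr (- (real j * s)) / F j" for j
    by (simp add: \<beta>_def F_def pow[symmetric] divide_inverse)
  have \<beta>0: "0 \<le> \<beta> j" for j using F[of j] by (simp add: \<beta>)
  obtain C1 where C1: "0 < C1" "\<And>j f g lam. represents g (multiplier_distr (eta \<eta>0 \<eta> j) f) \<Longrightarrow> 0 < lam \<Longrightarrow>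
      (\<And>k. (\<integral>\<^sup>+y\<in>dyadic_cube (int j) k. ennreal (norm (g y) powr p) \<partial>lborel)
        \<le> ennreal (lam powr p) * emeasure lborel (dyadic_cube (int j) k :: (real^'n) set)) \<Longrightarrow>
      AE x in lborel. norm (g x) \<le> C1 * lam"
  proof (rule plancherel_polya_nikolskii[OF P p])
    fix C1 assume *: "0 < C1" "\<And>j f g lam. represents g (multiplier_distr (eta \<eta>0 \<eta> j) f) \<Longrightarrow> 0 < lam \<Longrightarrow>
      (\<And>k. (\<integral>\<^sup>+y\<in>dyadic_cube (int j) k. ennreal (norm (g y) powr p) \<partial>lborel)
        \<le> ennreal (lam powr p) * emeasure lborel (dyadic_cube (int j) k :: (real^'n) set)) \<Longrightarrow>
      AE x in lborel. norm (g x) \<le> C1 * lam"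
    show ?thesis by (rule that[OF *])
  qed
  obtain C2 where C2: "0 < C2" "\<And>x A n. (\<And>j. 0 \<le> x j) \<Longrightarrow> 0 \<le> A \<Longrightarrow>
    lq_norm q (\<lambda>j. ennreal (x j)) \<le> ennreal A \<Longrightarrow> (\<Sum>j<n. x j * \<beta> j) \<le> C2 * A"
  proof (rule hoelder_lq[OF q b[folded \<beta>_def] \<beta>0])
    fix C2 assume *: "0 < C2" "\<And>x A n. (\<And>j. 0 \<le> x j) \<Longrightarrow> 0 \<le> A \<Longrightarrow>
      lq_norm q (\<lambda>j. ennreal (x j)) \<le> ennreal A \<Longrightarrow> (\<Sum>j<n. x j * \<beta> j) \<le> C2 * A"
    show ?thesis by (rule that[OF *])
  qed
  obtain C3 where C3: "0 < C3" "\<And>f g b. f \<in> tempered \<Longrightarrow> (\<And>i. represents (g i) (multiplier_distr (eta \<eta>0 \<eta> i) f)) \<Longrightarrow>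
      (\<And>i. AE x in lborel. norm (g i x) \<le> b i) \<Longrightarrow> (\<And>i. 0 \<le> b i) \<Longrightarrow> summable b \<Longrightarrow>
      \<exists>h. represents h f \<and> (\<forall>x. norm (h x) \<le> C3 * (\<Sum>i. b i))"
  proof (rule reassemble[OF P])
    fix C3 assume *: "0 < C3" "\<And>f g b. f \<in> tempered \<Longrightarrow> (\<And>i. represents (g i) (multiplier_distr (eta \<eta>0 \<eta> i) f)) \<Longrightarrow>
      (\<And>i. AE x in lborel. norm (g i x) \<le> b i) \<Longrightarrow> (\<And>i. 0 \<le> b i) \<Longrightarrow> summable b \<Longrightarrow>
      \<exists>h. represents h f \<and> (\<forall>x. norm (h x) \<le> C3 * (\<Sum>i. b i))"
    show ?thesis by (rule that[OF *])
  qed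
  show ?thesis
  proof (rule that[of "C3 * (C1 * C2)"])
    show "0 < C3 * (C1 * C2)" using C1 C2 C3 by simp
    fix f :: "'n functional" assume f: "f \<in> tempered"
    define N where "N j = distr_norm (morrey_norm \<phi> p) (multiplier_distr (eta \<eta>0 \<eta> j) f)" for j
    have norm: "besov_morrey_norm \<eta>0 \<eta> s \<phi> p q f = lq_norm q (\<lambda>j. ennreal (2 powr (real j * s)) * N j)"
      by (simp add: besov_morrey_norm_def N_def multiplier_distr_def)
    show "Linf_norm f \<le> ennreal (C3 * (C1 * C2)) * besov_morrey_norm \<eta>0 \<eta> s \<phi> p q f"
    proof (cases "besov_morrey_norm \<eta>0 \<eta> s \<phi> p q f = \<infinity>")
      case True
      then show ?thesis using C1 C2 C3 by (simp add: ennreal_mult_top)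
    next
      case False
      then have fin: "lq_norm q (\<lambda>j. ennreal (2 powr (real j * s)) * N j) < \<infinity>" by (simp add: norm less_top)
      then obtain A where A: "0 \<le> A" "lq_norm q (\<lambda>j. ennreal (2 powr (real j * s)) * N j) = ennreal A"
        by (cases "lq_norm q (\<lambda>j. ennreal (2 powr (real j * s)) * N j)") auto
      have Nfin: "N j < \<infinity>" for j
        using lq_norm_finite[OF q(1) fin, of j] by (auto simp: ennreal_mult_less_top)
      have "\<exists>x\<ge>0. N j = ennreal x" for j using Nfin[of j] by (cases "N j") auto
      then obtain m where m: "\<And>j. 0 \<le> m j" "\<And>j. N j = ennreal (m j)" by metis
      have "\<exists>g. represents g (multiplier_distr (eta \<eta>0 \<eta> j) f)" for j
      \<comment> \<open>A finite infimum shows that the set of representing functions is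
        nonempty.\<close>
      proof (rule ccontr)
        assume "\<nexists>g. represents g (multiplier_distr (eta \<eta>0 \<eta> j) f)"
        then have "N j = \<infinity>" by (simp add: N_def distr_norm_def)
        then show False using m by simp
      qed
      then obtain g where g: "\<And>j. represents (g j) (multiplier_distr (eta \<eta>0 \<eta> j) f)" by metis
      define b where "b j = C1 * (m j / F j)" for j
      have gb: "AE x in lborel. norm (g j x) \<le> b j" for j
      proof -
        \<comment> \<open>\<open>N j\<close> is an infimum, so the slack 1/(k+1) yields a
          representing function strictly below the threshold and keeps \<open>lam\<close> positive
          when \<open>m j\<close> is 0. Uniqueness transfers the bound to the fixed
          \<open>g j\<close>, and k tends to infinity.\<close>
        have "AE x in lborel. norm (g j x) \<le> C1 * (m j / F j + 1 / real (Suc k))" for k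
        proof -
          define lam where "lam = m j / F j + 1 / real (Suc k)"
          have lam: "0 < lam" using m(1)[of j] F[of j] by (simp add: lam_def add_nonneg_pos)
          have "m j < F j * lam" using F[of j] by (simp add: lam_def distrib_left)
          then have "N j < ennreal (F j * lam)" using m by (simp add: ennreal_less_iff)
          then obtain h where h: "represents h (multiplier_distr (eta \<eta>0 \<eta> j) f)" "morrey_norm \<phi> p h < ennreal (F j * lam)"
            unfolding N_def distr_norm_def INF_less_iff by auto
          have "AE x in lborel. norm (h x) \<le> C1 * lam"
            by (rule C1(2)[OF h(1) lam], rule morrey_norm_average[where \<phi>=\<phi>])
              (use p F[of j] lam h(2) in \<open>auto simp: F_def\<close>)
          then have "AE x in lborel. norm (g j x) \<le> C1 * lam"
            using represents_AE_eq[OF g h(1)] by eventually_elim simp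
          then show ?thesis by (simp add: lam_def)
        qed
        then have "AE x in lborel. \<forall>k. norm (g j x) \<le> C1 * (m j / F j + 1 / real (Suc k))"
          by (simp add: AE_all_countable)
        then show ?thesis
        proof eventually_elim
          case (elim x)
          have "(\<lambda>k. C1 * (m j / F j + 1 / real (Suc k))) \<longlonglongrightarrow> C1 * (m j / F j + 0)"
            using LIMSEQ_inverse_real_of_nat by (intro tendsto_intros) (simp add: inverse_eq_divide)
          then show ?case unfolding b_def
            using elim by (intro LIMSEQ_le_const) auto
        qed
      qed
      have b0: "0 \<le> b j" for j using m(1)[of j] F[of j] C1(1) by (simp add: b_def)
      \<comment> \<open>The weighted block norms; in the product with \<open>\<beta> j\<close> the
        factors 2^(js) cancel.\<close>
      define x where "x j = 2 powr (real j * s) * m j" for j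
      have x: "0 \<le> x j" "ennreal (2 powr (real j * s)) * N j = ennreal (x j)" for j
        using m[of j] by (auto simp: x_def ennreal_mult)
      have xb: "x j * \<beta> j = m j / F j" for j
        by (simp add: x_def \<beta> powr_minus field_simps)
      have sb: "(\<Sum>j<n. b j) \<le> C1 * (C2 * A)" for n
      proof -
        have "(\<Sum>j<n. x j * \<beta> j) \<le> C2 * A" using A x by (intro C2(2)) auto
        then have "C1 * (\<Sum>j<n. m j / F j) \<le> C1 * (C2 * A)" unfolding xb using C1(1) by (intro mult_left_mono) auto
        then show ?thesis by (simp add: b_def sum_distrib_left)
      qed
      have sm: "summable b" by (rule summableI_nonneg_bounded[OF b0 sb])
      have sle: "(\<Sum>j. b j) \<le> C1 * (C2 * A)" by (rule suminf_le_const[OF sm sb])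
      obtain h where h: "represents h f" "\<And>x. norm (h x) \<le> C3 * (\<Sum>i. b i)"
        using C3(2)[OF f g gb b0 sm] by blast
      have "norm (h x) \<le> C3 * (C1 * C2) * A" for x
      proof -
        have "C3 * (\<Sum>i. b i) \<le> C3 * (C1 * (C2 * A))" using C3(1) by (intro mult_left_mono sle) auto
        then show ?thesis using h(2)[of x] by (simp only: mult.assoc)
      qed
      then have "esssup lborel (\<lambda>x. ennreal (norm (h x))) \<le> ennreal (C3 * (C1 * C2) * A)"
        using represents_measurable[OF h(1)] by (intro esssup_I) (auto intro: ennreal_leI)
      then show ?thesis
        using A C1 C2 C3 by (simp add: Linf_norm_represents[OF h(1)] norm ennreal_mult)
    qed
  qed
qed

text \<open>Seminorms increase with their order, so both functionals are controlled by the one of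
  order \<open>N + M\<close>.\<close>

lemma tempered_functional_diff:
  assumes "g \<in> tempered" "f \<in> tempered"
  shows "g - f \<in> tempered"
proof -
  obtain C N where C: "\<And>\<psi>. \<psi> \<in> schwartz \<Longrightarrow> norm (g \<psi>) \<le> C * schwartz_seminorm N \<psi>"
    using assms(1) unfolding tempered_def by blast
  obtain D M where D: "\<And>\<psi>. \<psi> \<in> schwartz \<Longrightarrow> norm (f \<psi>) \<le> D * schwartz_seminorm M \<psi>"
    using assms(2) unfolding tempered_def by blast
  have mono: "schwartz_seminorm N' \<psi> \<le> schwartz_seminorm (N + M) \<psi>" if \<psi>: "\<psi> \<in> schwartz" and N': "N' \<le> N + M"
    for N' and \<psi> :: "real^'a \<Rightarrow> complex"
  proof (rule schwartz_seminorm_least)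
    fix \<alpha> :: "'a list" and x :: "real^'a" assume "length \<alpha> \<le> N'"
    then have "(1 + norm x) ^ (N + M) * norm (iter_deriv \<alpha> \<psi> x) \<le> schwartz_seminorm (N + M) \<psi>"
      using \<psi> N' by (intro schwartz_seminorm_upper) auto
    moreover have "(1 + norm x) ^ N' * norm (iter_deriv \<alpha> \<psi> x) \<le> (1 + norm x) ^ (N + M) * norm (iter_deriv \<alpha> \<psi> x)"
      using N' by (intro mult_right_mono power_increasing) auto
    ultimately show "(1 + norm x) ^ N' * norm (iter_deriv \<alpha> \<psi> x) \<le> schwartz_seminorm (N + M) \<psi>" by linarith
  qed
  have bd: "norm ((g - f) \<psi>) \<le> (\<bar>C\<bar> + \<bar>D\<bar>) * schwartz_seminorm (N + M) \<psi>" if \<psi>: "\<psi> \<in> schwartz" for \<psi>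
  proof -
    have "norm ((g - f) \<psi>) \<le> norm (g \<psi>) + norm (f \<psi>)" by (simp add: norm_triangle_ineq4)
    also have "\<dots> \<le> \<bar>C\<bar> * schwartz_seminorm N \<psi> + \<bar>D\<bar> * schwartz_seminorm M \<psi>"
      using C[OF \<psi>] D[OF \<psi>] schwartz_seminorm_nonneg[OF \<psi>]
      by (intro add_mono) (meson abs_ge_self mult_right_mono order.trans)+
    also have "\<dots> \<le> \<bar>C\<bar> * schwartz_seminorm (N + M) \<psi> + \<bar>D\<bar> * schwartz_seminorm (N + M) \<psi>"
      by (intro add_mono mult_left_mono mono \<psi>) auto
    finally show ?thesis by (simp add: distrib_right)
  qed
  then have "\<exists>C N. \<forall>\<psi>\<in>schwartz. norm ((g - f) \<psi>) \<le> C * schwartz_seminorm N \<psi>" by blast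
  then show ?thesis
    using assms unfolding tempered_def by (auto simp: algebra_simps)
qed

subsection \<open>Necessity\<close>

lemma ennpowr_mono: "x \<le> y \<Longrightarrow> 0 \<le> a \<Longrightarrow> ennpowr x a \<le> ennpowr y a"
  by (cases x; cases y) (auto simp: ennpowr_def top_unique intro!: ennreal_leI powr_mono2)

lemma lq_norm_mono:
  assumes "0 < q" "\<And>j. a j \<le> b j"
  shows "lq_norm q a \<le> lq_norm q b"
proof -
  have "0 \<le> real_of_ereal q" using assms(1) by (simp add: real_of_ereal_pos)
  then show ?thesis
    using assms(2) by (auto simp: lq_norm_def intro!: SUP_mono' ennpowr_mono suminf_le)
qed

text \<open>The multiplication formula: the exponential is symmetric in its two variables, and
  Fubini moves it from one factor to the other.\<close>

lemma inv_fourier_exchange: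
  fixes a b :: "real^'n::finite \<Rightarrow> complex"
  assumes "a \<in> schwartz" "b \<in> schwartz"
  shows "(\<integral>x. inv_fourier a x * b x \<partial>lborel) = (\<integral>x. a x * inv_fourier b x \<partial>lborel)"
proof -
  let ?k = "fourier_const TYPE('n)"
  have Bm: "(\<lambda>z::(real^'n) \<times> (real^'n). expi (snd z \<bullet> fst z)) \<in> borel_measurable borel"
    by (intro borel_measurable_continuous_onI continuous_intros)
  have "(\<integral>x. inv_fourier a x * b x \<partial>lborel) = (\<integral>x. ?k * (b x * (\<integral>y. expi (y \<bullet> x) * a y \<partial>lborel)) \<partial>lborel)"
    by (simp add: inv_fourier_eq mult_ac)
  also have "\<dots> = ?k * (\<integral>x. b x * (\<integral>y. expi (y \<bullet> x) * a y \<partial>lborel) \<partial>lborel)" by simp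
  also have "(\<integral>x. b x * (\<integral>y. expi (y \<bullet> x) * a y \<partial>lborel) \<partial>lborel) = (\<integral>y. a y * (\<integral>x. expi (y \<bullet> x) * b x \<partial>lborel) \<partial>lborel)"
    using fubini_bounded[OF schwartz_integrable[OF assms(2)] schwartz_integrable[OF assms(1)] Bm, of 1] by simp
  also have "?k * \<dots> = (\<integral>y. a y * inv_fourier b y \<partial>lborel)"
    unfolding inv_fourier_eq integral_mult_right_zero[symmetric] by (simp add: mult_ac inner_commute)
  finally show ?thesis .
qed

lemma inv_fourier_sum:
  fixes a :: "'i \<Rightarrow> real^'n::finite \<Rightarrow> real"
  assumes "\<And>i. i \<in> I \<Longrightarrow> a i \<in> schwartz"
  shows "inv_fourier (\<lambda>\<xi>. complex_of_real (\<Sum>i\<in>I. c i * a i \<xi>)) x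
    = (\<Sum>i\<in>I. of_real (c i) * inv_fourier (\<lambda>\<xi>. complex_of_real (a i \<xi>)) x)"
proof -
  have i: "integrable lborel (\<lambda>\<xi>. of_real (c i) * (expi (\<xi> \<bullet> x) * complex_of_real (a i \<xi>)))" if "i \<in> I" for i
    by (intro integrable_mult_right integrable_expi_mult schwartz_integrable schwartz_of_real assms that) measurable
  have "(\<integral>\<xi>. expi (\<xi> \<bullet> x) * complex_of_real (\<Sum>i\<in>I. c i * a i \<xi>) \<partial>lborel)
      = (\<integral>\<xi>. (\<Sum>i\<in>I. of_real (c i) * (expi (\<xi> \<bullet> x) * complex_of_real (a i \<xi>))) \<partial>lborel)"
    by (simp add: sum_distrib_left mult_ac)
  also have "\<dots> = (\<Sum>i\<in>I. of_real (c i) * (\<integral>\<xi>. expi (\<xi> \<bullet> x) * complex_of_real (a i \<xi>) \<partial>lborel))"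
    by (subst Bochner_Integration.integral_sum[OF i]) auto
  finally show ?thesis by (simp add: inv_fourier_eq sum_distrib_left mult_ac)
qed

text \<open>A violation would persist on a ball, which is not a null set. Through this the essential
  supremum controls the value at the single point 0.\<close>

lemma AE_le_continuous:
  fixes f :: "'a::euclidean_space \<Rightarrow> real"
  assumes "continuous_on UNIV f" "AE x in lborel. f x \<le> c"
  shows "f x0 \<le> c"
proof (rule ccontr)
  assume "\<not> f x0 \<le> c"
  then have "x0 \<in> {x. c < f x}" by simp
  moreover have "open {x. c < f x}" using assms(1) by (intro open_Collect_less continuous_on_const)
  ultimately obtain e where e: "e > 0" "ball x0 e \<subseteq> {x. c < f x}" using openE[of "{x. c < f x}" x0] by blast
  have "AE x in lborel. x \<notin> ball x0 e"
    using assms(2)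
  proof eventually_elim
    case (elim x)
    then show ?case using subsetD[OF e(2), of x] by force
  qed
  then have "emeasure lborel (ball x0 e) = 0"
    by (subst (asm) AE_iff_measurable[of "ball x0 e"]) auto
  then show False using content_ball_pos[OF e(1), of x0] by (simp add: measure_def)
qed

section \<open>Distributions given by Schwartz functions, and their blocks\<close>

definition distr_of :: "(real^'n::finite \<Rightarrow> complex) \<Rightarrow> 'n functional" where
  "distr_of F = (\<lambda>\<psi>. if \<psi> \<in> schwartz then (\<integral>x. F x * \<psi> x \<partial>lborel) else 0)"

lemma distr_of_schwartz:
  fixes F :: "real^'n::finite \<Rightarrow> complex"
  assumes F: "F \<in> schwartz"
  shows "distr_of F \<in> tempered" "represents F (distr_of F)"
proof -
  have i: "integrable lborel (\<lambda>x. F x * \<psi> x)" if "\<psi> \<in> schwartz" for \<psi>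
    by (intro schwartz_integrable schwartz_mult_fun F that)
  show "represents F (distr_of F)"
    using i schwartz_measurable[OF F] by (simp add: represents_def distr_of_def)
  have "norm (distr_of F \<psi>) \<le> (\<integral>x. norm (F x) \<partial>lborel) * schwartz_seminorm 0 \<psi>" if \<psi>: "\<psi> \<in> schwartz" for \<psi>
  proof -
    have "norm (\<integral>x. F x * \<psi> x \<partial>lborel) \<le> (\<integral>x. norm (F x) * schwartz_seminorm 0 \<psi> \<partial>lborel)"
    proof (rule Bochner_Integration.integral_norm_bound_integral[OF i[OF \<psi>]])
      show "integrable lborel (\<lambda>x. norm (F x) * schwartz_seminorm 0 \<psi>)"
        by (intro integrable_mult_left integrable_norm schwartz_integrable F)
      show "norm (F x * \<psi> x) \<le> norm (F x) * schwartz_seminorm 0 \<psi>" for x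
        using schwartz_seminorm_upper[OF \<psi>, of "[]" 0 x] by (simp add: norm_mult mult_left_mono iter_deriv_simps)
    qed
    then show ?thesis using \<psi> by (simp add: distr_of_def)
  qed
  then have "\<exists>C N. \<forall>\<psi>\<in>schwartz. norm (distr_of F \<psi>) \<le> C * schwartz_seminorm N \<psi>" by blast
  then show "distr_of F \<in> tempered"
    unfolding tempered_def
    using i by (auto simp: distr_of_def schwartz_add schwartz_cmult distrib_left mult.left_commute)
qed

text \<open>The multiplication formula moves the pairing to the frequency side, where the multiplier
  is a product with \<open>\<omega>\<close>, and a second use moves it back.\<close>

lemma multiplier_distr_of:
  fixes A :: "real^'n::finite \<Rightarrow> real"
  assumes A: "A \<in> schwartz" and \<omega>: "\<omega> \<in> schwartz"
  shows "represents (inv_fourier (\<lambda>\<xi>. complex_of_real (\<omega> \<xi> * A \<xi>)))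
    (multiplier_distr \<omega> (distr_of (inv_fourier (\<lambda>\<xi>. complex_of_real (A \<xi>)))))"
proof -
  have AS: "(\<lambda>\<xi>. complex_of_real (A \<xi>)) \<in> schwartz" "(\<lambda>\<xi>. complex_of_real (\<omega> \<xi> * A \<xi>)) \<in> schwartz"
    by (intro schwartz_of_real schwartz_mult_fun A \<omega>)+
  show ?thesis
  proof (rule represents_cong[OF distr_of_schwartz(2)[OF schwartz_inv_fourier[OF AS(2)]]])
    fix \<psi> :: "real^'n \<Rightarrow> complex" assume \<psi>: "\<psi> \<in> schwartz"
    have TS: "multiplier \<omega> \<psi> \<in> schwartz" by (rule schwartz_multiplier[OF \<omega> \<psi>])
    have "multiplier_distr \<omega> (distr_of (inv_fourier (\<lambda>\<xi>. complex_of_real (A \<xi>)))) \<psi>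
        = (\<integral>x. inv_fourier (\<lambda>\<xi>. complex_of_real (A \<xi>)) x * multiplier \<omega> \<psi> x \<partial>lborel)"
      by (simp add: multiplier_distr_apply[OF \<omega> \<psi>] distr_of_def TS)
    also have "\<dots> = (\<integral>x. complex_of_real (A x) * inv_fourier (multiplier \<omega> \<psi>) x \<partial>lborel)"
      by (rule inv_fourier_exchange[OF AS(1) TS])
    also have "\<dots> = (\<integral>x. complex_of_real (\<omega> x * A x) * inv_fourier \<psi> x \<partial>lborel)"
    proof -
      have "inv_fourier (multiplier \<omega> \<psi>) = (\<lambda>x. \<omega> x *\<^sub>R inv_fourier \<psi> x)"
        by (simp add: multiplier_def inv_fourier_fourier schwartz_scaleR_fun \<omega> schwartz_inv_fourier \<psi>)
      then show ?thesis by (simp add: scaleR_conv_of_real mult_ac)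
    qed
    also have "\<dots> = (\<integral>x. inv_fourier (\<lambda>\<xi>. complex_of_real (\<omega> \<xi> * A \<xi>)) x * \<psi> x \<partial>lborel)"
      by (rule inv_fourier_exchange[OF AS(2) \<psi>, symmetric])
    finally show "distr_of (inv_fourier (\<lambda>\<xi>. complex_of_real (\<omega> \<xi> * A \<xi>))) \<psi>
      = multiplier_distr \<omega> (distr_of (inv_fourier (\<lambda>\<xi>. complex_of_real (A \<xi>)))) \<psi>"
      by (simp add: distr_of_def \<psi>)
  qed
qed

text \<open>Cubes of side at most \<open>2\<^sup>-\<^sup>k\<close> are handled by monotonicity of \<open>\<phi>\<close>, larger ones by monotonicity of
  \<open>\<phi>(t) t\<^sup>-\<^sup>d\<^sup>/\<^sup>p\<close>.\<close>

lemma morrey_norm_le_concentrated: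
  fixes h :: "real^'n::finite \<Rightarrow> complex"
  assumes p: "0 < p" and \<phi>: "\<phi> \<in> morrey_class CARD('n) p" and c: "0 \<le> c"
    and L: "2 * real CARD('n) \<le> real L * p" and h: "\<And>x. norm (h x) * (1 + norm (2 ^ k *\<^sub>R x)) ^ L \<le> c"
  shows "morrey_norm \<phi> p h \<le> ennreal ((1 + (\<integral>x. weight (x :: real^'n) \<partial>lborel) powr (1 / p)) * c * \<phi> (2 powi (- int k)))"
  unfolding morrey_norm_def
proof (rule SUP_least, clarify)
  fix i :: int and l :: "int^'n"
  let ?d = "real CARD('n)" and ?W = "\<integral>x. weight (x :: real^'n) \<partial>lborel"
  let ?Q = "dyadic_cube i l :: (real^'n) set"
  let ?a = "\<phi> (2 powi (- i))" and ?b = "\<phi> (2 powi (- int k))"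
  have W0: "0 \<le> ?W" by (intro Bochner_Integration.integral_nonneg less_imp_le weight_pos)
  have pos: "0 < ?a" "0 < ?b" using \<phi> by (auto simp: morrey_class_def)
  have m: "emeasure lborel ?Q = ennreal ((2 powi (- i)) ^ CARD('n))" by (rule emeasure_dyadic_cube)
  have mpos: "0 < (2 powi (- i) :: real) ^ CARD('n)" by simp
  \<comment> \<open>The order \<open>L\<close> is such that the p-th power of the decay is still at
    least that of \<open>weight\<close>.\<close>
  have hp: "norm (h x) powr p \<le> c powr p * weight (2 ^ k *\<^sub>R x)" for x
  proof -
    define y where "y = 1 + norm (2 ^ k *\<^sub>R x)"
    have y: "1 \<le> y" by (simp add: y_def)
    then have y0: "0 < y ^ L" by (intro zero_less_power) linarith
    have "norm (h x) \<le> c / y ^ L" using h[of x] y0 by (simp only: pos_le_divide_eq y_def)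
    then have "norm (h x) powr p \<le> (c / y ^ L) powr p" using p by (intro powr_mono2) auto
    also have "\<dots> = c powr p / (y ^ L) powr p" using c y0 by (simp add: powr_divide)
    also have "(y ^ L) powr p = y powr (real L * p)"
      using less_le_trans[OF zero_less_one y] by (simp only: powr_realpow powr_powr[symmetric])
    also have "c powr p / y powr (real L * p) \<le> c powr p / y ^ (2 * CARD('n))"
    proof (rule divide_left_mono)
      have "y ^ (2 * CARD('n)) = y powr (2 * ?d)" using y by (subst powr_realpow[symmetric]) auto
      also have "\<dots> \<le> y powr (real L * p)" using L y by (intro powr_mono) auto
      finally show "y ^ (2 * CARD('n)) \<le> y powr (real L * p)" .
      have "0 < y powr (real L * p)" using y by (simp add: add_pos_nonneg)
      moreover have "0 < y ^ (2 * CARD('n))" using y by (intro zero_less_power) linarith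
      ultimately show "0 < y powr (real L * p) * y ^ (2 * CARD('n))" by (rule mult_pos_pos)
    qed auto
    finally show ?thesis by (simp add: weight_def y_def)
  qed
  \<comment> \<open>\<open>B\<close> bounds the mean of order \<open>p\<close> over the cube; the
    volume stays on the right to avoid division.\<close>
  have "\<exists>B\<ge>0. (\<integral>\<^sup>+y\<in>?Q. ennreal (norm (h y) powr p) \<partial>lborel) \<le> ennreal (B powr p * (2 powi (- i)) ^ CARD('n)) \<and>
      ?a * B \<le> (1 + ?W powr (1 / p)) * c * ?b"
  proof (cases "int k \<le> i")
    case True
    have "(\<integral>\<^sup>+y\<in>?Q. ennreal (norm (h y) powr p) \<partial>lborel) \<le> (\<integral>\<^sup>+y. ennreal (c powr p) * indicator ?Q y \<partial>lborel)"
    proof (intro nn_integral_mono mult_right_mono ennreal_leI)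
      fix x :: "real^'n"
      have "weight (2 ^ k *\<^sub>R x) \<le> 1" by (simp add: weight_def divide_le_eq one_le_power)
      then have "c powr p * weight (2 ^ k *\<^sub>R x) \<le> c powr p * 1" by (intro mult_left_mono) auto
      then show "norm (h x) powr p \<le> c powr p" using hp[of x] by linarith
    qed simp
    also have "\<dots> = ennreal (c powr p) * emeasure lborel ?Q" by (rule nn_integral_cmult_indicator) simp
    also have "\<dots> = ennreal (c powr p * (2 powi (- i)) ^ CARD('n))" unfolding m by (simp add: ennreal_mult)
    finally have I: "(\<integral>\<^sup>+y\<in>?Q. ennreal (norm (h y) powr p) \<partial>lborel) \<le> ennreal (c powr p * (2 powi (- i)) ^ CARD('n))" .
    have "?a \<le> ?b"
      using \<phi> True by (auto simp: morrey_class_def intro!: mono_onD[of "{0<..}" \<phi>] power_int_increasing)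
    then have "?a * c \<le> ?b * c" using c by (intro mult_right_mono)
    also have "?b * c = 1 * c * ?b" by simp
    also have "\<dots> \<le> (1 + ?W powr (1 / p)) * c * ?b" using c pos by (intro mult_right_mono) auto
    finally show ?thesis using I c by blast
  next
    case False
    \<comment> \<open>Forced by the target: \<open>?a * B\<close> has to be \<open>?b * c\<close>
      times the constant coming from the mass of the weight.\<close>
    define B where "B = ?b / ?a * c * ?W powr (1 / p)"
    have B0: "0 \<le> B" using pos c by (simp add: B_def)
    have "(\<integral>\<^sup>+y\<in>?Q. ennreal (norm (h y) powr p) \<partial>lborel) \<le> (\<integral>\<^sup>+y. ennreal (c powr p) * ennreal (weight (2 ^ k *\<^sub>R (y :: real^'n))) \<partial>lborel)"
    proof (intro nn_integral_mono)
      fix y :: "real^'n"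
      have "ennreal (norm (h y) powr p) * indicator ?Q y \<le> ennreal (norm (h y) powr p)"
        by (auto simp: indicator_def)
      also have "\<dots> \<le> ennreal (c powr p * weight (2 ^ k *\<^sub>R y))" by (intro ennreal_leI hp)
      finally show "ennreal (norm (h y) powr p) * indicator ?Q y \<le> ennreal (c powr p) * ennreal (weight (2 ^ k *\<^sub>R y))"
        by (simp add: ennreal_mult')
    qed
    also have "\<dots> = ennreal (c powr p) * (\<integral>\<^sup>+y. ennreal (weight (2 ^ k *\<^sub>R (y :: real^'n))) \<partial>lborel)"
      by (rule nn_integral_cmult) measurable
    also have "(\<integral>\<^sup>+y. ennreal (weight (2 ^ k *\<^sub>R (y :: real^'n))) \<partial>lborel) = ennreal ((2 powi (- int k)) ^ CARD('n) * ?W)"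
    proof -
      let ?c = "2 powi (- int k) :: real"
      have c2: "2 ^ k * ?c = 1" by (simp add: power_int_minus)
      have "(\<integral>\<^sup>+y. ennreal (weight (2 ^ k *\<^sub>R (y :: real^'n))) \<partial>lborel)
        = ennreal (\<bar>?c\<bar> ^ CARD('n)) * (\<integral>\<^sup>+y. ennreal (weight (2 ^ k *\<^sub>R (0 + ?c *\<^sub>R (y :: real^'n)))) \<partial>lborel)"
        using nn_integral_lborel_affine[of "\<lambda>y::real^'n. ennreal (weight (2 ^ k *\<^sub>R y))" ?c 0] by simp
      also have "\<dots> = ennreal (?c ^ CARD('n)) * (\<integral>\<^sup>+y. ennreal (weight (y :: real^'n)) \<partial>lborel)"
        using c2 by simp
      also have "(\<integral>\<^sup>+y. ennreal (weight (y :: real^'n)) \<partial>lborel) = ennreal ?W"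
        using integrable_weight weight_pos by (intro nn_integral_eq_integral) (auto intro!: AE_I2 less_imp_le)
      finally show ?thesis using W0 by (simp add: ennreal_mult)
    qed
    also have "ennreal (c powr p) * ennreal ((2 powi (- int k)) ^ CARD('n) * ?W) \<le> ennreal (B powr p * (2 powi (- i)) ^ CARD('n))"
    proof -
      have t: "(2::real) powi (- int k) \<le> 2 powi (- i)" using False by (intro power_int_increasing) auto
      \<comment> \<open>The p-th power of this inequality compares volumes: the cube of side 2^(-k)
        has at most \<open>(?b / ?a) powr p\<close> times the volume of the larger cube. That is the
        loss allowed for by \<open>B\<close>.\<close>
      have "antimono_on {0<..} (\<lambda>t. \<phi> t * t powr (- ?d / p))" using \<phi> by (simp add: morrey_class_def)
      then have "?a * (2 powi (- i)) powr (- ?d / p) \<le> ?b * (2 powi (- int k)) powr (- ?d / p)"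
        using monotone_onD[of "{0<..}" "(\<le>)" "(\<ge>)" _ "2 powi (- int k)" "2 powi (- i)"] t by fastforce
      then have "(2 powi (- i)) powr (- ?d / p) \<le> ?b / ?a * (2 powi (- int k)) powr (- ?d / p)"
        using pos by (simp add: field_simps)
      then have "((2 powi (- i)) powr (- ?d / p)) powr p \<le> (?b / ?a * (2 powi (- int k)) powr (- ?d / p)) powr p"
        using p by (intro powr_mono2[of p]) auto
      moreover have "- ?d / p * p = - ?d" using p by simp
      ultimately have "(2 powi (- i)) powr (- ?d) \<le> (?b / ?a) powr p * (2 powi (- int k)) powr (- ?d)"
        by (simp only: powr_mult powr_powr)
      then have "inverse ((2 powi (- i)) ^ CARD('n)) \<le> (?b / ?a) powr p * inverse ((2 powi (- int k)) ^ CARD('n))"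
        by (simp add: powr_minus powr_realpow)
      then have key: "(2 powi (- int k)) ^ CARD('n) \<le> (?b / ?a) powr p * (2 powi (- i)) ^ CARD('n)"
        by (simp add: field_simps power_int_minus)
      have "c powr p * ((2 powi (- int k)) ^ CARD('n) * ?W) \<le> c powr p * (((?b / ?a) powr p * (2 powi (- i)) ^ CARD('n)) * ?W)"
        using W0 by (intro mult_left_mono mult_right_mono key) auto
      also have "\<dots> = B powr p * (2 powi (- i)) ^ CARD('n)"
      proof -
        have "1 / p * p = 1" using p by simp
        then have "(?W powr (1 / p)) powr p = ?W" using W0 by (simp only: powr_powr powr_one)
        then show ?thesis unfolding B_def by (simp only: powr_mult mult_ac)
      qed
      finally show ?thesis using W0 by (simp add: ennreal_leI flip: ennreal_mult)
    qed
    finally have I: "(\<integral>\<^sup>+y\<in>?Q. ennreal (norm (h y) powr p) \<partial>lborel) \<le> ennreal (B powr p * (2 powi (- i)) ^ CARD('n))" .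
    have "?a * B = ?W powr (1 / p) * c * ?b" using pos by (simp add: B_def)
    also have "\<dots> \<le> (1 + ?W powr (1 / p)) * c * ?b" using c pos by (intro mult_right_mono) auto
    finally show ?thesis using I B0 by blast
  qed
  then obtain B where B: "0 \<le> B" "?a * B \<le> (1 + ?W powr (1 / p)) * c * ?b"
    and I: "(\<integral>\<^sup>+y\<in>?Q. ennreal (norm (h y) powr p) \<partial>lborel) \<le> ennreal (B powr p * (2 powi (- i)) ^ CARD('n))" by blast
  have "(\<integral>\<^sup>+y\<in>?Q. ennreal (norm (h y) powr p) \<partial>lborel) / emeasure lborel ?Q
     \<le> ennreal (B powr p * (2 powi (- i)) ^ CARD('n)) / ennreal ((2 powi (- i)) ^ CARD('n))"
    unfolding m by (intro divide_right_mono_ennreal I)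
  also have "\<dots> = ennreal (B powr p)" using mpos by (simp add: divide_ennreal)
  finally have "ennpowr ((\<integral>\<^sup>+y\<in>?Q. ennreal (norm (h y) powr p) \<partial>lborel) / emeasure lborel ?Q) (1 / p) \<le> ennreal B"
    using p B(1) by (simp add: ennpowr_le_iff)
  then have "ennreal ?a * ennpowr ((\<integral>\<^sup>+y\<in>?Q. ennreal (norm (h y) powr p) \<partial>lborel) / emeasure lborel ?Q) (1 / p) \<le> ennreal ?a * ennreal B"
    by (rule mult_left_mono) simp
  also have "\<dots> \<le> ennreal ((1 + ?W powr (1 / p)) * c * ?b)"
    using B pos by (simp add: ennreal_leI flip: ennreal_mult)
  finally show "ennreal ?a * ennpowr ((\<integral>\<^sup>+y\<in>?Q. ennreal (norm (h y) powr p) \<partial>lborel) / emeasure lborel ?Q) (1 / p)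
      \<le> ennreal ((1 + ?W powr (1 / p)) * c * ?b)" .
qed

section \<open>Overlap of neighbouring frequency blocks\<close>

text \<open>Blocks of positive index lie in the annuli between radii 2^j r and 2^j R, so two of them
  can meet only if their indices differ by at most about log2(R / r), uniformly in the
  level.\<close>

lemma eta_overlap:
  fixes \<eta>0 \<eta> :: "real^'n::finite \<Rightarrow> real"
  assumes P: "resolution_pair \<eta>0 \<eta>"
  obtains m :: nat where "\<And>j k \<xi>. 1 \<le> j \<Longrightarrow> eta \<eta>0 \<eta> k \<xi> * eta \<eta>0 \<eta> j \<xi> \<noteq> 0 \<Longrightarrow> j \<le> k + m \<and> k \<le> j + m"
proof -
  obtain R r where Rr: "0 < R" "0 < r"
    "\<And>j x. eta \<eta>0 \<eta> j x \<noteq> 0 \<Longrightarrow> norm x \<le> 2 ^ j * R"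
    "\<And>j x. eta \<eta>0 \<eta> j x \<noteq> 0 \<Longrightarrow> j > 0 \<Longrightarrow> 2 ^ j * r \<le> norm x"
    using eta_support[OF P] by metis
  obtain m where m: "R / r < 2 ^ m" using real_arch_pow[of 2 "R / r"] by auto
  have le: "j \<le> k + m" if "eta \<eta>0 \<eta> k \<xi> \<noteq> 0" "eta \<eta>0 \<eta> j \<xi> \<noteq> 0" "1 \<le> j" for j k \<xi>
  proof -
    have "2 ^ j * r \<le> 2 ^ k * R" using Rr(3)[OF that(1)] Rr(4)[OF that(2)] that(3) by linarith
    also have "\<dots> < 2 ^ k * (2 ^ m * r)" using m Rr by (simp add: divide_less_eq)
    finally have "(2::real) ^ j < 2 ^ (k + m)" using Rr by (simp add: power_add mult.assoc[symmetric])
    then show ?thesis by (simp add: power_less_imp_less_exp less_imp_le)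
  qed
  show ?thesis
  proof (rule that[of m])
    fix j k :: nat and \<xi> assume "1 \<le> j" "eta \<eta>0 \<eta> k \<xi> * eta \<eta>0 \<eta> j \<xi> \<noteq> 0"
    \<comment> \<open>Block 0 has no inner radius, but for \<open>k = 0\<close> the second
      inequality is trivial.\<close>
    then show "j \<le> k + m \<and> k \<le> j + m" using le[of k \<xi> j] le[of j \<xi> k] by (cases "k = 0") auto
  qed
qed

lemma inv_fourier_decay:
  fixes P :: "real^'n::finite \<Rightarrow> real"
  assumes "P \<in> schwartz"
  shows "\<exists>C. \<forall>x. norm (inv_fourier (\<lambda>\<xi>. complex_of_real (P \<xi>)) x) * (1 + norm x) ^ L \<le> C"
  using schwartz_rapidly_decaying[OF schwartz_inv_fourier[OF schwartz_of_real[OF assms]]]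
  unfolding rapidly_decaying_def by (simp add: mult.commute)

text \<open>Up to dilation by \<open>2\<^sup>j\<close>, only finitely many products \<open>\<eta>\<^sub>k \<eta>\<^sub>j\<close> occur.\<close>

lemma block_product_decay:
  fixes \<eta>0 \<eta> :: "real^'n::finite \<Rightarrow> real"
  assumes P: "resolution_pair \<eta>0 \<eta>"
    and m: "\<And>j k \<xi>. 1 \<le> j \<Longrightarrow> eta \<eta>0 \<eta> k \<xi> * eta \<eta>0 \<eta> j \<xi> \<noteq> 0 \<Longrightarrow> j \<le> k + m \<and> k \<le> j + m"
  obtains C where "0 \<le> C" "\<And>j k x. 1 \<le> j \<Longrightarrow> j \<le> k + m \<Longrightarrow> k \<le> j + m \<Longrightarrow>
    norm ((1 / 2 ^ j) ^ CARD('n) * inv_fourier (\<lambda>\<xi>. complex_of_real (eta \<eta>0 \<eta> k \<xi> * eta \<eta>0 \<eta> j \<xi>)) x)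
      * (1 + norm (2 ^ k *\<^sub>R x)) ^ L \<le> C"
proof -
  have S: "\<eta>0 \<in> schwartz" "\<eta> \<in> schwartz" by (rule resolution_pair_schwartz[OF P])+
  define Q where "Q c \<xi> = \<eta> (c *\<^sub>R \<xi>) * \<eta> \<xi>" for c :: real and \<xi>
  define Q0 where "Q0 c \<xi> = \<eta>0 (c *\<^sub>R \<xi>) * \<eta> \<xi>" for c :: real and \<xi>
  have QS: "Q c \<in> schwartz" "Q0 c \<in> schwartz" if "0 < c" for c
    unfolding Q_def[abs_def] Q0_def[abs_def] using that by (auto intro!: schwartz_mult_fun schwartz_dilation S)
  have "\<exists>C. \<forall>x. norm (inv_fourier (\<lambda>\<xi>. complex_of_real (Q (2 ^ m / 2 ^ i) \<xi>)) x) * (1 + norm x) ^ L \<le> C" for i :: nat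
    by (intro inv_fourier_decay QS) simp
  then obtain A where A: "\<And>i::nat. \<And>x. norm (inv_fourier (\<lambda>\<xi>. complex_of_real (Q (2 ^ m / 2 ^ i) \<xi>)) x) * (1 + norm x) ^ L \<le> A i"
    by metis
  have "\<exists>C. \<forall>x. norm (inv_fourier (\<lambda>\<xi>. complex_of_real (Q0 (2 ^ i) \<xi>)) x) * (1 + norm x) ^ L \<le> C" for i :: nat
    by (intro inv_fourier_decay QS) simp
  then obtain B where B: "\<And>i::nat. \<And>x. norm (inv_fourier (\<lambda>\<xi>. complex_of_real (Q0 (2 ^ i) \<xi>)) x) * (1 + norm x) ^ L \<le> B i"
    by metis
  \<comment> \<open>Covers the 2m + 1 possible ratios of scales between dilates of
    \<open>\<eta>\<close>, and the m + 1 products with \<open>\<eta>0\<close>.\<close>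
  define C where "C = (\<Sum>i\<le>2 * m. \<bar>A i\<bar>) + (\<Sum>i\<le>m. \<bar>B i\<bar>)"
  have AC: "A i \<le> C" if "i \<le> 2 * m" for i
  proof -
    have "\<bar>A i\<bar> \<le> (\<Sum>i\<le>2 * m. \<bar>A i\<bar>)" using that by (intro member_le_sum) auto
    moreover have "0 \<le> (\<Sum>i\<le>m. \<bar>B i\<bar>)" by (intro sum_nonneg) auto
    ultimately show ?thesis unfolding C_def by linarith
  qed
  have BC: "B i \<le> C" if "i \<le> m" for i
  proof -
    have "\<bar>B i\<bar> \<le> (\<Sum>i\<le>m. \<bar>B i\<bar>)" using that by (intro member_le_sum) auto
    moreover have "0 \<le> (\<Sum>i\<le>2 * m. \<bar>A i\<bar>)" by (intro sum_nonneg) auto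
    ultimately show ?thesis unfolding C_def by linarith
  qed
  have C0: "0 \<le> C" unfolding C_def by (intro add_nonneg_nonneg sum_nonneg) auto
  show ?thesis
  proof (rule that[of "(2 ^ m) ^ L * C"])
    show "0 \<le> (2 ^ m) ^ L * C" using C0 by simp
    fix j k :: nat and x :: "real^'n" assume jk: "1 \<le> j" "j \<le> k + m" "k \<le> j + m"
    obtain T where T: "T \<in> schwartz" "\<And>\<xi>. eta \<eta>0 \<eta> k \<xi> * eta \<eta>0 \<eta> j \<xi> = T ((1 / 2 ^ j) *\<^sub>R \<xi>)"
      "\<And>x. norm (inv_fourier (\<lambda>\<xi>. complex_of_real (T \<xi>)) x) * (1 + norm x) ^ L \<le> C"
    proof (cases "k = 0")
      case True
      show ?thesis
      proof (rule that[of "Q0 (2 ^ j)"])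
        show "norm (inv_fourier (\<lambda>\<xi>. complex_of_real (Q0 (2 ^ j) \<xi>)) x) * (1 + norm x) ^ L \<le> C" for x
          using B[where i=j and x=x] BC[of j] jk True by simp
        show "eta \<eta>0 \<eta> k \<xi> * eta \<eta>0 \<eta> j \<xi> = Q0 (2 ^ j) ((1 / 2 ^ j) *\<^sub>R \<xi>)" for \<xi>
          using jk True by (simp add: eta_def Q0_def)
      qed (intro QS, simp)
    next
      case False
      \<comment> \<open>Encodes the ratio of the two scales as 2^m / 2^i with a natural number
        \<open>i\<close> in 0..2m.\<close>
      define i where "i = k + m - j"
      have i: "i \<le> 2 * m" "i + j = k + m" using jk by (auto simp: i_def)
      have "(2::real) ^ i * 2 ^ j = 2 ^ k * 2 ^ m" by (simp only: i(2) power_add[symmetric])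
      then have c: "(2::real) ^ m / 2 ^ i * (1 / 2 ^ j) = 1 / 2 ^ k" by (simp add: field_simps)
      show ?thesis
      proof (rule that[of "Q (2 ^ m / 2 ^ i)"])
        show "norm (inv_fourier (\<lambda>\<xi>. complex_of_real (Q (2 ^ m / 2 ^ i) \<xi>)) x) * (1 + norm x) ^ L \<le> C" for x
          using A[where i=i and x=x] AC[OF i(1)] by simp
        show "eta \<eta>0 \<eta> k \<xi> * eta \<eta>0 \<eta> j \<xi> = Q (2 ^ m / 2 ^ i) ((1 / 2 ^ j) *\<^sub>R \<xi>)" for \<xi>
          using jk False c unfolding eta_def Q_def scaleR_scaleR by simp
      qed (intro QS, simp)
    qed
    let ?F = "inv_fourier (\<lambda>\<xi>. complex_of_real (T \<xi>))"
    have "inv_fourier (\<lambda>\<xi>. complex_of_real (eta \<eta>0 \<eta> k \<xi> * eta \<eta>0 \<eta> j \<xi>)) x = (2 ^ j) ^ CARD('n) * ?F (2 ^ j *\<^sub>R x)"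
      unfolding T(2) using inv_fourier_dilation[OF schwartz_of_real[OF T(1)], of "2 ^ j" x] by simp
    then have eq: "(1 / 2 ^ j) ^ CARD('n) * inv_fourier (\<lambda>\<xi>. complex_of_real (eta \<eta>0 \<eta> k \<xi> * eta \<eta>0 \<eta> j \<xi>)) x = ?F (2 ^ j *\<^sub>R x)"
      by (simp add: power_divide)
    \<comment> \<open>Changing the weight from scale 2^j to scale 2^k costs at most 2^m per
      power.\<close>
    have "(2::real) ^ k \<le> 2 ^ m * 2 ^ j" using jk by (simp add: power_add[symmetric] add.commute)
    then have "2 ^ k * norm x \<le> 2 ^ m * 2 ^ j * norm x" by (intro mult_right_mono) auto
    moreover have "(1::real) \<le> 2 ^ m" by simp
    ultimately have "1 + 2 ^ k * norm x \<le> 2 ^ m + 2 ^ m * 2 ^ j * norm x" by linarith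
    then have "1 + norm (2 ^ k *\<^sub>R x) \<le> 2 ^ m * (1 + norm (2 ^ j *\<^sub>R x))"
      by (simp add: distrib_left mult.assoc)
    then have "(1 + norm (2 ^ k *\<^sub>R x)) ^ L \<le> (2 ^ m * (1 + norm (2 ^ j *\<^sub>R x))) ^ L" by (intro power_mono) auto
    then have "norm (?F (2 ^ j *\<^sub>R x)) * (1 + norm (2 ^ k *\<^sub>R x)) ^ L
       \<le> norm (?F (2 ^ j *\<^sub>R x)) * (2 ^ m * (1 + norm (2 ^ j *\<^sub>R x))) ^ L" by (intro mult_left_mono) auto
    also have "\<dots> = (2 ^ m) ^ L * (norm (?F (2 ^ j *\<^sub>R x)) * (1 + norm (2 ^ j *\<^sub>R x)) ^ L)"
      by (simp add: power_mult_distrib)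
    also have "\<dots> \<le> (2 ^ m) ^ L * C" by (intro mult_left_mono T(3)) auto
    finally show "norm ((1 / 2 ^ j) ^ CARD('n) * inv_fourier (\<lambda>\<xi>. complex_of_real (eta \<eta>0 \<eta> k \<xi> * eta \<eta>0 \<eta> j \<xi>)) x)
      * (1 + norm (2 ^ k *\<^sub>R x)) ^ L \<le> (2 ^ m) ^ L * C" unfolding eq .
  qed
qed

text \<open>The indices at distance at most \<open>m\<close> from \<open>k\<close>; two additions
  avoid truncated subtraction and make the relation visibly symmetric.\<close>

definition window :: "nat \<Rightarrow> nat \<Rightarrow> nat set" where
  "window m k = {j. j \<le> k + m \<and> k \<le> j + m}"

lemma finite_window: "finite (window m k)" and card_window: "card (window m k) \<le> 2 * m + 1"
proof -
  have sub: "window m k \<subseteq> {k - m..k + m}" by (auto simp: window_def)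
  show "finite (window m k)" using finite_subset[OF sub] by simp
  have "card (window m k) \<le> card {k - m..k + m}" using sub by (intro card_mono) auto
  also have "\<dots> \<le> 2 * m + 1" by simp
  finally show "card (window m k) \<le> 2 * m + 1" .
qed

text \<open>A sum over a window is at most its number of terms times its maximum, a bound that needs
  no triangle inequality and so covers q < 1. Double counting then shows that each index is used in
  boundedly many windows.\<close>

lemma lq_norm_window:
  fixes \<mu> :: "nat \<Rightarrow> real"
  assumes q: "0 < q" and C: "0 \<le> C"
  obtains D where "0 < D" "\<And>\<mu> A. (\<And>j. 0 \<le> \<mu> j) \<Longrightarrow> 0 \<le> A \<Longrightarrow> lq_norm q (\<lambda>j. ennreal (\<mu> j)) \<le> ennreal A \<Longrightarrow>
    lq_norm q (\<lambda>k. ennreal (C * (\<Sum>j\<in>window m k. \<mu> j))) \<le> ennreal (D * A)"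
proof (cases "q = \<infinity>")
  case True
  show ?thesis
  proof (rule that[of "C * (2 * real m + 1) + 1"])
    show "0 < C * (2 * real m + 1) + 1" using C by (simp add: add_nonneg_pos)
    fix \<mu> :: "nat \<Rightarrow> real" and A assume mu: "\<And>j. 0 \<le> \<mu> j" "0 \<le> A" "lq_norm q (\<lambda>j. ennreal (\<mu> j)) \<le> ennreal A"
    have le: "\<mu> j \<le> A" for j using mu True by (simp add: lq_norm_infinity_le_iff)
    have "C * (\<Sum>j\<in>window m k. \<mu> j) \<le> (C * (2 * real m + 1) + 1) * A" for k
    proof -
      have "(\<Sum>j\<in>window m k. \<mu> j) \<le> real (card (window m k)) * A" using le by (intro sum_bounded_above) auto
      also have "\<dots> \<le> (2 * real m + 1) * A"
        using card_window[of m k] mu(2) by (intro mult_right_mono) linarith+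
      finally have "C * (\<Sum>j\<in>window m k. \<mu> j) \<le> C * ((2 * real m + 1) * A)" using C by (intro mult_left_mono)
      then show ?thesis using mu(2) by (simp add: distrib_right mult.assoc)
    qed
    moreover have "0 \<le> C * (\<Sum>j\<in>window m k. \<mu> j)" for k using C mu(1) by (intro mult_nonneg_nonneg sum_nonneg) auto
    moreover have "0 \<le> (C * (2 * real m + 1) + 1) * A" using C mu(2) by simp
    ultimately show "lq_norm q (\<lambda>k. ennreal (C * (\<Sum>j\<in>window m k. \<mu> j))) \<le> ennreal ((C * (2 * real m + 1) + 1) * A)"
      unfolding True by (subst lq_norm_infinity_le_iff) auto
  qed
next
  case False
  then obtain r where r: "q = ereal r" "0 < r" using q by (cases q) auto
  define K where "K = 2 * real m + 1"
  have K: "1 \<le> K" by (simp add: K_def)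
  define D where "D = C * K * K powr (1 / r) + 1"
  have D: "0 < D" using C K by (simp add: D_def add_nonneg_pos)
  show ?thesis
  proof (rule that[OF D])
    fix \<mu> :: "nat \<Rightarrow> real" and A assume mu: "\<And>j. 0 \<le> \<mu> j" "0 \<le> A" "lq_norm q (\<lambda>j. ennreal (\<mu> j)) \<le> ennreal A"
    have muA: "(\<Sum>j<n. \<mu> j powr r) \<le> A powr r" for n using mu r by (simp add: lq_norm_le_iff)
    have win: "(C * (\<Sum>j\<in>window m k. \<mu> j)) powr r \<le> (C * K) powr r * (\<Sum>j\<in>window m k. \<mu> j powr r)" for k
    proof -
      have ne: "k \<in> window m k" by (simp add: window_def)
      \<comment> \<open>The maximum is attained in the window, so its r-th power is one of the terms
        of the sum of r-th powers.\<close>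
      define M where "M = Max (\<mu> ` window m k)"
      have Mi: "M \<in> \<mu> ` window m k" unfolding M_def using ne finite_window by (intro Max_in) auto
      have le: "\<mu> j \<le> M" if "j \<in> window m k" for j unfolding M_def using that finite_window by (intro Max_ge) auto
      have M0: "0 \<le> M" using Mi mu by auto
      have "(\<Sum>j\<in>window m k. \<mu> j) \<le> real (card (window m k)) * M" using le by (intro sum_bounded_above) auto
      also have "\<dots> \<le> K * M" using card_window[of m k] M0 unfolding K_def by (intro mult_right_mono) linarith+
      finally have "C * (\<Sum>j\<in>window m k. \<mu> j) \<le> C * (K * M)" using C by (intro mult_left_mono)
      then have "(C * (\<Sum>j\<in>window m k. \<mu> j)) powr r \<le> (C * (K * M)) powr r"
        using C mu r by (intro powr_mono2[of r] mult_nonneg_nonneg sum_nonneg) auto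
      also have "\<dots> = (C * K) powr r * M powr r" using C K M0 by (simp add: powr_mult)
      also have "M powr r \<le> (\<Sum>j\<in>window m k. \<mu> j powr r)"
        using Mi finite_window by (auto intro: member_le_sum)
      finally show ?thesis by (simp add: mult_left_mono)
    qed
    have "(\<Sum>k<n. (C * (\<Sum>j\<in>window m k. \<mu> j)) powr r) \<le> (D * A) powr r" for n
    proof -
      \<comment> \<open>Windows of indices below \<open>n\<close> reach no further than
        \<open>n + m\<close>, which makes both ranges finite for the exchange of sums.\<close>
      have "(\<Sum>k<n. (\<Sum>j\<in>window m k. \<mu> j powr r)) = (\<Sum>k<n. (\<Sum>j\<in>{j\<in>{..<n+m}. j \<in> window m k}. \<mu> j powr r))"
        by (intro sum.cong refl) (auto simp: window_def)
      also have "\<dots> = (\<Sum>j<n+m. (\<Sum>k\<in>{k\<in>{..<n}. j \<in> window m k}. \<mu> j powr r))"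
        by (rule sum.swap_restrict) auto
      also have "\<dots> \<le> (\<Sum>j<n+m. K * \<mu> j powr r)"
      proof (rule sum_mono)
        fix j
        have "{k\<in>{..<n}. j \<in> window m k} \<subseteq> window m j" by (auto simp: window_def)
        then have "card {k\<in>{..<n}. j \<in> window m k} \<le> 2 * m + 1"
          using card_mono[OF finite_window] card_window order.trans by blast
        then have "real (card {k\<in>{..<n}. j \<in> window m k}) \<le> K" unfolding K_def by linarith
        then show "(\<Sum>k\<in>{k\<in>{..<n}. j \<in> window m k}. \<mu> j powr r) \<le> K * \<mu> j powr r"
          by (simp add: mult_right_mono)
      qed
      also have "\<dots> = K * (\<Sum>j<n+m. \<mu> j powr r)" by (simp add: sum_distrib_left)
      also have "\<dots> \<le> K * A powr r" using K by (intro mult_left_mono muA) auto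
      finally have dbl: "(\<Sum>k<n. (\<Sum>j\<in>window m k. \<mu> j powr r)) \<le> K * A powr r" .
      have "(\<Sum>k<n. (C * (\<Sum>j\<in>window m k. \<mu> j)) powr r) \<le> (C * K) powr r * (\<Sum>k<n. (\<Sum>j\<in>window m k. \<mu> j powr r))"
        unfolding sum_distrib_left using win by (intro sum_mono) (simp add: sum_distrib_left)
      also have "\<dots> \<le> (C * K) powr r * (K * A powr r)" by (intro mult_left_mono dbl) auto
      also have "\<dots> = (C * K * K powr (1 / r) * A) powr r"
        using C K mu(2) r by (simp add: powr_mult powr_powr)
      also have "\<dots> \<le> (D * A) powr r"
        using C K mu(2) r unfolding D_def by (intro powr_mono2[of r] mult_right_mono) auto
      finally show ?thesis .
    qed
    moreover have "0 \<le> C * (\<Sum>j\<in>window m k. \<mu> j)" for k using C mu(1) by (intro mult_nonneg_nonneg sum_nonneg) auto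
    moreover have "0 \<le> D * A" using D mu(2) by simp
    ultimately show "lq_norm q (\<lambda>k. ennreal (C * (\<Sum>j\<in>window m k. \<mu> j))) \<le> ennreal (D * A)"
      unfolding r by (subst lq_norm_le_iff[OF r(2)]) auto
  qed
qed

text \<open>If \<open>j\<close> is at most \<open>k\<close>, monotonicity of \<open>\<phi>\<close>
  suffices. Otherwise \<open>\<phi>\<close> grows at most like t^(d/p), and the side lengths differ
  by a factor of at most 2^m.\<close>

lemma morrey_class_shift:
  assumes \<phi>: "\<phi> \<in> morrey_class d p" and p: "0 < p" and jk: "j \<le> k + m"
  shows "\<phi> (2 powi (- int k)) \<le> 2 powr (real m * (real d / p)) * \<phi> (2 powi (- int j))"
proof -
  let ?a = "\<phi> (2 powi (- int k))" and ?b = "\<phi> (2 powi (- int j))" and ?e = "real d / p"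
  have pos: "0 < ?a" "0 < ?b" using \<phi> by (auto simp: morrey_class_def)
  have e0: "0 \<le> ?e" using p by simp
  have two: "(2::real) powi (- int i) = 2 powr (- real i)" for i by (simp add: power_int_minus powr_minus powr_realpow)
  show ?thesis
  proof (cases "j \<le> k")
    case True
    have "?a \<le> ?b"
      using \<phi> True by (auto simp: morrey_class_def intro!: mono_onD[of "{0<..}" \<phi>] power_int_increasing)
    also have "\<dots> = 1 * ?b" by simp
    also have "\<dots> \<le> 2 powr (real m * ?e) * ?b"
      using pos e0 by (intro mult_right_mono ge_one_powr_ge_zero mult_nonneg_nonneg) auto
    finally show ?thesis .
  next
    case False
    have t: "(2::real) powi (- int j) \<le> 2 powi (- int k)" using False by (intro power_int_increasing) auto
    have "antimono_on {0<..} (\<lambda>t. \<phi> t * t powr (- real d / p))" using \<phi> by (simp add: morrey_class_def)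
    then have "?a * (2 powi (- int k)) powr (- real d / p) \<le> ?b * (2 powi (- int j)) powr (- real d / p)"
      using monotone_onD[of "{0<..}" "(\<le>)" "(\<ge>)" _ "2 powi (- int j)" "2 powi (- int k)"] t by fastforce
    then have "?a * 2 powr (real k * ?e) \<le> ?b * 2 powr (real j * ?e)"
      by (simp add: two powr_powr)
    also have "\<dots> \<le> ?b * 2 powr (real k * ?e + real m * ?e)"
    proof -
      have "real j \<le> real k + real m" using jk by linarith
      then have "real j * ?e \<le> (real k + real m) * ?e" using e0 by (intro mult_right_mono)
      then have "real j * ?e \<le> real k * ?e + real m * ?e" by (simp only: distrib_right)
      then show ?thesis using pos by (intro mult_left_mono powr_mono) simp_all
    qed
    finally have "?a * 2 powr (real k * ?e) \<le> (2 powr (real m * ?e) * ?b) * 2 powr (real k * ?e)"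
      by (simp add: powr_add mult_ac)
    then show ?thesis by (simp add: mult_le_cancel_right)
  qed
qed

text \<open>Phrased in terms of the weighted sequence \<open>\<mu>\<close> whose
  \<open>lq_norm\<close> bounds that of the test function. Supports start at index 1, where every
  block is a dilate of \<open>\<eta>\<close>, so that all blocks have the same normalised value at 0
  and the overlap bound applies.\<close>

lemma besov_morrey_test_functions:
  fixes s p :: real and q :: ereal and \<phi> :: "real \<Rightarrow> real"
    and \<eta>0 \<eta> :: "real^'n::finite \<Rightarrow> real"
  assumes p: "0 < p" and q: "0 < q" and \<phi>: "\<phi> \<in> morrey_class CARD('n) p" and P: "resolution_pair \<eta>0 \<eta>"
  obtains C a where "0 < C" "0 < a"
    "\<And>\<mu> J A. (\<And>j. 0 \<le> \<mu> j) \<Longrightarrow> (\<And>j. \<mu> j \<noteq> 0 \<Longrightarrow> 1 \<le> j \<and> j \<le> J) \<Longrightarrow> 0 \<le> A \<Longrightarrow>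
      lq_norm q (\<lambda>j. ennreal (\<mu> j)) \<le> ennreal A \<Longrightarrow>
      \<exists>u\<in>tempered. besov_morrey_norm \<eta>0 \<eta> s \<phi> p q u \<le> ennreal (C * A) \<and>
        ennreal (a * (\<Sum>j=1..J. \<mu> j * (2 powr (- (real j * s)) / \<phi> (2 powi (- int j))))) \<le> Linf_norm u"
proof -
  let ?d = "real CARD('n)"
  define F where "F j = \<phi> (2 powi (- int j))" for j :: nat
  have F: "0 < F j" for j using \<phi> by (simp add: morrey_class_def F_def)
  obtain m where m: "\<And>j k \<xi>. 1 \<le> j \<Longrightarrow> eta \<eta>0 \<eta> k \<xi> * eta \<eta>0 \<eta> j \<xi> \<noteq> 0 \<Longrightarrow> j \<le> k + m \<and> k \<le> j + m"
    using eta_overlap[OF P] by metis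
  \<comment> \<open>Decay of order \<open>L\<close> of the blocks, raised to the power
    \<open>p\<close>, has to reach the exponent 2d of \<open>weight\<close>.\<close>
  obtain L :: nat where L: "2 * ?d / p \<le> real L" using real_arch_simple by blast
  then have L': "2 * ?d \<le> real L * p" using p by (simp add: divide_le_eq)
  obtain C1 where C1: "0 \<le> C1" "\<And>j k x. 1 \<le> j \<Longrightarrow> j \<le> k + m \<Longrightarrow> k \<le> j + m \<Longrightarrow>
    norm ((1 / 2 ^ j) ^ CARD('n) * inv_fourier (\<lambda>\<xi>. complex_of_real (eta \<eta>0 \<eta> k \<xi> * eta \<eta>0 \<eta> j \<xi>)) x)
      * (1 + norm (2 ^ k *\<^sub>R x)) ^ L \<le> C1"
  proof (rule block_product_decay[OF P m, where L=L])
    fix C1 assume *: "0 \<le> C1" "\<And>j k x. 1 \<le> j \<Longrightarrow> j \<le> k + m \<Longrightarrow> k \<le> j + m \<Longrightarrow>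
      norm ((1 / 2 ^ j) ^ CARD('n) * inv_fourier (\<lambda>\<xi>. complex_of_real (eta \<eta>0 \<eta> k \<xi> * eta \<eta>0 \<eta> j \<xi>)) x)
        * (1 + norm (2 ^ k *\<^sub>R x)) ^ L \<le> C1"
    show ?thesis by (rule that[OF *])
  qed
  have eS: "eta \<eta>0 \<eta> j \<in> schwartz" for j by (rule resolution_pair_schwartz[OF P])
  have \<eta>S: "\<eta> \<in> schwartz" by (rule resolution_pair_schwartz[OF P])
  obtain \<xi>0 where \<xi>0: "0 < \<eta> \<xi>0"
  proof -
    \<comment> \<open>A corner of the larger cube, hence a point where \<open>\<eta>\<close> is
      assumed positive.\<close>
    define v :: "real^'n" where "v = (\<chi> i. 1)"
    have "v \<in> centred_cube 2 - centred_cube 1" by (auto simp: centred_cube_def v_def)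
    then have "0 < \<eta> v" using P by (simp add: resolution_pair_def)
    then show ?thesis by (rule that)
  qed
  obtain a where a: "0 < a" "inv_fourier (\<lambda>\<xi>. complex_of_real (\<eta> \<xi>)) 0 = of_real a"
    using inv_fourier_nonneg_bound[OF \<eta>S _ \<xi>0] P unfolding resolution_pair_def by metis
  define W where "W = 1 + (\<integral>x. weight (x :: real^'n) \<partial>lborel) powr (1 / p)"
  have W: "0 < W" by (simp add: W_def add_pos_nonneg)
  \<comment> \<open>Morrey estimate \<open>W\<close>, block decay \<open>C1\<close>, and the price
    of moving by at most \<open>m\<close> indices in 2^(js) and in \<open>\<phi>\<close>.\<close>
  define C4 where "C4 = W * C1 * (2 powr (real m * \<bar>s\<bar>) * 2 powr (real m * (?d / p)))"
  have C4: "0 \<le> C4" using W C1 by (simp add: C4_def)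
  obtain D where D: "0 < D" "\<And>\<mu> A. (\<And>j. 0 \<le> \<mu> j) \<Longrightarrow> 0 \<le> A \<Longrightarrow> lq_norm q (\<lambda>j. ennreal (\<mu> j)) \<le> ennreal A \<Longrightarrow>
    lq_norm q (\<lambda>k. ennreal (C4 * (\<Sum>j\<in>window m k. \<mu> j))) \<le> ennreal (D * A)"
  proof (rule lq_norm_window[OF q C4, where m=m])
    fix D assume *: "0 < D" "\<And>\<mu> A. (\<And>j. 0 \<le> \<mu> j) \<Longrightarrow> 0 \<le> A \<Longrightarrow> lq_norm q (\<lambda>j. ennreal (\<mu> j)) \<le> ennreal A \<Longrightarrow>
      lq_norm q (\<lambda>k. ennreal (C4 * (\<Sum>j\<in>window m k. \<mu> j))) \<le> ennreal (D * A)"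
    show ?thesis by (rule that[OF *])
  qed
  show ?thesis
  proof (rule that[OF D(1) a(1)])
    fix \<mu> :: "nat \<Rightarrow> real" and J A
    assume mu: "\<And>j. 0 \<le> \<mu> j" "\<And>j. \<mu> j \<noteq> 0 \<Longrightarrow> 1 \<le> j \<and> j \<le> J" and A: "0 \<le> A" "lq_norm q (\<lambda>j. ennreal (\<mu> j)) \<le> ennreal A"
    \<comment> \<open>Undoes the weight 2^(js) and the Morrey factor of the \<open>j\<close>-th
      block.\<close>
    define lam where "lam j = \<mu> j * (2 powr (- (real j * s)) / F j)" for j
    have lam0: "0 \<le> lam j" for j using mu(1)[of j] F[of j] by (simp add: lam_def)
    have lam: "2 powr (real j * s) * F j * lam j = \<mu> j" for j
      using F[of j] by (simp add: lam_def powr_minus)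
    \<comment> \<open>The factor 2^(-jd) cancels the one produced by dilating \<open>\<eta>\<close>,
      so each block contributes \<open>lam j * a\<close> at the origin.\<close>
    define c where "c j = lam j * (1 / 2 ^ j) ^ CARD('n)" for j :: nat
    define B where "B \<xi> = (\<Sum>j=1..J. c j * eta \<eta>0 \<eta> j \<xi>)" for \<xi>
    have BS: "B \<in> schwartz" unfolding B_def[abs_def] by (intro schwartz_sum schwartz_cmult eS)
    define G where "G = inv_fourier (\<lambda>\<xi>. complex_of_real (B \<xi>))"
    have GS: "G \<in> schwartz" unfolding G_def by (intro schwartz_inv_fourier schwartz_of_real BS)
    define u where "u = distr_of G"
    have ut: "u \<in> tempered" and ur: "represents G u" unfolding u_def by (rule distr_of_schwartz[OF GS])+
    have block: "norm (inv_fourier (\<lambda>\<xi>. complex_of_real (eta \<eta>0 \<eta> k \<xi> * B \<xi>)) x) * (1 + norm (2 ^ k *\<^sub>R x)) ^ L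
        \<le> C1 * (\<Sum>j\<in>window m k. lam j)" for k x
    proof -
      let ?I = "\<lambda>j. inv_fourier (\<lambda>\<xi>. complex_of_real (eta \<eta>0 \<eta> k \<xi> * eta \<eta>0 \<eta> j \<xi>)) x"
      let ?w = "(1 + norm (2 ^ k *\<^sub>R x)) ^ L"
      have "inv_fourier (\<lambda>\<xi>. complex_of_real (eta \<eta>0 \<eta> k \<xi> * B \<xi>)) x
          = inv_fourier (\<lambda>\<xi>. complex_of_real (\<Sum>j=1..J. c j * (eta \<eta>0 \<eta> k \<xi> * eta \<eta>0 \<eta> j \<xi>))) x"
        by (simp add: B_def sum_distrib_left mult.left_commute)
      also have "\<dots> = (\<Sum>j=1..J. of_real (c j) * ?I j)"
        by (intro inv_fourier_sum schwartz_mult_fun eS)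
      also have "\<dots> = (\<Sum>j=1..J. of_real (lam j) * ((1 / 2 ^ j) ^ CARD('n) * ?I j))"
        by (simp add: c_def mult.assoc)
      finally have "norm (inv_fourier (\<lambda>\<xi>. complex_of_real (eta \<eta>0 \<eta> k \<xi> * B \<xi>)) x) * ?w
         \<le> (\<Sum>j=1..J. norm (of_real (lam j) * ((1 / 2 ^ j) ^ CARD('n) * ?I j))) * ?w"
        by (simp only:) (intro mult_right_mono norm_sum, simp)
      also have "\<dots> = (\<Sum>j=1..J. lam j * (norm ((1 / 2 ^ j) ^ CARD('n) * ?I j) * ?w))"
        unfolding sum_distrib_right using lam0 by (intro sum.cong refl) (simp add: norm_mult)
      also have "\<dots> \<le> (\<Sum>j=1..J. lam j * (if j \<in> window m k then C1 else 0))"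
      proof (intro sum_mono mult_left_mono lam0)
        fix j assume j: "j \<in> {1..J}"
        show "norm ((1 / 2 ^ j) ^ CARD('n) * ?I j) * ?w \<le> (if j \<in> window m k then C1 else 0)"
        proof (cases "j \<in> window m k")
          case True
          then show ?thesis using C1(2)[of j k x] j by (simp add: window_def)
        next
          case False
          then have "eta \<eta>0 \<eta> k \<xi> * eta \<eta>0 \<eta> j \<xi> = 0" for \<xi> using m[of j k \<xi>] j by (auto simp: window_def)
          then have "(\<lambda>\<xi>. complex_of_real (eta \<eta>0 \<eta> k \<xi> * eta \<eta>0 \<eta> j \<xi>)) = (\<lambda>_. 0)" by (simp only: of_real_0)
          then have "?I j = 0" by (simp only: inv_fourier_eq) simp
          then show ?thesis using False by simp
        qed
      qed
      also have "\<dots> = C1 * (\<Sum>j\<in>{1..J} \<inter> window m k. lam j)"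
        by (simp add: sum.inter_restrict sum_distrib_left if_distrib mult.commute cong: if_cong)
      also have "\<dots> \<le> C1 * (\<Sum>j\<in>window m k. lam j)"
        using C1(1) lam0 finite_window by (intro mult_left_mono sum_mono2) auto
      finally show ?thesis .
    qed
    have N: "ennreal (2 powr (real k * s)) * distr_norm (morrey_norm \<phi> p) (multiplier_distr (eta \<eta>0 \<eta> k) u)
        \<le> ennreal (C4 * (\<Sum>j\<in>window m k. \<mu> j))" for k
    proof -
      let ?S = "\<Sum>j\<in>window m k. lam j"
      have S0: "0 \<le> ?S" using lam0 by (intro sum_nonneg)
      have "distr_norm (morrey_norm \<phi> p) (multiplier_distr (eta \<eta>0 \<eta> k) u)
        \<le> morrey_norm \<phi> p (inv_fourier (\<lambda>\<xi>. complex_of_real (eta \<eta>0 \<eta> k \<xi> * B \<xi>)))"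
        unfolding distr_norm_def u_def G_def by (intro INF_lower CollectI multiplier_distr_of BS eS)
      also have "\<dots> \<le> ennreal (W * (C1 * ?S) * F k)"
        unfolding W_def F_def
        by (rule morrey_norm_le_concentrated[OF p \<phi> _ L' block]) (use C1(1) S0 in simp)
      finally have "ennreal (2 powr (real k * s)) * distr_norm (morrey_norm \<phi> p) (multiplier_distr (eta \<eta>0 \<eta> k) u)
        \<le> ennreal (2 powr (real k * s)) * ennreal (W * (C1 * ?S) * F k)" by (rule mult_left_mono) simp
      also have "\<dots> = ennreal (W * C1 * (\<Sum>j\<in>window m k. 2 powr (real k * s) * F k * lam j))"
        by (simp add: sum_distrib_left mult_ac flip: ennreal_mult')
      also have "\<dots> \<le> ennreal (C4 * (\<Sum>j\<in>window m k. \<mu> j))"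
      proof (rule ennreal_leI)
        have "2 powr (real k * s) * F k * lam j \<le> (2 powr (real m * \<bar>s\<bar>) * 2 powr (real m * (?d / p))) * \<mu> j" if j: "j \<in> window m k" for j
        proof -
          have "(real k - real j) * s \<le> \<bar>real k - real j\<bar> * \<bar>s\<bar>" by (simp flip: abs_mult)
          also have "\<dots> \<le> real m * \<bar>s\<bar>" using j by (intro mult_right_mono) (auto simp: window_def)
          finally have "real k * s \<le> real m * \<bar>s\<bar> + real j * s" by (simp add: algebra_simps)
          then have 1: "2 powr (real k * s) \<le> 2 powr (real m * \<bar>s\<bar>) * 2 powr (real j * s)"
            by (simp flip: powr_add)
          have 2: "F k \<le> 2 powr (real m * (?d / p)) * F j"
            unfolding F_def using j by (intro morrey_class_shift[OF \<phi> p]) (simp add: window_def)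
          have "2 powr (real k * s) * F k * lam j
            \<le> (2 powr (real m * \<bar>s\<bar>) * 2 powr (real j * s)) * (2 powr (real m * (?d / p)) * F j) * lam j"
            using F[of k] by (intro mult_right_mono[OF mult_mono[OF 1 2]] lam0) auto
          also have "\<dots> = (2 powr (real m * \<bar>s\<bar>) * 2 powr (real m * (?d / p))) * (2 powr (real j * s) * F j * lam j)"
            by (simp only: mult_ac)
          finally show ?thesis unfolding lam .
        qed
        then have "(\<Sum>j\<in>window m k. 2 powr (real k * s) * F k * lam j)
           \<le> (2 powr (real m * \<bar>s\<bar>) * 2 powr (real m * (?d / p))) * (\<Sum>j\<in>window m k. \<mu> j)"
          unfolding sum_distrib_left by (intro sum_mono)
        then have "W * C1 * (\<Sum>j\<in>window m k. 2 powr (real k * s) * F k * lam j)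
           \<le> W * C1 * ((2 powr (real m * \<bar>s\<bar>) * 2 powr (real m * (?d / p))) * (\<Sum>j\<in>window m k. \<mu> j))"
          using W C1(1) by (intro mult_left_mono) auto
        then show "W * C1 * (\<Sum>j\<in>window m k. 2 powr (real k * s) * F k * lam j) \<le> C4 * (\<Sum>j\<in>window m k. \<mu> j)"
          by (simp only: C4_def mult.assoc)
      qed
      finally show ?thesis .
    qed
    have "besov_morrey_norm \<eta>0 \<eta> s \<phi> p q u \<le> lq_norm q (\<lambda>k. ennreal (C4 * (\<Sum>j\<in>window m k. \<mu> j)))"
      unfolding besov_morrey_norm_def multiplier_distr_def[symmetric] by (intro lq_norm_mono q N)
    also have "\<dots> \<le> ennreal (D * A)" by (rule D(2)[OF mu(1) A])
    finally have le: "besov_morrey_norm \<eta>0 \<eta> s \<phi> p q u \<le> ennreal (D * A)" .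
    \<comment> \<open>All summands are nonnegative at the origin, so there is no cancellation, and
      continuity of \<open>G\<close> makes its value there a lower bound for the essential
      supremum.\<close>
    have "ennreal (a * (\<Sum>j=1..J. lam j)) \<le> Linf_norm u"
    proof (cases "Linf_norm u")
      case (real l)
      have G0: "G 0 = of_real (a * (\<Sum>j=1..J. lam j))"
      proof -
        have "G 0 = (\<Sum>j=1..J. of_real (c j) * inv_fourier (\<lambda>\<xi>. complex_of_real (eta \<eta>0 \<eta> j \<xi>)) 0)"
          unfolding G_def B_def by (rule inv_fourier_sum[OF eS])
        also have "\<dots> = (\<Sum>j=1..J. of_real (lam j) * of_real a)"
        proof (rule sum.cong[OF refl])
          fix j assume "j \<in> {1..J}"
          then have "(\<lambda>\<xi>. complex_of_real (eta \<eta>0 \<eta> j \<xi>)) = (\<lambda>\<xi>. complex_of_real (\<eta> ((1 / 2 ^ j) *\<^sub>R \<xi>)))"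
            by (auto simp: eta_def)
          then have "inv_fourier (\<lambda>\<xi>. complex_of_real (eta \<eta>0 \<eta> j \<xi>)) 0 = (2 ^ j) ^ CARD('n) * of_real a"
            using inv_fourier_dilation[OF schwartz_of_real[OF \<eta>S], of "2 ^ j" 0] a(2) by simp
          then show "of_real (c j) * inv_fourier (\<lambda>\<xi>. complex_of_real (eta \<eta>0 \<eta> j \<xi>)) 0 = of_real (lam j) * of_real a"
            by (simp add: c_def power_divide)
        qed
        finally show ?thesis by (simp add: sum_distrib_left mult.commute)
      qed
      have "AE x in lborel. ennreal (norm (G x)) \<le> ennreal l"
        using esssup_AE[of "\<lambda>x. ennreal (norm (G x))" lborel] real by (simp add: Linf_norm_represents[OF ur])
      then have "AE x in lborel. norm (G x) \<le> l" using real(1) by simp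
      then have "norm (G 0) \<le> l"
        by (intro AE_le_continuous[of "\<lambda>x. norm (G x)"] continuous_on_norm schwartz_continuous GS)
      moreover have "norm (G 0) = a * (\<Sum>j=1..J. lam j)"
        unfolding G0 norm_of_real using a(1) lam0 by (intro abs_of_nonneg mult_nonneg_nonneg sum_nonneg) auto
      ultimately show ?thesis using real by (simp add: ennreal_leI)
    qed simp
    then have "ennreal (a * (\<Sum>j=1..J. \<mu> j * (2 powr (- (real j * s)) / \<phi> (2 powi (- int j))))) \<le> Linf_norm u"
      by (simp only: lam_def F_def)
    with ut le show "\<exists>u\<in>tempered. besov_morrey_norm \<eta>0 \<eta> s \<phi> p q u \<le> ennreal (D * A) \<and>
        ennreal (a * (\<Sum>j=1..J. \<mu> j * (2 powr (- (real j * s)) / \<phi> (2 powi (- int j))))) \<le> Linf_norm u" by blast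
  qed
qed

section \<open>From the test functions to the sequence condition\<close>

text \<open>Extremal sequences for each regime: truncated constants if q is infinite, unit vectors
  if q is at most 1, powers of \<open>\<beta>\<close> otherwise. Index 0 is never tested, but a
  single term does not affect membership.\<close>

lemma converse_hoelder_lq:
  fixes \<beta> :: "nat \<Rightarrow> real"
  assumes q: "0 < q" "1 \<le> q'" "1 / q' = max (1 - 1 / q) (0::ereal)" and \<beta>: "\<And>j. 0 < \<beta> j" and K: "0 \<le> K"
    and bd: "\<And>\<mu> J A. (\<And>j. 0 \<le> \<mu> j) \<Longrightarrow> (\<And>j. \<mu> j \<noteq> 0 \<Longrightarrow> 1 \<le> j \<and> j \<le> J) \<Longrightarrow> 0 < A \<Longrightarrow>
      lq_norm q (\<lambda>j. ennreal (\<mu> j)) \<le> ennreal A \<Longrightarrow> (\<Sum>j=1..J. \<mu> j * \<beta> j) \<le> K * A"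
  shows "\<beta> \<in> lq q'"
proof -
  have \<beta>0: "0 \<le> \<beta> j" for j using \<beta>[of j] by simp
  have split: "(\<Sum>j<n. h j) \<le> h 0 + (\<Sum>j=1..n. h j)" if "\<And>j. 0 \<le> h j" for h :: "nat \<Rightarrow> real" and n
  proof -
    have "(\<Sum>j<n. h j) \<le> (\<Sum>j\<in>insert 0 {1..n}. h j)" using that by (intro sum_mono2) auto
    then show ?thesis by simp
  qed
  have mem: "\<beta> \<in> lq q'" if "lq_norm q' (\<lambda>j. ennreal (\<beta> j)) \<le> ennreal B" for B
    using that \<beta>0 by (auto simp: lq_def intro: le_less_trans)
  show ?thesis
    using q
  proof (cases rule: conjugate_exponent_cases)
    case 1
    have "(\<Sum>j=1..J. \<beta> j) \<le> K" for J
    proof -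
      let ?\<mu> = "\<lambda>j. if j \<in> {1..J} then 1 else (0::real)"
      have "(\<Sum>j=1..J. ?\<mu> j * \<beta> j) \<le> K * 1"
      proof (rule bd)
        show "lq_norm q (\<lambda>j. ennreal (?\<mu> j)) \<le> ennreal 1"
          unfolding 1(1) by (subst lq_norm_infinity_le_iff) auto
      qed (auto split: if_splits)
      then show ?thesis by simp
    qed
    then have "(\<Sum>j<n. \<beta> j) \<le> \<beta> 0 + K" for n using split[where h=\<beta> and n=n, OF \<beta>0] by (meson add_left_mono order.trans)
    then show ?thesis
      using \<beta>0 K unfolding 1(2) by (intro mem[of "\<beta> 0 + K", unfolded 1(2)]) (subst lq_norm_le_iff, auto)
  next
    case (2 r)
    have "\<beta> j \<le> K" if j: "1 \<le> j" for j
    proof -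
      let ?\<mu> = "\<lambda>i. if i = j then 1 else (0::real)"
      have "lq_norm q (\<lambda>i. ennreal (?\<mu> i)) \<le> ennreal 1"
        unfolding 2 by (subst lq_norm_le_iff) (use 2 in \<open>auto simp: if_distrib[of "\<lambda>x. x powr r"] cong: if_cong\<close>)
      then have "(\<Sum>i=1..j. ?\<mu> i * \<beta> i) \<le> K * 1" using j by (intro bd) (auto split: if_splits)
      moreover have "(\<Sum>i=1..j. ?\<mu> i * \<beta> i) = (\<Sum>i=1..j. if i = j then \<beta> i else 0)" by (intro sum.cong) auto
      ultimately show ?thesis using j by simp
    qed
    then have "\<beta> j \<le> \<beta> 0 + K" for j using \<beta>0[of 0] K by (cases "j = 0") (auto intro: add_increasing)
    then show ?thesis
      using \<beta>0 K by (intro mem[of "\<beta> 0 + K"]) (subst 2(4), subst lq_norm_infinity_le_iff, auto)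
  next
    case (3 r)
    define t where "t = r / (r - 1)"
    have t: "1 < t" "(t - 1) * r = t" "1 - 1 / r = 1 / t" using 3(2) by (auto simp: t_def field_simps)
    have "(\<Sum>j=1..J. \<beta> j powr t) \<le> K powr t" for J
    proof (cases "J = 0")
      case False
      define S where "S = (\<Sum>j=1..J. \<beta> j powr t)"
      have "0 < \<beta> j powr t" for j using \<beta>[of j] by simp
      then have S: "0 < S" unfolding S_def using False by (intro sum_pos) simp_all
      \<comment> \<open>The equality case of Hoelder's inequality; since (t - 1) r = t, its r-th
        powers and its pairing with \<open>\<beta>\<close> are both governed by
        \<open>S\<close>.\<close>
      define \<mu> where "\<mu> j = (if j \<in> {1..J} then \<beta> j powr (t - 1) else 0)" for j
      have "(\<Sum>j<n. \<mu> j powr r) \<le> S" for n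
      proof -
        have "(\<Sum>j<n. \<mu> j powr r) = (\<Sum>j\<in>{..<n} \<inter> {1..J}. \<beta> j powr t)"
          using t by (subst sum.inter_restrict) (auto intro!: sum.cong simp: \<mu>_def powr_powr)
        also have "\<dots> \<le> S" unfolding S_def by (intro sum_mono2) auto
        finally show ?thesis .
      qed
      then have "lq_norm q (\<lambda>j. ennreal (\<mu> j)) \<le> ennreal (S powr (1 / r))"
        unfolding 3 using 3(2) S by (subst lq_norm_le_iff) (auto simp: \<mu>_def powr_powr)
      then have "(\<Sum>j=1..J. \<mu> j * \<beta> j) \<le> K * S powr (1 / r)"
        using S by (intro bd) (auto simp: \<mu>_def split: if_splits)
      moreover have "(\<Sum>j=1..J. \<mu> j * \<beta> j) = S"
        unfolding S_def
      proof (rule sum.cong[OF refl])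
        fix j assume "j \<in> {1..J}"
        then have "\<mu> j * \<beta> j = \<beta> j powr (t - 1) * \<beta> j powr 1" using \<beta>0 by (simp add: \<mu>_def)
        also have "\<dots> = \<beta> j powr t" by (simp only: powr_add[symmetric] diff_add_cancel)
        finally show "\<mu> j * \<beta> j = \<beta> j powr t" .
      qed
      moreover have "S = S powr (1 / t) * S powr (1 / r)"
      proof -
        have "1 / t + 1 / r = 1" using t(3) by linarith
        then show ?thesis using S by (simp only: powr_add[symmetric] powr_one less_imp_le)
      qed
      ultimately have "S powr (1 / t) * S powr (1 / r) \<le> K * S powr (1 / r)" by simp
      \<comment> \<open>The truncation at \<open>J\<close> makes \<open>S\<close> finite and
        positive, so it can be cancelled; the resulting bound is independent of
        \<open>J\<close>.\<close>
      then have "S powr (1 / t) \<le> K" using S by (simp add: mult_le_cancel_right)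
      then have "(S powr (1 / t)) powr t \<le> K powr t" using t by (intro powr_mono2[of t]) auto
      then have "S \<le> K powr t" using S t by (simp add: powr_powr)
      then show ?thesis unfolding S_def .
    qed simp
    then have bnd: "(\<Sum>j<n. \<beta> j powr t) \<le> \<beta> 0 powr t + K powr t" for n
      using split[where h="\<lambda>j. \<beta> j powr t" and n=n, OF powr_ge_zero] by (meson add_left_mono order.trans)
    define B where "B = (\<beta> 0 powr t + K powr t) powr (1 / t)"
    have "B powr t = \<beta> 0 powr t + K powr t" using t by (simp add: B_def powr_powr)
    then have "lq_norm q' (\<lambda>j. ennreal (\<beta> j)) \<le> ennreal B"
      unfolding 3(3) t_def[symmetric] using t \<beta>0 bnd by (subst lq_norm_le_iff) (auto simp: B_def)
    then show ?thesis by (rule mem)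
  qed
qed

text \<open>Homogeneity on the side of sequences: test functions are rescaled through their
  coefficients rather than as distributions.\<close>

lemma lq_norm_scale:
  fixes \<mu> :: "nat \<Rightarrow> real"
  assumes "0 < q" "\<And>j. 0 \<le> \<mu> j" "0 \<le> A" "0 \<le> t" "lq_norm q (\<lambda>j. ennreal (\<mu> j)) \<le> ennreal A"
  shows "lq_norm q (\<lambda>j. ennreal (t * \<mu> j)) \<le> ennreal (t * A)"
proof (cases q)
  case (real r)
  then have r: "0 < r" using assms(1) by simp
  have "(\<Sum>j<n. \<mu> j powr r) \<le> A powr r" for n using assms(2,3,5) r unfolding real by (simp add: lq_norm_le_iff)
  then have "(\<Sum>j<n. (t * \<mu> j) powr r) \<le> (t * A) powr r" for n
    using assms(2-4) by (simp add: powr_mult sum_distrib_left[symmetric] mult_left_mono)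
  then show ?thesis using assms(2-4) r unfolding real by (subst lq_norm_le_iff) auto
next
  case PInf
  then have "\<mu> j \<le> A" for j using assms(2,3,5) by (simp add: lq_norm_infinity_le_iff)
  then show ?thesis using assms(2-4) unfolding PInf by (subst lq_norm_infinity_le_iff) (auto intro: mult_left_mono)
qed (use assms in auto)

lemma zero_in_besov_morrey:
  fixes \<eta>0 \<eta> :: "real^'n::finite \<Rightarrow> real"
  assumes "0 < q" "0 < p"
  shows "(\<lambda>_. 0) \<in> besov_morrey \<eta>0 \<eta> s \<phi> p q"
proof -
  have "norm (0::complex) \<le> 0 * schwartz_seminorm 0 \<psi>" for \<psi> :: "real^'n \<Rightarrow> complex" by simp
  then have t: "(\<lambda>_. 0) \<in> (tempered :: 'n functional set)" unfolding tempered_def by fastforce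
  have "represents (\<lambda>_. 0) (\<lambda>_. 0)" by (simp add: represents_def)
  moreover have "morrey_norm \<phi> p (\<lambda>_::real^'n. 0) = 0"
    unfolding morrey_norm_def using assms(2) by (simp add: ennpowr_def case_prod_beta)
  ultimately have "distr_norm (morrey_norm \<phi> p) (\<lambda>_::real^'n \<Rightarrow> complex. 0) \<le> 0"
    unfolding distr_norm_def by (metis (mono_tags, lifting) INF_lower mem_Collect_eq)
  then have "besov_morrey_norm \<eta>0 \<eta> s \<phi> p q (\<lambda>_::real^'n \<Rightarrow> complex. 0) = lq_norm q (\<lambda>_. ennreal 0)"
    by (simp add: besov_morrey_norm_def inv_fourier_distr_def mult_distr_def fourier_distr_def)
  also have "\<dots> \<le> ennreal 0"
    using assms(1) by (cases q) (auto simp: lq_norm_def ennpowr_def)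
  finally show ?thesis using t by (simp add: besov_morrey_def)
qed

text \<open>Continuity at 0 sends a small ball into the unit ball of the supremum norm; rescaling
  each test sequence into that ball turns this into a linear inequality.\<close>

lemma embedding_imp_lq:
  fixes s p :: real and q q' :: ereal and \<phi> :: "real \<Rightarrow> real"
    and \<eta>0 \<eta> :: "real^'n::finite \<Rightarrow> real"
  assumes p: "0 < p" and q: "0 < q" "1 \<le> q'" "1 / q' = max (1 - 1 / q) 0"
    and \<phi>: "\<phi> \<in> morrey_class CARD('n) p" and P: "resolution_pair \<eta>0 \<eta>"
    and E: "continuously_embedded (besov_morrey \<eta>0 \<eta> s \<phi> p q) (besov_morrey_norm \<eta>0 \<eta> s \<phi> p q) Linf Linf_norm"
  shows "(\<lambda>j::nat. 2 powr (- (real j * s)) * inverse (\<phi> (2 powr (- real j)))) \<in> lq q'"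
proof (rule besov_morrey_test_functions[OF p q(1) \<phi> P, of s])
  fix C a :: real assume C: "0 < C" and a: "0 < a"
    and test: "\<And>\<mu> J A. (\<And>j. 0 \<le> \<mu> j) \<Longrightarrow> (\<And>j. \<mu> j \<noteq> 0 \<Longrightarrow> 1 \<le> j \<and> j \<le> J) \<Longrightarrow> 0 \<le> A \<Longrightarrow>
      lq_norm q (\<lambda>j. ennreal (\<mu> j)) \<le> ennreal A \<Longrightarrow>
      \<exists>u\<in>tempered. besov_morrey_norm \<eta>0 \<eta> s \<phi> p q u \<le> ennreal (C * A) \<and>
        ennreal (a * (\<Sum>j=1..J. \<mu> j * (2 powr (- (real j * s)) / \<phi> (2 powi (- int j))))) \<le> Linf_norm u"
  let ?X = "besov_morrey \<eta>0 \<eta> s \<phi> p q" and ?n = "besov_morrey_norm \<eta>0 \<eta> s \<phi> p q"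
  define \<beta> where "\<beta> j = 2 powr (- (real j * s)) / \<phi> (2 powi (- int j))" for j :: nat
  have eq: "(\<lambda>j::nat. 2 powr (- (real j * s)) * inverse (\<phi> (2 powr (- real j)))) = \<beta>"
    by (simp add: \<beta>_def fun_eq_iff divide_inverse power_int_minus powr_minus powr_realpow)
  have \<beta>: "0 < \<beta> j" for j using \<phi> by (simp add: \<beta>_def morrey_class_def)
  have "\<exists>\<delta>>0. \<forall>g\<in>?X. ?n (g - (\<lambda>_. 0)) < \<delta> \<longrightarrow> Linf_norm (g - (\<lambda>_. 0)) < 1"
    using E zero_in_besov_morrey[OF q(1) p] zero_less_one unfolding continuously_embedded_def by blast
  then obtain \<delta> where \<delta>: "0 < \<delta>" "\<And>g. g \<in> ?X \<Longrightarrow> ?n g < \<delta> \<Longrightarrow> Linf_norm g < 1"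
    by (auto simp: fun_diff_def)
  \<comment> \<open>\<open>\<delta>\<close> may be infinite, so a finite positive radius below it is
    chosen.\<close>
  obtain e where e: "0 < e" "ennreal e \<le> \<delta>"
  proof (cases \<delta>)
    case (real x)
    then show ?thesis using \<delta>(1) that[of x] by simp
  qed (use that[of 1] in simp)
  have bd: "(\<Sum>j=1..J. \<mu> j * \<beta> j) \<le> (2 * C / (a * e)) * A"
    if mu: "\<And>j. 0 \<le> \<mu> j" "\<And>j. \<mu> j \<noteq> 0 \<Longrightarrow> 1 \<le> j \<and> j \<le> J" and A: "0 < A" "lq_norm q (\<lambda>j. ennreal (\<mu> j)) \<le> ennreal A"
    for \<mu> J A
  proof -
    \<comment> \<open>Chosen so that the norm of the rescaled test function is at most e / 2,
      strictly inside the ball.\<close>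
    define t where "t = e / (2 * C * A)"
    have t: "0 < t" using e C A by (simp add: t_def)
    have "lq_norm q (\<lambda>j. ennreal (t * \<mu> j)) \<le> ennreal (t * A)"
      using lq_norm_scale[OF q(1) mu(1) _ _ A(2), of t] t A by simp
    then obtain u where u: "u \<in> tempered" "?n u \<le> ennreal (C * (t * A))"
      "ennreal (a * (\<Sum>j=1..J. (t * \<mu> j) * \<beta> j)) \<le> Linf_norm u"
      using test[of "\<lambda>j. t * \<mu> j" J "t * A"] mu t A unfolding \<beta>_def by auto
    have "C * (t * A) = e / 2" using C A by (simp add: t_def)
    then have "ennreal (C * (t * A)) < ennreal e" using e by (simp add: ennreal_lessI)
    then have "?n u < ennreal e" using u(2) by (rule le_less_trans[rotated])
    then have "?n u < \<delta>" using e(2) by (rule less_le_trans)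
    moreover have "?n u < \<infinity>" using u(2) by (rule le_less_trans) simp
    ultimately have "Linf_norm u < 1" using u(1) by (intro \<delta>(2)) (auto simp: besov_morrey_def)
    then have "ennreal (a * (\<Sum>j=1..J. (t * \<mu> j) * \<beta> j)) < ennreal 1"
      unfolding ennreal_1 by (rule le_less_trans[OF u(3)])
    then have "a * (\<Sum>j=1..J. (t * \<mu> j) * \<beta> j) < 1"
      by (subst (asm) ennreal_less_iff)
        (use a t mu(1) \<beta> in \<open>auto intro!: mult_nonneg_nonneg sum_nonneg intro: less_imp_le\<close>)
    then have "(a * t) * (\<Sum>j=1..J. \<mu> j * \<beta> j) < 1" by (simp add: sum_distrib_left mult.assoc)
    then have "(\<Sum>j=1..J. \<mu> j * \<beta> j) < 1 / (a * t)"
      using a t by (simp add: less_divide_eq mult.commute)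
    also have "1 / (a * t) = (2 * C / (a * e)) * A" using a e C A by (simp add: t_def)
    finally show ?thesis by simp
  qed
  have "\<beta> \<in> lq q'"
  proof (rule converse_hoelder_lq[OF q \<beta>])
    show "0 \<le> 2 * C / (a * e)" using C a e by simp
  qed (rule bd)
  then show ?thesis unfolding eq .
qed

theorem theorem3p4:
  fixes s p :: real and q q' :: ereal and \<phi> :: "real \<Rightarrow> real"
    and \<eta>0 \<eta> :: "real^'n::finite \<Rightarrow> real"
  assumes "0 < p" and "0 < q"
    and "\<phi> \<in> morrey_class CARD('n) p"
    and "1 \<le> q'" and "1 / q' = max (1 - 1 / q) 0"
    and "resolution_pair \<eta>0 \<eta>"
  shows "continuously_embedded
           (besov_morrey \<eta>0 \<eta> s \<phi> p q) (besov_morrey_norm \<eta>0 \<eta> s \<phi> p q) Linf Linf_norm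
         \<longleftrightarrow> (\<lambda>j::nat. 2 powr (- (real j * s)) * inverse (\<phi> (2 powr (- real j)))) \<in> lq q'"
proof
  let ?X = "besov_morrey \<eta>0 \<eta> s \<phi> p q" and ?n = "besov_morrey_norm \<eta>0 \<eta> s \<phi> p q"
  assume "(\<lambda>j::nat. 2 powr (- (real j * s)) * inverse (\<phi> (2 powr (- real j)))) \<in> lq q'"
  from Linf_norm_le_besov_morrey_norm[OF assms(1,2,4,5,3,6) this]
  obtain C where C: "0 < C" "\<And>f. f \<in> tempered \<Longrightarrow> Linf_norm f \<le> ennreal C * ?n f" by blast
  show "continuously_embedded ?X ?n Linf Linf_norm"
    unfolding continuously_embedded_def
  proof (intro conjI subsetI ballI allI impI)
    fix f :: "'n functional" assume f: "f \<in> ?X"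
    then have "Linf_norm f \<le> ennreal C * ?n f" "?n f < \<infinity>" "f \<in> tempered"
      using C(2) by (auto simp: besov_morrey_def)
    then show "f \<in> Linf"
      unfolding Linf_def by (auto simp: ennreal_mult_less_top intro: le_less_trans)
  next
    fix f :: "'n functional" and \<epsilon> :: ennreal assume f: "f \<in> ?X" and \<epsilon>: "0 < \<epsilon>"
    \<comment> \<open>The estimate is available for all tempered functionals, so it applies to
      \<open>g - f\<close> without first showing that \<open>?X\<close> is closed under
      differences.\<close>
    have "Linf_norm (g - f) < \<epsilon>" if "g \<in> ?X" "?n (g - f) < \<epsilon> / ennreal C" for g
    proof -
      have "Linf_norm (g - f) \<le> ennreal C * ?n (g - f)"
        using f that(1) by (intro C(2) tempered_functional_diff) (auto simp: besov_morrey_def)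
      also have "\<dots> < ennreal C * (\<epsilon> / ennreal C)"
        using C(1) that(2) by (intro ennreal_mult_strict_left_mono) auto
      also have "\<dots> = \<epsilon>" using C(1) by (simp add: ennreal_times_divide ennreal_mult_divide_eq mult.commute)
      finally show ?thesis .
    qed
    moreover have "0 < \<epsilon> / ennreal C" using \<epsilon> by (simp add: ennreal_zero_less_divide)
    ultimately show "\<exists>\<delta>>0. \<forall>g\<in>?X. ?n (g - f) < \<delta> \<longrightarrow> Linf_norm (g - f) < \<epsilon>" by blast
  qed
next
  assume "continuously_embedded (besov_morrey \<eta>0 \<eta> s \<phi> p q) (besov_morrey_norm \<eta>0 \<eta> s \<phi> p q) Linf Linf_norm"
  then show "(\<lambda>j::nat. 2 powr (- (real j * s)) * inverse (\<phi> (2 powr (- real j)))) \<in> lq q'"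
    by (rule embedding_imp_lq[OF assms(1,2,4,5,3,6)])
qed

end
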